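(* Let $N\ge2$, let $A\in M_N(\{0,1\})$ be primitive and let $\ell\in\mathbb N\cup\{\infty\}$. The classical version of the compact quantum group $\mathbb G_A^\ell$ is the compact group $\mathbb T\wr\mathrm{Aut}(A)=\mathbb T^N\rtimes\mathrm{Aut}(A)$.
   Context: $A\in M_N(\{0,1\})$ primitive means some power of $A$ has strictly positive entries; $\vec u$ is its right Perron--Frobenius eigenvector (positive entries summing to $1$). $V_A^n$ is the set of words $x_1\cdots x_n$ over $\{1,\dots,N\}$ with $A_{x_i,x_{i+1}}=1$ for all $i$. A magic unitary is a square matrix of projections in a unital $C^*$-algebra with all rows and columns summing to $1$. $C(\mathbb G_A^\ell)$ is the universal unital $C^*$-algebra generated by partial isometries $(u_{\alpha,\beta})_{1\le\alpha,\beta\le N}$ such that, with $p_{\alpha,\beta}=u_{\alpha,\beta}u_{\alpha,\beta}^*$ and $q_{\alpha,\beta}=u_{\alpha,\beta}^*u_{\alpha,\beta}$: (I) $p,q$ are magic unitaries with $p\vec u=\vec u1=q\vec u$; (II) $Ap=qA$; (III) for all finite $n\le\ell$ and $\alpha,\beta\in V_A^n$, $u_{\alpha_1,\beta_1}\cdots u_{\alpha_n,\beta_n}$ is a partial isometry. It is a compact quantum group with coproduct $u_{\alpha,\beta}\mapsto\sum_\gamma u_{\alpha,\gamma}\otimes u_{\gamma,\beta}$. The classical version $\mathbb G_{\mathrm{clas}}$ of a compact quantum group $\mathbb G$ is the compact group with $C(\mathbb G_{\mathrm{clas}})=C(\mathbb G)/J_c$, where $J_c$ is the commutator ideal (closed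 two-sided ideal generated by commutators), with coproduct induced from that of $C(\mathbb G)$. $\mathrm{Aut}(A)$ is the group of permutations $\pi$ of $\{1,\dots,N\}$ with $A_{\pi(i),\pi(j)}=A_{i,j}$ for all $i,j$, and $\mathbb T\wr\mathrm{Aut}(A)$ is the permutational wreath product, $\mathrm{Aut}(A)$ acting on $\mathbb T^N$ by permuting coordinates. *)

theory Defs
  imports "HOL-Analysis.Analysis" "HOL-Algebra.QuotRing" "HOL-Algebra.Module"
begin

section \<open>Seminormed *-algebras\<close>

text \<open>Complex unital *-algebras with a (semi)norm, as carrier-based structures extending the
  records of HOL-Algebra.\<close>

record 'a star_algebra = "(complex, 'a) module" +
  star :: "'a \<Rightarrow> 'a"
  nrm :: "'a \<Rightarrow> real"

definition star_hom :: "'a star_algebra \<Rightarrow> 'b star_algebra \<Rightarrow> ('a \<Rightarrow> 'b) \<Rightarrow> bool" where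
  "star_hom B D \<phi> \<longleftrightarrow> \<phi> \<in> ring_hom B D
     \<and> (\<forall>c. \<forall>x\<in>carrier B. \<phi> (c \<odot>\<^bsub>B\<^esub> x) = c \<odot>\<^bsub>D\<^esub> \<phi> x)
     \<and> (\<forall>x\<in>carrier B. \<phi> (star B x) = star D (\<phi> x))"

definition star_iso :: "'a star_algebra \<Rightarrow> 'b star_algebra \<Rightarrow> ('a \<Rightarrow> 'b) \<Rightarrow> bool" where
  "star_iso B D \<phi> \<longleftrightarrow> star_hom B D \<phi> \<and> bij_betw \<phi> (carrier B) (carrier D)"

definition cstar_seminorm :: "'a star_algebra \<Rightarrow> ('a \<Rightarrow> real) \<Rightarrow> bool" where
  "cstar_seminorm B p \<longleftrightarrow>
     (\<forall>x\<in>carrier B. 0 \<le> p x)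
     \<and> (\<forall>x\<in>carrier B. \<forall>y\<in>carrier B. p (x \<oplus>\<^bsub>B\<^esub> y) \<le> p x + p y)
     \<and> (\<forall>c. \<forall>x\<in>carrier B. p (c \<odot>\<^bsub>B\<^esub> x) = cmod c * p x)
     \<and> (\<forall>x\<in>carrier B. \<forall>y\<in>carrier B. p (x \<otimes>\<^bsub>B\<^esub> y) \<le> p x * p y)
     \<and> (\<forall>x\<in>carrier B. p (star B x \<otimes>\<^bsub>B\<^esub> x) = (p x)\<^sup>2)"

subsection \<open>Quotients and completions\<close>

text \<open>The quotient by a two-sided (and *-invariant) ideal, with the quotient seminorm.\<close>

definition star_quot :: "'a star_algebra \<Rightarrow> 'a set \<Rightarrow> 'a set star_algebra" where
  "star_quot B I =
     \<lparr>carrier = carrier (B Quot I), mult = mult (B Quot I), one = one (B Quot I),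
      zero = zero (B Quot I), add = add (B Quot I),
      smult = (\<lambda>c S. \<Union>x\<in>S. I +>\<^bsub>B\<^esub> (c \<odot>\<^bsub>B\<^esub> x)),
      star = (\<lambda>S. \<Union>x\<in>S. I +>\<^bsub>B\<^esub> star B x),
      nrm = (\<lambda>S. Inf (nrm B ` S))\<rparr>"

definition cauchy_algebra :: "'a star_algebra \<Rightarrow> (nat \<Rightarrow> 'a) star_algebra" where
  "cauchy_algebra B =
     \<lparr>carrier = {X. range X \<subseteq> carrier B \<and>
         (\<forall>e>0. \<exists>k. \<forall>m\<ge>k. \<forall>n\<ge>k. nrm B (X m \<ominus>\<^bsub>B\<^esub> X n) < e)},
      mult = (\<lambda>X Y n. X n \<otimes>\<^bsub>B\<^esub> Y n), one = (\<lambda>n. \<one>\<^bsub>B\<^esub>),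
      zero = (\<lambda>n. \<zero>\<^bsub>B\<^esub>), add = (\<lambda>X Y n. X n \<oplus>\<^bsub>B\<^esub> Y n),
      smult = (\<lambda>c X n. c \<odot>\<^bsub>B\<^esub> X n),
      star = (\<lambda>X n. star B (X n)),
      nrm = (\<lambda>X. lim (\<lambda>n. nrm B (X n)))\<rparr>"

definition null_sequences :: "'a star_algebra \<Rightarrow> (nat \<Rightarrow> 'a) set" where
  "null_sequences B = {X. range X \<subseteq> carrier B \<and> (\<lambda>n. nrm B (X n)) \<longlonglongrightarrow> 0}"

text \<open>The Hausdorff completion of a seminormed *-algebra (Cauchy sequences modulo null sequences),
  and the canonical map into it.\<close>

definition completion :: "'a star_algebra \<Rightarrow> (nat \<Rightarrow> 'a) set star_algebra" where
  "completion B = star_quot (cauchy_algebra B) (null_sequences B)"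

definition to_completion :: "'a star_algebra \<Rightarrow> 'a \<Rightarrow> (nat \<Rightarrow> 'a) set" where
  "to_completion B x = null_sequences B +>\<^bsub>cauchy_algebra B\<^esub> (\<lambda>n. x)"

subsection \<open>The *-algebra of a monoid with involution\<close>

text \<open>Finitely supported functions on the monoid \<open>M\<close> with convolution; the map \<open>i\<close> is an involutive
  anti-automorphism of \<open>M\<close>. The seminorm is a parameter.\<close>

definition monoid_star_algebra ::
  "('m, 'z) monoid_scheme \<Rightarrow> ('m \<Rightarrow> 'm) \<Rightarrow> (('m \<Rightarrow> complex) \<Rightarrow> real) \<Rightarrow> ('m \<Rightarrow> complex) star_algebra" where
  "monoid_star_algebra M i p =
     \<lparr>carrier = {f. finite {x. f x \<noteq> 0} \<and> {x. f x \<noteq> 0} \<subseteq> carrier M},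
      mult = (\<lambda>f g z. \<Sum>x | f x \<noteq> 0. \<Sum>y | g y \<noteq> 0. if x \<otimes>\<^bsub>M\<^esub> y = z then f x * g y else 0),
      one = (\<lambda>z. if z = \<one>\<^bsub>M\<^esub> then 1 else 0),
      zero = (\<lambda>z. 0), add = (\<lambda>f g z. f z + g z),
      smult = (\<lambda>c f z. c * f z),
      star = (\<lambda>f z. \<Sum>x | f x \<noteq> 0. if i x = z then cnj (f x) else 0),
      nrm = p\<rparr>"

definition basis_elt :: "'m \<Rightarrow> 'm \<Rightarrow> complex" where
  "basis_elt x = (\<lambda>z. if z = x then 1 else 0)"

subsection \<open>Continuous functions on a compact space\<close>

definition C_of :: "'g topology \<Rightarrow> ('g \<Rightarrow> complex) star_algebra" where
  "C_of X =
     \<lparr>carrier = {f. continuous_map X euclidean f \<and> f \<in> extensional (topspace X)},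
      mult = (\<lambda>f g. restrict (\<lambda>x. f x * g x) (topspace X)),
      one = restrict (\<lambda>x. 1) (topspace X),
      zero = restrict (\<lambda>x. 0) (topspace X),
      add = (\<lambda>f g. restrict (\<lambda>x. f x + g x) (topspace X)),
      smult = (\<lambda>c f. restrict (\<lambda>x. c * f x) (topspace X)),
      star = (\<lambda>f. restrict (\<lambda>x. cnj (f x)) (topspace X)),
      nrm = (\<lambda>f. Sup (insert 0 ((\<lambda>x. cmod (f x)) ` topspace X)))\<rparr>"

section \<open>The minimal tensor product\<close>

definition state :: "'a star_algebra \<Rightarrow> ('a \<Rightarrow> complex) \<Rightarrow> bool" where
  "state B \<phi> \<longleftrightarrow>
     (\<forall>x\<in>carrier B. \<forall>y\<in>carrier B. \<phi> (x \<oplus>\<^bsub>B\<^esub> y) = \<phi> x + \<phi> y)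
     \<and> (\<forall>c. \<forall>x\<in>carrier B. \<phi> (c \<odot>\<^bsub>B\<^esub> x) = c * \<phi> x)
     \<and> (\<forall>x\<in>carrier B. \<phi> (star B x \<otimes>\<^bsub>B\<^esub> x) \<in> \<real>\<^sub>\<ge>\<^sub>0)
     \<and> (\<forall>x\<in>carrier B. cmod (\<phi> x) \<le> nrm B x)
     \<and> \<phi> \<one>\<^bsub>B\<^esub> = 1"

text \<open>The free vector space on \<open>carrier B \<times> carrier D\<close>; its quotient by the bilinearity relations is
  the algebraic tensor product. These relations lie in the kernel of the seminorm below, so
  they need not be divided out before completing.\<close>

abbreviation formal_tensors ::
  "'a star_algebra \<Rightarrow> 'b star_algebra \<Rightarrow> (('a \<times> 'b \<Rightarrow> complex) \<Rightarrow> real)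
    \<Rightarrow> ('a \<times> 'b \<Rightarrow> complex) star_algebra" where
  "formal_tensors B D \<equiv> monoid_star_algebra (B \<times>\<times> D) (map_prod (star B) (star D))"

definition tensor_functional ::
  "('a \<Rightarrow> complex) \<Rightarrow> ('b \<Rightarrow> complex) \<Rightarrow> ('a \<times> 'b \<Rightarrow> complex) \<Rightarrow> complex" where
  "tensor_functional \<phi> \<psi> t = (\<Sum>(a, b) | t (a, b) \<noteq> 0. t (a, b) * \<phi> a * \<psi> b)"

text \<open>The spatial C*-norm: the supremum over states \<open>\<phi>\<close>, \<open>\<psi>\<close> of the operator norm of \<open>t\<close> in the
  tensor product of the GNS representations of \<open>\<phi>\<close> and \<open>\<psi>\<close>. The vectors \<open>s \<cdot> (\<xi>\<^sub>\<phi> \<otimes> \<xi>\<^sub>\<psi>)\<close>, with \<open>s\<close> an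
  algebraic tensor, are dense in the representation space and have squared norm
  \<open>(\<phi> \<otimes> \<psi>)(s* s)\<close>.\<close>

definition spatial_norm ::
  "'a star_algebra \<Rightarrow> 'b star_algebra \<Rightarrow> ('a \<times> 'b \<Rightarrow> complex) \<Rightarrow> real" where
  "spatial_norm B D t =
     (let F = formal_tensors B D (\<lambda>_. 0) in
      Sup (insert 0
        {sqrt (Re (tensor_functional \<phi> \<psi> (star F (t \<otimes>\<^bsub>F\<^esub> s) \<otimes>\<^bsub>F\<^esub> (t \<otimes>\<^bsub>F\<^esub> s)))
             / Re (tensor_functional \<phi> \<psi> (star F s \<otimes>\<^bsub>F\<^esub> s))) | \<phi> \<psi> s.
         state B \<phi> \<and> state D \<psi> \<and> s \<in> carrier F
         \<and> tensor_functional \<phi> \<psi> (star F s \<otimes>\<^bsub>F\<^esub> s) \<noteq> 0}))"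

type_synonym ('a, 'b) tensor = "(nat \<Rightarrow> 'a \<times> 'b \<Rightarrow> complex) set"

definition min_tensor :: "'a star_algebra \<Rightarrow> 'b star_algebra \<Rightarrow> ('a, 'b) tensor star_algebra" where
  "min_tensor B D = completion (formal_tensors B D (spatial_norm B D))"

definition pure_tensor :: "'a star_algebra \<Rightarrow> 'b star_algebra \<Rightarrow> 'a \<Rightarrow> 'b \<Rightarrow> ('a, 'b) tensor" where
  "pure_tensor B D a b = to_completion (formal_tensors B D (spatial_norm B D)) (basis_elt (a, b))"

section \<open>Primitive matrices\<close>

definition primitive_matrix :: "real^'n^'n \<Rightarrow> bool" where
  "primitive_matrix A \<longleftrightarrow> (\<exists>k\<ge>1. \<forall>i j. 0 < (((**) A ^^ k) (mat 1)) $ i $ j)"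

definition perron_vector :: "real^'n^'n \<Rightarrow> real^'n" where
  "perron_vector A =
     (THE v. (\<forall>i. 0 < v $ i) \<and> (\<Sum>i\<in>UNIV. v $ i) = 1 \<and> (\<exists>r. A *v v = r *\<^sub>R v))"

definition words :: "real^'n^'n \<Rightarrow> nat \<Rightarrow> 'n list set" where
  "words A n = {w. length w = n \<and> (\<forall>i. Suc i < n \<longrightarrow> A $ (w ! i) $ (w ! Suc i) = 1)}"

section \<open>The C*-algebra of the quantum group\<close>

text \<open>All relations are read modulo the kernel of \<open>nrm B\<close>; if that is a norm, they are equations.\<close>

definition eqv :: "'a star_algebra \<Rightarrow> 'a \<Rightarrow> 'a \<Rightarrow> bool" where
  "eqv B x y \<longleftrightarrow> nrm B (x \<ominus>\<^bsub>B\<^esub> y) = 0"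

definition partial_isometry :: "'a star_algebra \<Rightarrow> 'a \<Rightarrow> bool" where
  "partial_isometry B v \<longleftrightarrow> eqv B (v \<otimes>\<^bsub>B\<^esub> star B v \<otimes>\<^bsub>B\<^esub> v) v"

definition projection :: "'a star_algebra \<Rightarrow> 'a \<Rightarrow> bool" where
  "projection B e \<longleftrightarrow> eqv B (star B e) e \<and> eqv B (e \<otimes>\<^bsub>B\<^esub> e) e"

definition magic_unitary :: "'a star_algebra \<Rightarrow> ('n::finite \<Rightarrow> 'n \<Rightarrow> 'a) \<Rightarrow> bool" where
  "magic_unitary B p \<longleftrightarrow>
     (\<forall>\<alpha> \<beta>. projection B (p \<alpha> \<beta>))
     \<and> (\<forall>\<alpha>. eqv B (\<Oplus>\<^bsub>B\<^esub>\<beta>\<in>UNIV. p \<alpha> \<beta>) \<one>\<^bsub>B\<^esub>)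
     \<and> (\<forall>\<beta>. eqv B (\<Oplus>\<^bsub>B\<^esub>\<alpha>\<in>UNIV. p \<alpha> \<beta>) \<one>\<^bsub>B\<^esub>)"

definition fixes_vector :: "'a star_algebra \<Rightarrow> ('n::finite \<Rightarrow> 'n \<Rightarrow> 'a) \<Rightarrow> real^'n \<Rightarrow> bool" where
  "fixes_vector B p v \<longleftrightarrow>
     (\<forall>\<alpha>. eqv B (\<Oplus>\<^bsub>B\<^esub>\<beta>\<in>UNIV. complex_of_real (v $ \<beta>) \<odot>\<^bsub>B\<^esub> p \<alpha> \<beta>)
                (complex_of_real (v $ \<alpha>) \<odot>\<^bsub>B\<^esub> \<one>\<^bsub>B\<^esub>))"

definition word_product :: "'a star_algebra \<Rightarrow> ('n \<Rightarrow> 'n \<Rightarrow> 'a) \<Rightarrow> 'n list \<Rightarrow> 'n list \<Rightarrow> 'a" where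
  "word_product B u \<alpha> \<beta> = foldr (\<lambda>(a, b) x. u a b \<otimes>\<^bsub>B\<^esub> x) (zip \<alpha> \<beta>) \<one>\<^bsub>B\<^esub>"

definition GA_relations ::
  "real^'n^'n \<Rightarrow> enat \<Rightarrow> 'a star_algebra \<Rightarrow> ('n::finite \<Rightarrow> 'n \<Rightarrow> 'a) \<Rightarrow> bool" where
  "GA_relations A l B u \<longleftrightarrow>
     (let p = (\<lambda>\<alpha> \<beta>. u \<alpha> \<beta> \<otimes>\<^bsub>B\<^esub> star B (u \<alpha> \<beta>));
          q = (\<lambda>\<alpha> \<beta>. star B (u \<alpha> \<beta>) \<otimes>\<^bsub>B\<^esub> u \<alpha> \<beta>) in
      (\<forall>\<alpha> \<beta>. partial_isometry B (u \<alpha> \<beta>))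
      \<and> magic_unitary B p \<and> magic_unitary B q
      \<and> fixes_vector B p (perron_vector A) \<and> fixes_vector B q (perron_vector A)
      \<and> (\<forall>\<alpha> \<beta>. eqv B (\<Oplus>\<^bsub>B\<^esub>\<gamma>\<in>UNIV. complex_of_real (A $ \<alpha> $ \<gamma>) \<odot>\<^bsub>B\<^esub> p \<gamma> \<beta>)
                      (\<Oplus>\<^bsub>B\<^esub>\<gamma>\<in>UNIV. complex_of_real (A $ \<gamma> $ \<beta>) \<odot>\<^bsub>B\<^esub> q \<alpha> \<gamma>))
      \<and> (\<forall>n. enat n \<le> l \<longrightarrow> (\<forall>\<alpha>\<in>words A n. \<forall>\<beta>\<in>words A n.
            partial_isometry B (word_product B u \<alpha> \<beta>))))"

text \<open>The free unital *-algebra on generators indexed by pairs of indices: letters \<open>(\<alpha>, \<beta>, False)\<close> stand for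
  generators and \<open>(\<alpha>, \<beta>, True)\<close> for their adjoints.\<close>

type_synonym 'n letter = "'n \<times> 'n \<times> bool"
type_synonym 'n free_elt = "'n letter list \<Rightarrow> complex"

abbreviation word_monoid :: "'n letter list monoid" where
  "word_monoid \<equiv> \<lparr>carrier = UNIV, mult = (@), one = []\<rparr>"

definition free_star_algebra :: "('n free_elt \<Rightarrow> real) \<Rightarrow> 'n free_elt star_algebra" where
  "free_star_algebra =
     monoid_star_algebra word_monoid (\<lambda>w. rev (map (\<lambda>(\<alpha>, \<beta>, s). (\<alpha>, \<beta>, \<not> s)) w))"

definition free_gen :: "'n \<Rightarrow> 'n \<Rightarrow> 'n free_elt" where
  "free_gen \<alpha> \<beta> = basis_elt [(\<alpha>, \<beta>, False)]"

text \<open>The universal C*-algebra is the Hausdorff completion of the free *-algebra in the largest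
  C*-seminorm modulo whose kernel the relations hold. The supremum is finite since generators
  have norm at most one in each such seminorm.\<close>

definition GA_seminorm :: "real^'n^'n \<Rightarrow> enat \<Rightarrow> 'n::finite free_elt \<Rightarrow> real" where
  "GA_seminorm A l x =
     Sup {p x | p. cstar_seminorm (free_star_algebra p) p
                   \<and> GA_relations A l (free_star_algebra p) free_gen}"

type_synonym 'n GA_elt = "(nat \<Rightarrow> 'n free_elt) set"

definition C_GA :: "real^'n^'n \<Rightarrow> enat \<Rightarrow> 'n::finite GA_elt star_algebra" where
  "C_GA A l = completion (free_star_algebra (GA_seminorm A l))"

definition GA_gen :: "real^'n^'n \<Rightarrow> enat \<Rightarrow> 'n::finite \<Rightarrow> 'n \<Rightarrow> 'n GA_elt" where
  "GA_gen A l \<alpha> \<beta> = to_completion (free_star_algebra (GA_seminorm A l)) (free_gen \<alpha> \<beta>)"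

text \<open>Only the values on the carrier matter, and they are determined by the values on the
  generators.\<close>

definition GA_coproduct ::
  "real^'n^'n \<Rightarrow> enat \<Rightarrow> 'n::finite GA_elt \<Rightarrow> ('n GA_elt, 'n GA_elt) tensor" where
  "GA_coproduct A l =
     (let C = C_GA A l; CC = min_tensor C C; u = GA_gen A l in
      SOME \<Delta>. star_hom C CC \<Delta>
        \<and> (\<forall>\<alpha> \<beta>. \<Delta> (u \<alpha> \<beta>) = (\<Oplus>\<^bsub>CC\<^esub>\<gamma>\<in>UNIV. pure_tensor C C (u \<alpha> \<gamma>) (u \<gamma> \<beta>))))"

section \<open>The classical version of a compact quantum group\<close>

definition closed_ideal :: "'a star_algebra \<Rightarrow> 'a set \<Rightarrow> bool" where
  "closed_ideal B I \<longleftrightarrow> ideal I B \<and>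
     (\<forall>X x. range X \<subseteq> I \<longrightarrow> x \<in> carrier B \<longrightarrow> (\<lambda>n. nrm B (X n \<ominus>\<^bsub>B\<^esub> x)) \<longlonglongrightarrow> 0 \<longrightarrow> x \<in> I)"

definition commutator_ideal :: "'a star_algebra \<Rightarrow> 'a set" where
  "commutator_ideal B = \<Inter> {I. closed_ideal B I \<and>
     (\<forall>x\<in>carrier B. \<forall>y\<in>carrier B. x \<otimes>\<^bsub>B\<^esub> y \<ominus>\<^bsub>B\<^esub> y \<otimes>\<^bsub>B\<^esub> x \<in> I)}"

definition compact_group :: "'g monoid \<Rightarrow> 'g topology \<Rightarrow> bool" where
  "compact_group G X \<longleftrightarrow> Group.group G \<and> topspace X = carrier G
     \<and> compact_space X \<and> Hausdorff_space X
     \<and> continuous_map (prod_topology X X) X (\<lambda>(g, h). g \<otimes>\<^bsub>G\<^esub> h)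
     \<and> continuous_map X X (\<lambda>g. inv\<^bsub>G\<^esub> g)"

text \<open>\<open>(G, X)\<close> is the classical version of the compact quantum group \<open>(C, \<Delta>)\<close>. Here \<open>q\<close> is the quotient
  map onto \<open>Q = C/J\<close> and \<open>qq\<close> is \<open>q \<otimes> q\<close>, so \<open>\<Delta>'\<close> is the coproduct on \<open>Q\<close> induced by \<open>\<Delta>\<close>.
  The map \<open>\<Phi>\<close> identifies \<open>Q\<close> with \<open>C(G)\<close>, and \<open>\<Phi>\<Phi>\<close> is \<open>\<Phi> \<otimes> \<Phi>\<close> followed by the canonical identification of
  \<open>C(G) \<otimes> C(G)\<close> with \<open>C(G \<times> G)\<close>. The maps \<open>qq\<close> and \<open>\<Phi>\<Phi>\<close> are determined by their values on pure tensors.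
  The last clause states that \<open>\<Delta>'\<close> corresponds to the coproduct \<open>f \<mapsto> ((g, h) \<mapsto> f (g h))\<close> of \<open>C(G)\<close>.\<close>

definition is_classical_version ::
  "'a star_algebra \<Rightarrow> ('a \<Rightarrow> ('a, 'a) tensor) \<Rightarrow> 'g monoid \<Rightarrow> 'g topology \<Rightarrow> bool" where
  "is_classical_version C \<Delta> G X \<longleftrightarrow> compact_group G X \<and>
     (let J = commutator_ideal C; Q = star_quot C J; q = (\<lambda>a. J +>\<^bsub>C\<^esub> a);
          CC = min_tensor C C; QQ = min_tensor Q Q in
      \<exists>qq \<Delta>' \<Phi> \<Phi>\<Phi>.
        star_hom CC QQ qq
        \<and> (\<forall>a\<in>carrier C. \<forall>b\<in>carrier C. qq (pure_tensor C C a b) = pure_tensor Q Q (q a) (q b))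
        \<and> star_hom Q QQ \<Delta>'
        \<and> (\<forall>a\<in>carrier C. \<Delta>' (q a) = qq (\<Delta> a))
        \<and> star_iso Q (C_of X) \<Phi>
        \<and> star_hom QQ (C_of (prod_topology X X)) \<Phi>\<Phi>
        \<and> (\<forall>a\<in>carrier Q. \<forall>b\<in>carrier Q. \<forall>g\<in>carrier G. \<forall>h\<in>carrier G.
              \<Phi>\<Phi> (pure_tensor Q Q a b) (g, h) = \<Phi> a g * \<Phi> b h)
        \<and> (\<forall>a\<in>carrier Q. \<forall>g\<in>carrier G. \<forall>h\<in>carrier G. \<Phi>\<Phi> (\<Delta>' a) (g, h) = \<Phi> a (g \<otimes>\<^bsub>G\<^esub> h)))"

section \<open>The wreath product of the circle by the automorphism group\<close>

definition Aut_matrix :: "real^'n^'n \<Rightarrow> ('n \<Rightarrow> 'n) set" where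
  "Aut_matrix A = {\<pi>. bij \<pi> \<and> (\<forall>i j. A $ \<pi> i $ \<pi> j = A $ i $ j)}"

definition torus :: "(complex^'n) set" where
  "torus = {z. \<forall>i. cmod (z $ i) = 1}"

text \<open>A permutation \<open>\<pi>\<close> acts on the torus by \<open>(\<pi> \<cdot> w)\<^sub>i = w\<^sub>j\<close> with \<open>j = \<pi>\<^sup>-\<^sup>1(i)\<close>, a left action.\<close>

definition torus_wreath_Aut :: "real^'n^'n \<Rightarrow> ((complex^'n) \<times> ('n \<Rightarrow> 'n)) monoid" where
  "torus_wreath_Aut A =
     \<lparr>carrier = torus \<times> Aut_matrix A,
      mult = (\<lambda>(z, \<pi>) (w, \<sigma>). (\<chi> i. z $ i * w $ (Hilbert_Choice.inv \<pi> i), \<pi> \<circ> \<sigma>)),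
      one = (\<chi> i. 1, id)\<rparr>"

definition torus_wreath_topology ::
  "real^'n^'n \<Rightarrow> ((complex^'n) \<times> ('n \<Rightarrow> 'n)) topology" where
  "torus_wreath_topology A =
     prod_topology (subtopology euclidean torus) (discrete_topology (Aut_matrix A))"

end

theory Submission
  imports Defs
begin

text \<open>
  Evaluation at a point \<open>(z, \<pi>)\<close> of the wreath product sends \<open>u\<^sub>a\<^sub>b\<close> to \<open>z\<^sub>a\<close> if \<open>a = \<pi> b\<close> and to 0 otherwise, and
  polynomials in these functions are dense by the Stone--Weierstrass theorem. The point is therefore that
  the norm of the commutative quotient \<open>Q\<close> is bounded by the supremum norm. The projections
  \<open>p = u u*\<close> commute in \<open>Q\<close>, and multiplying by one of them for each column costs at most a
  factor \<open>N\<^sup>N\<close> in norm and leaves a piece on which the generators behave like those at a fixed \<open>\<pi> \<in> Aut A\<close>.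
  There a polynomial \<open>f\<close> of degree \<open>D\<close> is a combination of \<open>(2D + 1)\<^sup>N\<close> Laurent monomials with coefficients
  at most \<open>sup |f|\<close>. Hence \<open>\<parallel>f\<parallel> \<le> N\<^sup>N (2D + 1)\<^sup>N sup |f|\<close>, and passing from \<open>f\<close> to \<open>f* f\<close> repeatedly removes the
  polynomial factor, because \<open>\<parallel>f\<parallel>\<^sup>2 \<le> \<parallel>f* f\<parallel>\<close> holds in a quotient by a closed ideal.

  The coproduct of the universal algebra exists because projections with sum 1 in a C*-algebra are
  orthogonal, so that \<open>\<Sum>\<^sub>c u\<^sub>a\<^sub>c \<otimes> u\<^sub>c\<^sub>b\<close> satisfies the defining relations. It induces the group law since
  characters are contractive, hence determined by their values on generators.
\<close>

\<comment> \<open>Sandwiched between projections, relation (II) says that q_ac p_a'c' = 0 unless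
  A_aa' = A_cc'. In a commutative quotient p = q, and this is what forces \<pi> into Aut(A).
  Conversely, points of the wreath product satisfy (I) because the Perron-Frobenius vector is
  unique, hence invariant under Aut(A). For the coproduct the obstacle is (III): a word in the
  elements \<Sum>_c u_ac \<otimes> u_cb is a sum of pure tensors over intermediate words, and it is
  a partial isometry once these summands have orthogonal supports and ranges. That follows by
  induction, since (III) for a word and for its tail makes a support and a range projection commute.
  No representation is constructed: GNS operator norms enter only as inequalities between the
  numbers \<omega>(s* s), and are bounded by repeated squaring as well. In this way the spatial norm
  on Q \<otimes> Q is at most the supremum over G x G, so Q \<otimes> Q embeds into C(G x G). This
  is why the coproduct, followed by the quotient map in both legs, annihilates the commutator ideal
  and descends to Q.\<close>
syntax "_index" :: "logic \<Rightarrow> index" ("\<^sub>_" [1000] 1000)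

section \<open>Unital complex *-algebras, finite sums and *-homomorphisms\<close>

locale star_alg = ring B for B :: "'a star_algebra" (structure) +
  assumes smult_closed [simp, intro]: "x \<in> carrier B \<Longrightarrow> c \<odot> x \<in> carrier B"
    and smult_l_distr: "x \<in> carrier B \<Longrightarrow> (c + d) \<odot> x = c \<odot> x \<oplus> d \<odot> x"
    and smult_r_distr: "x \<in> carrier B \<Longrightarrow> y \<in> carrier B \<Longrightarrow> c \<odot> (x \<oplus> y) = c \<odot> x \<oplus> c \<odot> y"
    and smult_assoc: "x \<in> carrier B \<Longrightarrow> (c * d) \<odot> x = c \<odot> (d \<odot> x)"
    and smult_one [simp]: "x \<in> carrier B \<Longrightarrow> 1 \<odot> x = x"
    and smult_mult_l: "x \<in> carrier B \<Longrightarrow> y \<in> carrier B \<Longrightarrow> (c \<odot> x) \<otimes> y = c \<odot> (x \<otimes> y)"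
    and smult_mult_r: "x \<in> carrier B \<Longrightarrow> y \<in> carrier B \<Longrightarrow> x \<otimes> (c \<odot> y) = c \<odot> (x \<otimes> y)"
    and star_closed [simp, intro]: "x \<in> carrier B \<Longrightarrow> star B x \<in> carrier B"
    and star_star [simp]: "x \<in> carrier B \<Longrightarrow> star B (star B x) = x"
    and star_add: "x \<in> carrier B \<Longrightarrow> y \<in> carrier B \<Longrightarrow> star B (x \<oplus> y) = star B x \<oplus> star B y"
    and star_mult: "x \<in> carrier B \<Longrightarrow> y \<in> carrier B \<Longrightarrow> star B (x \<otimes> y) = star B y \<otimes> star B x"
    and star_smult: "x \<in> carrier B \<Longrightarrow> star B (c \<odot> x) = cnj c \<odot> star B x"

text \<open>Additive inverses come from the scalar -1, as (-1) x + x = 0 x, which is why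
  \<open>0 \<odot> x = \<zero>\<close> appears among the assumptions. Function algebras, monoid
  algebras, quotients and algebras of Cauchy sequences are all checked through this rule.\<close>

lemma star_algI:
  fixes B :: "'a star_algebra" (structure)
  assumes add: "\<And>x y. x \<in> carrier B \<Longrightarrow> y \<in> carrier B \<Longrightarrow> x \<oplus> y \<in> carrier B"
    and zero: "\<zero> \<in> carrier B"
    and assoc: "\<And>x y z. x \<in> carrier B \<Longrightarrow> y \<in> carrier B \<Longrightarrow> z \<in> carrier B \<Longrightarrow> x \<oplus> y \<oplus> z = x \<oplus> (y \<oplus> z)"
    and comm: "\<And>x y. x \<in> carrier B \<Longrightarrow> y \<in> carrier B \<Longrightarrow> x \<oplus> y = y \<oplus> x"
    and l_zero: "\<And>x. x \<in> carrier B \<Longrightarrow> \<zero> \<oplus> x = x"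
    and mult: "\<And>x y. x \<in> carrier B \<Longrightarrow> y \<in> carrier B \<Longrightarrow> x \<otimes> y \<in> carrier B"
    and one: "\<one> \<in> carrier B"
    and massoc: "\<And>x y z. x \<in> carrier B \<Longrightarrow> y \<in> carrier B \<Longrightarrow> z \<in> carrier B \<Longrightarrow> x \<otimes> y \<otimes> z = x \<otimes> (y \<otimes> z)"
    and l_one: "\<And>x. x \<in> carrier B \<Longrightarrow> \<one> \<otimes> x = x"
    and r_one: "\<And>x. x \<in> carrier B \<Longrightarrow> x \<otimes> \<one> = x"
    and l_distr: "\<And>x y z. x \<in> carrier B \<Longrightarrow> y \<in> carrier B \<Longrightarrow> z \<in> carrier B \<Longrightarrow> (x \<oplus> y) \<otimes> z = x \<otimes> z \<oplus> y \<otimes> z"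
    and r_distr: "\<And>x y z. x \<in> carrier B \<Longrightarrow> y \<in> carrier B \<Longrightarrow> z \<in> carrier B \<Longrightarrow> z \<otimes> (x \<oplus> y) = z \<otimes> x \<oplus> z \<otimes> y"
    and smult: "\<And>c x. x \<in> carrier B \<Longrightarrow> c \<odot> x \<in> carrier B"
    and smult_zero: "\<And>x. x \<in> carrier B \<Longrightarrow> 0 \<odot> x = \<zero>"
    and smult_rest: "\<And>c d x. x \<in> carrier B \<Longrightarrow> (c + d) \<odot> x = c \<odot> x \<oplus> d \<odot> x"
      "\<And>c x y. x \<in> carrier B \<Longrightarrow> y \<in> carrier B \<Longrightarrow> c \<odot> (x \<oplus> y) = c \<odot> x \<oplus> c \<odot> y"
      "\<And>c d x. x \<in> carrier B \<Longrightarrow> (c * d) \<odot> x = c \<odot> (d \<odot> x)"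
      "\<And>x. x \<in> carrier B \<Longrightarrow> 1 \<odot> x = x"
      "\<And>c x y. x \<in> carrier B \<Longrightarrow> y \<in> carrier B \<Longrightarrow> (c \<odot> x) \<otimes> y = c \<odot> (x \<otimes> y)"
      "\<And>c x y. x \<in> carrier B \<Longrightarrow> y \<in> carrier B \<Longrightarrow> x \<otimes> (c \<odot> y) = c \<odot> (x \<otimes> y)"
    and star: "\<And>x. x \<in> carrier B \<Longrightarrow> star B x \<in> carrier B"
      "\<And>x. x \<in> carrier B \<Longrightarrow> star B (star B x) = x"
      "\<And>x y. x \<in> carrier B \<Longrightarrow> y \<in> carrier B \<Longrightarrow> star B (x \<oplus> y) = star B x \<oplus> star B y"
      "\<And>x y. x \<in> carrier B \<Longrightarrow> y \<in> carrier B \<Longrightarrow> star B (x \<otimes> y) = star B y \<otimes> star B x"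
      "\<And>c x. x \<in> carrier B \<Longrightarrow> star B (c \<odot> x) = cnj c \<odot> star B x"
  shows "star_alg B"
proof -
  have inv: "\<exists>y\<in>carrier B. y \<oplus> x = \<zero>" if x: "x \<in> carrier B" for x
  proof
    show "(-1) \<odot> x \<in> carrier B" using smult x .
    have "(-1) \<odot> x \<oplus> x = (-1) \<odot> x \<oplus> 1 \<odot> x" using smult_rest(4) x by simp
    also have "\<dots> = (-1 + 1) \<odot> x" using smult_rest(1) x by metis
    finally show "(-1) \<odot> x \<oplus> x = \<zero>" using smult_zero x by simp
  qed
  have "ring B"
  proof (rule ringI)
    show "abelian_group B" by (rule abelian_groupI) (use add zero assoc comm l_zero inv in auto)
    show "Group.monoid B" by (rule monoidI) (use mult one massoc l_one r_one in auto)
  qed (use l_distr r_distr in auto)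
  then interpret ring B .
  show ?thesis by unfold_locales (use assms in auto)
qed

context star_alg
begin

lemma smult_zero_l [simp]:
  assumes "x \<in> carrier B" shows "0 \<odot> x = \<zero>"
proof -
  have "0 \<odot> x \<oplus> 0 \<odot> x = 0 \<odot> x" using smult_l_distr[of x 0 0] assms by simp
  then show ?thesis using assms by (metis local.add.r_cancel_one smult_closed)
qed

lemma smult_zero_r [simp]: "c \<odot> \<zero> = \<zero>" by (metis local.add.r_cancel_one r_zero smult_closed smult_r_distr zero_closed)

lemma a_inv_smult: "x \<in> carrier B \<Longrightarrow> \<ominus> x = (-1) \<odot> x" using smult_l_distr[of x "-1" 1] by (intro minus_equality) auto

lemma minus_smult: "x \<in> carrier B \<Longrightarrow> y \<in> carrier B \<Longrightarrow> x \<ominus> y = x \<oplus> (-1) \<odot> y" by (simp add: a_minus_def a_inv_smult)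

lemma star_zero [simp]: "star B \<zero> = \<zero>" using star_smult[of \<zero> 0] by simp

lemma star_one [simp]: "star B \<one> = \<one>"
proof -
  have "star B \<one> = star B (star B \<one>) \<otimes> star B \<one>" by simp
  also have "\<dots> = star B (\<one> \<otimes> star B \<one>)" by (subst star_mult) auto
  also have "\<dots> = \<one>" by simp
  finally show ?thesis .
qed

lemma star_a_inv: "x \<in> carrier B \<Longrightarrow> star B (\<ominus> x) = \<ominus> star B x" by (simp add: a_inv_smult star_smult)

lemma star_minus: "x \<in> carrier B \<Longrightarrow> y \<in> carrier B \<Longrightarrow> star B (x \<ominus> y) = star B x \<ominus> star B y" by (simp add: a_minus_def star_add star_a_inv)

lemma finsum_smult:
  assumes "f \<in> A \<rightarrow> carrier B"
  shows "(\<Oplus>i\<in>A. c \<odot> f i) = c \<odot> (\<Oplus>i\<in>A. f i)"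
proof (cases "finite A")
  case True
  then show ?thesis using assms by induction (auto simp: smult_r_distr finsum_insert finsum_closed Pi_def)
qed (simp add: finsum_infinite)

lemma star_finsum:
  assumes "f \<in> A \<rightarrow> carrier B"
  shows "star B (\<Oplus>i\<in>A. f i) = (\<Oplus>i\<in>A. star B (f i))"
proof (cases "finite A")
  case True
  then show ?thesis using assms by induction (auto simp: star_add finsum_insert finsum_closed Pi_def)
qed (simp add: finsum_infinite)

lemma finsum_smult_const:
  assumes "x \<in> carrier B" "finite A"
  shows "(\<Oplus>i\<in>A. c i \<odot> x) = (\<Sum>i\<in>A. c i) \<odot> x" using assms(2) by induction (auto simp: assms(1) smult_l_distr finsum_insert Pi_def)

lemma finsum_swap:
  assumes "finite A" "finite D" "\<And>i j. i \<in> A \<Longrightarrow> j \<in> D \<Longrightarrow> f i j \<in> carrier B"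
  shows "(\<Oplus>i\<in>A. \<Oplus>j\<in>D. f i j) = (\<Oplus>j\<in>D. \<Oplus>i\<in>A. f i j)" using assms(1,3)
proof induction
  case (insert a A)
  have "(\<Oplus>j\<in>D. f a j \<oplus> (\<Oplus>i\<in>A. f i j)) = (\<Oplus>j\<in>D. f a j) \<oplus> (\<Oplus>j\<in>D. \<Oplus>i\<in>A. f i j)"
    using insert.prems by (intro finsum_addf) (auto intro!: finsum_closed)
  moreover have "(\<Oplus>j\<in>D. \<Oplus>i\<in>insert a A. f i j) = (\<Oplus>j\<in>D. f a j \<oplus> (\<Oplus>i\<in>A. f i j))"
    using insert by (intro finsum_cong') (auto intro!: finsum_closed simp: finsum_insert Pi_def)
  ultimately show ?case using insert by (subst finsum_insert) (auto intro!: finsum_closed)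
qed simp

lemma finsum_Sigma_prod:
  assumes "finite A" "finite D" "\<And>i j. i \<in> A \<Longrightarrow> j \<in> D \<Longrightarrow> f i j \<in> carrier B"
  shows "(\<Oplus>x\<in>A \<times> D. f (fst x) (snd x)) = (\<Oplus>i\<in>A. \<Oplus>j\<in>D. f i j)" using assms(1,3)
proof induction
  case (insert a A)
  have "(\<Oplus>x\<in>insert a A \<times> D. f (fst x) (snd x)) = (\<Oplus>x\<in>({a} \<times> D) \<union> (A \<times> D). f (fst x) (snd x))"
    by (rule arg_cong[where f = "finsum B _"]) auto
  also have "\<dots> = (\<Oplus>x\<in>{a} \<times> D. f (fst x) (snd x)) \<oplus> (\<Oplus>x\<in>A \<times> D. f (fst x) (snd x))"
    using insert assms(2) by (intro finsum_Un_disjoint) auto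
  also have "(\<Oplus>x\<in>{a} \<times> D. f (fst x) (snd x)) = (\<Oplus>x\<in>Pair a ` D. f (fst x) (snd x))" by (rule arg_cong[where f = "finsum B _"]) auto
  also have "\<dots> = (\<Oplus>j\<in>D. f a j)" using insert.prems by (subst finsum_reindex) (auto simp: inj_on_def)
  finally show ?case using insert by (subst finsum_insert) (auto intro!: finsum_closed)
qed simp

lemma finsum_delta:
  assumes "finite A" "x \<in> carrier B"
  shows "(\<Oplus>i\<in>A. if i = j then x else \<zero>) = (if j \<in> A then x else \<zero>)"
proof (cases "j \<in> A")
  case True
  have "(\<Oplus>i\<in>A. if i = j then x else \<zero>) = (\<Oplus>i\<in>A. if j = i then x else \<zero>)" by (simp add: eq_commute)
  also have "\<dots> = x" using finsum_singleton[of j A "\<lambda>_. x"] assms True by simp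
  finally show ?thesis using True by simp
next
  case False
  then have "(\<Oplus>i\<in>A. if i = j then x else \<zero>) = (\<Oplus>i\<in>A. \<zero>)" by (intro finsum_cong') auto
  then show ?thesis using False by (simp add: finsum_zero)
qed

lemma finsum_superset:
  assumes "finite A" "S \<subseteq> A" "f \<in> A \<rightarrow> carrier B" "\<And>i. i \<in> A - S \<Longrightarrow> f i = \<zero>"
  shows "finsum B f A = finsum B f S"
proof -
  have "finsum B f A = finsum B f (S \<union> (A - S))" using assms(2) by (intro arg_cong[where f = "finsum B f"]) auto
  also have "\<dots> = finsum B f S \<oplus> finsum B f (A - S)" using assms by (intro finsum_Un_disjoint) (auto intro: finite_subset)
  also have "finsum B f (A - S) = (\<Oplus>i\<in>A - S. \<zero>)" using assms by (intro finsum_cong') auto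
  moreover have "finsum B f S \<in> carrier B" using assms by (intro finsum_closed) auto
  ultimately show ?thesis by (simp add: finsum_zero)
qed

end

lemma star_homD:
  assumes "star_hom B D \<phi>"
  shows "\<And>x. x \<in> carrier B \<Longrightarrow> \<phi> x \<in> carrier D"
    and "\<And>x y. x \<in> carrier B \<Longrightarrow> y \<in> carrier B \<Longrightarrow> \<phi> (x \<oplus>\<^sub>B y) = \<phi> x \<oplus>\<^sub>D \<phi> y"
    and "\<And>x y. x \<in> carrier B \<Longrightarrow> y \<in> carrier B \<Longrightarrow> \<phi> (x \<otimes>\<^sub>B y) = \<phi> x \<otimes>\<^sub>D \<phi> y"
    and "\<phi> \<one>\<^sub>B = \<one>\<^sub>D"
    and "\<And>c x. x \<in> carrier B \<Longrightarrow> \<phi> (c \<odot>\<^sub>B x) = c \<odot>\<^sub>D \<phi> x"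
    and "\<And>x. x \<in> carrier B \<Longrightarrow> \<phi> (star B x) = star D (\<phi> x)" using assms by (auto simp: star_hom_def ring_hom_def)

lemma star_homI:
  assumes "\<And>x. x \<in> carrier B \<Longrightarrow> \<phi> x \<in> carrier D"
    and "\<And>x y. x \<in> carrier B \<Longrightarrow> y \<in> carrier B \<Longrightarrow> \<phi> (x \<oplus>\<^sub>B y) = \<phi> x \<oplus>\<^sub>D \<phi> y"
    and "\<And>x y. x \<in> carrier B \<Longrightarrow> y \<in> carrier B \<Longrightarrow> \<phi> (x \<otimes>\<^sub>B y) = \<phi> x \<otimes>\<^sub>D \<phi> y"
    and "\<phi> \<one>\<^sub>B = \<one>\<^sub>D"
    and "\<And>c x. x \<in> carrier B \<Longrightarrow> \<phi> (c \<odot>\<^sub>B x) = c \<odot>\<^sub>D \<phi> x"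
    and "\<And>x. x \<in> carrier B \<Longrightarrow> \<phi> (star B x) = star D (\<phi> x)"
  shows "star_hom B D \<phi>" using assms by (auto simp: star_hom_def ring_hom_def)

lemma star_hom_compose:
  assumes "star_hom B D \<phi>" "star_hom D E \<psi>"
  shows "star_hom B E (\<lambda>x. \<psi> (\<phi> x))" using assms by (auto simp: star_hom_def ring_hom_def Pi_def)

locale star_alg_hom = B: star_alg B + D: star_alg D
  for B :: "'a star_algebra" and D :: "'b star_algebra" and \<phi> +
  assumes hom: "star_hom B D \<phi>"

lemmas star_alg_homI = star_alg_hom.intro[OF _ _ star_alg_hom_axioms.intro]

context star_alg_hom
begin

lemmas hom_closed [simp, intro] = star_homD(1)[OF hom]
lemmas hom_add = star_homD(2)[OF hom]
lemmas hom_mult = star_homD(3)[OF hom]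
lemmas hom_one = star_homD(4)[OF hom]
lemmas hom_smult = star_homD(5)[OF hom]
lemmas hom_star = star_homD(6)[OF hom]

lemma hom_zero: "\<phi> \<zero>\<^sub>B = \<zero>\<^sub>D" using hom_smult[of "\<zero>\<^sub>B" 0] by simp

lemma hom_a_inv: "x \<in> carrier B \<Longrightarrow> \<phi> (\<ominus>\<^sub>B x) = \<ominus>\<^sub>D \<phi> x" by (simp add: B.a_inv_smult D.a_inv_smult hom_smult)

lemma hom_minus: "x \<in> carrier B \<Longrightarrow> y \<in> carrier B \<Longrightarrow> \<phi> (x \<ominus>\<^sub>B y) = \<phi> x \<ominus>\<^sub>D \<phi> y" by (simp add: a_minus_def hom_add hom_a_inv)

lemma hom_finsum:
  assumes "f \<in> A \<rightarrow> carrier B"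
  shows "\<phi> (finsum B f A) = finsum D (\<lambda>i. \<phi> (f i)) A"
proof (cases "finite A")
  case True
  then show ?thesis using assms by induction (auto simp: hom_zero hom_add B.finsum_insert D.finsum_insert B.finsum_closed Pi_def)
qed (simp add: B.finsum_infinite D.finsum_infinite hom_zero)

end

subsection \<open>Monoid algebras\<close>

locale inv_monoid = Group.monoid M for M :: "'m monoid" (structure) and i :: "'m \<Rightarrow> 'm" +
  assumes inv_closed [simp, intro]: "x \<in> carrier M \<Longrightarrow> i x \<in> carrier M"
    and inv_inv [simp]: "x \<in> carrier M \<Longrightarrow> i (i x) = x"
    and inv_mult: "x \<in> carrier M \<Longrightarrow> y \<in> carrier M \<Longrightarrow> i (x \<otimes> y) = i y \<otimes> i x"
begin

end

text \<open>Convolution and involution of \<open>monoid_star_algebra\<close> are both push-forwards: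
  a finite family of coefficients \<open>c k\<close> is placed at the points \<open>h k\<close> and
  summed over fibres. The index k is a pair with h the product, or a single element with h the map
  \<open>i\<close>. Both operations are handled through this common shape.\<close>

lemma fiber_sum_support: "{z. (\<Sum>k\<in>I. if h k = z then c k else (0::complex)) \<noteq> 0} \<subseteq> h ` I"
proof
  fix z assume "z \<in> {z. (\<Sum>k\<in>I. if h k = z then c k else 0) \<noteq> 0}"
  then obtain k where "k \<in> I" "(if h k = z then c k else 0) \<noteq> 0"
    unfolding mem_Collect_eq by (rule sum.not_neutral_contains_not_neutral)
  then show "z \<in> h ` I" by (auto split: if_splits)
qed

lemma finite_fiber_sum:
  assumes "finite I"
  shows "finite {z. (\<Sum>k\<in>I. if h k = z then c k else (0::complex)) \<noteq> 0}"
proof -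
  have "finite (h ` I)" using assms by (rule finite_imageI)
  then show ?thesis by (rule finite_subset[OF fiber_sum_support[where I = I and h = h and c = c]])
qed

lemma sum_fiber:
  assumes "finite I"
  shows "(\<Sum>z | (\<Sum>k\<in>I. if h k = z then c k else (0::complex)) \<noteq> 0.
            (\<Sum>k\<in>I. if h k = z then c k else 0) * \<eta> z) = (\<Sum>k\<in>I. c k * \<eta> (h k))"
    (is "(\<Sum>z | ?F z \<noteq> 0. ?F z * \<eta> z) = _")
proof -
  have "(\<Sum>z | ?F z \<noteq> 0. ?F z * \<eta> z) = (\<Sum>z\<in>h ` I. ?F z * \<eta> z)"
    using assms fiber_sum_support[where I = I and h = h and c = c] by (intro sum.mono_neutral_left) auto
  also have "\<dots> = (\<Sum>z\<in>h ` I. \<Sum>k\<in>I. if h k = z then c k * \<eta> z else 0)"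
    by (intro sum.cong) (auto simp: sum_distrib_right intro!: sum.cong)
  also have "\<dots> = (\<Sum>k\<in>I. \<Sum>z\<in>h ` I. if h k = z then c k * \<eta> z else 0)" by (rule sum.swap)
  also have "\<dots> = (\<Sum>k\<in>I. c k * \<eta> (h k))" using assms by (intro sum.cong) (auto simp: sum.delta')
  finally show ?thesis .
qed

lemma msa_simps [simp]:
  "f \<in> carrier (monoid_star_algebra M i p) \<longleftrightarrow> finite {x. f x \<noteq> 0} \<and> {x. f x \<noteq> 0} \<subseteq> carrier M"
  "mult (monoid_star_algebra M i p) f g =
    (\<lambda>z. \<Sum>x | f x \<noteq> 0. \<Sum>y | g y \<noteq> 0. if mult M x y = z then f x * g y else 0)"
  "one (monoid_star_algebra M i p) = basis_elt (one M)"
  "zero (monoid_star_algebra M i p) = (\<lambda>z. 0)"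
  "add (monoid_star_algebra M i p) f g = (\<lambda>z. f z + g z)"
  "smult (monoid_star_algebra M i p) c f = (\<lambda>z. c * f z)"
  "star (monoid_star_algebra M i p) f = (\<lambda>z. \<Sum>x | f x \<noteq> 0. if i x = z then cnj (f x) else 0)"
  "nrm (monoid_star_algebra M i p) = p" by (auto simp: monoid_star_algebra_def basis_elt_def fun_eq_iff)

lemma basis_elt_support [simp]: "{z. basis_elt x z \<noteq> 0} = {x}" by (auto simp: basis_elt_def)

lemma basis_elt_self [simp]: "basis_elt x x = 1" by (simp add: basis_elt_def)

lemma msa_mult_superset:
  assumes "finite X" "{x. f x \<noteq> 0} \<subseteq> X" "finite Y" "{x. g x \<noteq> 0} \<subseteq> Y"
  shows "(\<Sum>x | f x \<noteq> 0. \<Sum>y | g y \<noteq> 0. if mult M x y = z then f x * g y else (0::complex))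
    = (\<Sum>x\<in>X. \<Sum>y\<in>Y. if mult M x y = z then f x * g y else 0)"
proof -
  have "(\<Sum>y | g y \<noteq> 0. if mult M x y = z then f x * g y else 0)
      = (\<Sum>y\<in>Y. if mult M x y = z then f x * g y else 0)" for x
    using assms by (intro sum.mono_neutral_left) auto
  then show ?thesis using assms by (simp, intro sum.mono_neutral_left ballI sum.neutral) auto
qed

lemma msa_mult_pairs:
  "(\<Sum>x | f x \<noteq> 0. \<Sum>y | g y \<noteq> 0. if mult M x y = z then f x * g y else (0::complex))
    = (\<Sum>k\<in>{x. f x \<noteq> 0} \<times> {y. g y \<noteq> 0}. if mult M (fst k) (snd k) = z then f (fst k) * g (snd k) else 0)"
  by (simp add: sum.cartesian_product case_prod_beta')

lemma msa_mult_apply: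
  assumes "finite {x. f x \<noteq> 0}" "finite {x. g x \<noteq> 0}"
  shows "(\<Sum>z | mult (monoid_star_algebra M i p) f g z \<noteq> 0. mult (monoid_star_algebra M i p) f g z * \<eta> z)
    = (\<Sum>x | f x \<noteq> 0. \<Sum>y | g y \<noteq> 0. f x * g y * \<eta> (mult M x y))"
  unfolding msa_simps msa_mult_pairs by (subst sum_fiber) (use assms in \<open>auto simp: sum.cartesian_product case_prod_beta'\<close>)

lemma msa_star_apply:
  assumes "finite {x. f x \<noteq> 0}"
  shows "(\<Sum>z | star (monoid_star_algebra M i p) f z \<noteq> 0. star (monoid_star_algebra M i p) f z * \<eta> z)
    = (\<Sum>x | f x \<noteq> 0. cnj (f x) * \<eta> (i x))"
  unfolding msa_simps by (rule sum_fiber) fact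

lemma cnj_of_bool: "cnj (of_bool P) = of_bool P" by (cases P) auto

context inv_monoid
begin

abbreviation A where "A \<equiv> monoid_star_algebra M i"

lemma msa_mult_closed:
  assumes "f \<in> carrier (A p)" "g \<in> carrier (A p)"
  shows "mult (A p) f g \<in> carrier (A p)"
proof -
  have "finite {z. mult (A p) f g z \<noteq> 0}" unfolding msa_simps msa_mult_pairs using assms by (intro finite_fiber_sum) auto
  moreover have "z \<in> carrier M" if "mult (A p) f g z \<noteq> 0" for z
  proof (rule ccontr)
    assume "z \<notin> carrier M"
    then have "x \<otimes> y \<noteq> z" if "f x \<noteq> 0" "g y \<noteq> 0" for x y using that assms by auto
    then have "mult (A p) f g z = 0" by (auto intro!: sum.neutral)
    with that show False by simp
  qed
  ultimately show ?thesis by (subst msa_simps(1)) blast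
qed

lemma msa_star_closed:
  assumes "f \<in> carrier (A p)"
  shows "star (A p) f \<in> carrier (A p)"
proof -
  have "finite {z. star (A p) f z \<noteq> 0}" unfolding msa_simps using assms by (intro finite_fiber_sum) auto
  moreover have "z \<in> carrier M" if "star (A p) f z \<noteq> 0" for z
  proof (rule ccontr)
    assume "z \<notin> carrier M"
    then have "i x \<noteq> z" if "f x \<noteq> 0" for x using that assms by auto
    then have "star (A p) f z = 0" by (auto intro!: sum.neutral)
    with that show False by simp
  qed
  ultimately show ?thesis by (subst msa_simps(1)) blast
qed

lemma msa_mult_alt1:
  "mult (A p) f g z = (\<Sum>x | f x \<noteq> 0. f x * (\<Sum>y | g y \<noteq> 0. g y * of_bool (x \<otimes> y = z)))" unfolding msa_simps sum_distrib_left
  by (intro sum.cong) (auto simp: sum_distrib_left)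

lemma msa_star_alt: "star (A p) f z = (\<Sum>x | f x \<noteq> 0. cnj (f x) * of_bool (i x = z))" unfolding msa_simps by (intro sum.cong) auto

text \<open>The value of a product or an adjoint at z is a pairing with the indicator of an
  equation. Associativity and the antimultiplicativity of the involution are therefore verified by
  unfolding pairings with \<open>msa_mult_apply\<close> and \<open>msa_star_apply\<close>, and the
  exact support of a product never has to be determined.\<close>

theorem star_alg_msa: "star_alg (A p)"
proof (rule star_algI, goal_cases)
  case (1 x y)
  have *: "{z. x z + y z \<noteq> 0} \<subseteq> {z. x z \<noteq> 0} \<union> {z. y z \<noteq> 0}" by auto
  from 1 have "finite {z. x z + y z \<noteq> 0}" by (intro finite_subset[OF *]) simp
  with 1 * show ?case unfolding msa_simps by blast
next
  case (6 x y)
  then show ?case by (rule msa_mult_closed)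
next
  case (7)
  then show ?case by (auto simp: basis_elt_def)
next
  case (8 f g h)
  have fin: "finite {x. mult (A p) f g x \<noteq> 0}" "finite {x. mult (A p) g h x \<noteq> 0}"
    using msa_mult_closed[OF 8(1,2)] msa_mult_closed[OF 8(2,3)] unfolding msa_simps(1) by blast+
  have fin': "finite {x. f x \<noteq> 0}" "finite {x. g x \<noteq> 0}" "finite {x. h x \<noteq> 0}" using 8 by auto
  have cm: "f x \<noteq> 0 \<Longrightarrow> x \<in> carrier M" "g x \<noteq> 0 \<Longrightarrow> x \<in> carrier M" "h x \<noteq> 0 \<Longrightarrow> x \<in> carrier M" for x using 8 by auto
  show ?case
  proof
    fix z
    have "mult (A p) (mult (A p) f g) h z
        = (\<Sum>x | f x \<noteq> 0. \<Sum>y | g y \<noteq> 0. f x * g y * (\<Sum>w | h w \<noteq> 0. h w * of_bool (x \<otimes> y \<otimes> w = z)))"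
      by (subst msa_mult_alt1, rule msa_mult_apply) (use fin' in auto)
    also have "\<dots> = (\<Sum>x | f x \<noteq> 0. f x * (\<Sum>y | g y \<noteq> 0. \<Sum>w | h w \<noteq> 0. g y * h w * of_bool (x \<otimes> (y \<otimes> w) = z)))"
      unfolding sum_distrib_left using cm by (intro sum.cong refl) (simp add: mult_ac m_assoc)
    also have "\<dots> = (\<Sum>x | f x \<noteq> 0. f x * (\<Sum>y | mult (A p) g h y \<noteq> 0. mult (A p) g h y * of_bool (x \<otimes> y = z)))"
      by (subst msa_mult_apply) (use fin' in auto)
    also have "\<dots> = mult (A p) f (mult (A p) g h) z" by (rule msa_mult_alt1[symmetric])
    finally show "mult (A p) (mult (A p) f g) h z = mult (A p) f (mult (A p) g h) z" .
  qed
next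
  case (9 f)
  have *: "(\<Sum>y | f y \<noteq> 0. if \<one> \<otimes> y = z then f y else 0) = (\<Sum>y | f y \<noteq> 0. if y = z then f y else 0)" for z
    using 9 by (intro sum.cong) auto
  show ?case unfolding msa_simps basis_elt_support
  proof (rule ext)
    fix z
    have "(\<Sum>x\<in>{\<one>}. \<Sum>y | f y \<noteq> 0. if x \<otimes> y = z then basis_elt \<one> x * f y else 0)
        = (\<Sum>y | f y \<noteq> 0. if \<one> \<otimes> y = z then f y else 0)"
      by (simp cong: if_cong)
    then show "(\<Sum>x\<in>{\<one>}. \<Sum>y | f y \<noteq> 0. if x \<otimes> y = z then basis_elt \<one> x * f y else 0) = f z" using 9 by (simp add: *)
  qed
next
  case (10 f)
  have *: "(\<Sum>y | f y \<noteq> 0. if y \<otimes> \<one> = z then f y else 0) = (\<Sum>y | f y \<noteq> 0. if y = z then f y else 0)" for z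
    using 10 by (intro sum.cong) auto
  show ?case unfolding msa_simps basis_elt_support by (rule ext) (use 10 in \<open>simp add: * cong: if_cong\<close>)
next
  case (11 f g h)
  let ?X = "{x. f x \<noteq> 0} \<union> {x. g x \<noteq> 0}"
  have fin: "finite ?X" "finite {x. h x \<noteq> 0}" using 11 by auto
  have e: "mult (A p) u h = (\<lambda>z. \<Sum>x\<in>?X. \<Sum>y | h y \<noteq> 0. if x \<otimes> y = z then u x * h y else 0)" if "{x. u x \<noteq> 0} \<subseteq> ?X" for u
    unfolding msa_simps using fin that by (intro ext msa_mult_superset) auto
  have "{x. (f \<oplus>\<^sub>(A p) g) x \<noteq> 0} \<subseteq> ?X" by auto
  note e = e[of f, OF Un_upper1] e[of g, OF Un_upper2] e[OF this]
  show ?case unfolding e unfolding msa_simps by (auto simp: algebra_simps intro!: sum.cong simp flip: sum.distrib)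
next
  case (12 f g h)
  let ?X = "{x. f x \<noteq> 0} \<union> {x. g x \<noteq> 0}"
  have fin: "finite ?X" "finite {x. h x \<noteq> 0}" using 12 by auto
  have e: "mult (A p) h u = (\<lambda>z. \<Sum>x | h x \<noteq> 0. \<Sum>y\<in>?X. if x \<otimes> y = z then h x * u y else 0)" if "{x. u x \<noteq> 0} \<subseteq> ?X" for u
    unfolding msa_simps using fin that by (intro ext msa_mult_superset) auto
  have "{x. (f \<oplus>\<^sub>(A p) g) x \<noteq> 0} \<subseteq> ?X" by auto
  note e = e[of f, OF Un_upper1] e[of g, OF Un_upper2] e[OF this]
  show ?case unfolding e unfolding msa_simps by (auto simp: algebra_simps intro!: sum.cong simp flip: sum.distrib)
next
  case (13 c x)
  then show ?case by (cases "c = 0") auto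
next
  case (19 c f g)
  \<comment> \<open>The sums range over supports; a nonzero scalar does not change the support, and
    c = 0 makes it empty.\<close>
  show ?case by (cases "c = 0") (auto simp: sum_distrib_left fun_eq_iff intro!: sum.cong)
next
  case (20 c f g)
  show ?case by (cases "c = 0") (auto simp: sum_distrib_left fun_eq_iff intro!: sum.cong)
next
  case (21 f)
  then show ?case by (rule msa_star_closed)
next
  case (22 f)
  show ?case
  proof
    fix z
    have "star (A p) (star (A p) f) z
        = cnj (\<Sum>x | star (A p) f x \<noteq> 0. star (A p) f x * of_bool (i x = z))"
      by (subst msa_star_alt) (simp only: cnj_sum complex_cnj_mult cnj_of_bool)
    also have "\<dots> = cnj (\<Sum>x | f x \<noteq> 0. cnj (f x) * of_bool (i (i x) = z))" by (subst msa_star_apply) (use 22 in auto)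
    also have "\<dots> = (\<Sum>x | f x \<noteq> 0. if x = z then f x else 0)" unfolding cnj_sum using 22 by (intro sum.cong) auto
    also have "\<dots> = f z" using 22 by auto
    finally show "star (A p) (star (A p) f) z = f z" .
  qed
next
  case (23 f g)
  let ?X = "{x. f x \<noteq> 0} \<union> {x. g x \<noteq> 0}"
  have fin: "finite ?X" using 23 by auto
  have *: "(\<Sum>x | u x \<noteq> 0. if i x = z then cnj (u x) else 0) = (\<Sum>x\<in>?X. if i x = z then cnj (u x) else 0)"
    if "{x. u x \<noteq> 0} \<subseteq> ?X" for u z
    using fin that by (intro sum.mono_neutral_left) auto
  show ?case unfolding msa_simps
  proof (rule ext, subst (1 2 3) *, goal_cases)
    case (4 z)
    show ?case by (auto intro!: sum.cong simp flip: sum.distrib)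
  qed auto
next
  case (24 f g)
  have fin': "finite {x. f x \<noteq> 0}" "finite {x. g x \<noteq> 0}" using 24 by auto
  have cm: "f x \<noteq> 0 \<Longrightarrow> x \<in> carrier M" "g x \<noteq> 0 \<Longrightarrow> x \<in> carrier M" for x using 24 by auto
  have fin: "finite {x. star (A p) f x \<noteq> 0}" "finite {x. star (A p) g x \<noteq> 0}" using msa_star_closed[OF 24(1)] msa_star_closed[OF 24(2)]
    unfolding msa_simps(1) by blast+
  show ?case
  proof
    fix z
    have "star (A p) (mult (A p) f g) z
        = cnj (\<Sum>x | mult (A p) f g x \<noteq> 0. mult (A p) f g x * of_bool (i x = z))"
      by (subst msa_star_alt) (simp only: cnj_sum complex_cnj_mult cnj_of_bool)
    also have "\<dots> = cnj (\<Sum>x | f x \<noteq> 0. \<Sum>y | g y \<noteq> 0. f x * g y * of_bool (i (x \<otimes> y) = z))" by (subst msa_mult_apply) (use fin' in auto)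
    also have "\<dots> = (\<Sum>x | f x \<noteq> 0. \<Sum>y | g y \<noteq> 0. cnj (f x) * cnj (g y) * of_bool (i y \<otimes> i x = z))"
      unfolding cnj_sum using cm by (intro sum.cong refl) (simp add: inv_mult cnj_of_bool)
    also have "\<dots> = (\<Sum>y | g y \<noteq> 0. cnj (g y) * (\<Sum>x | f x \<noteq> 0. cnj (f x) * of_bool (i y \<otimes> i x = z)))"
      by (subst sum.swap) (auto simp: sum_distrib_left mult_ac intro!: sum.cong)
    also have "\<dots> = (\<Sum>y | g y \<noteq> 0. cnj (g y) * (\<Sum>x | star (A p) f x \<noteq> 0. star (A p) f x * of_bool (i y \<otimes> x = z)))"
      by (subst msa_star_apply) (use fin' in auto)
    also have "\<dots> = (\<Sum>y | star (A p) g y \<noteq> 0. star (A p) g y * (\<Sum>x | star (A p) f x \<noteq> 0. star (A p) f x * of_bool (y \<otimes> x = z)))"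
      by (subst msa_star_apply) (use fin' in auto)
    also have "\<dots> = mult (A p) (star (A p) g) (star (A p) f) z" by (rule msa_mult_alt1[symmetric])
    finally show "star (A p) (mult (A p) f g) z = mult (A p) (star (A p) g) (star (A p) f) z" .
  qed
next
  case (25 c f)
  show ?case by (cases "c = 0") (auto simp: sum_distrib_left fun_eq_iff intro!: sum.cong)
qed (auto simp: algebra_simps fun_eq_iff)

end

subsection \<open>Linear extensions\<close>

definition lin_ext :: "'a star_algebra \<Rightarrow> ('m \<Rightarrow> 'a) \<Rightarrow> ('m \<Rightarrow> complex) \<Rightarrow> 'a" where
  "lin_ext D \<eta> f = (\<Oplus>\<^sub>D x\<in>{x. f x \<noteq> 0}. f x \<odot>\<^sub>D \<eta> x)"

context star_alg
begin

lemma lin_ext_superset: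
  assumes "finite X" "{x. f x \<noteq> 0} \<subseteq> X" "\<And>x. x \<in> X \<Longrightarrow> \<eta> x \<in> carrier B"
  shows "lin_ext B \<eta> f = (\<Oplus>x\<in>X. f x \<odot> \<eta> x)" unfolding lin_ext_def using assms by (intro finsum_superset[symmetric]) auto

lemma lin_ext_closed:
  assumes "\<And>x. f x \<noteq> 0 \<Longrightarrow> \<eta> x \<in> carrier B"
  shows "lin_ext B \<eta> f \<in> carrier B" unfolding lin_ext_def using assms by (intro finsum_closed) auto

lemma lin_ext_fiber:
  assumes "finite I" "\<And>k. k \<in> I \<Longrightarrow> \<eta> (h k) \<in> carrier B"
  shows "lin_ext B \<eta> (\<lambda>z. \<Sum>k\<in>I. if h k = z then c k else 0) = (\<Oplus>k\<in>I. c k \<odot> \<eta> (h k))"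
proof -
  have "lin_ext B \<eta> (\<lambda>z. \<Sum>k\<in>I. if h k = z then c k else 0)
      = (\<Oplus>z\<in>h ` I. (\<Sum>k\<in>I. if h k = z then c k else 0) \<odot> \<eta> z)"
    using assms fiber_sum_support[where I = I and h = h and c = c] by (intro lin_ext_superset) auto
  also have "\<dots> = (\<Oplus>z\<in>h ` I. \<Oplus>k\<in>I. (if h k = z then c k else 0) \<odot> \<eta> z)"
    using assms by (intro finsum_cong') (auto simp: finsum_smult_const)
  also have "\<dots> = (\<Oplus>k\<in>I. \<Oplus>z\<in>h ` I. (if h k = z then c k else 0) \<odot> \<eta> z)" using assms by (intro finsum_swap) auto
  also have "\<dots> = (\<Oplus>k\<in>I. c k \<odot> \<eta> (h k))"
  proof (intro finsum_cong' refl Pi_I)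
    fix k assume k: "k \<in> I"
    have "(\<Oplus>z\<in>h ` I. (if h k = z then c k else 0) \<odot> \<eta> z) = (\<Oplus>z\<in>h ` I. if z = h k then c k \<odot> \<eta> (h k) else \<zero>)"
      using assms k by (intro finsum_cong') auto
    also have "\<dots> = c k \<odot> \<eta> (h k)" using assms k by (subst finsum_delta) auto
    finally show "(\<Oplus>z\<in>h ` I. (if h k = z then c k else 0) \<odot> \<eta> z) = c k \<odot> \<eta> (h k)" .
  qed (use assms in auto)
  finally show ?thesis .
qed

lemma lin_ext_basis [simp]: "\<eta> x \<in> carrier B \<Longrightarrow> lin_ext B \<eta> (basis_elt x) = \<eta> x" by (simp add: lin_ext_def finsum_insert)

end

text \<open>The universal property of the monoid algebra: a monoid homomorphism compatible with the
  involutions extends linearly. It serves the free *-algebra, characters of formal tensors, and the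
  map induced on formal tensors by the quotient map.\<close>

lemma lin_ext_star_hom:
  assumes "inv_monoid M i" "star_alg D"
    and closed: "\<And>x. x \<in> carrier M \<Longrightarrow> \<eta> x \<in> carrier D"
    and one: "\<eta> \<one>\<^sub>M = \<one>\<^sub>D"
    and mult: "\<And>x y. x \<in> carrier M \<Longrightarrow> y \<in> carrier M \<Longrightarrow> \<eta> (x \<otimes>\<^sub>M y) = \<eta> x \<otimes>\<^sub>D \<eta> y"
    and star: "\<And>x. x \<in> carrier M \<Longrightarrow> \<eta> (i x) = star D (\<eta> x)"
  shows "star_hom (monoid_star_algebra M i p) D (lin_ext D \<eta>)"
proof -
  interpret M: inv_monoid M i by fact
  interpret D: star_alg D by fact
  show ?thesis
  proof (rule star_homI, goal_cases)
    case (1 f)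
    then show ?case using closed by (intro D.lin_ext_closed) auto
  next
    case (2 f g)
    let ?X = "{x. f x \<noteq> 0} \<union> {x. g x \<noteq> 0}"
    have *: "finite ?X" "\<And>x. x \<in> ?X \<Longrightarrow> \<eta> x \<in> carrier D" using 2 closed by auto
    have "lin_ext D \<eta> (\<lambda>z. f z + g z) = (\<Oplus>\<^sub>D x\<in>?X. (f x + g x) \<odot>\<^sub>D \<eta> x)" using * by (intro D.lin_ext_superset) auto
    also have "\<dots> = (\<Oplus>\<^sub>D x\<in>?X. f x \<odot>\<^sub>D \<eta> x \<oplus>\<^sub>D g x \<odot>\<^sub>D \<eta> x)" using * by (intro D.finsum_cong') (auto simp: D.smult_l_distr)
    also have "\<dots> = (\<Oplus>\<^sub>D x\<in>?X. f x \<odot>\<^sub>D \<eta> x) \<oplus>\<^sub>D (\<Oplus>\<^sub>D x\<in>?X. g x \<odot>\<^sub>D \<eta> x)" using * by (intro D.finsum_addf) auto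
    also have "(\<Oplus>\<^sub>D x\<in>?X. f x \<odot>\<^sub>D \<eta> x) = lin_ext D \<eta> f" using * by (intro D.lin_ext_superset[symmetric]) auto
    also have "(\<Oplus>\<^sub>D x\<in>?X. g x \<odot>\<^sub>D \<eta> x) = lin_ext D \<eta> g" using * by (intro D.lin_ext_superset[symmetric]) auto
    finally show ?case by simp
  next
    case (3 f g)
    let ?F = "{x. f x \<noteq> 0}" and ?G = "{x. g x \<noteq> 0}"
    have fin: "finite ?F" "finite ?G" using 3 by auto
    have cl: "\<And>x. f x \<noteq> 0 \<Longrightarrow> \<eta> x \<in> carrier D" "\<And>x. g x \<noteq> 0 \<Longrightarrow> \<eta> x \<in> carrier D" using 3 closed by auto
    have "lin_ext D \<eta> (f \<otimes>\<^sub>(monoid_star_algebra M i p) g)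
        = (\<Oplus>\<^sub>D k\<in>?F \<times> ?G. (f (fst k) * g (snd k)) \<odot>\<^sub>D \<eta> (fst k \<otimes>\<^sub>M snd k))"
      unfolding msa_simps msa_mult_pairs using fin 3 by (intro D.lin_ext_fiber) (auto intro!: closed M.m_closed)
    also have "\<dots> = (\<Oplus>\<^sub>D k\<in>?F \<times> ?G. (f (fst k) \<odot>\<^sub>D \<eta> (fst k)) \<otimes>\<^sub>D (g (snd k) \<odot>\<^sub>D \<eta> (snd k)))"
    proof (intro D.finsum_cong' refl Pi_I)
      fix k assume "k \<in> ?F \<times> ?G"
      then show "(f (fst k) * g (snd k)) \<odot>\<^sub>D \<eta> (fst k \<otimes>\<^sub>M snd k)
          = (f (fst k) \<odot>\<^sub>D \<eta> (fst k)) \<otimes>\<^sub>D (g (snd k) \<odot>\<^sub>D \<eta> (snd k))"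
        using 3 cl by (subst mult) (auto simp: D.smult_mult_l D.smult_mult_r mult.commute simp flip: D.smult_assoc)
    qed (use cl in auto)
    also have "\<dots> = (\<Oplus>\<^sub>D x\<in>?F. \<Oplus>\<^sub>D y\<in>?G. (f x \<odot>\<^sub>D \<eta> x) \<otimes>\<^sub>D (g y \<odot>\<^sub>D \<eta> y))" using fin cl by (intro D.finsum_Sigma_prod) auto
    also have "\<dots> = (\<Oplus>\<^sub>D x\<in>?F. (f x \<odot>\<^sub>D \<eta> x) \<otimes>\<^sub>D lin_ext D \<eta> g)" unfolding lin_ext_def
      using fin cl by (intro D.finsum_cong' refl Pi_I D.finsum_rdistr[symmetric]) (auto intro!: D.finsum_closed)
    also have "\<dots> = lin_ext D \<eta> f \<otimes>\<^sub>D lin_ext D \<eta> g" unfolding lin_ext_def[of D \<eta> f]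
      using fin cl by (intro D.finsum_ldistr[symmetric]) (auto intro!: D.lin_ext_closed)
    finally show ?case .
  next
    case 4
    then show ?case using closed[of "\<one>\<^sub>M"] one by simp
  next
    case (5 c f)
    have cl: "\<And>x. f x \<noteq> 0 \<Longrightarrow> \<eta> x \<in> carrier D" using 5 closed by auto
    have "lin_ext D \<eta> (\<lambda>z. c * f z) = (\<Oplus>\<^sub>D x\<in>{x. f x \<noteq> 0}. (c * f x) \<odot>\<^sub>D \<eta> x)" using 5 closed by (intro D.lin_ext_superset) auto
    also have "\<dots> = (\<Oplus>\<^sub>D x\<in>{x. f x \<noteq> 0}. c \<odot>\<^sub>D (f x \<odot>\<^sub>D \<eta> x))" using cl by (intro D.finsum_cong') (auto simp: D.smult_assoc)
    also have "\<dots> = c \<odot>\<^sub>D lin_ext D \<eta> f" unfolding lin_ext_def using cl by (intro D.finsum_smult) auto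
    finally show ?case by simp
  next
    case (6 f)
    have cl: "\<And>x. f x \<noteq> 0 \<Longrightarrow> \<eta> x \<in> carrier D" using 6 closed by auto
    have "lin_ext D \<eta> (star (monoid_star_algebra M i p) f)
        = (\<Oplus>\<^sub>D x\<in>{x. f x \<noteq> 0}. cnj (f x) \<odot>\<^sub>D \<eta> (i x))"
      unfolding msa_simps using 6 closed by (intro D.lin_ext_fiber) auto
    also have "\<dots> = (\<Oplus>\<^sub>D x\<in>{x. f x \<noteq> 0}. star D (f x \<odot>\<^sub>D \<eta> x))" using 6 cl by (intro D.finsum_cong') (auto simp: D.star_smult star)
    also have "\<dots> = star D (lin_ext D \<eta> f)" unfolding lin_ext_def using cl by (intro D.star_finsum[symmetric]) auto
    finally show ?case .
  qed
qed

text \<open>The uniqueness half of the universal property, since f is the finite sum of its values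
  times basis elements.\<close>

lemma star_hom_lin_ext:
  assumes "inv_monoid M i" "star_alg D" "star_hom (monoid_star_algebra M i p) D \<phi>"
    and f: "f \<in> carrier (monoid_star_algebra M i p)"
  shows "\<phi> f = lin_ext D (\<lambda>x. \<phi> (basis_elt x)) f"
proof -
  interpret M: inv_monoid M i by fact
  let ?A = "monoid_star_algebra M i p"
  interpret D: star_alg_hom ?A D \<phi>
    by (intro star_alg_homI M.star_alg_msa assms)
  have b: "basis_elt x \<in> carrier ?A" if "f x \<noteq> 0" for x using that f by auto
  have fin: "finite X \<Longrightarrow> X \<subseteq> {x. f x \<noteq> 0} \<Longrightarrow>
      (\<Oplus>\<^sub>?A x\<in>X. f x \<odot>\<^sub>?A basis_elt x) = (\<lambda>z. if z \<in> X then f z else 0)" for X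
  proof (induction rule: finite_induct)
    case (insert x X)
    have "(\<Oplus>\<^sub>?A x\<in>insert x X. f x \<odot>\<^sub>?A basis_elt x)
        = (f x \<odot>\<^sub>?A basis_elt x) \<oplus>\<^sub>?A (\<Oplus>\<^sub>?A x\<in>X. f x \<odot>\<^sub>?A basis_elt x)"
      using insert b by (intro D.B.finsum_insert D.B.smult_closed Pi_I) auto
    also have "\<dots> = (\<lambda>z. if z \<in> insert x X then f z else 0)" using insert by (auto simp: fun_eq_iff basis_elt_def)
    finally show ?case .
  qed (simp add: D.B.finsum_empty)
  have "f = (\<Oplus>\<^sub>?A x\<in>{x. f x \<noteq> 0}. f x \<odot>\<^sub>?A basis_elt x)" using f by (subst fin) auto
  then have "\<phi> f = \<phi> (\<Oplus>\<^sub>?A x\<in>{x. f x \<noteq> 0}. f x \<odot>\<^sub>?A basis_elt x)" by simp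
  also have "\<dots> = (\<Oplus>\<^sub>D x\<in>{x. f x \<noteq> 0}. \<phi> (f x \<odot>\<^sub>?A basis_elt x))" using b by (intro D.hom_finsum Pi_I D.B.smult_closed) auto
  also have "\<dots> = lin_ext D (\<lambda>x. \<phi> (basis_elt x)) f" unfolding lin_ext_def
    using b by (intro D.D.finsum_cong' refl Pi_I D.hom_smult D.D.smult_closed D.hom_closed) auto
  finally show ?thesis .
qed

context star_alg
begin

text \<open>The reverse inequality is the assumed one for \<open>inverse c\<close>, applied to
  \<open>c \<odot> t\<close>.\<close>

lemma nrm_smultI:
  assumes nonneg: "\<And>x. x \<in> carrier B \<Longrightarrow> 0 \<le> n x" and le: "\<And>c x. x \<in> carrier B \<Longrightarrow> n (c \<odot> x) \<le> cmod c * n x" and t: "t \<in> carrier B"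
  shows "n (c \<odot> t) = cmod c * n t"
proof (cases "c = 0")
  case True
  then show ?thesis using le[OF t, of 0] nonneg[of \<zero>] t by simp
next
  case False
  have "n t \<le> cmod (inverse c) * n (c \<odot> t)" using le[of "c \<odot> t" "inverse c"] t False by (simp flip: smult_assoc)
  from mult_left_mono[OF this norm_ge_zero[of c]] have "cmod c * n t \<le> n (c \<odot> t)"
    using False by (simp add: norm_inverse mult.assoc[symmetric])
  then show ?thesis using le[OF t, of c] by simp
qed

lemma minus_eq_0_iff: "x \<in> carrier B \<Longrightarrow> y \<in> carrier B \<Longrightarrow> x \<ominus> y = \<zero> \<longleftrightarrow> x = y"
  by (metis a_minus_def minus_equality minus_minus r_neg a_inv_closed)

lemma add_minus_cancel: "x \<in> carrier B \<Longrightarrow> y \<in> carrier B \<Longrightarrow> x \<oplus> y \<ominus> y = x" by algebra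

end

subsection \<open>Seminorms\<close>

locale seminormed_star_alg = star_alg +
  assumes nrm_nonneg [simp]: "x \<in> carrier B \<Longrightarrow> 0 \<le> nrm B x"
    and nrm_add: "x \<in> carrier B \<Longrightarrow> y \<in> carrier B \<Longrightarrow> nrm B (x \<oplus> y) \<le> nrm B x + nrm B y"
    and nrm_smult: "x \<in> carrier B \<Longrightarrow> nrm B (c \<odot> x) = cmod c * nrm B x"
    and nrm_mult: "x \<in> carrier B \<Longrightarrow> y \<in> carrier B \<Longrightarrow> nrm B (x \<otimes> y) \<le> nrm B x * nrm B y"
    and nrm_star: "x \<in> carrier B \<Longrightarrow> nrm B (star B x) = nrm B x"
    and nrm_one: "nrm B \<one> \<le> 1"
begin

lemma nrm_zero [simp]: "nrm B \<zero> = 0" using nrm_smult[of \<zero> 0] by simp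

lemma nrm_a_inv [simp]: "x \<in> carrier B \<Longrightarrow> nrm B (\<ominus> x) = nrm B x" by (simp add: a_inv_smult nrm_smult)

lemma nrm_minus: "x \<in> carrier B \<Longrightarrow> y \<in> carrier B \<Longrightarrow> nrm B (x \<ominus> y) \<le> nrm B x + nrm B y"
  using nrm_add[of x "\<ominus> y"] by (simp add: a_minus_def)

lemma nrm_minus_commute: "x \<in> carrier B \<Longrightarrow> y \<in> carrier B \<Longrightarrow> nrm B (x \<ominus> y) = nrm B (y \<ominus> x)"
  using nrm_a_inv[of "x \<ominus> y"] by (simp add: a_minus_def minus_add a_comm)

lemma nrm_triangle:
  assumes "x \<in> carrier B" "y \<in> carrier B" "z \<in> carrier B"
  shows "nrm B (x \<ominus> z) \<le> nrm B (x \<ominus> y) + nrm B (y \<ominus> z)"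
proof -
  have "x \<ominus> z = (x \<ominus> y) \<oplus> (y \<ominus> z)" using assms by algebra
  then show ?thesis using nrm_add[of "x \<ominus> y" "y \<ominus> z"] assms by simp
qed

lemma nrm_le_minus:
  assumes "x \<in> carrier B" "y \<in> carrier B"
  shows "nrm B x \<le> nrm B y + nrm B (x \<ominus> y)"
proof -
  have "x = y \<oplus> (x \<ominus> y)" using assms by algebra
  then show ?thesis using nrm_add[of y "x \<ominus> y"] assms by (metis minus_closed)
qed

lemma abs_nrm_diff:
  assumes "x \<in> carrier B" "y \<in> carrier B"
  shows "\<bar>nrm B x - nrm B y\<bar> \<le> nrm B (x \<ominus> y)"
  using nrm_le_minus[OF assms] nrm_le_minus[OF assms(2,1)] nrm_minus_commute[OF assms] by linarith

lemma nrm_finsum: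
  assumes "f \<in> A \<rightarrow> carrier B"
  shows "nrm B (finsum B f A) \<le> (\<Sum>i\<in>A. nrm B (f i))"
proof (cases "finite A")
  case True
  then show ?thesis using assms
  proof induction
    case (insert a A)
    then have "nrm B (finsum B f (insert a A)) = nrm B (f a \<oplus> finsum B f A)" by (subst finsum_insert) auto
    also have "\<dots> \<le> nrm B (f a) + nrm B (finsum B f A)" using insert.prems by (intro nrm_add finsum_closed) auto
    finally show ?case using insert by force
  qed (simp add: finsum_empty)
qed (simp add: finsum_infinite)

lemma nrm_pow: "x \<in> carrier B \<Longrightarrow> nrm B (x [^] (n::nat)) \<le> nrm B x ^ n"
proof (induction n)
  case 0
  then show ?case by (simp add: nrm_one)
next
  case (Suc n)
  have "nrm B (x [^] n \<otimes> x) \<le> nrm B (x [^] n) * nrm B x" using Suc by (intro nrm_mult) auto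
  also have "\<dots> \<le> nrm B x ^ n * nrm B x" using Suc by (intro mult_right_mono) auto
  finally show ?case by (simp add: mult.commute)
qed

end

locale cstar_alg = seminormed_star_alg +
  assumes nrm_cstar: "x \<in> carrier B \<Longrightarrow> nrm B (star B x \<otimes> x) = (nrm B x)\<^sup>2"

text \<open>A pre-C*-algebra: completeness is not part of the notion. The orthogonality of
  projections with sum 1 and the C*-inequality in quotients are proved at this generality.\<close>

locale cstar_normed = cstar_alg +
  assumes nrm_eq_0: "x \<in> carrier B \<Longrightarrow> nrm B x = 0 \<Longrightarrow> x = \<zero>"

text \<open>Isometry of the involution is derived from the C*-identity: |x|^2 = |x* x| \<le> |x*|
  |x|, applied to x and to its adjoint. The identity at 1 shows that the norm of 1 is 0 or
  1.\<close>

lemma cstar_algI: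
  fixes B :: "'a star_algebra" (structure)
  assumes "star_alg B" "cstar_seminorm B (nrm B)"
  shows "cstar_alg B"
proof -
  interpret star_alg B by fact
  note c = assms(2)[unfolded cstar_seminorm_def]
  have le: "nrm B x \<le> nrm B (star B x)" if x: "x \<in> carrier B" for x
  proof (cases "nrm B x = 0")
    case False
    then have pos: "nrm B x > 0" using c x by (metis order_le_less)
    have "nrm B x * nrm B x = nrm B (star B x \<otimes> x)" using c x by (simp add: power2_eq_square)
    also have "\<dots> \<le> nrm B (star B x) * nrm B x" using c x by (meson star_closed)
    finally show ?thesis using pos by simp
  qed (use c x in auto)
  have one: "nrm B \<one> = nrm B \<one> ^ 2" using c by (metis l_one one_closed star_one)
  show ?thesis
  proof unfold_locales
    show "nrm B (star B x) = nrm B x" if "x \<in> carrier B" for x using le[of x] le[of "star B x"] that by simp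
    show "nrm B \<one> \<le> 1" using one by (cases "nrm B \<one> = 0") (auto simp: power2_eq_square)
  qed (use c in auto)
qed

subsection \<open>Quotients\<close>

lemma (in star_alg) idealI2:
  assumes "I \<subseteq> carrier B" "\<zero> \<in> I" "\<And>x y. x \<in> I \<Longrightarrow> y \<in> I \<Longrightarrow> x \<oplus> y \<in> I"
    "\<And>x y. x \<in> I \<Longrightarrow> y \<in> carrier B \<Longrightarrow> y \<otimes> x \<in> I"
    "\<And>x y. x \<in> I \<Longrightarrow> y \<in> carrier B \<Longrightarrow> x \<otimes> y \<in> I"
  shows "ideal I B"
proof (rule idealI)
  show "subgroup I (add_monoid B)"
  proof
    fix x assume x: "x \<in> I"
    have "\<ominus> x = (\<ominus> \<one>) \<otimes> x" using x assms(1) by (auto simp: l_minus)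
    then have "\<ominus> x \<in> I" using assms(4)[OF x, of "\<ominus> \<one>"] by simp
    then show "inv\<^sub>(add_monoid B) x \<in> I" by (simp add: a_inv_def)
  qed (use assms in auto)
qed (use assms ring_axioms in auto)

locale star_ideal = star_alg + ideal I B for I +
  assumes star_I: "x \<in> I \<Longrightarrow> star B x \<in> I"
begin

abbreviation Q where "Q \<equiv> star_quot B I"
abbreviation q where "q x \<equiv> I +> x"

lemma smult_I: "x \<in> I \<Longrightarrow> c \<odot> x \<in> I" using I_l_closed[of x "c \<odot> \<one>"] by (simp add: smult_mult_l)

lemma carrier_Q: "carrier Q = q ` carrier B" by (auto simp: star_quot_def FactRing_def A_RCOSETS_def' a_r_coset_def')

lemma q_eq_iff: "x \<in> carrier B \<Longrightarrow> y \<in> carrier B \<Longrightarrow> q x = q y \<longleftrightarrow> x \<ominus> y \<in> I" using quotient_eq_iff_same_a_r_cos[OF is_ideal] by blast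

lemma q_zero: "zero Q = q \<zero>" using a_rcos_zero[OF is_ideal, of \<zero>] by (simp add: star_quot_def FactRing_def)

lemma q_zero_iff: "x \<in> carrier B \<Longrightarrow> q x = zero Q \<longleftrightarrow> x \<in> I" unfolding q_zero by (simp add: q_eq_iff minus_eq)

lemma q_one: "one Q = q \<one>" by (simp add: star_quot_def FactRing_def)

lemma q_add: "x \<in> carrier B \<Longrightarrow> y \<in> carrier B \<Longrightarrow> add Q (q x) (q y) = q (x \<oplus> y)" by (simp add: star_quot_def FactRing_def a_rcos_sum)

lemma q_mult: "x \<in> carrier B \<Longrightarrow> y \<in> carrier B \<Longrightarrow> mult Q (q x) (q y) = q (x \<otimes> y)"
  by (simp add: star_quot_def FactRing_def rcoset_mult_add)

lemma q_elem: "x \<in> carrier B \<Longrightarrow> z \<in> q x \<longleftrightarrow> (\<exists>j\<in>I. z = j \<oplus> x)" by (auto simp: a_r_coset_def')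

text \<open>\<open>star_quot\<close> forms the union over all representatives of a coset. The union
  collapses because every representative produces the same coset; the involution is treated
  alike.\<close>

lemma q_smult:
  assumes "x \<in> carrier B" shows "smult Q c (q x) = q (c \<odot> x)"
proof -
  have "q (c \<odot> z) = q (c \<odot> x)" if z: "z \<in> q x" for z
  proof -
    obtain j where j: "j \<in> I" "z = j \<oplus> x" using z q_elem assms by auto
    then have "c \<odot> z \<ominus> c \<odot> x = c \<odot> j" using assms by (simp add: smult_r_distr add_minus_cancel)
    then show ?thesis using j assms smult_I by (subst q_eq_iff) auto
  qed
  moreover have "q x \<noteq> {}" using a_rcos_self[OF assms] by blast
  ultimately have "(\<Union>z\<in>q x. q (c \<odot> z)) = q (c \<odot> x)" by (intro SUP_eq_const)
  then show ?thesis by (simp add: star_quot_def)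
qed

lemma q_star:
  assumes "x \<in> carrier B" shows "star Q (q x) = q (star B x)"
proof -
  have "q (star B z) = q (star B x)" if z: "z \<in> q x" for z
  proof -
    obtain j where j: "j \<in> I" "z = j \<oplus> x" using z q_elem assms by auto
    then have "star B z \<ominus> star B x = star B j" using assms by (simp add: star_add add_minus_cancel)
    then show ?thesis using j assms star_I by (subst q_eq_iff) auto
  qed
  moreover have "q x \<noteq> {}" using a_rcos_self[OF assms] by blast
  ultimately have "(\<Union>z\<in>q x. q (star B z)) = q (star B x)" by (intro SUP_eq_const)
  then show ?thesis by (simp add: star_quot_def)
qed

lemmas q_simps = q_zero q_one q_add q_mult q_smult q_star

lemma q_closed [simp, intro]: "x \<in> carrier B \<Longrightarrow> q x \<in> carrier Q" by (simp add: carrier_Q)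

lemma star_alg_Q: "star_alg Q" by (rule star_algI)
    (auto simp: carrier_Q q_simps a_ac m_assoc l_distr r_distr
      smult_l_distr smult_r_distr smult_assoc smult_mult_l smult_mult_r star_add star_mult star_smult)

lemma star_hom_q: "star_hom B Q q" by (rule star_homI) (auto simp: q_simps)

lemma star_alg_hom_q: "star_alg_hom B Q q" by (intro star_alg_homI star_alg_Q star_hom_q star_alg_axioms)

lemma quot_lift:
  assumes "star_alg E" "star_hom B E h" "\<And>x. x \<in> I \<Longrightarrow> h x = zero E"
  obtains h' where "star_hom Q E h'" "\<And>x. x \<in> carrier B \<Longrightarrow> h' (q x) = h x"
proof -
  interpret h: star_alg_hom B E h
    by (intro star_alg_homI star_alg_axioms assms)
  define h' where "h' S = h (SOME x. x \<in> carrier B \<and> S = q x)" for S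
  have h': "h' (q x) = h x" if x: "x \<in> carrier B" for x
  proof -
    define y where "y = (SOME y. y \<in> carrier B \<and> q x = q y)"
    have y: "y \<in> carrier B \<and> q x = q y" unfolding y_def by (rule someI[of _ x]) (use x in auto)
    then have "h (x \<ominus> y) = zero E" using x q_eq_iff assms(3) by blast
    then have "h x = h y" using x y by (metis h.D.minus_eq_0_iff h.hom_closed h.hom_minus)
    then show ?thesis by (simp add: h'_def y_def)
  qed
  moreover have "star_hom Q E h'" by (rule star_homI)
      (auto simp: carrier_Q q_simps h' h.hom_add h.hom_mult h.hom_one h.hom_smult h.hom_star)
  ultimately show ?thesis using that by blast
qed

end

locale seminormed_star_ideal = seminormed_star_alg + star_ideal
begin

lemma nrm_q: "nrm Q S = Inf (nrm B ` S)" by (simp add: star_quot_def)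

lemma nrm_q_le_add: "x \<in> carrier B \<Longrightarrow> j \<in> I \<Longrightarrow> nrm Q (q x) \<le> nrm B (j \<oplus> x)"
  unfolding nrm_q by (intro cInf_lower bdd_belowI2[of _ 0]) (auto simp: q_elem)

lemma nrm_q_le: "x \<in> carrier B \<Longrightarrow> nrm Q (q x) \<le> nrm B x" using nrm_q_le_add[of x \<zero>] by simp

lemma nrm_q_approx:
  assumes "x \<in> carrier B" "e > 0"
  obtains j where "j \<in> I" "nrm B (j \<oplus> x) < nrm Q (q x) + e"
proof -
  have ne: "nrm B ` (q x) \<noteq> {}" using a_rcos_self[OF assms(1)] by blast
  have "\<exists>r \<in> nrm B ` (q x). r < nrm Q (q x) + e" unfolding nrm_q using assms by (intro cInf_lessD[OF ne]) auto
  then show ?thesis using that q_elem assms by auto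
qed

lemma nrm_q_nonneg: "x \<in> carrier B \<Longrightarrow> 0 \<le> nrm Q (q x)"
proof -
  assume x: "x \<in> carrier B"
  have "x \<in> q x" using x by (rule a_rcos_self)
  then have "nrm B ` q x \<noteq> {}" by blast
  then show ?thesis unfolding nrm_q by (rule cInf_greatest) (use x q_elem in auto)
qed

lemma seminormed_Q: "seminormed_star_alg Q"
proof -
  interpret Q: star_alg Q by (rule star_alg_Q)
  have smult_le: "nrm Q (q (c \<odot> x)) \<le> cmod c * nrm Q (q x)" if x: "x \<in> carrier B" for c x
  proof (cases "c = 0")
    case True
    then show ?thesis using x nrm_q_le[of \<zero>] by simp
  next
    case False
    show ?thesis
    proof (rule field_le_epsilon)
      fix e :: real assume e: "e > 0"
      obtain j where j: "j \<in> I" "nrm B (j \<oplus> x) < nrm Q (q x) + e / cmod c" using nrm_q_approx[of x "e / cmod c"] e x False by auto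
      have "nrm Q (q (c \<odot> x)) \<le> nrm B (c \<odot> j \<oplus> c \<odot> x)" using x j smult_I by (intro nrm_q_le_add) auto
      also have "\<dots> = nrm B (c \<odot> (j \<oplus> x))" using x j by (simp add: smult_r_distr)
      also have "\<dots> = cmod c * nrm B (j \<oplus> x)" using x j by (intro nrm_smult) auto
      also have "\<dots> \<le> cmod c * (nrm Q (q x) + e / cmod c)" using j by (intro mult_left_mono) auto
      also have "\<dots> = cmod c * nrm Q (q x) + e" using False by (simp add: field_simps)
      finally show "nrm Q (q (c \<odot> x)) \<le> cmod c * nrm Q (q x) + e" .
    qed
  qed
  have star_le: "nrm Q (q (star B x)) \<le> nrm Q (q x)" if x: "x \<in> carrier B" for x
  proof (rule field_le_epsilon)
    fix e :: real assume e: "e > 0"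
    obtain j where j: "j \<in> I" "nrm B (j \<oplus> x) < nrm Q (q x) + e" using nrm_q_approx[of x e] e x by auto
    have "nrm Q (q (star B x)) \<le> nrm B (star B j \<oplus> star B x)" using x j star_I by (intro nrm_q_le_add) auto
    also have "\<dots> = nrm B (star B (j \<oplus> x))" using x j by (simp add: star_add)
    also have "\<dots> = nrm B (j \<oplus> x)" using x j by (intro nrm_star) auto
    finally show "nrm Q (q (star B x)) \<le> nrm Q (q x) + e" using j by simp
  qed
  show ?thesis
  proof unfold_locales
    fix x y assume "x \<in> carrier Q" "y \<in> carrier Q"
    then obtain a b where ab: "a \<in> carrier B" "b \<in> carrier B" "x = q a" "y = q b" by (auto simp: carrier_Q)
    show "nrm Q (x \<oplus>\<^sub>Q y) \<le> nrm Q x + nrm Q y"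
    proof (rule field_le_epsilon)
      fix e :: real assume e: "e > 0"
      obtain j where j: "j \<in> I" "nrm B (j \<oplus> a) < nrm Q (q a) + e / 2" using nrm_q_approx[of a "e/2"] e ab by auto
      obtain k where k: "k \<in> I" "nrm B (k \<oplus> b) < nrm Q (q b) + e / 2" using nrm_q_approx[of b "e/2"] e ab by auto
      have c: "j \<in> carrier B" "k \<in> carrier B" using j k by auto
      have "nrm Q (q (a \<oplus> b)) \<le> nrm B ((j \<oplus> k) \<oplus> (a \<oplus> b))" using ab j k by (intro nrm_q_le_add) auto
      also have "(j \<oplus> k) \<oplus> (a \<oplus> b) = (j \<oplus> a) \<oplus> (k \<oplus> b)" using ab c by algebra
      also have "nrm B \<dots> \<le> nrm B (j \<oplus> a) + nrm B (k \<oplus> b)" using ab c by (intro nrm_add) auto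
      finally show "nrm Q (x \<oplus>\<^sub>Q y) \<le> nrm Q x + nrm Q y + e" using j k ab by (simp add: q_simps)
    qed
    show "nrm Q (x \<otimes>\<^sub>Q y) \<le> nrm Q x * nrm Q y"
    \<comment> \<open>The error of a product of two approximations is not linear in e, so the bound
      is passed to the limit e -> 0 instead of adding one e at the end.\<close>
    proof (rule tendsto_lowerbound[where F = "at_right 0"])
      show "((\<lambda>e. (nrm Q x + e) * (nrm Q y + e)) \<longlongrightarrow> nrm Q x * nrm Q y) (at_right 0)" by (auto intro!: tendsto_eq_intros)
      show "\<forall>\<^sub>F e in at_right 0. nrm Q (x \<otimes>\<^sub>Q y) \<le> (nrm Q x + e) * (nrm Q y + e)"
      proof (rule eventually_at_right_less[THEN eventually_mono])
        fix e :: real assume e: "0 < e"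
        obtain j where j: "j \<in> I" "nrm B (j \<oplus> a) < nrm Q (q a) + e" using nrm_q_approx[of a e] e ab by auto
        obtain k where k: "k \<in> I" "nrm B (k \<oplus> b) < nrm Q (q b) + e" using nrm_q_approx[of b e] e ab by auto
        have c: "j \<in> carrier B" "k \<in> carrier B" using j k by auto
        have "nrm Q (q (a \<otimes> b)) \<le> nrm B ((j \<otimes> k \<oplus> j \<otimes> b \<oplus> a \<otimes> k) \<oplus> (a \<otimes> b))"
          using ab j k c by (intro nrm_q_le_add) (simp_all add: I_l_closed I_r_closed)
        also have "(j \<otimes> k \<oplus> j \<otimes> b \<oplus> a \<otimes> k) \<oplus> (a \<otimes> b) = (j \<oplus> a) \<otimes> (k \<oplus> b)" using ab c by algebra
        also have "nrm B \<dots> \<le> nrm B (j \<oplus> a) * nrm B (k \<oplus> b)" using ab c by (intro nrm_mult) auto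
        also have "\<dots> \<le> (nrm Q x + e) * (nrm Q y + e)" using j k c ab e nrm_q_nonneg[of a] by (intro mult_mono) auto
        finally show "nrm Q (x \<otimes>\<^sub>Q y) \<le> (nrm Q x + e) * (nrm Q y + e)" using ab by (simp add: q_simps)
      qed
    qed auto
  next
    fix x c assume "x \<in> carrier Q"
    then obtain a where a: "a \<in> carrier B" "x = q a" by (auto simp: carrier_Q)
    show "0 \<le> nrm Q x" using a nrm_q_nonneg by simp
    show "nrm Q (star Q x) = nrm Q x" using star_le[of a] star_le[of "star B a"] a by (simp add: q_simps)
    have nn: "0 \<le> nrm Q y" if "y \<in> carrier Q" for y using that nrm_q_nonneg by (auto simp: carrier_Q)
    have le: "nrm Q (d \<odot>\<^sub>Q y) \<le> cmod d * nrm Q y" if "y \<in> carrier Q" for d y using that smult_le by (auto simp: carrier_Q q_simps)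
    show "nrm Q (c \<odot>\<^sub>Q x) = cmod c * nrm Q x" by (rule Q.nrm_smultI[where n = "nrm Q", OF nn le \<open>x \<in> carrier Q\<close>])
  next
    show "nrm Q \<one>\<^sub>Q \<le> 1" using nrm_q_le[of \<one>] nrm_one by (simp add: q_simps)
  qed
qed

text \<open>Moving a representative by an element of seminorm 0 does not change its seminorm. With
  the null sequences as ideal, this makes the passage to the completion isometric.\<close>

lemma nrm_q_null:
  assumes "\<And>j. j \<in> I \<Longrightarrow> nrm B j = 0" "x \<in> carrier B"
  shows "nrm Q (q x) = nrm B x"
proof (rule antisym[OF nrm_q_le[OF assms(2)]], rule field_le_epsilon)
  fix e :: real assume e: "e > 0"
  obtain j where j: "j \<in> I" "nrm B (j \<oplus> x) < nrm Q (q x) + e" using nrm_q_approx[OF assms(2) e] .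
  have "nrm B x \<le> nrm B (j \<oplus> x) + nrm B (x \<ominus> (j \<oplus> x))" using assms j by (intro nrm_le_minus) auto
  also have "x \<ominus> (j \<oplus> x) = \<ominus> j" using assms(2) j(1) Icarr by algebra
  finally show "nrm B x \<le> nrm Q (q x) + e" using j assms by simp
qed

end

subsection \<open>Completions\<close>

lemma cauchy_algebra_simps [simp]:
  "mult (cauchy_algebra B) X Y = (\<lambda>n. X n \<otimes>\<^sub>B Y n)"
  "one (cauchy_algebra B) = (\<lambda>n. \<one>\<^sub>B)"
  "zero (cauchy_algebra B) = (\<lambda>n. \<zero>\<^sub>B)"
  "add (cauchy_algebra B) X Y = (\<lambda>n. X n \<oplus>\<^sub>B Y n)"
  "smult (cauchy_algebra B) c X = (\<lambda>n. c \<odot>\<^sub>B X n)"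
  "star (cauchy_algebra B) X = (\<lambda>n. star B (X n))"
  "nrm (cauchy_algebra B) X = lim (\<lambda>n. nrm B (X n))" by (simp_all add: cauchy_algebra_def)

lemma cauchy_algebra_carrier:
  "X \<in> carrier (cauchy_algebra B) \<longleftrightarrow> (\<forall>n. X n \<in> carrier B) \<and>
     (\<forall>e>0. \<exists>k. \<forall>m\<ge>k. \<forall>n\<ge>k. nrm B (X m \<ominus>\<^sub>B X n) < e)"
  by (auto simp: cauchy_algebra_def)

context seminormed_star_alg
begin

abbreviation CA where "CA \<equiv> cauchy_algebra B"

lemma CA_carrierD: "X \<in> carrier CA \<Longrightarrow> X n \<in> carrier B" by (simp add: cauchy_algebra_carrier)

lemma CA_nrm_Cauchy:
  assumes "X \<in> carrier CA"
  shows "Cauchy (\<lambda>n. nrm B (X n))"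
proof (rule metric_CauchyI)
  fix e :: real assume "e > 0"
  then obtain k where k: "\<forall>m\<ge>k. \<forall>n\<ge>k. nrm B (X m \<ominus> X n) < e" using assms cauchy_algebra_carrier by blast
  have "dist (nrm B (X m)) (nrm B (X n)) < e" if "m \<ge> k" "n \<ge> k" for m n using abs_nrm_diff[of "X m" "X n"] k that assms
    by (force simp: dist_real_def cauchy_algebra_carrier)
  then show "\<exists>M. \<forall>m\<ge>M. \<forall>n\<ge>M. dist (nrm B (X m)) (nrm B (X n)) < e" by blast
qed

lemma CA_nrm_tendsto:
  assumes "X \<in> carrier CA"
  shows "(\<lambda>n. nrm B (X n)) \<longlonglongrightarrow> nrm CA X" using CA_nrm_Cauchy[OF assms] Cauchy_convergent convergent_LIMSEQ_iff
  unfolding cauchy_algebra_simps by blast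

lemma CA_bounded:
  assumes "X \<in> carrier CA"
  obtains K where "K > 0" "\<And>n. nrm B (X n) \<le> K"
proof -
  have "Bseq (\<lambda>n. nrm B (X n))" using CA_nrm_Cauchy[OF assms] by (rule Cauchy_Bseq)
  then show ?thesis using that unfolding Bseq_def by (metis abs_le_D1 real_norm_def)
qed

lemma CA_mult_closed:
  assumes X: "X \<in> carrier CA" and Y: "Y \<in> carrier CA"
  shows "(\<lambda>n. X n \<otimes> Y n) \<in> carrier CA"
proof -
  obtain K where K: "K > 0" "\<And>n. nrm B (X n) \<le> K" using CA_bounded[OF X] by metis
  obtain L where L: "L > 0" "\<And>n. nrm B (Y n) \<le> L" using CA_bounded[OF Y] by metis
  note c = CA_carrierD[OF X] CA_carrierD[OF Y]
  show ?thesis unfolding cauchy_algebra_carrier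
  proof (intro conjI allI impI)
    fix e :: real assume e: "e > 0"
    obtain k where k: "\<And>m n. m \<ge> k \<Longrightarrow> n \<ge> k \<Longrightarrow> nrm B (X m \<ominus> X n) < e / (2 * L)"
      using X e L(1) unfolding cauchy_algebra_carrier by (meson divide_pos_pos mult_pos_pos zero_less_numeral)
    obtain l where l: "\<And>m n. m \<ge> l \<Longrightarrow> n \<ge> l \<Longrightarrow> nrm B (Y m \<ominus> Y n) < e / (2 * K)"
      using Y e K(1) unfolding cauchy_algebra_carrier by (meson divide_pos_pos mult_pos_pos zero_less_numeral)
    have "nrm B (X m \<otimes> Y m \<ominus> X n \<otimes> Y n) < e" if mn: "m \<ge> max k l" "n \<ge> max k l" for m n
    proof -
      have "X m \<otimes> Y m \<ominus> X n \<otimes> Y n = (X m \<ominus> X n) \<otimes> Y m \<oplus> X n \<otimes> (Y m \<ominus> Y n)" using c(1)[of m] c(1)[of n] c(2)[of m] c(2)[of n] by algebra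
      also have "nrm B \<dots> \<le> nrm B ((X m \<ominus> X n) \<otimes> Y m) + nrm B (X n \<otimes> (Y m \<ominus> Y n))" using c by (intro nrm_add) auto
      also have "\<dots> \<le> nrm B (X m \<ominus> X n) * nrm B (Y m) + nrm B (X n) * nrm B (Y m \<ominus> Y n)" using c by (intro add_mono nrm_mult) auto
      also have "\<dots> \<le> nrm B (X m \<ominus> X n) * L + K * nrm B (Y m \<ominus> Y n)" using c K L by (intro add_mono mult_mono) auto
      also have "\<dots> < (e / (2 * L)) * L + K * (e / (2 * K))"
        using k[of m n] l[of m n] mn K L by (intro add_strict_mono mult_strict_right_mono mult_strict_left_mono) auto
      also have "\<dots> = e" using K L by simp
      finally show ?thesis .
    qed
    then show "\<exists>k. \<forall>m\<ge>k. \<forall>n\<ge>k. nrm B (X m \<otimes> Y m \<ominus> X n \<otimes> Y n) < e" by blast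
  qed (use c in auto)
qed

lemma CA_add_closed:
  assumes X: "X \<in> carrier CA" and Y: "Y \<in> carrier CA"
  shows "(\<lambda>n. X n \<oplus> Y n) \<in> carrier CA"
proof -
  note c = CA_carrierD[OF X] CA_carrierD[OF Y]
  show ?thesis unfolding cauchy_algebra_carrier
  proof (intro conjI allI impI)
    fix e :: real assume e: "e > 0"
    obtain k where k: "\<And>m n. m \<ge> k \<Longrightarrow> n \<ge> k \<Longrightarrow> nrm B (X m \<ominus> X n) < e / 2"
      using X e unfolding cauchy_algebra_carrier by (meson half_gt_zero)
    obtain l where l: "\<And>m n. m \<ge> l \<Longrightarrow> n \<ge> l \<Longrightarrow> nrm B (Y m \<ominus> Y n) < e / 2"
      using Y e unfolding cauchy_algebra_carrier by (meson half_gt_zero)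
    have "nrm B (X m \<oplus> Y m \<ominus> (X n \<oplus> Y n)) < e" if mn: "m \<ge> max k l" "n \<ge> max k l" for m n
    proof -
      have "X m \<oplus> Y m \<ominus> (X n \<oplus> Y n) = (X m \<ominus> X n) \<oplus> (Y m \<ominus> Y n)" using c(1)[of m] c(1)[of n] c(2)[of m] c(2)[of n] by algebra
      also have "nrm B \<dots> \<le> nrm B (X m \<ominus> X n) + nrm B (Y m \<ominus> Y n)" using c by (intro nrm_add) auto
      also have "\<dots> < e" using k[of m n] l[of m n] mn by auto
      finally show ?thesis .
    qed
    then show "\<exists>k. \<forall>m\<ge>k. \<forall>n\<ge>k. nrm B (X m \<oplus> Y m \<ominus> (X n \<oplus> Y n)) < e" by blast
  qed (use c in auto)
qed

lemma CA_const: "x \<in> carrier B \<Longrightarrow> (\<lambda>n. x) \<in> carrier CA" by (simp add: cauchy_algebra_carrier minus_eq_0_iff[THEN iffD2])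

lemma CA_smult_closed:
  assumes X: "X \<in> carrier CA"
  shows "(\<lambda>n. c \<odot> X n) \<in> carrier CA"
proof -
  have "(\<lambda>n. (c \<odot> \<one>) \<otimes> X n) \<in> carrier CA" using CA_mult_closed[OF CA_const X, of "c \<odot> \<one>"] by simp
  then show ?thesis using CA_carrierD[OF X] by (simp add: smult_mult_l)
qed

lemma CA_star_closed:
  assumes X: "X \<in> carrier CA"
  shows "(\<lambda>n. star B (X n)) \<in> carrier CA"
proof -
  have "nrm B (star B (X m) \<ominus> star B (X n)) = nrm B (X m \<ominus> X n)" for m n
    using CA_carrierD[OF X] by (simp add: nrm_star flip: star_minus)
  then show ?thesis using X by (auto simp: cauchy_algebra_carrier)
qed

lemma star_alg_CA: "star_alg CA"
proof -
  have c: "X \<in> carrier CA \<Longrightarrow> X n \<in> carrier B" for X n by (rule CA_carrierD)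
  show ?thesis by (rule star_algI)
      (auto simp: c CA_mult_closed CA_add_closed CA_smult_closed CA_star_closed CA_const
       a_assoc m_assoc l_distr r_distr smult_l_distr smult_r_distr smult_assoc smult_mult_l smult_mult_r
       star_add star_mult star_smult fun_eq_iff intro: a_comm)
qed

lemma CA_minus:
  assumes "X \<in> carrier CA" "Y \<in> carrier CA"
  shows "X \<ominus>\<^sub>CA Y = (\<lambda>n. X n \<ominus> Y n)"
proof -
  interpret CA: star_alg CA by (rule star_alg_CA)
  show ?thesis using assms CA_carrierD by (simp add: CA.minus_smult minus_smult)
qed

lemma seminormed_CA: "seminormed_star_alg CA"
proof -
  interpret CA: star_alg CA by (rule star_alg_CA)
  have c: "X \<in> carrier CA \<Longrightarrow> X n \<in> carrier B" for X n by (rule CA_carrierD)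
  note t = CA_nrm_tendsto
  show ?thesis
  proof unfold_locales
    show "0 \<le> nrm CA x" if "x \<in> carrier CA" for x by (rule LIMSEQ_le_const[OF t[OF that]]) (use c that in auto)
    show "nrm CA (x \<oplus>\<^sub>CA y) \<le> nrm CA x + nrm CA y" if "x \<in> carrier CA" "y \<in> carrier CA" for x y
      by (rule LIMSEQ_le[OF t[OF CA.a_closed[OF that]] tendsto_add[OF t[OF that(1)] t[OF that(2)]]])
        (use c that nrm_add in auto)
    show "nrm CA (x \<otimes>\<^sub>CA y) \<le> nrm CA x * nrm CA y" if "x \<in> carrier CA" "y \<in> carrier CA" for x y
      by (rule LIMSEQ_le[OF t[OF CA.m_closed[OF that]] tendsto_mult[OF t[OF that(1)] t[OF that(2)]]])
        (use c that nrm_mult in auto)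
    show "nrm CA (r \<odot>\<^sub>CA x) = cmod r * nrm CA x" if "x \<in> carrier CA" for x r by (rule LIMSEQ_unique[OF t[OF CA.smult_closed[OF that]]])
        (use c[OF that] t[OF that] in \<open>auto simp: nrm_smult simp del: cauchy_algebra_simps(7) intro!: tendsto_intros\<close>)
    show "nrm CA (star CA x) = nrm CA x" if "x \<in> carrier CA" for x using c that by (simp add: nrm_star)
    show "nrm CA \<one>\<^sub>CA \<le> 1" using nrm_one by simp
  qed
qed

lemma null_carrier:
  assumes "X \<in> null_sequences B" shows "X \<in> carrier CA" unfolding cauchy_algebra_carrier
proof (intro conjI allI impI)
  show c: "X n \<in> carrier B" for n using assms by (auto simp: null_sequences_def)
  fix e :: real assume "e > 0"
  then obtain k where k: "\<And>n. n \<ge> k \<Longrightarrow> nrm B (X n) < e / 2"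
    using assms LIMSEQ_D[of "\<lambda>n. nrm B (X n)" 0 "e/2"] c by (fastforce simp: null_sequences_def)
  then have "nrm B (X m \<ominus> X n) < e" if "m \<ge> k" "n \<ge> k" for m n
    using nrm_minus[OF c[of m] c[of n]] k[OF that(1)] k[OF that(2)] by linarith
  then show "\<exists>k. \<forall>m\<ge>k. \<forall>n\<ge>k. nrm B (X m \<ominus> X n) < e" by blast
qed

lemma null_iff: "X \<in> null_sequences B \<longleftrightarrow> X \<in> carrier CA \<and> nrm CA X = 0"
proof
  assume X: "X \<in> null_sequences B"
  then have "(\<lambda>n. nrm B (X n)) \<longlonglongrightarrow> 0" by (simp add: null_sequences_def)
  then show "X \<in> carrier CA \<and> nrm CA X = 0" using null_carrier[OF X] CA_nrm_tendsto LIMSEQ_unique by blast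
next
  assume "X \<in> carrier CA \<and> nrm CA X = 0"
  then show "X \<in> null_sequences B" using CA_nrm_tendsto[of X] by (auto simp: null_sequences_def CA_carrierD)
qed

lemma null_ideal: "seminormed_star_ideal CA (null_sequences B)"
proof -
  interpret CA: seminormed_star_alg CA by (rule seminormed_CA)
  have n: "nrm CA x = 0" if "nrm CA x \<le> 0" "x \<in> carrier CA" for x using CA.nrm_nonneg[OF that(2)] that(1) by linarith
  have "ideal (null_sequences B) CA"
  proof (rule CA.idealI2)
    fix X Y assume X: "X \<in> null_sequences B"
    show "X \<oplus>\<^sub>CA Y \<in> null_sequences B" if Y: "Y \<in> null_sequences B"
    proof -
      have c: "X \<in> carrier CA" "Y \<in> carrier CA" "nrm CA X = 0" "nrm CA Y = 0" using X Y null_iff by auto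
      then show ?thesis unfolding null_iff using CA.nrm_add[of X Y] n CA.a_closed by simp
    qed
    assume Y: "Y \<in> carrier CA"
    have c: "X \<in> carrier CA" "nrm CA X = 0" using X null_iff by auto
    show "Y \<otimes>\<^sub>CA X \<in> null_sequences B" unfolding null_iff using c Y CA.nrm_mult[of Y X] n CA.m_closed[of Y X] by simp
    show "X \<otimes>\<^sub>CA Y \<in> null_sequences B" unfolding null_iff using c Y CA.nrm_mult[of X Y] n CA.m_closed[of X Y] by simp
  qed (use CA.nrm_zero CA.zero_closed in \<open>auto simp: null_iff simp del: cauchy_algebra_simps\<close>)
  then interpret ideal "null_sequences B" CA .
  show ?thesis by unfold_locales (metis null_iff CA.nrm_star CA.star_closed)
qed

interpretation CI: seminormed_star_ideal "cauchy_algebra B" "null_sequences B"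
  by (rule null_ideal)

lemma completion_quot: "completion B = star_quot CA (null_sequences B)" by (simp add: completion_def)

abbreviation CB where "CB \<equiv> completion B"
abbreviation cl where "cl X \<equiv> null_sequences B +>\<^sub>CA X"

lemma carrier_completion: "carrier CB = cl ` carrier CA" unfolding completion_quot by (rule CI.carrier_Q)

lemma nrm_cl: "X \<in> carrier CA \<Longrightarrow> nrm CB (cl X) = nrm CA X"
  unfolding completion_quot by (rule CI.nrm_q_null) (auto simp: null_iff simp del: cauchy_algebra_simps)

lemma nrm_cl_tendsto: "X \<in> carrier CA \<Longrightarrow> (\<lambda>n. nrm B (X n)) \<longlonglongrightarrow> nrm CB (cl X)" using nrm_cl CA_nrm_tendsto by metis

lemma seminormed_completion: "seminormed_star_alg CB" unfolding completion_quot by (rule CI.seminormed_Q)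

lemma to_completion_cl: "to_completion B x = cl (\<lambda>n. x)" by (simp add: to_completion_def)

lemma star_hom_cl: "star_hom CA CB cl" unfolding completion_quot by (rule CI.star_hom_q)

lemma star_hom_to_completion: "star_hom B CB (to_completion B)"
proof -
  have "star_hom B CA (\<lambda>x n. x)" by (rule star_homI) (auto simp: CA_const)
  then show ?thesis unfolding to_completion_def[abs_def] using star_hom_cl by (rule star_hom_compose)
qed

lemma to_completion_closed: "x \<in> carrier B \<Longrightarrow> to_completion B x \<in> carrier CB" by (rule star_homD(1)[OF star_hom_to_completion])

lemma nrm_to_completion: "x \<in> carrier B \<Longrightarrow> nrm CB (to_completion B x) = nrm B x"
  using nrm_cl[OF CA_const, of x] by (simp add: to_completion_cl)

lemma nrm_cl_minus:
  assumes "X \<in> carrier CA" "Y \<in> carrier CA"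
  shows "(\<lambda>n. nrm B (X n \<ominus> Y n)) \<longlonglongrightarrow> nrm CB (cl X \<ominus>\<^sub>CB cl Y)"
proof -
  interpret h: star_alg_hom CA "CB" cl
    unfolding completion_quot by (rule CI.star_alg_hom_q)
  have "X \<ominus>\<^sub>CA Y \<in> carrier CA" using assms by simp
  from nrm_cl_tendsto[OF this] show ?thesis using assms by (simp add: CA_minus flip: h.hom_minus)
qed

lemma cl_approx:
  assumes X: "X \<in> carrier CA"
  shows "(\<lambda>n. nrm CB (cl X \<ominus>\<^sub>CB to_completion B (X n))) \<longlonglongrightarrow> 0"
proof (rule LIMSEQ_I)
  fix e :: real assume e: "e > 0"
  obtain k where k: "\<And>m n. m \<ge> k \<Longrightarrow> n \<ge> k \<Longrightarrow> nrm B (X m \<ominus> X n) < e / 2"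
    using X e unfolding cauchy_algebra_carrier by (meson half_gt_zero)
  interpret C: seminormed_star_alg "CB" by (rule seminormed_completion)
  have cX: "cl X \<in> carrier CB" using X carrier_completion by auto
  have "nrm CB (cl X \<ominus>\<^sub>CB to_completion B (X n)) < e" if n: "n \<ge> k" for n
  proof -
    have "nrm CB (cl X \<ominus>\<^sub>CB to_completion B (X n)) \<le> e / 2" unfolding to_completion_cl
      by (rule LIMSEQ_le_const2[OF nrm_cl_minus[OF X CA_const]])
        (use k n X CA_carrierD less_imp_le in blast)+
    then show ?thesis using e by simp
  qed
  then show "\<exists>no. \<forall>n\<ge>no. norm (nrm CB (cl X \<ominus>\<^sub>CB to_completion B (X n)) - 0) < e"
    using cX to_completion_closed[OF CA_carrierD[OF X]] by (auto intro!: exI[of _ k])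
qed

lemma completion_dense:
  assumes "c \<in> carrier CB" "e > 0"
  obtains x where "x \<in> carrier B" "nrm CB (c \<ominus>\<^sub>CB to_completion B x) < e"
proof -
  obtain X where X: "X \<in> carrier CA" "c = cl X" using assms carrier_completion by auto
  obtain k where "\<And>n. n \<ge> k \<Longrightarrow> \<bar>nrm CB (c \<ominus>\<^sub>CB to_completion B (X n))\<bar> < e" using LIMSEQ_D[OF cl_approx[OF X(1)] assms(2)] X by auto
  then have "nrm CB (c \<ominus>\<^sub>CB to_completion B (X k)) < e" by force
  then show ?thesis using that CA_carrierD[OF X(1)] by blast
qed

text \<open>Applied termwise, a contractive map sends Cauchy sequences to Cauchy sequences and null
  sequences to null sequences. The coproduct and the map q \<otimes> q are obtained in this way,
  from maps between the uncompleted algebras.\<close>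

lemma completion_map:
  assumes "seminormed_star_alg D" "star_hom B D \<theta>"
    and le: "\<And>x. x \<in> carrier B \<Longrightarrow> nrm D (\<theta> x) \<le> nrm B x"
  obtains \<theta>' where "star_hom CB (completion D) \<theta>'"
    "\<And>x. x \<in> carrier B \<Longrightarrow> \<theta>' (to_completion B x) = to_completion D (\<theta> x)"
proof -
  interpret D: seminormed_star_alg D by fact
  interpret h: star_alg_hom B D \<theta>
    by (intro star_alg_homI star_alg_axioms D.star_alg_axioms assms)
  interpret D': star_alg "completion D"
    using D.seminormed_completion by (simp add: seminormed_star_alg_def)
  interpret DCI: seminormed_star_ideal "cauchy_algebra D" "null_sequences D"
    by (rule D.null_ideal)
  let ?h = "\<lambda>X n. \<theta> (X n)"
  have le': "nrm D (\<theta> x \<ominus>\<^sub>D \<theta> y) \<le> nrm B (x \<ominus> y)" if "x \<in> carrier B" "y \<in> carrier B" for x y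
    using le[of "x \<ominus> y"] that by (simp add: h.hom_minus)
  have "star_hom CA D.CA ?h"
  proof (rule star_homI)
    show "?h X \<in> carrier D.CA" if X: "X \<in> carrier CA" for X
      using X le' unfolding cauchy_algebra_carrier by (meson h.hom_closed order_le_less_trans)
  qed (auto simp: fun_eq_iff CA_carrierD h.hom_add h.hom_mult h.hom_one h.hom_smult h.hom_star)
  then have hom: "star_hom CA (completion D) (\<lambda>X. D.cl (?h X))" using D.star_hom_cl by (rule star_hom_compose)
  have "D.cl (?h X) = zero (completion D)" if X: "X \<in> null_sequences B" for X
  proof -
    have "?h X \<in> null_sequences D" unfolding null_sequences_def
    proof (intro CollectI conjI)
      have t: "(\<lambda>n. nrm B (X n)) \<longlonglongrightarrow> 0" and c: "\<And>n. X n \<in> carrier B" using X by (auto simp: null_sequences_def)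
      show "(\<lambda>n. nrm D (\<theta> (X n))) \<longlonglongrightarrow> 0" by (rule tendsto_sandwich[OF _ _ tendsto_const t]) (use le c in auto)
      show "range (?h X) \<subseteq> carrier D" using c by auto
    qed
    then show ?thesis unfolding D.completion_quot using DCI.q_zero_iff D.null_carrier by blast
  qed
  from CI.quot_lift[OF D'.star_alg_axioms hom this, folded completion_quot]
  obtain \<theta>' where t: "star_hom CB (completion D) \<theta>'"
      "\<And>X. X \<in> carrier CA \<Longrightarrow> \<theta>' (cl X) = D.cl (?h X)" by metis
  then show ?thesis using that[OF t(1)] CA_const by (simp add: to_completion_cl D.to_completion_cl)
qed

end

text \<open>The C*-identity passes to the limit along a representing sequence, and definiteness is
  gained by dividing out the null sequences.\<close>

lemma (in cstar_alg) cstar_normed_completion: "cstar_normed (completion B)"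
proof -
  interpret C: seminormed_star_alg "CB" by (rule seminormed_completion)
  interpret CI: seminormed_star_ideal "cauchy_algebra B" "null_sequences B" by (rule null_ideal)
  show ?thesis
  proof unfold_locales
    fix x assume "x \<in> carrier CB"
    then obtain X where X: "X \<in> carrier CA" "x = cl X" using carrier_completion by auto
    have "star CA X \<otimes>\<^sub>CA X \<in> carrier CA" using X(1) by blast
    from nrm_cl_tendsto[OF this]
    have "(\<lambda>n. (nrm B (X n))\<^sup>2) \<longlonglongrightarrow> nrm CB (star CB x \<otimes>\<^sub>CB x)" using X CA_carrierD[OF X(1)] star_homD[OF star_hom_cl]
      by (simp add: nrm_cstar CA_star_closed)
    moreover have "(\<lambda>n. (nrm B (X n))\<^sup>2) \<longlonglongrightarrow> (nrm CB x)\<^sup>2" using nrm_cl_tendsto[OF X(1)] X by (intro tendsto_power) auto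
    ultimately show "nrm CB (star CB x \<otimes>\<^sub>CB x) = (nrm CB x)\<^sup>2" by (rule LIMSEQ_unique)
    show "x = \<zero>\<^sub>CB " if "nrm CB x = 0" using that X nrm_cl[of X] CI.q_zero_iff[of X] null_iff[of X] unfolding completion_quot by simp
  qed
qed

subsection \<open>Positive functionals\<close>

text \<open>A state without normalisation and without the norm bound, so that the notion does not
  depend on the seminorm field. Boundedness of the associated operators has to be earned by
  \<open>pf_bound\<close>.\<close>

definition posfun :: "'a star_algebra \<Rightarrow> ('a \<Rightarrow> complex) \<Rightarrow> bool" where
  "posfun B \<omega> \<longleftrightarrow>
     (\<forall>x\<in>carrier B. \<forall>y\<in>carrier B. \<omega> (x \<oplus>\<^sub>B y) = \<omega> x + \<omega> y)
     \<and> (\<forall>c. \<forall>x\<in>carrier B. \<omega> (c \<odot>\<^sub>B x) = c * \<omega> x)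
     \<and> (\<forall>x\<in>carrier B. \<omega> (star B x \<otimes>\<^sub>B x) \<in> \<real>\<^sub>\<ge>\<^sub>0)"

lemma state_posfun: "state B \<phi> \<Longrightarrow> posfun B \<phi>" by (simp add: state_def posfun_def)

text \<open>The form needed for Cauchy-Schwarz: the polynomial is the squared length of x - r
  conj(c) y, with d = |c|^2. For b > 0 it is evaluated at its minimum r = 1/b; for b = 0 the linear
  term would become arbitrarily negative unless d = 0.\<close>

lemma nonneg_quadratic_imp:
  fixes a b d :: real
  assumes "\<And>r. 0 \<le> a - 2 * r * d + r\<^sup>2 * d * b" "d \<ge> 0" "b \<ge> 0"
  shows "d \<le> a * b"
proof (cases "b = 0")
  case True
  have "d = 0"
  proof (rule ccontr)
    assume "d \<noteq> 0"
    then have "d > 0" using assms by simp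
    then show False using assms(1)[of "(a + 1) / (2 * d)"] True by simp
  qed
  then show ?thesis using True by simp
next
  case False
  then have "b > 0" using assms by simp
  then show ?thesis using assms(1)[of "1 / b"] by (simp add: field_simps power2_eq_square)
qed

context star_alg
begin

text \<open>The squared norm of the GNS vector of x. The representation space is not formed;
  operator bounds are inequalities between these numbers.\<close>

abbreviation gns where "gns \<omega> x \<equiv> Re (\<omega> (star B x \<otimes> x))"

context
  fixes \<omega> assumes pos: "posfun B \<omega>"
begin

lemma pf_add: "x \<in> carrier B \<Longrightarrow> y \<in> carrier B \<Longrightarrow> \<omega> (x \<oplus> y) = \<omega> x + \<omega> y"
  and pf_smult: "x \<in> carrier B \<Longrightarrow> \<omega> (c \<odot> x) = c * \<omega> x"
  and pf_pos: "x \<in> carrier B \<Longrightarrow> \<omega> (star B x \<otimes> x) \<in> \<real>\<^sub>\<ge>\<^sub>0" using pos by (auto simp: posfun_def)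

lemma pf_zero [simp]: "\<omega> \<zero> = 0" using pf_smult[of \<zero> 0] by simp

lemma pf_gns_nonneg: "x \<in> carrier B \<Longrightarrow> 0 \<le> gns \<omega> x" using pf_pos by (simp add: complex_nonneg_Reals_iff)

lemma pf_gns: "x \<in> carrier B \<Longrightarrow> \<omega> (star B x \<otimes> x) = of_real (gns \<omega> x)"
  using pf_pos by (simp add: complex_nonneg_Reals_iff complex_eq_iff)

lemma pf_expand:
  assumes "x \<in> carrier B" "y \<in> carrier B"
  shows "\<omega> (star B (x \<oplus> c \<odot> y) \<otimes> (x \<oplus> c \<odot> y))
    = \<omega> (star B x \<otimes> x) + c * \<omega> (star B x \<otimes> y) + cnj c * \<omega> (star B y \<otimes> x) + c * cnj c * \<omega> (star B y \<otimes> y)"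
proof -
  have "star B (x \<oplus> c \<odot> y) \<otimes> (x \<oplus> c \<odot> y)
      = (star B x \<otimes> x \<oplus> c \<odot> (star B x \<otimes> y)) \<oplus> (cnj c \<odot> (star B y \<otimes> x) \<oplus> c \<odot> (cnj c \<odot> (star B y \<otimes> y)))"
    using assms by (simp add: star_add star_smult l_distr r_distr smult_mult_l smult_mult_r smult_r_distr a_ac)
  then show ?thesis using assms by (simp add: pf_add pf_smult)
qed

text \<open>Polarisation: \<omega>(z* z) is real for z = x + y and for z = x + i y, which gives the
  imaginary and the real part of the identity.\<close>

lemma pf_herm:
  assumes "x \<in> carrier B" "y \<in> carrier B"
  shows "\<omega> (star B y \<otimes> x) = cnj (\<omega> (star B x \<otimes> y))"
proof -
  have 1: "Im (\<omega> (star B (x \<oplus> c \<odot> y) \<otimes> (x \<oplus> c \<odot> y))) = 0" for c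
    using pf_pos[of "x \<oplus> c \<odot> y"] assms by (simp add: complex_nonneg_Reals_iff)
  have "Im (\<omega> (star B x \<otimes> x)) = 0" "Im (\<omega> (star B y \<otimes> y)) = 0" using pf_pos assms by (auto simp: complex_nonneg_Reals_iff)
  then show ?thesis using 1[of 1] 1[of \<i>] pf_expand[OF assms, of 1] pf_expand[OF assms, of \<i>] by (simp add: complex_eq_iff)
qed

lemma pf_cauchy_schwarz:
  assumes "x \<in> carrier B" "y \<in> carrier B"
  shows "(cmod (\<omega> (star B x \<otimes> y)))\<^sup>2 \<le> gns \<omega> x * gns \<omega> y"
proof (rule nonneg_quadratic_imp)
  fix r :: real
  define c where "c = \<omega> (star B x \<otimes> y)"
  define t where "t = - of_real r * cnj c"
  have "t * c = - of_real (r * (cmod c)\<^sup>2)" "cnj t * cnj c = - of_real (r * (cmod c)\<^sup>2)"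
    "t * cnj t = of_real (r\<^sup>2 * (cmod c)\<^sup>2)"
    unfolding t_def using complex_norm_square[of c] by (simp_all add: power2_eq_square mult_ac)
  moreover have "0 \<le> gns \<omega> (x \<oplus> t \<odot> y)" using assms by (intro pf_gns_nonneg) auto
  moreover have "\<omega> (star B y \<otimes> x) = cnj c" using pf_herm[OF assms] by (simp add: c_def)
  ultimately have "0 \<le> Re (\<omega> (star B x \<otimes> x) + - of_real (r * (cmod c)\<^sup>2) + - of_real (r * (cmod c)\<^sup>2)
      + of_real (r\<^sup>2 * (cmod c)\<^sup>2) * of_real (gns \<omega> y))"
    using pf_expand[OF assms, of t] pf_gns[OF assms(2)] by (simp flip: c_def)
  then show "0 \<le> gns \<omega> x - 2 * r * (cmod (\<omega> (star B x \<otimes> y)))\<^sup>2 + r\<^sup>2 * (cmod (\<omega> (star B x \<otimes> y)))\<^sup>2 * gns \<omega> y" unfolding c_def by simp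
qed (use assms pf_gns_nonneg in auto)

lemma pf_cs_sqrt:
  assumes "x \<in> carrier B" "y \<in> carrier B"
  shows "cmod (\<omega> (star B x \<otimes> y)) \<le> sqrt (gns \<omega> x) * sqrt (gns \<omega> y)"
  using pf_cauchy_schwarz[OF assms] by (simp add: real_le_rsqrt real_sqrt_mult[symmetric])

lemma pf_minkowski:
  assumes "x \<in> carrier B" "y \<in> carrier B"
  shows "sqrt (gns \<omega> (x \<oplus> y)) \<le> sqrt (gns \<omega> x) + sqrt (gns \<omega> y)"
proof (rule real_le_lsqrt)
  have 1: "x \<oplus> y = x \<oplus> 1 \<odot> y" using assms by simp
  have "gns \<omega> (x \<oplus> y) = gns \<omega> x + 2 * Re (\<omega> (star B x \<otimes> y)) + gns \<omega> y" unfolding 1 pf_expand[OF assms] using pf_herm[OF assms] by simp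
  also have "\<dots> \<le> gns \<omega> x + 2 * (sqrt (gns \<omega> x) * sqrt (gns \<omega> y)) + gns \<omega> y"
    using pf_cs_sqrt[OF assms] complex_Re_le_cmod[of "\<omega> (star B x \<otimes> y)"] by linarith
  also have "\<dots> = (sqrt (gns \<omega> x) + sqrt (gns \<omega> y))\<^sup>2" using pf_gns_nonneg assms by (simp add: power2_sum)
  finally show "gns \<omega> (x \<oplus> y) \<le> (sqrt (gns \<omega> x) + sqrt (gns \<omega> y))\<^sup>2" .
qed (use pf_gns_nonneg assms in auto)

text \<open>Iterating the Cauchy--Schwarz inequality gives \<open>(\<omega>(s*hs) / \<omega>(s*s))^(2^m) \<le> \<omega>(s*h^(2^m)s) / \<omega>(s*s)\<close>
  for \<open>h = a*a\<close>, so only the growth rate of the right-hand side matters.\<close>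

lemma pf_bound:
  assumes a: "a \<in> carrier B" and s: "s \<in> carrier B" and r: "r \<ge> 0"
    and K: "\<And>n::nat. cmod (\<omega> (star B s \<otimes> ((star B a \<otimes> a) [^] n \<otimes> s))) \<le> K * r ^ n"
  shows "gns \<omega> (a \<otimes> s) \<le> r * gns \<omega> s"
proof -
  let ?h = "star B a \<otimes> a"
  have h: "?h \<in> carrier B" using a by simp
  have sh: "star B (?h [^] (n::nat)) = ?h [^] n" for n
  proof (induction n)
    case (Suc n)
    have "star B (?h [^] Suc n) = ?h \<otimes> ?h [^] n" using Suc a by (simp add: star_mult)
    then show ?case using h by (metis nat_pow_Suc2)
  qed simp
  define b where "b n = Re (\<omega> (star B s \<otimes> (?h [^] n \<otimes> s)))" for n :: nat
  have b0: "b 0 = gns \<omega> s" using s by (simp add: b_def)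
  have b1: "b 1 = gns \<omega> (a \<otimes> s)" using s a by (simp add: b_def star_mult m_assoc)
  have sq: "(b n)\<^sup>2 \<le> b 0 * b (n + n)" for n
  proof -
    have p: "?h [^] n \<in> carrier B" using h by simp
    have "(b n)\<^sup>2 \<le> (cmod (\<omega> (star B s \<otimes> (?h [^] n \<otimes> s))))\<^sup>2"
      unfolding b_def by (metis abs_Re_le_cmod abs_le_square_iff abs_norm_cancel)
    also have "\<dots> \<le> gns \<omega> s * gns \<omega> (?h [^] n \<otimes> s)" using s p by (intro pf_cauchy_schwarz) auto
    also have "star B (?h [^] n \<otimes> s) \<otimes> (?h [^] n \<otimes> s) = star B s \<otimes> ((?h [^] n \<otimes> ?h [^] n) \<otimes> s)"
      using s p by (simp add: star_mult sh m_assoc)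
    also have "?h [^] n \<otimes> ?h [^] n = ?h [^] (n + n)" using h by (rule nat_pow_mult)
    finally show ?thesis unfolding b0 by (simp add: b_def)
  qed
  show ?thesis
  proof (cases "b 0 = 0")
    case True
    then show ?thesis using sq[of 1] b0 b1 by simp
  next
    case False
    then have c: "b 0 > 0" using b0 pf_gns_nonneg[OF s] by simp
    define t where "t = b 1 / b 0"
    have t0: "t \<ge> 0" unfolding t_def b1 using c pf_gns_nonneg[of "a \<otimes> s"] a s by simp
    have low: "b 0 * t ^ (2 ^ m) \<le> b (2 ^ m)" for m
    proof (induction m)
      case (Suc m)
      have "b 0 * (b 0 * t ^ (2 ^ Suc m)) = (b 0 * t ^ (2 ^ m))\<^sup>2"
        by (simp add: power2_eq_square power_mult_distrib mult_ac flip: power_add mult_2)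
      also have "\<dots> \<le> (b (2 ^ m))\<^sup>2" using Suc c t0 by (intro power_mono) auto
      also have "\<dots> \<le> b 0 * b (2 ^ Suc m)" using sq[of "2 ^ m"] by (simp add: mult_2)
      finally show ?case using c by simp
    qed (use c in \<open>simp add: t_def\<close>)
    have up: "b n \<le> K * r ^ n" for n using K[of n] complex_Re_le_cmod order_trans unfolding b_def by blast
    have le: "b 0 * t ^ (2 ^ m) \<le> K * r ^ (2 ^ m)" for m :: nat using low up order_trans by blast
    have "t \<le> r"
    proof (rule ccontr)
      assume "\<not> t \<le> r"
      then have tr: "r < t" by simp
      show False
      proof (cases "r = 0")
        case True
        then show False using le[of 0] tr c by (simp add: mult_le_0_iff)
      next
        case False
        then have rp: "r > 0" using r by simp
        then have "1 < t / r" using tr by simp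
        then obtain n where n: "K / b 0 < (t / r) ^ n" using real_arch_pow by blast
        have "n \<le> 2 ^ n" by (simp add: less_imp_le)
        then have "(t / r) ^ n \<le> (t / r) ^ (2 ^ n)" using \<open>1 < t / r\<close> by (intro power_increasing) auto
        also have "\<dots> \<le> K / b 0" using le[of n] rp c by (simp add: power_divide field_simps)
        finally show False using n by simp
      qed
    qed
    then show ?thesis using c b0 b1 unfolding t_def by (simp add: field_simps)
  qed
qed

lemma pf_finsum:
  assumes "f \<in> A \<rightarrow> carrier B"
  shows "\<omega> (finsum B f A) = (\<Sum>i\<in>A. \<omega> (f i))"
proof (cases "finite A")
  case True
  then show ?thesis using assms by induction (auto simp: pf_add finsum_empty finsum_insert finsum_closed Pi_def)
qed (simp add: finsum_infinite)

end

text \<open>Inequalities suffice: |x* x| \<le> |x*| |x| \<le> |x|^2 closes the C*-identity, and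
  \<open>nrm_smultI\<close> gives homogeneity.\<close>

lemma cstar_seminormI:
  assumes nonneg: "\<And>x. x \<in> carrier B \<Longrightarrow> 0 \<le> n x"
    and add: "\<And>x y. x \<in> carrier B \<Longrightarrow> y \<in> carrier B \<Longrightarrow> n (x \<oplus> y) \<le> n x + n y"
    and smult_le: "\<And>c x. x \<in> carrier B \<Longrightarrow> n (c \<odot> x) \<le> cmod c * n x"
    and mult: "\<And>x y. x \<in> carrier B \<Longrightarrow> y \<in> carrier B \<Longrightarrow> n (x \<otimes> y) \<le> n x * n y"
    and star_le: "\<And>x. x \<in> carrier B \<Longrightarrow> n (star B x) \<le> n x"
    and cstar_le: "\<And>x. x \<in> carrier B \<Longrightarrow> (n x)\<^sup>2 \<le> n (star B x \<otimes> x)"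
  shows "cstar_seminorm B n" unfolding cstar_seminorm_def
proof (intro conjI ballI allI)
  fix t assume t: "t \<in> carrier B"
  have "n (star B t \<otimes> t) \<le> n (star B t) * n t" using t mult by simp
  also have "\<dots> \<le> n t * n t" using t star_le nonneg by (intro mult_right_mono) auto
  finally show "n (star B t \<otimes> t) = (n t)\<^sup>2" using cstar_le[OF t] by (simp add: power2_eq_square)
  show "n (c \<odot> t) = cmod c * n t" for c by (rule nrm_smultI[where n = n, OF nonneg smult_le t])
qed (use nonneg add mult in auto)

text \<open>The properties (nonneg), (upper) and (least) characterise the supremum over \<open>\<omega> \<in> \<Omega>\<close> of the
  operator norm in the GNS representation of \<open>\<omega>\<close>.\<close>

lemma gns_cstar_seminorm:
  assumes \<Omega>: "\<And>\<omega>. \<omega> \<in> \<Omega> \<Longrightarrow> posfun B \<omega>"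
    and nonneg: "\<And>t. t \<in> carrier B \<Longrightarrow> 0 \<le> N t"
    and upper: "\<And>\<omega> t s. \<omega> \<in> \<Omega> \<Longrightarrow> t \<in> carrier B \<Longrightarrow> s \<in> carrier B \<Longrightarrow> gns \<omega> (t \<otimes> s) \<le> (N t)\<^sup>2 * gns \<omega> s"
    and least: "\<And>t r. t \<in> carrier B \<Longrightarrow> r \<ge> 0 \<Longrightarrow>
      (\<And>\<omega> s. \<omega> \<in> \<Omega> \<Longrightarrow> s \<in> carrier B \<Longrightarrow> gns \<omega> (t \<otimes> s) \<le> r\<^sup>2 * gns \<omega> s) \<Longrightarrow> N t \<le> r"
  shows "cstar_seminorm B N"
proof -
  have up: "sqrt (gns \<omega> (t \<otimes> s)) \<le> N t * sqrt (gns \<omega> s)"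
    if "\<omega> \<in> \<Omega>" "t \<in> carrier B" "s \<in> carrier B" for \<omega> t s
  proof -
    have "sqrt (gns \<omega> (t \<otimes> s)) \<le> sqrt ((N t)\<^sup>2 * gns \<omega> s)" using upper[OF that] by simp
    then show ?thesis using nonneg that by (simp add: real_sqrt_mult)
  qed
  have lst: "N t \<le> r" if "t \<in> carrier B" "r \<ge> 0"
    "\<And>\<omega> s. \<omega> \<in> \<Omega> \<Longrightarrow> s \<in> carrier B \<Longrightarrow> sqrt (gns \<omega> (t \<otimes> s)) \<le> r * sqrt (gns \<omega> s)" for t r
  proof (rule least[OF that(1,2)])
    fix \<omega> s assume *: "\<omega> \<in> \<Omega>" "s \<in> carrier B"
    have "(sqrt (gns \<omega> (t \<otimes> s)))\<^sup>2 \<le> (r * sqrt (gns \<omega> s))\<^sup>2"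
      using that(3)[OF *] pf_gns_nonneg[OF \<Omega>[OF *(1)], of "t \<otimes> s"] that * by (intro power_mono) auto
    then show "gns \<omega> (t \<otimes> s) \<le> r\<^sup>2 * gns \<omega> s" using pf_gns_nonneg[OF \<Omega>[OF *(1)]] that * by (simp add: power_mult_distrib)
  qed
  have smult_le: "N (c \<odot> t) \<le> cmod c * N t" if t: "t \<in> carrier B" for c t
  proof (rule lst)
    fix \<omega> s assume *: "\<omega> \<in> \<Omega>" "s \<in> carrier B"
    note pf = \<Omega>[OF *(1)]
    have "\<omega> (star B ((c \<odot> t) \<otimes> s) \<otimes> ((c \<odot> t) \<otimes> s)) = (c * cnj c) * \<omega> (star B (t \<otimes> s) \<otimes> (t \<otimes> s))"
      using t * by (simp add: star_smult smult_mult_l smult_mult_r pf_smult[OF pf])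
    then have "gns \<omega> ((c \<odot> t) \<otimes> s) = (cmod c)\<^sup>2 * gns \<omega> (t \<otimes> s)" by (simp add: complex_mult_cnj cmod_power2)
    then have "sqrt (gns \<omega> ((c \<odot> t) \<otimes> s)) = cmod c * sqrt (gns \<omega> (t \<otimes> s))" by (simp add: real_sqrt_mult)
    also have "\<dots> \<le> cmod c * (N t * sqrt (gns \<omega> s))" using up[OF *(1) t *(2)] by (intro mult_left_mono) auto
    finally show "sqrt (gns \<omega> ((c \<odot> t) \<otimes> s)) \<le> cmod c * N t * sqrt (gns \<omega> s)" by simp
  qed (use t nonneg in auto)
  have mult_le: "N (t \<otimes> u) \<le> N t * N u" if t: "t \<in> carrier B" and u: "u \<in> carrier B" for t u
  proof (rule lst)
    fix \<omega> s assume *: "\<omega> \<in> \<Omega>" "s \<in> carrier B"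
    have "sqrt (gns \<omega> (t \<otimes> u \<otimes> s)) = sqrt (gns \<omega> (t \<otimes> (u \<otimes> s)))" using t u * by (simp add: m_assoc)
    also have "\<dots> \<le> N t * sqrt (gns \<omega> (u \<otimes> s))" using up t u * by simp
    also have "\<dots> \<le> N t * (N u * sqrt (gns \<omega> s))" using up t u * nonneg by (intro mult_left_mono) auto
    finally show "sqrt (gns \<omega> (t \<otimes> u \<otimes> s)) \<le> N t * N u * sqrt (gns \<omega> s)" by simp
  qed (use t u nonneg in auto)
  have star_le: "N (star B t) \<le> N t" if t: "t \<in> carrier B" for t
  proof (rule lst)
    fix \<omega> s assume *: "\<omega> \<in> \<Omega>" "s \<in> carrier B"
    note pf = \<Omega>[OF *(1)]
    let ?x = "star B t \<otimes> s"
    have x: "?x \<in> carrier B" using t * by simp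
    \<comment> \<open>The squared length of t* s equals \<omega>(s* t t* s). Cauchy-Schwarz and the
      bound for t produce a factor |t* s| on the right, which is then cancelled.\<close>
    have "gns \<omega> ?x = Re (\<omega> (star B s \<otimes> (t \<otimes> ?x)))" using t * by (simp add: star_mult m_assoc)
    also have "\<dots> \<le> cmod (\<omega> (star B s \<otimes> (t \<otimes> ?x)))" by (rule complex_Re_le_cmod)
    also have "\<dots> \<le> sqrt (gns \<omega> s) * sqrt (gns \<omega> (t \<otimes> ?x))" using t * x by (intro pf_cs_sqrt[OF pf]) auto
    also have "\<dots> \<le> sqrt (gns \<omega> s) * (N t * sqrt (gns \<omega> ?x))"
      using up[OF *(1) t x] pf_gns_nonneg[OF pf] * by (intro mult_left_mono) auto
    finally have "sqrt (gns \<omega> ?x) * sqrt (gns \<omega> ?x) \<le> (N t * sqrt (gns \<omega> s)) * sqrt (gns \<omega> ?x)"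
      using pf_gns_nonneg[OF pf x] by (simp add: mult_ac)
    note le = this
    show "sqrt (gns \<omega> ?x) \<le> N t * sqrt (gns \<omega> s)"
    proof (cases "gns \<omega> ?x = 0")
      case True
      then show ?thesis using pf_gns_nonneg[OF pf *(2)] nonneg[OF t] by simp
    next
      case False
      then have "0 < sqrt (gns \<omega> ?x)" using pf_gns_nonneg[OF pf x] by simp
      then show ?thesis using le by (rule mult_right_le_imp_le[rotated])
    qed
  qed (use t nonneg in auto)
  have cstar_le: "(N t)\<^sup>2 \<le> N (star B t \<otimes> t)" if t: "t \<in> carrier B" for t
  proof -
    have n: "0 \<le> N (star B t \<otimes> t)" using t nonneg by simp
    have "N t \<le> sqrt (N (star B t \<otimes> t))"
    proof (rule least[OF t])
      fix \<omega> s assume *: "\<omega> \<in> \<Omega>" "s \<in> carrier B"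
      note pf = \<Omega>[OF *(1)]
      have "gns \<omega> (t \<otimes> s) = Re (\<omega> (star B s \<otimes> (star B t \<otimes> t \<otimes> s)))" using t * by (simp add: star_mult m_assoc)
      also have "\<dots> \<le> cmod (\<omega> (star B s \<otimes> (star B t \<otimes> t \<otimes> s)))" by (rule complex_Re_le_cmod)
      also have "\<dots> \<le> sqrt (gns \<omega> s) * sqrt (gns \<omega> (star B t \<otimes> t \<otimes> s))" using t * by (intro pf_cs_sqrt[OF pf]) auto
      also have "\<dots> \<le> sqrt (gns \<omega> s) * (N (star B t \<otimes> t) * sqrt (gns \<omega> s))"
        using up[OF *(1) _ *(2), of "star B t \<otimes> t"] t pf_gns_nonneg[OF pf] * by (intro mult_left_mono) auto
      also have "\<dots> = (sqrt (N (star B t \<otimes> t)))\<^sup>2 * gns \<omega> s" using n pf_gns_nonneg[OF pf *(2)] by (simp add: mult_ac)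
      finally show "gns \<omega> (t \<otimes> s) \<le> (sqrt (N (star B t \<otimes> t)))\<^sup>2 * gns \<omega> s" .
    qed (use n in auto)
    then show ?thesis using n nonneg[OF t] real_le_rsqrt by (metis power_mono real_sqrt_pow2)
  qed
  show ?thesis
  proof (rule cstar_seminormI[where n = N, OF nonneg _ smult_le mult_le star_le cstar_le])
    fix t u assume t: "t \<in> carrier B" and u: "u \<in> carrier B"
    show "N (t \<oplus> u) \<le> N t + N u"
    proof (rule lst)
      fix \<omega> s assume *: "\<omega> \<in> \<Omega>" "s \<in> carrier B"
      note pf = \<Omega>[OF *(1)]
      have "sqrt (gns \<omega> ((t \<oplus> u) \<otimes> s)) = sqrt (gns \<omega> (t \<otimes> s \<oplus> u \<otimes> s))" using t u * by (simp add: l_distr)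
      also have "\<dots> \<le> sqrt (gns \<omega> (t \<otimes> s)) + sqrt (gns \<omega> (u \<otimes> s))" using t u * by (intro pf_minkowski[OF pf]) auto
      also have "\<dots> \<le> N t * sqrt (gns \<omega> s) + N u * sqrt (gns \<omega> s)" using up t u * by (intro add_mono) auto
      finally show "sqrt (gns \<omega> ((t \<oplus> u) \<otimes> s)) \<le> (N t + N u) * sqrt (gns \<omega> s)" by (simp add: distrib_right)
    qed (use t u nonneg in auto)
  qed
qed

end

subsection \<open>Positive semidefinite kernels\<close>

definition psd_on :: "'i set \<Rightarrow> ('i \<Rightarrow> 'i \<Rightarrow> complex) \<Rightarrow> bool" where
  "psd_on S K \<longleftrightarrow> (\<forall>c. (\<Sum>x\<in>S. \<Sum>y\<in>S. cnj (c x) * c y * K x y) \<in> \<real>\<^sub>\<ge>\<^sub>0)"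

lemma psd_on_subset:
  assumes "psd_on S K" "T \<subseteq> S" "finite S"
  shows "psd_on T K" unfolding psd_on_def
proof
  fix c :: "'a \<Rightarrow> complex"
  define c' where "c' x = (if x \<in> T then c x else 0)" for x
  have "(\<Sum>x\<in>S. \<Sum>y\<in>S. cnj (c' x) * c' y * K x y) = (\<Sum>x\<in>T. \<Sum>y\<in>S. cnj (c' x) * c' y * K x y)"
    using assms by (intro sum.mono_neutral_right) (auto simp: c'_def)
  also have "\<dots> = (\<Sum>x\<in>T. \<Sum>y\<in>T. cnj (c' x) * c' y * K x y)"
    using assms by (intro sum.cong refl sum.mono_neutral_right) (auto simp: c'_def)
  also have "\<dots> = (\<Sum>x\<in>T. \<Sum>y\<in>T. cnj (c x) * c y * K x y)" by (intro sum.cong) (auto simp: c'_def)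
  finally show "(\<Sum>x\<in>T. \<Sum>y\<in>T. cnj (c x) * c y * K x y) \<in> \<real>\<^sub>\<ge>\<^sub>0" using assms(1)[unfolded psd_on_def, THEN spec, of c'] by simp
qed

lemma psd_on_diag: "psd_on S K \<Longrightarrow> finite S \<Longrightarrow> a \<in> S \<Longrightarrow> K a a \<in> \<real>\<^sub>\<ge>\<^sub>0"
proof -
  assume "psd_on S K" "finite S" "a \<in> S"
  then have "psd_on {a} K" using psd_on_subset[of S K "{a}"] by simp
  then have "(\<Sum>x\<in>{a}. \<Sum>y\<in>{a}. cnj ((\<lambda>_. 1) x) * (\<lambda>_. 1) y * K x y) \<in> \<real>\<^sub>\<ge>\<^sub>0" unfolding psd_on_def by (rule spec)
  then show ?thesis by simp
qed

lemma psd_on_pair: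
  assumes "psd_on S K" "finite S" "a \<in> S" "b \<in> S" "a \<noteq> b"
  shows "cnj u * u * K a a + cnj u * w * K a b + cnj w * u * K b a + cnj w * w * K b b \<in> \<real>\<^sub>\<ge>\<^sub>0"
proof -
  have "psd_on {a, b} K" using assms by (intro psd_on_subset[OF assms(1) _ assms(2)]) simp
  then have "(\<Sum>x\<in>{a, b}. \<Sum>y\<in>{a, b}. cnj ((\<lambda>z. if z = a then u else w) x) * (\<lambda>z. if z = a then u else w) y * K x y) \<in> \<real>\<^sub>\<ge>\<^sub>0"
    unfolding psd_on_def by (rule spec)
  then show ?thesis using assms(5) by (simp add: add.assoc)
qed

lemma psd_on_herm:
  assumes "psd_on S K" "finite S" "a \<in> S" "b \<in> S"
  shows "K b a = cnj (K a b)"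
proof (cases "a = b")
  case True
  then show ?thesis using psd_on_diag[OF assms(1-3)] by (auto simp: complex_eq_iff complex_nonneg_Reals_iff)
next
  case False
  note p = psd_on_pair[OF assms False]
  have "Im (K a a) = 0" "Im (K b b) = 0"
    using psd_on_diag[OF assms(1,2,3)] psd_on_diag[OF assms(1,2,4)] by (auto simp: complex_nonneg_Reals_iff)
  then show ?thesis using p[of 1 1] p[of 1 \<i>] by (auto simp: complex_nonneg_Reals_iff complex_eq_iff)
qed

text \<open>The 2 x 2 minor argument: with a zero on the diagonal the quadratic in
  \<open>nonneg_quadratic_imp\<close> has b = 0, which forces the off-diagonal entry to
  vanish.\<close>

lemma psd_on_zero:
  assumes "psd_on S K" "finite S" "a \<in> S" "b \<in> S" "K a a = 0"
  shows "K a b = 0"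
proof (cases "a = b")
  case False
  have *: "0 \<le> Re (K b b) - 2 * r * (cmod (K a b))\<^sup>2 + r\<^sup>2 * (cmod (K a b))\<^sup>2 * 0" for r
  proof -
    have "0 \<le> Re (cnj (- of_real r * K a b) * K a b + (- of_real r * K a b) * K b a + K b b)"
      using psd_on_pair[OF assms(1-4) False, of "- of_real r * K a b" 1] assms(5)
      by (simp add: complex_nonneg_Reals_iff del: Re_complex_of_real)
    also have "K b a = cnj (K a b)" using psd_on_herm[OF assms(1-4)] .
    finally show ?thesis unfolding cmod_power2 by (simp add: power2_eq_square algebra_simps)
  qed
  then show ?thesis using nonneg_quadratic_imp[OF *] by simp
qed (use assms in simp)

text \<open>Cholesky factorisation, eliminating one index a at a time. Row a contributes the
  rank-one kernel conj(w x) w y, and the Schur complement \<open>K'\<close> is again positive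
  semidefinite. It is needed for the Schur product argument in \<open>posfun_tensor\<close>.\<close>

lemma psd_factor:
  assumes "finite S" "psd_on S K"
  shows "\<exists>m v. \<forall>x\<in>S. \<forall>y\<in>S. K x y = (\<Sum>i<(m::nat). cnj (v i x) * v i y)" using assms
proof (induction S arbitrary: K)
  case (insert a S)
  note psd = insert.prems and fin = finite.insertI[OF insert.hyps(1), of a]
  define \<alpha> where "\<alpha> = Re (K a a)"
  have Kaa: "K a a = of_real \<alpha>" and \<alpha>0: "\<alpha> \<ge> 0"
    using psd_on_diag[OF psd fin, of a] by (auto simp: \<alpha>_def complex_nonneg_Reals_iff complex_eq_iff)
  have herm: "K x y = cnj (K y x)" if "x \<in> insert a S" "y \<in> insert a S" for x y using psd_on_herm[OF psd fin that(2,1)] .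
  \<comment> \<open>If \<alpha> = 0 the division yields 0, which is the right value because the
    whole row a vanishes by \<open>psd_on_zero\<close>.\<close>
  define w where "w y = K a y / of_real (sqrt \<alpha>)" for y
  have w: "of_real (sqrt \<alpha>) * w y = K a y" if "y \<in> insert a S" for y
    using psd_on_zero[OF psd fin, of a y] that Kaa by (cases "\<alpha> = 0") (auto simp: w_def)
  have ww: "cnj (w x) * w y * of_real \<alpha> = cnj (K a x) * K a y" if "x \<in> insert a S" "y \<in> insert a S" for x y
  proof -
    have "cnj (K a x) * K a y = cnj (w x) * w y * (of_real (sqrt \<alpha>) * of_real (sqrt \<alpha>))"
      unfolding w[OF that(1), symmetric] w[OF that(2), symmetric] by simp
    then show ?thesis using \<alpha>0 by (simp flip: of_real_mult)
  qed
  define K' where "K' x y = K x y - cnj (w x) * w y" for x y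
  have "psd_on S K'" unfolding psd_on_def
  proof
    fix c :: "'a \<Rightarrow> complex"
    define T where "T = (\<Sum>y\<in>S. c y * K a y)"
    define W where "W = (\<Sum>y\<in>S. c y * w y)"
    \<comment> \<open>The coefficient at a that minimises the form when the others are fixed; it
      completes the square and leaves the form of \<open>K'\<close>.\<close>
    define ca where "ca = - W / of_real (sqrt \<alpha>)"
    define c' where "c' x = (if x = a then ca else c x)" for x
    have TW: "T = of_real (sqrt \<alpha>) * W" unfolding T_def W_def sum_distrib_left
      by (intro sum.cong refl) (use w in \<open>auto simp: mult.left_commute\<close>)
    have W0: "W = 0" if "\<alpha> = 0" using that by (simp add: W_def w_def)
    have caW: "of_real (sqrt \<alpha>) * ca = - W" using W0 by (cases "\<alpha> = 0") (auto simp: ca_def)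
    have cT: "(\<Sum>x\<in>S. cnj (c x) * K x a) = cnj T" unfolding T_def cnj_sum
    proof (intro sum.cong refl)
      fix x assume "x \<in> S"
      then have "K x a = cnj (K a x)" by (intro herm) auto
      then show "cnj (c x) * K x a = cnj (c x * K a x)" by (simp only: complex_cnj_mult)
    qed
    have "(\<Sum>x\<in>insert a S. \<Sum>y\<in>insert a S. cnj (c' x) * c' y * K x y)
       = cnj ca * ca * K a a + (\<Sum>y\<in>S. cnj ca * c y * K a y) + (\<Sum>x\<in>S. cnj (c x) * ca * K x a + (\<Sum>y\<in>S. cnj (c x) * c y * K x y))"
      using insert.hyps by (auto simp: c'_def intro!: sum.cong arg_cong2[where f = "(+)"])
    also have "\<dots> = cnj ca * ca * K a a + cnj ca * T + ca * (\<Sum>x\<in>S. cnj (c x) * K x a) + (\<Sum>x\<in>S. \<Sum>y\<in>S. cnj (c x) * c y * K x y)"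
      by (simp add: T_def sum_distrib_left sum.distrib mult_ac)
    also have "\<dots> = (of_real (sqrt \<alpha>) * cnj ca) * (of_real (sqrt \<alpha>) * ca)
        + (of_real (sqrt \<alpha>) * cnj ca) * W + (of_real (sqrt \<alpha>) * ca) * cnj W + (\<Sum>x\<in>S. \<Sum>y\<in>S. cnj (c x) * c y * K x y)"
      unfolding cT TW Kaa using \<alpha>0 by (simp add: mult_ac flip: of_real_mult)
    also have "of_real (sqrt \<alpha>) * cnj ca = - cnj W" using arg_cong[OF caW, of cnj] by simp
    also have "(- cnj W) * (of_real (sqrt \<alpha>) * ca) + (- cnj W) * W + (of_real (sqrt \<alpha>) * ca) * cnj W
        + (\<Sum>x\<in>S. \<Sum>y\<in>S. cnj (c x) * c y * K x y) = (\<Sum>x\<in>S. \<Sum>y\<in>S. cnj (c x) * c y * K x y) - cnj W * W"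
      unfolding caW by simp
    also have "cnj W * W = (\<Sum>x\<in>S. \<Sum>y\<in>S. cnj (c x) * c y * (cnj (w x) * w y))"
      unfolding W_def cnj_sum sum_product by (intro sum.cong) auto
    also have "(\<Sum>x\<in>S. \<Sum>y\<in>S. cnj (c x) * c y * K x y) - \<dots> = (\<Sum>x\<in>S. \<Sum>y\<in>S. cnj (c x) * c y * K' x y)"
      by (simp add: K'_def right_diff_distrib sum_subtractf)
    finally show "(\<Sum>x\<in>S. \<Sum>y\<in>S. cnj (c x) * c y * K' x y) \<in> \<real>\<^sub>\<ge>\<^sub>0" using psd[unfolded psd_on_def, THEN spec, of c'] by (simp only:)
  qed
  from insert.IH[OF this] obtain m v where
    mv: "\<And>x y. x \<in> S \<Longrightarrow> y \<in> S \<Longrightarrow> K' x y = (\<Sum>i<(m::nat). cnj (v i x) * v i y)" by blast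
  define v' where "v' i x = (if i = m then (if x = a then of_real (sqrt \<alpha>) else w x) else if x = a then 0 else v i x)" for i x
  have "K x y = (\<Sum>i<Suc m. cnj (v' i x) * v' i y)" if xy: "x \<in> insert a S" "y \<in> insert a S" for x y
  proof -
    consider "x = a" "y = a" | "x = a" "y \<noteq> a" | "x \<noteq> a" "y = a" | "x \<noteq> a" "y \<noteq> a" by blast
    then show ?thesis
    proof cases
      case 1
      then show ?thesis using Kaa \<alpha>0 by (simp add: v'_def flip: of_real_mult)
    next
      case 2
      then show ?thesis using w[OF xy(2)] by (simp add: v'_def)
    next
      case 3
      then show ?thesis using arg_cong[OF w[OF xy(1)], of cnj] herm[OF xy] by (simp add: v'_def mult.commute)
    next
      case 4
      then have "(\<Sum>i<m. cnj (v' i x) * v' i y) = (\<Sum>i<m. cnj (v i x) * v i y)" by (intro sum.cong) (auto simp: v'_def)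
      also have "\<dots> = K' x y" using mv 4 xy by simp
      finally show ?thesis using 4 by (simp add: v'_def K'_def)
    qed
  qed
  then show ?case by blast
qed auto

subsection \<open>The Perron--Frobenius eigenvector\<close>

lemma matrix_power_vector:
  fixes A :: "real^'n^'n"
  shows "((**) A ^^ k) (mat 1) *v v = ((*v) A ^^ k) v" by (induction k) (simp_all add: matrix_vector_mul_assoc[symmetric])

lemma eigen_power:
  fixes A :: "real^'n^'n"
  shows "A *v v = r *\<^sub>R v \<Longrightarrow> ((*v) A ^^ k) v = r ^ k *\<^sub>R v"
  by (induction k) (simp_all add: scaleR_matrix_vector_assoc[symmetric] matrix_vector_mult_scaleR mult.commute)

lemma positive_matrix_vector:
  fixes P :: "real^'n^'n"
  assumes "\<And>i j. 0 < P $ i $ j" "\<And>j. 0 \<le> v $ j" "v \<noteq> 0"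
  shows "0 < (P *v v) $ i"
proof -
  obtain j where "v $ j \<noteq> 0" using assms(3) by (auto simp: vec_eq_iff)
  then have "0 < v $ j" using assms(2)[of j] by simp
  then show ?thesis unfolding matrix_vector_mult_def using assms by (simp, intro sum_pos2[of _ j]) (auto simp: less_imp_le)
qed

context
  fixes A :: "real^'n^'n"
  assumes nonneg: "\<And>i j. 0 \<le> A $ i $ j" and prim: "primitive_matrix A"
begin

lemma primitive_power_pos:
  obtains k :: nat where "k \<ge> 1" "\<And>v i. (\<And>j. 0 \<le> v $ j) \<Longrightarrow> v \<noteq> 0 \<Longrightarrow> 0 < (((*v) A ^^ k) v) $ i"
proof -
  obtain k where k: "k \<ge> 1" "\<And>i j. 0 < (((**) A ^^ k) (mat 1)) $ i $ j" using prim unfolding primitive_matrix_def by blast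
  show ?thesis by (rule that[OF k(1)]) (use positive_matrix_vector[OF k(2)] in \<open>simp add: matrix_power_vector\<close>)
qed

text \<open>Brouwer's theorem for v -> Av / sum(Av) on the simplex. The denominator is nonzero
  because Av = 0 would give A^k v = 0, against positivity of A^k. The same positivity makes the
  fixed point strictly positive.\<close>

lemma perron_exists: "\<exists>v. (\<forall>i. 0 < v $ i) \<and> (\<Sum>i\<in>UNIV. v $ i) = 1 \<and> (\<exists>r. A *v v = r *\<^sub>R v)"
proof -
  obtain k where k: "k \<ge> 1" "\<And>v i. (\<And>j. 0 \<le> v $ j) \<Longrightarrow> v \<noteq> 0 \<Longrightarrow> 0 < (((*v) A ^^ k) v) $ i" by (rule primitive_power_pos) blast
  define S :: "(real^'n) set" where "S = {v. (\<forall>i. 0 \<le> v $ i) \<and> (\<Sum>i\<in>UNIV. v $ i) = 1}"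
  define s where "s v = (\<Sum>i\<in>UNIV. (A *v v) $ i)" for v :: "real^'n"
  define f where "f v = (1 / s v) *\<^sub>R (A *v v)" for v
  have Av: "0 \<le> (A *v v) $ i" if "v \<in> S" for v i using that nonneg by (auto simp: S_def matrix_vector_mult_def intro!: sum_nonneg)
  have sp: "0 < s v" if v: "v \<in> S" for v
  proof (rule ccontr)
    assume "\<not> 0 < s v"
    then have "s v = 0" using Av[OF v] by (simp add: s_def sum_nonneg order_antisym not_less)
    then have "A *v v = 0" using Av[OF v] by (simp add: s_def sum_nonneg_eq_0_iff vec_eq_iff)
    then have "A *v v = 0 *\<^sub>R v" by simp
    from eigen_power[OF this, of k] have "((*v) A ^^ k) v = 0" using k(1) by simp
    moreover have "v \<noteq> 0" using v by (auto simp: S_def)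
    ultimately show False using k(2)[of v] v by (force simp: S_def)
  qed
  have "closed S"
  proof -
    have "S = (\<Inter>i. {v. 0 \<le> v $ i}) \<inter> {v. (\<Sum>i\<in>UNIV. v $ i) = 1}" by (auto simp: S_def)
    moreover have "closed \<dots>" by (intro closed_Int closed_INT closed_Collect_le closed_Collect_eq ballI continuous_intros)
    ultimately show ?thesis by simp
  qed
  moreover have "bounded S"
  proof -
    have "norm v \<le> 1" if "v \<in> S" for v using norm_le_l1_cart[of v] that by (simp add: S_def)
    then show ?thesis by (auto simp: bounded_iff)
  qed
  ultimately have "compact S" by (simp add: compact_eq_bounded_closed)
  moreover have "convex S" unfolding convex_def S_def by (auto simp: sum.distrib simp flip: sum_distrib_left)
  moreover have "S \<noteq> {}"
  proof -
    have "(\<chi> i. 1 / real CARD('n)) \<in> S" by (simp add: S_def)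
    then show ?thesis by blast
  qed
  moreover have "continuous_on S f" unfolding f_def s_def by (intro continuous_intros) (use sp in \<open>force simp: s_def\<close>)
  moreover have "f \<in> S \<rightarrow> S"
  proof
    fix v assume v: "v \<in> S"
    have "(\<Sum>i\<in>UNIV. f v $ i) = s v / s v" by (simp add: f_def s_def flip: sum_divide_distrib)
    then show "f v \<in> S" using sp[OF v] Av[OF v] by (auto simp: S_def f_def)
  qed
  ultimately obtain v where v: "v \<in> S" "f v = v" by (rule brouwer)
  have "A *v v = s v *\<^sub>R f v" using sp[OF v(1)] by (simp add: f_def)
  then have e: "A *v v = s v *\<^sub>R v" using v by simp
  have "v \<noteq> 0" using v by (auto simp: S_def)
  then have "0 < (s v ^ k) * v $ i" for i using k(2)[of v i] v(1) eigen_power[OF e, of k] by (simp add: S_def)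
  then have "0 < v $ i" for i using sp[OF v(1)] by (simp add: zero_less_mult_iff)
  then show ?thesis using v(1) e by (auto simp: S_def)
qed

text \<open>The two eigenvalues may differ a priori, since \<open>perron_vector\<close> leaves the
  eigenvalue open. Let t be the least ratio v_i / w_i. If v is not a multiple of w, then A^k (v - t
  w) is strictly positive even at the index where v - t w vanishes, and this gives s^k < r^k.
  Exchanging v and w gives the opposite inequality.\<close>

lemma perron_unique:
  assumes v: "\<And>i. 0 < v $ i" "(\<Sum>i\<in>UNIV. v $ i) = 1" "A *v v = r *\<^sub>R v"
    and w: "\<And>i. 0 < w $ i" "(\<Sum>i\<in>UNIV. w $ i) = 1" "A *v w = s *\<^sub>R w"
  shows "v = w"
proof -
  have scaled: "v' = w'" if "v' = t *\<^sub>R w'" "(\<Sum>i\<in>UNIV. v' $ i) = 1" "(\<Sum>i\<in>UNIV. w' $ i) = 1" for v' w' :: "real^'n" and t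
  proof -
    have "1 = (\<Sum>i\<in>UNIV. t * w' $ i)" using that(1,2) by simp
    then have "t = 1" using that(3) by (simp flip: sum_distrib_left)
    then show ?thesis using that(1) by simp
  qed
  obtain k where k: "k \<ge> 1" "\<And>v i. (\<And>j. 0 \<le> v $ j) \<Longrightarrow> v \<noteq> 0 \<Longrightarrow> 0 < (((*v) A ^^ k) v) $ i" by (rule primitive_power_pos) blast
  have *: "s' ^ k < r' ^ k"
    if v: "\<And>i. 0 < v $ i" "A *v v = r' *\<^sub>R v" and w: "\<And>i. 0 < w $ i" "A *v w = s' *\<^sub>R w"
      and ne: "\<And>t. v \<noteq> t *\<^sub>R w" for v w r' s'
  proof -
    define t where "t = Min (range (\<lambda>i. v $ i / w $ i))"
    have tle: "t \<le> v $ i / w $ i" for i by (simp add: t_def)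
    have "t \<in> range (\<lambda>i. v $ i / w $ i)" unfolding t_def by (rule Min_in) auto
    then obtain i where i: "t = v $ i / w $ i" by blast
    have "0 \<le> (v - t *\<^sub>R w) $ j" for j using tle[of j] w(1)[of j] by (simp add: field_simps)
    moreover have "v - t *\<^sub>R w \<noteq> 0" using ne by auto
    ultimately have "0 < (((*v) A ^^ k) (v - t *\<^sub>R w)) $ i" by (rule k(2))
    also have "((*v) A ^^ k) (v - t *\<^sub>R w) = ((*v) A ^^ k) v - t *\<^sub>R ((*v) A ^^ k) w"
      unfolding matrix_power_vector[symmetric] by (simp add: matrix_vector_mult_diff_distrib matrix_vector_mult_scaleR)
    also have "\<dots> $ i = (r' ^ k - s' ^ k) * v $ i"
      using i w(1)[of i] by (simp add: eigen_power[OF v(2)] eigen_power[OF w(2)] algebra_simps)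
    finally show ?thesis using v(1)[of i] by (simp add: zero_less_mult_iff)
  qed
  show ?thesis
  proof (rule ccontr)
    assume "v \<noteq> w"
    then have "v \<noteq> t *\<^sub>R w" "w \<noteq> t *\<^sub>R v" for t using scaled[of v t w] scaled[of w t v] v(2) w(2) by metis+
    then have "s ^ k < r ^ k" "r ^ k < s ^ k" using *[OF v(1,3) w(1,3)] *[OF w(1,3) v(1,3)] by blast+
    then show False by simp
  qed
qed

lemma perron_vector_props:
  "(\<forall>i. 0 < perron_vector A $ i) \<and> (\<Sum>i\<in>UNIV. perron_vector A $ i) = 1
    \<and> (\<exists>r. A *v perron_vector A = r *\<^sub>R perron_vector A)"
  unfolding perron_vector_def by (rule theI') (use perron_exists perron_unique in blast)

text \<open>Permuting the coordinates by an automorphism yields another normalised positive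
  eigenvector, so uniqueness applies. This is what condition (I) requires of the classical
  points.\<close>

lemma perron_vector_Aut:
  assumes "\<pi> \<in> Aut_matrix A"
  shows "perron_vector A $ \<pi> i = perron_vector A $ i"
proof -
  define v where "v = perron_vector A"
  obtain r where v: "\<And>i. 0 < v $ i" "(\<Sum>i\<in>UNIV. v $ i) = 1" "A *v v = r *\<^sub>R v" using perron_vector_props by (auto simp: v_def)
  have b: "bij \<pi>" and inv: "\<And>i j. A $ \<pi> i $ \<pi> j = A $ i $ j" using assms by (auto simp: Aut_matrix_def)
  define w where "w = (\<chi> i. v $ \<pi> i)"
  have "(\<Sum>i\<in>UNIV. w $ i) = 1" using v(2) sum.reindex_bij_betw[OF b, of "\<lambda>i. v $ i"] by (simp add: w_def)
  moreover have "A *v w = r *\<^sub>R w"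
  proof (subst vec_eq_iff, intro allI)
    fix i
    have "(A *v w) $ i = (\<Sum>j\<in>UNIV. A $ \<pi> i $ \<pi> j * v $ \<pi> j)" by (simp add: matrix_vector_mult_def w_def inv)
    also have "\<dots> = (\<Sum>j\<in>UNIV. A $ \<pi> i $ j * v $ j)" using sum.reindex_bij_betw[OF b, of "\<lambda>j. A $ \<pi> i $ j * v $ j"] .
    also have "\<dots> = (A *v v) $ \<pi> i" by (simp add: matrix_vector_mult_def)
    finally show "(A *v w) $ i = (r *\<^sub>R w) $ i" using v(3) by (simp add: w_def)
  qed
  ultimately have "v = w" using v by (intro perron_unique[of v r w r]) (auto simp: w_def)
  then show ?thesis by (metis v_def w_def vec_lambda_beta)
qed

end

subsection \<open>The wreath product as a compact group\<close>

text \<open>Continuity on an abstract topological space is turned into limits along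
  \<open>atin\<close>, so that the limit rules for sums, products and conjugation apply.\<close>

lemma continuous_map_euclidean_atin:
  "continuous_map X euclidean f \<longleftrightarrow> (\<forall>x\<in>topspace X. (f \<longlongrightarrow> f x) (atin X x))" by (simp add: continuous_map_atin)

lemma continuous_map_mult_cx:
  fixes f g :: "'a \<Rightarrow> complex"
  shows "continuous_map X euclidean f \<Longrightarrow> continuous_map X euclidean g \<Longrightarrow> continuous_map X euclidean (\<lambda>x. f x * g x)"
  unfolding continuous_map_euclidean_atin by (auto intro: tendsto_mult)

lemma continuous_map_cnj:
  "continuous_map X euclidean f \<Longrightarrow> continuous_map X euclidean (\<lambda>x. cnj (f x))"
  unfolding continuous_map_euclidean_atin by (auto intro: tendsto_cnj)

lemma continuous_map_sum_cx:
  fixes f :: "'i \<Rightarrow> 'a \<Rightarrow> complex"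
  shows "(\<And>i. i \<in> I \<Longrightarrow> continuous_map X euclidean (f i)) \<Longrightarrow> continuous_map X euclidean (\<lambda>x. \<Sum>i\<in>I. f i x)"
  unfolding continuous_map_euclidean_atin by (auto intro: tendsto_sum)

lemma continuous_map_vec_nth:
  fixes f :: "'a \<Rightarrow> complex^'n"
  shows "continuous_map X euclidean f \<Longrightarrow> continuous_map X euclidean (\<lambda>x. f x $ i)"
  unfolding continuous_map_euclidean_atin by (auto intro: tendsto_vec_nth)

lemma continuous_map_vecI:
  fixes f :: "'a \<Rightarrow> 'b::topological_space^'n"
  shows "(\<And>i. continuous_map X euclidean (\<lambda>x. f x $ i)) \<Longrightarrow> continuous_map X euclidean f"
  unfolding continuous_map_euclidean_atin by (auto intro: vec_tendstoI)

lemma compact_torus: "compact (torus :: (complex^'n) set)"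
proof -
  have "torus = (\<Inter>i. {z :: complex^'n. cmod (z $ i) = 1})" by (auto simp: torus_def)
  moreover have "closed \<dots>" by (intro closed_INT closed_Collect_eq ballI continuous_intros)
  moreover have "norm z \<le> real CARD('n)" if "z \<in> torus" for z :: "complex^'n"
  proof -
    have "norm z \<le> (\<Sum>i\<in>UNIV. norm (z $ i))" by (simp add: norm_vec_def L2_set_le_sum)
    then show ?thesis using that by (simp add: torus_def)
  qed
  ultimately show ?thesis by (auto simp: compact_eq_bounded_closed bounded_iff)
qed

lemma Aut_matrix_id: "id \<in> Aut_matrix A" by (auto simp: Aut_matrix_def)

lemma Aut_matrix_comp: "\<pi> \<in> Aut_matrix A \<Longrightarrow> \<sigma> \<in> Aut_matrix A \<Longrightarrow> \<pi> \<circ> \<sigma> \<in> Aut_matrix A" by (auto simp: Aut_matrix_def intro: bij_comp)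

lemma Aut_matrix_inv: "\<pi> \<in> Aut_matrix A \<Longrightarrow> Hilbert_Choice.inv \<pi> \<in> Aut_matrix A" unfolding Aut_matrix_def
  by (auto simp: bij_imp_bij_inv) (metis bij_inv_eq_iff)+

lemma finite_Aut_matrix: "finite (Aut_matrix (A :: real^'n^'n))" by (rule finite_subset[of _ "UNIV"]) auto

lemma group_torus_wreath_Aut: "Group.group (torus_wreath_Aut A)"
proof (rule groupI)
  fix x y z
  assume x: "x \<in> carrier (torus_wreath_Aut A)" and y: "y \<in> carrier (torus_wreath_Aut A)"
    and z: "z \<in> carrier (torus_wreath_Aut A)"
  then have b: "bij (snd x)" "bij (snd y)" by (auto simp: torus_wreath_Aut_def Aut_matrix_def)
  show "x \<otimes>\<^sub>(torus_wreath_Aut A) y \<in> carrier (torus_wreath_Aut A)"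
    using x y by (auto simp: torus_wreath_Aut_def torus_def norm_mult Aut_matrix_comp)
  show "x \<otimes>\<^sub>(torus_wreath_Aut A) y \<otimes>\<^sub>(torus_wreath_Aut A) z = x \<otimes>\<^sub>(torus_wreath_Aut A) (y \<otimes>\<^sub>(torus_wreath_Aut A) z)"
    using b by (cases x, cases y, cases z) (auto simp: torus_wreath_Aut_def vec_eq_iff o_inv_distrib mult.assoc)
  show "\<one>\<^sub>(torus_wreath_Aut A) \<otimes>\<^sub>(torus_wreath_Aut A) x = x" by (cases x) (auto simp: torus_wreath_Aut_def vec_eq_iff)
  define w :: "(complex^'a) \<times> ('a \<Rightarrow> 'a)" where "w = (\<chi> i. cnj (fst x $ (snd x i)), Hilbert_Choice.inv (snd x))"
  have "w \<in> carrier (torus_wreath_Aut A)" using x by (auto simp: w_def torus_wreath_Aut_def torus_def Aut_matrix_inv)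
  moreover have "w \<otimes>\<^sub>(torus_wreath_Aut A) x = \<one>\<^sub>(torus_wreath_Aut A)"
  proof -
    have "cnj u * u = 1" if "cmod u = 1" for u using that by (metis complex_norm_square mult.commute of_real_1 one_power2)
    then show ?thesis using x b by (cases x) (auto simp: w_def torus_wreath_Aut_def torus_def vec_eq_iff inv_inv_eq bij_is_inj)
  qed
  ultimately show "\<exists>w\<in>carrier (torus_wreath_Aut A). w \<otimes>\<^sub>(torus_wreath_Aut A) x = \<one>\<^sub>(torus_wreath_Aut A)" by blast
qed (simp add: torus_wreath_Aut_def torus_def Aut_matrix_id)

lemma torus_wreath_inv:
  assumes "x \<in> carrier (torus_wreath_Aut A)"
  shows "inv\<^sub>(torus_wreath_Aut A) x = (\<chi> i. cnj (fst x $ (snd x i)), Hilbert_Choice.inv (snd x))" (is "_ = ?w")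
proof (rule group.inv_equality[OF group_torus_wreath_Aut])
  have b: "bij (snd x)" using assms by (auto simp: torus_wreath_Aut_def Aut_matrix_def)
  show "?w \<in> carrier (torus_wreath_Aut A)" using assms by (auto simp: torus_wreath_Aut_def torus_def Aut_matrix_inv)
  have "cnj u * u = 1" if "cmod u = 1" for u using that by (metis complex_norm_square mult.commute of_real_1 one_power2)
  then show "?w \<otimes>\<^sub>(torus_wreath_Aut A) x = \<one>\<^sub>(torus_wreath_Aut A)" using assms b
    by (cases x) (auto simp: torus_wreath_Aut_def torus_def vec_eq_iff inv_inv_eq bij_is_inj)
qed (use assms in auto)

lemma continuous_map_discrete_factor:
  assumes "continuous_map X (discrete_topology U) f"
  shows "continuous_map X euclidean (\<lambda>x. h (f x))" using continuous_map_compose[OF assms, of euclidean h] by (simp add: o_def)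

lemma compact_group_torus_wreath: "compact_group (torus_wreath_Aut A) (torus_wreath_topology (A :: real^'n^'n))"
proof -
  let ?T = "subtopology euclidean (torus :: (complex^'n) set)" and ?D = "discrete_topology (Aut_matrix A)"
  let ?X = "torus_wreath_topology A"
  have X: "?X = prod_topology ?T ?D" by (simp add: torus_wreath_topology_def)
  have top: "topspace ?X = carrier (torus_wreath_Aut A)" by (simp add: X torus_wreath_Aut_def)
  have "compact_space ?T" by (intro compact_space_subtopology) (simp add: compactin_euclidean_iff compact_torus)
  then have "compact_space ?X" unfolding X compact_space_prod_topology
    using finite_Aut_matrix by (simp add: compact_space_discrete_topology)
  moreover have "Hausdorff_space ?X" unfolding X by (simp add: Hausdorff_space_prod_topology Hausdorff_space_subtopology)
  moreover have "continuous_map (prod_topology ?X ?X) ?X (\<lambda>(g, h). g \<otimes>\<^sub>(torus_wreath_Aut A) h)"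
  proof -
    let ?Y = "prod_topology ?X ?X"
    have f: "continuous_map ?Y ?T (\<lambda>p. fst (fst p))" "continuous_map ?Y ?T (\<lambda>p. fst (snd p))"
      "continuous_map ?Y ?D (\<lambda>p. snd (fst p))" "continuous_map ?Y ?D (\<lambda>p. snd (snd p))" unfolding X
      using continuous_map_compose[OF continuous_map_fst continuous_map_fst, unfolded o_def]
        continuous_map_compose[OF continuous_map_snd continuous_map_fst, unfolded o_def]
        continuous_map_compose[OF continuous_map_fst continuous_map_snd, unfolded o_def]
        continuous_map_compose[OF continuous_map_snd continuous_map_snd, unfolded o_def] by blast+
    have e: "continuous_map ?Y euclidean (\<lambda>p. fst (fst p))" "continuous_map ?Y euclidean (\<lambda>p. fst (snd p))"
      using f(1,2) continuous_map_into_fulltopology by blast+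
    have "continuous_map ?Y euclidean (\<lambda>p. (\<chi> i. fst (fst p) $ i * fst (snd p) $ (Hilbert_Choice.inv (snd (fst p)) i)))"
    proof (rule continuous_map_vecI)
      fix i
      \<comment> \<open>The coordinate inv(\<pi>)(i) depends on the point. A finite sum with
        indicator functions of the discrete component expresses the entry through continuous
        functions with fixed indices.\<close>
      have "continuous_map ?Y euclidean (\<lambda>p. fst (fst p) $ i * (\<Sum>j\<in>UNIV. of_bool (Hilbert_Choice.inv (snd (fst p)) i = j) * fst (snd p) $ j))"
        by (intro continuous_map_mult_cx continuous_map_sum_cx continuous_map_vec_nth e
            continuous_map_discrete_factor[OF f(3), of "\<lambda>\<pi>. of_bool (Hilbert_Choice.inv \<pi> i = _)"])
      then show "continuous_map ?Y euclidean (\<lambda>p. (\<chi> i. fst (fst p) $ i * fst (snd p) $ (Hilbert_Choice.inv (snd (fst p)) i)) $ i)"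
        by (simp add: of_bool_def if_distrib[where f = "\<lambda>x. x * _"] cong: if_cong)
    qed
    moreover have "continuous_map ?Y ?D (\<lambda>p. snd (fst p) \<circ> snd (snd p))"
    proof -
      have a: "continuous_map ?Y (prod_topology ?D ?D) (\<lambda>p. (snd (fst p), snd (snd p)))" using f by (simp add: continuous_map_pairedI)
      have b: "continuous_map (prod_topology ?D ?D) ?D (\<lambda>p. fst p \<circ> snd p)"
        unfolding prod_topology_discrete_topology[symmetric] by (auto simp: Aut_matrix_comp)
      show ?thesis using continuous_map_compose[OF a b] by (simp add: comp_def)
    qed
    moreover have "(\<chi> i. fst (fst p) $ i * fst (snd p) $ (Hilbert_Choice.inv (snd (fst p)) i)) \<in> torus" if "p \<in> topspace ?Y" for p
      using that by (auto simp: X torus_def norm_mult)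
    ultimately have "continuous_map ?Y (prod_topology ?T ?D)
       (\<lambda>p. ((\<chi> i. fst (fst p) $ i * fst (snd p) $ (Hilbert_Choice.inv (snd (fst p)) i)), snd (fst p) \<circ> snd (snd p)))"
      by (intro continuous_map_pairedI) (auto simp: continuous_map_in_subtopology)
    then show ?thesis unfolding X by (simp add: torus_wreath_Aut_def case_prod_unfold)
  qed
  moreover have "continuous_map ?X ?X (\<lambda>g. inv\<^sub>(torus_wreath_Aut A) g)"
  proof -
    have e: "continuous_map ?X euclidean fst" unfolding X using continuous_map_fst continuous_map_into_fulltopology by blast
    have f: "continuous_map ?X ?D snd" unfolding X by (rule continuous_map_snd)
    have "continuous_map ?X euclidean (\<lambda>p. (\<chi> i. cnj (fst p $ (snd p i))))"
    proof (rule continuous_map_vecI)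
      fix i
      have "continuous_map ?X euclidean (\<lambda>p. cnj (\<Sum>j\<in>UNIV. of_bool (snd p i = j) * fst p $ j))"
        by (intro continuous_map_cnj continuous_map_mult_cx continuous_map_sum_cx continuous_map_vec_nth e
            continuous_map_discrete_factor[OF f, of "\<lambda>\<pi>. of_bool (\<pi> i = _)"])
      then show "continuous_map ?X euclidean (\<lambda>p. (\<chi> i. cnj (fst p $ (snd p i))) $ i)"
        by (simp add: of_bool_def if_distrib[where f = "\<lambda>x. x * _"] del: cnj_sum cong: if_cong)
    qed
    moreover have "continuous_map ?X ?D (\<lambda>p. Hilbert_Choice.inv (snd p))"
    proof -
      have "continuous_map ?D ?D Hilbert_Choice.inv" by (auto simp: Aut_matrix_inv)
      from continuous_map_compose[OF f this] show ?thesis by (simp add: o_def)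
    qed
    moreover have "(\<chi> i. cnj (fst p $ (snd p i))) \<in> torus" if "p \<in> topspace ?X" for p using that by (auto simp: X torus_def)
    ultimately have "continuous_map ?X (prod_topology ?T ?D) (\<lambda>p. ((\<chi> i. cnj (fst p $ (snd p i))), Hilbert_Choice.inv (snd p)))"
      by (intro continuous_map_pairedI) (auto simp: continuous_map_in_subtopology)
    then have "continuous_map ?X ?X (\<lambda>p. ((\<chi> i. cnj (fst p $ (snd p i))), Hilbert_Choice.inv (snd p)))" by (simp only: X)
    then show ?thesis by (rule continuous_map_eq) (simp add: top torus_wreath_inv)
  qed
  ultimately show ?thesis using group_torus_wreath_Aut top by (simp add: compact_group_def)
qed

subsection \<open>Algebras of continuous functions\<close>

lemma C_of_simps [simp]:
  "f \<in> carrier (C_of X) \<longleftrightarrow> continuous_map X euclidean f \<and> f \<in> extensional (topspace X)"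
  "mult (C_of X) f g = restrict (\<lambda>x. f x * g x) (topspace X)"
  "one (C_of X) = restrict (\<lambda>x. 1) (topspace X)"
  "zero (C_of X) = restrict (\<lambda>x. 0) (topspace X)"
  "add (C_of X) f g = restrict (\<lambda>x. f x + g x) (topspace X)"
  "smult (C_of X) c f = restrict (\<lambda>x. c * f x) (topspace X)"
  "star (C_of X) f = restrict (\<lambda>x. cnj (f x)) (topspace X)" by (auto simp: C_of_def)

lemma continuous_map_restrict_iff: "continuous_map X Y (restrict f (topspace X)) \<longleftrightarrow> continuous_map X Y f"
  using continuous_map_eq[of X Y f "restrict f (topspace X)"] continuous_map_eq[of X Y "restrict f (topspace X)" f] by auto

lemma star_alg_C_of: "star_alg (C_of X)" by (rule star_algI)
    (auto simp: continuous_map_restrict_iff fun_eq_iff algebra_simps extensional_def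
      intro!: continuous_map_mult_cx continuous_map_cnj continuous_map_add)

definition complex_alg :: "complex star_algebra" where
  "complex_alg = \<lparr>carrier = UNIV, mult = (*), one = 1, zero = 0, add = (+), smult = (*), star = cnj, nrm = cmod\<rparr>"

lemma complex_alg_simps [simp]:
  "carrier complex_alg = UNIV" "mult complex_alg = (*)" "one complex_alg = 1" "zero complex_alg = 0"
  "add complex_alg = (+)" "smult complex_alg = (*)" "star complex_alg = cnj" "nrm complex_alg = cmod"
  by (simp_all add: complex_alg_def)

lemma star_alg_complex_alg: "star_alg complex_alg" by (rule star_algI) (auto simp: algebra_simps)

interpretation cx: cstar_normed complex_alg
  rewrites "carrier complex_alg = UNIV" and "mult complex_alg = (*)" and "one complex_alg = 1" and "zero complex_alg = 0"
    and "add complex_alg = (+)" and "smult complex_alg = (*)" and "star complex_alg = cnj" and "nrm complex_alg = cmod"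
proof -
  interpret star_alg complex_alg by (rule star_alg_complex_alg)
  show "cstar_normed complex_alg" by unfold_locales (auto simp: norm_triangle_ineq norm_mult power2_eq_square)
qed simp_all

lemma finsum_complex_alg [simp]: "finsum complex_alg f A = sum f A"
proof (cases "finite A")
  case True
  then show ?thesis by induction (auto simp: cx.finsum_insert)
qed (simp add: cx.finsum_infinite)

lemma minus_complex_alg [simp]: "a_minus complex_alg x y = x - y" using cx.minus_smult[of x y] by simp

lemma lin_ext_complex: "lin_ext complex_alg \<eta> f = (\<Sum>x | f x \<noteq> 0. f x * \<eta> x)" by (simp add: lin_ext_def)

text \<open>From here on products and involutions of monoid algebras stay folded and are treated
  through the algebra laws.\<close>

declare msa_simps(2,7) [simp del]

subsection \<open>The spatial norm\<close>

definition lin :: "('m \<Rightarrow> complex) \<Rightarrow> ('m \<Rightarrow> complex) \<Rightarrow> complex" where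
  "lin f t = (\<Sum>x | t x \<noteq> 0. t x * f x)"

lemma lin_superset: "finite X \<Longrightarrow> {x. t x \<noteq> 0} \<subseteq> X \<Longrightarrow> lin f t = (\<Sum>x\<in>X. t x * f x)" unfolding lin_def by (intro sum.mono_neutral_left) auto

lemma lin_add:
  assumes "finite {x. t x \<noteq> 0}" "finite {x. u x \<noteq> 0}"
  shows "lin f (\<lambda>x. t x + u x) = lin f t + lin f u"
proof -
  let ?X = "{x. t x \<noteq> 0} \<union> {x. u x \<noteq> 0}"
  have X: "finite ?X" using assms by simp
  have "lin f t = (\<Sum>x\<in>?X. t x * f x)" "lin f u = (\<Sum>x\<in>?X. u x * f x)"
    "lin f (\<lambda>x. t x + u x) = (\<Sum>x\<in>?X. (t x + u x) * f x)" by (rule lin_superset[OF X]; auto)+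
  then show ?thesis by (simp add: distrib_right sum.distrib)
qed

lemma lin_smult: "lin f (\<lambda>x. c * t x) = c * lin f t" by (cases "c = 0") (simp_all add: lin_def sum_distrib_left mult.assoc)

lemma lin_basis [simp]: "lin f (basis_elt x) = f x" by (simp add: lin_def)

lemma lin_mult:
  "finite {x. t x \<noteq> 0} \<Longrightarrow> finite {x. u x \<noteq> 0} \<Longrightarrow>
    lin f (mult (monoid_star_algebra M i p) t u) = lin (\<lambda>x. lin (\<lambda>y. f (mult M x y)) u) t"
  unfolding lin_def by (subst msa_mult_apply) (auto simp: sum_distrib_left mult.assoc)

lemma lin_star:
  "finite {x. t x \<noteq> 0} \<Longrightarrow>
    lin f (star (monoid_star_algebra M i p) t) = (\<Sum>x | t x \<noteq> 0. cnj (t x) * f (i x))"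
  unfolding lin_def by (rule msa_star_apply)

lemma sqrt_ratio_le_iff:
  fixes a b n :: real
  assumes "0 < b" "0 \<le> a" "0 \<le> n"
  shows "sqrt (a / b) \<le> n \<longleftrightarrow> a \<le> n\<^sup>2 * b"
proof -
  have "sqrt (a / b) \<le> n \<longleftrightarrow> a / b \<le> n\<^sup>2" using assms by (metis real_sqrt_le_iff real_sqrt_pow2_iff real_sqrt_unique)
  then show ?thesis using assms by (simp add: divide_le_eq)
qed

text \<open>Coefficients in a fibre may cancel, so a push-forward can only decrease a weighted l1
  norm. This yields the estimates for \<open>proj_bound\<close>.\<close>

lemma sum_fiber_le:
  fixes c :: "'i \<Rightarrow> complex" and n :: "'m \<Rightarrow> real"
  assumes "finite I" "\<And>k. k \<in> I \<Longrightarrow> 0 \<le> n (h k)"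
  shows "(\<Sum>z | (\<Sum>k\<in>I. if h k = z then c k else 0) \<noteq> 0. cmod (\<Sum>k\<in>I. if h k = z then c k else 0) * n z)
    \<le> (\<Sum>k\<in>I. cmod (c k) * n (h k))"
proof -
  let ?F = "\<lambda>z. \<Sum>k\<in>I. if h k = z then c k else 0"
  have fin: "finite (h ` I)" using assms by simp
  have sup: "{z. ?F z \<noteq> 0} \<subseteq> h ` I" by (rule fiber_sum_support)
  have "(\<Sum>z | ?F z \<noteq> 0. cmod (?F z) * n z) = (\<Sum>z\<in>h ` I. cmod (?F z) * n z)" by (rule sum.mono_neutral_left[OF fin sup]) simp
  also have "\<dots> \<le> (\<Sum>z\<in>h ` I. \<Sum>k\<in>I. if h k = z then cmod (c k) * n z else 0)"
  proof (rule sum_mono)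
    fix z assume z: "z \<in> h ` I"
    have "cmod (?F z) \<le> (\<Sum>k\<in>I. cmod (if h k = z then c k else 0))" by (rule norm_sum)
    then have "cmod (?F z) * n z \<le> (\<Sum>k\<in>I. cmod (if h k = z then c k else 0)) * n z" using z assms by (intro mult_right_mono) auto
    also have "\<dots> = (\<Sum>k\<in>I. if h k = z then cmod (c k) * n z else 0)" unfolding sum_distrib_right by (intro sum.cong) auto
    finally show "cmod (?F z) * n z \<le> (\<Sum>k\<in>I. if h k = z then cmod (c k) * n z else 0)" .
  qed
  also have "\<dots> = (\<Sum>k\<in>I. \<Sum>z\<in>h ` I. if h k = z then cmod (c k) * n z else 0)" by (rule sum.swap)
  also have "\<dots> = (\<Sum>k\<in>I. cmod (c k) * n (h k))" using assms by (intro sum.cong) (auto simp: sum.delta')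
  finally show ?thesis .
qed

lemma (in star_alg) pf_sesquilinear:
  assumes pf: "posfun B \<omega>" and fin: "finite S" and a: "\<And>x. x \<in> S \<Longrightarrow> a x \<in> carrier B"
  shows "\<omega> (star B (\<Oplus>x\<in>S. c x \<odot> a x) \<otimes> (\<Oplus>x\<in>S. c x \<odot> a x))
    = (\<Sum>x\<in>S. \<Sum>y\<in>S. cnj (c x) * c y * \<omega> (star B (a x) \<otimes> a y))"
proof -
  have "star B (\<Oplus>x\<in>S. c x \<odot> a x) \<otimes> (\<Oplus>x\<in>S. c x \<odot> a x)
      = (\<Oplus>x\<in>S. star B (c x \<odot> a x)) \<otimes> (\<Oplus>x\<in>S. c x \<odot> a x)"
    using a by (subst star_finsum) auto
  also have "\<dots> = (\<Oplus>x\<in>S. star B (c x \<odot> a x) \<otimes> (\<Oplus>x\<in>S. c x \<odot> a x))" using a fin by (intro finsum_ldistr) (auto intro!: finsum_closed)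
  also have "\<omega> \<dots> = (\<Sum>x\<in>S. \<omega> (star B (c x \<odot> a x) \<otimes> (\<Oplus>x\<in>S. c x \<odot> a x)))" using a by (intro pf_finsum[OF pf]) (auto intro!: finsum_closed)
  also have "\<dots> = (\<Sum>x\<in>S. \<Sum>y\<in>S. cnj (c x) * c y * \<omega> (star B (a x) \<otimes> a y))"
  proof (intro sum.cong refl)
    fix x assume x: "x \<in> S"
    have "star B (c x \<odot> a x) \<otimes> (\<Oplus>x\<in>S. c x \<odot> a x) = (\<Oplus>y\<in>S. star B (c x \<odot> a x) \<otimes> (c y \<odot> a y))"
      using a fin x by (intro finsum_rdistr) auto
    also have "\<omega> \<dots> = (\<Sum>y\<in>S. \<omega> (star B (c x \<odot> a x) \<otimes> (c y \<odot> a y)))" using a x by (intro pf_finsum[OF pf]) auto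
    also have "\<dots> = (\<Sum>y\<in>S. cnj (c x) * c y * \<omega> (star B (a x) \<otimes> a y))"
      using a x by (intro sum.cong) (auto simp: star_smult smult_mult_l smult_mult_r pf_smult[OF pf])
    finally show "\<omega> (star B (c x \<odot> a x) \<otimes> (\<Oplus>x\<in>S. c x \<odot> a x)) = (\<Sum>y\<in>S. cnj (c x) * c y * \<omega> (star B (a x) \<otimes> a y))" .
  qed
  finally show ?thesis .
qed

lemma (in star_alg) psd_on_posfun:
  assumes pf: "posfun B \<omega>" and fin: "finite S" and a: "\<And>x. x \<in> S \<Longrightarrow> a x \<in> carrier B"
  shows "psd_on S (\<lambda>x y. \<omega> (star B (a x) \<otimes> a y))" unfolding psd_on_def
proof
  fix c
  have "(\<Oplus>x\<in>S. c x \<odot> a x) \<in> carrier B" using a by (intro finsum_closed) auto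
  from pf_pos[OF pf this] pf_sesquilinear[OF pf fin a, where c = c]
  show "(\<Sum>x\<in>S. \<Sum>y\<in>S. cnj (c x) * c y * \<omega> (star B (a x) \<otimes> a y)) \<in> \<real>\<^sub>\<ge>\<^sub>0" by (simp only:)
qed

lemma sum_nonneg_Reals: "(\<And>i. i \<in> I \<Longrightarrow> f i \<in> \<real>\<^sub>\<ge>\<^sub>0) \<Longrightarrow> (\<Sum>i\<in>I. f i) \<in> (\<real>\<^sub>\<ge>\<^sub>0 :: complex set)"
  by (induction I rule: infinite_finite_induct) auto

locale tensor_pair = B: seminormed_star_alg B + D: seminormed_star_alg D
  for B :: "'a star_algebra" and D :: "'b star_algebra"
begin

abbreviation M where "M \<equiv> B \<times>\<times> D"
abbreviation F where "F \<equiv> formal_tensors B D"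
abbreviation \<eta> where "\<eta> \<phi> \<psi> \<equiv> (\<lambda>x. \<phi> (fst x) * \<psi> (snd x))"

lemma inv_monoid_M: "inv_monoid M (map_prod (star B) (star D))"
proof -
  interpret M: Group.monoid M
    by (rule DirProd_monoid) (rule B.is_monoid D.is_monoid)+
  show ?thesis by unfold_locales (auto simp: DirProd_def B.star_mult D.star_mult)
qed

sublocale M: inv_monoid M "map_prod (star B) (star D)" by (rule inv_monoid_M)

lemma star_alg_F: "star_alg (F p)" by (rule M.star_alg_msa)

lemma carrier_M: "x \<in> carrier M \<longleftrightarrow> fst x \<in> carrier B \<and> snd x \<in> carrier D" by (cases x) (simp add: DirProd_def)

lemma mult_M: "x \<otimes>\<^sub>M y = (fst x \<otimes>\<^sub>B fst y, snd x \<otimes>\<^sub>D snd y)" by (cases x, cases y) (simp add: DirProd_def)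

lemma F_carrierD: "t \<in> carrier (F p) \<Longrightarrow> finite {x. t x \<noteq> 0}"
  "t \<in> carrier (F p) \<Longrightarrow> t x \<noteq> 0 \<Longrightarrow> fst x \<in> carrier B"
  "t \<in> carrier (F p) \<Longrightarrow> t x \<noteq> 0 \<Longrightarrow> snd x \<in> carrier D"
  "t \<in> carrier (F p) \<Longrightarrow> t x \<noteq> 0 \<Longrightarrow> x \<in> carrier M" unfolding msa_simps using carrier_M by auto

lemma tensor_functional_lin: "tensor_functional \<phi> \<psi> = lin (\<eta> \<phi> \<psi>)"
  by (rule ext) (simp add: tensor_functional_def lin_def case_prod_unfold mult.assoc)

text \<open>Schur's product theorem: on t* t the functional is the sum over x and y of conj(t x) (t
  y) (K x y) (L x y) with two positive semidefinite kernels. Factoring K into rank-one kernels turns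
  this into a sum of values of the form of L, each at a coefficient vector t x times v i x.\<close>

lemma posfun_tensor:
  assumes \<phi>: "posfun B \<phi>" and \<psi>: "posfun D \<psi>"
  shows "posfun (F p) (tensor_functional \<phi> \<psi>)" unfolding posfun_def tensor_functional_lin
proof (intro conjI ballI allI)
  fix t assume t: "t \<in> carrier (F p)"
  note tD = F_carrierD[OF t]
  show "lin (\<eta> \<phi> \<psi>) (t \<oplus>\<^sub>(F p) u) = lin (\<eta> \<phi> \<psi>) t + lin (\<eta> \<phi> \<psi>) u" if "u \<in> carrier (F p)" for u
    using lin_add tD(1) F_carrierD(1)[OF that] by simp
  show "lin (\<eta> \<phi> \<psi>) (c \<odot>\<^sub>(F p) t) = c * lin (\<eta> \<phi> \<psi>) t" for c using lin_smult by simp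
  let ?S = "{x. t x \<noteq> 0}"
  define K where "K x y = \<phi> (star B (fst x) \<otimes>\<^sub>B fst y)" for x y :: "'a \<times> 'b"
  define L where "L x y = \<psi> (star D (snd x) \<otimes>\<^sub>D snd y)" for x y :: "'a \<times> 'b"
  have K: "psd_on ?S K" unfolding K_def using tD by (intro B.psd_on_posfun \<phi>) auto
  have L: "psd_on ?S L" unfolding L_def using tD by (intro D.psd_on_posfun \<psi>) auto
  obtain m :: nat and v where v: "\<And>x y. x \<in> ?S \<Longrightarrow> y \<in> ?S \<Longrightarrow> K x y = (\<Sum>i<m. cnj (v i x) * v i y)" using psd_factor[OF tD(1) K] by blast
  interpret F: star_alg "F p" by (rule star_alg_F)
  have fin: "finite {x. star (F p) t x \<noteq> 0}" using F_carrierD(1)[OF F.star_closed[OF t]] .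
  have "lin (\<eta> \<phi> \<psi>) (star (F p) t \<otimes>\<^sub>(F p) t)
      = (\<Sum>x\<in>?S. cnj (t x) * lin (\<lambda>y. \<eta> \<phi> \<psi> (map_prod (star B) (star D) x \<otimes>\<^sub>M y)) t)"
    unfolding lin_mult[OF fin tD(1)] by (rule lin_star[OF tD(1)])
  also have "\<dots> = (\<Sum>x\<in>?S. \<Sum>y\<in>?S. cnj (t x) * t y * (K x y * L x y))"
    unfolding lin_def sum_distrib_left by (intro sum.cong refl) (simp add: mult_M K_def L_def)
  also have "\<dots> = (\<Sum>x\<in>?S. \<Sum>y\<in>?S. \<Sum>i<m. cnj (t x * v i x) * (t y * v i y) * L x y)"
    by (intro sum.cong refl) (simp add: v sum_distrib_left sum_distrib_right mult_ac)
  also have "\<dots> = (\<Sum>x\<in>?S. \<Sum>i<m. \<Sum>y\<in>?S. cnj (t x * v i x) * (t y * v i y) * L x y)" by (intro sum.cong refl sum.swap)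
  also have "\<dots> = (\<Sum>i<m. \<Sum>x\<in>?S. \<Sum>y\<in>?S. cnj (t x * v i x) * (t y * v i y) * L x y)" by (rule sum.swap)
  also have "\<dots> \<in> \<real>\<^sub>\<ge>\<^sub>0"
  proof (rule sum_nonneg_Reals)
    fix i
    show "(\<Sum>x\<in>?S. \<Sum>y\<in>?S. cnj (t x * v i x) * (t y * v i y) * L x y) \<in> \<real>\<^sub>\<ge>\<^sub>0" by (rule L[unfolded psd_on_def, THEN spec])
  qed
  finally show "lin (\<eta> \<phi> \<psi>) (star (F p) t \<otimes>\<^sub>(F p) t) \<in> \<real>\<^sub>\<ge>\<^sub>0" .
qed

text \<open>The quantity whose infimum over all representations of a tensor is the projective norm.
  It is submultiplicative, compatible with the involution, and dominates every product of states,
  which is what \<open>gns_le_bound\<close> asks of a majorant.\<close>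

definition proj_bound :: "('a \<times> 'b \<Rightarrow> complex) \<Rightarrow> real" where
  "proj_bound t = (\<Sum>x | t x \<noteq> 0. cmod (t x) * (nrm B (fst x) * nrm D (snd x)))"

lemma proj_bound_nonneg: "t \<in> carrier (F p) \<Longrightarrow> 0 \<le> proj_bound t"
  unfolding proj_bound_def using F_carrierD by (intro sum_nonneg mult_nonneg_nonneg) auto

lemma proj_bound_mult:
  assumes t: "t \<in> carrier (F p)" and u: "u \<in> carrier (F p)"
  shows "proj_bound (t \<otimes>\<^sub>(F p) u) \<le> proj_bound t * proj_bound u"
proof -
  note tD = F_carrierD[OF t] and uD = F_carrierD[OF u]
  let ?n = "\<lambda>x. nrm B (fst x) * nrm D (snd x)"
  let ?I = "{x. t x \<noteq> 0} \<times> {x. u x \<noteq> 0}"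
  have "proj_bound (t \<otimes>\<^sub>(F p) u) \<le> (\<Sum>k\<in>?I. cmod (t (fst k) * u (snd k)) * ?n (fst k \<otimes>\<^sub>M snd k))"
    unfolding proj_bound_def msa_simps msa_mult_pairs using tD uD by (intro sum_fiber_le) (auto simp: mult_M)
  also have "\<dots> \<le> (\<Sum>k\<in>?I. (cmod (t (fst k)) * ?n (fst k)) * (cmod (u (snd k)) * ?n (snd k)))"
  proof (rule sum_mono)
    fix k assume k: "k \<in> ?I"
    have "?n (fst k \<otimes>\<^sub>M snd k) \<le> (nrm B (fst (fst k)) * nrm B (fst (snd k))) * (nrm D (snd (fst k)) * nrm D (snd (snd k)))"
      unfolding mult_M fst_conv snd_conv using k tD uD by (intro mult_mono B.nrm_mult D.nrm_mult) auto
    then have "cmod (t (fst k) * u (snd k)) * ?n (fst k \<otimes>\<^sub>M snd k) \<le> cmod (t (fst k) * u (snd k)) *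
      ((nrm B (fst (fst k)) * nrm B (fst (snd k))) * (nrm D (snd (fst k)) * nrm D (snd (snd k))))"
      by (intro mult_left_mono) auto
    then show "cmod (t (fst k) * u (snd k)) * ?n (fst k \<otimes>\<^sub>M snd k) \<le> (cmod (t (fst k)) * ?n (fst k)) * (cmod (u (snd k)) * ?n (snd k))"
      by (simp add: norm_mult mult_ac)
  qed
  also have "\<dots> = proj_bound t * proj_bound u"
    unfolding proj_bound_def sum_product by (simp add: sum.cartesian_product case_prod_unfold)
  finally show ?thesis .
qed

lemma proj_bound_star:
  assumes t: "t \<in> carrier (F p)"
  shows "proj_bound (star (F p) t) \<le> proj_bound t"
proof -
  note tD = F_carrierD[OF t]
  let ?n = "\<lambda>x. nrm B (fst x) * nrm D (snd x)"
  have "proj_bound (star (F p) t) \<le> (\<Sum>k | t k \<noteq> 0. cmod (cnj (t k)) * ?n (map_prod (star B) (star D) k))"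
    unfolding proj_bound_def msa_simps using tD by (intro sum_fiber_le) auto
  also have "\<dots> = proj_bound t" unfolding proj_bound_def using tD by (intro sum.cong) (auto simp: B.nrm_star D.nrm_star)
  finally show ?thesis .
qed

lemma state_tensor_bound:
  assumes \<phi>: "state B \<phi>" and \<psi>: "state D \<psi>" and t: "t \<in> carrier (F p)"
  shows "cmod (tensor_functional \<phi> \<psi> t) \<le> proj_bound t"
proof -
  note tD = F_carrierD[OF t]
  have "cmod (tensor_functional \<phi> \<psi> t) \<le> (\<Sum>x | t x \<noteq> 0. cmod (t x * (\<phi> (fst x) * \<psi> (snd x))))"
    unfolding tensor_functional_lin lin_def by (rule norm_sum)
  also have "\<dots> \<le> proj_bound t" unfolding proj_bound_def norm_mult
    using tD \<phi> \<psi> by (intro sum_mono mult_left_mono mult_mono) (auto simp: state_def)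
  finally show ?thesis .
qed

text \<open>Any submultiplicative bound of a positive functional bounds the operator norm in its GNS
  representation; this makes the suprema in the spatial norm finite.\<close>

lemma gns_le_bound:
  assumes pf: "posfun (F p) \<omega>" and P0: "\<And>x. x \<in> carrier (F p) \<Longrightarrow> 0 \<le> P x"
    and bd: "\<And>x. x \<in> carrier (F p) \<Longrightarrow> cmod (\<omega> x) \<le> P x"
    and Pm: "\<And>x y. x \<in> carrier (F p) \<Longrightarrow> y \<in> carrier (F p) \<Longrightarrow> P (x \<otimes>\<^sub>(F p) y) \<le> P x * P y"
    and Ps: "\<And>x. x \<in> carrier (F p) \<Longrightarrow> P (star (F p) x) \<le> P x"
    and t: "t \<in> carrier (F p)" and s: "s \<in> carrier (F p)"
  shows "Re (\<omega> (star (F p) (t \<otimes>\<^sub>(F p) s) \<otimes>\<^sub>(F p) (t \<otimes>\<^sub>(F p) s))) \<le> (P t)\<^sup>2 * Re (\<omega> (star (F p) s \<otimes>\<^sub>(F p) s))"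
proof -
  interpret F: star_alg "F p" by (rule star_alg_F)
  let ?h = "star (F p) t \<otimes>\<^sub>(F p) t"
  have h: "?h \<in> carrier (F p)" by (intro F.m_closed F.star_closed t)
  have Ph: "P ?h \<le> (P t)\<^sup>2"
  proof -
    have "P ?h \<le> P (star (F p) t) * P t" by (intro Pm F.star_closed t)
    also have "\<dots> \<le> P t * P t" by (intro mult_right_mono Ps P0 t)
    finally show ?thesis by (simp add: power2_eq_square)
  qed
  have hn: "P (?h [^]\<^sub>(F p) (n::nat)) \<le> P (one (F p)) * ((P t)\<^sup>2) ^ n" for n
  proof (induction n)
    case (Suc n)
    have "P (?h [^]\<^sub>(F p) Suc n) \<le> P (?h [^]\<^sub>(F p) n) * P ?h" unfolding F.nat_pow_Suc by (intro Pm h F.nat_pow_closed)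
    also have "\<dots> \<le> (P (one (F p)) * ((P t)\<^sup>2) ^ n) * (P t)\<^sup>2" by (intro mult_mono Suc Ph P0 h mult_nonneg_nonneg F.one_closed) auto
    finally show ?case by (simp add: mult_ac)
  qed (simp add: F.nat_pow_0)
  show ?thesis
  proof (rule F.pf_bound[OF pf t s])
    fix n :: nat
    have c: "?h [^]\<^sub>(F p) n \<in> carrier (F p)" by (intro F.nat_pow_closed h)
    have "cmod (\<omega> (star (F p) s \<otimes>\<^sub>(F p) (?h [^]\<^sub>(F p) n \<otimes>\<^sub>(F p) s))) \<le> P (star (F p) s \<otimes>\<^sub>(F p) (?h [^]\<^sub>(F p) n \<otimes>\<^sub>(F p) s))"
      by (intro bd F.m_closed F.star_closed s c)
    also have "\<dots> \<le> P (star (F p) s) * P (?h [^]\<^sub>(F p) n \<otimes>\<^sub>(F p) s)" by (intro Pm F.m_closed F.star_closed s c)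
    also have "\<dots> \<le> P s * (P (?h [^]\<^sub>(F p) n) * P s)" by (intro mult_mono Ps Pm P0 F.m_closed F.star_closed s c)
    also have "\<dots> \<le> P s * ((P (one (F p)) * ((P t)\<^sup>2) ^ n) * P s)" by (intro mult_left_mono mult_right_mono hn P0 s)
    finally show "cmod (\<omega> (star (F p) s \<otimes>\<^sub>(F p) (?h [^]\<^sub>(F p) n \<otimes>\<^sub>(F p) s))) \<le> (P s * P (one (F p)) * P s) * ((P t)\<^sup>2) ^ n"
      by (simp add: mult_ac)
  qed simp
qed

abbreviation N where "N \<equiv> spatial_norm B D"
abbreviation F0 where "F0 \<equiv> F (\<lambda>_. 0)"
abbreviation gT where "gT \<phi> \<psi> x \<equiv> Re (tensor_functional \<phi> \<psi> (star F0 x \<otimes>\<^sub>F0 x))"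
abbreviation ratio where "ratio \<omega> t s \<equiv> sqrt (Re (\<omega> (star F0 (t \<otimes>\<^sub>F0 s) \<otimes>\<^sub>F0 (t \<otimes>\<^sub>F0 s))) / Re (\<omega> (star F0 s \<otimes>\<^sub>F0 s)))"
abbreviation ratios where "ratios t \<equiv> insert 0 {ratio (tensor_functional \<phi> \<psi>) t s | \<phi> \<psi> s.
     state B \<phi> \<and> state D \<psi> \<and> s \<in> carrier F0 \<and> tensor_functional \<phi> \<psi> (star F0 s \<otimes>\<^sub>F0 s) \<noteq> 0}"

lemma spatial_norm_alt: "N t = Sup (ratios t)" unfolding spatial_norm_def Let_def by (rule refl)

lemma gns_proj_bound:
  assumes "state B \<phi>" "state D \<psi>" "t \<in> carrier F0" "s \<in> carrier F0"
  shows "gT \<phi> \<psi> (t \<otimes>\<^sub>F0 s) \<le> (proj_bound t)\<^sup>2 * gT \<phi> \<psi> s" by (rule gns_le_bound)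
    (intro posfun_tensor state_posfun proj_bound_nonneg state_tensor_bound proj_bound_mult proj_bound_star assms; assumption)+

lemma ratio_le:
  assumes st: "state B \<phi>" "state D \<psi>" "s \<in> carrier F0" "r \<ge> 0" and t: "t \<in> carrier F0"
    and nz: "tensor_functional \<phi> \<psi> (star F0 s \<otimes>\<^sub>F0 s) \<noteq> 0"
    and le: "gT \<phi> \<psi> (t \<otimes>\<^sub>F0 s) \<le> r\<^sup>2 * gT \<phi> \<psi> s"
  shows "ratio (tensor_functional \<phi> \<psi>) t s \<le> r"
proof -
  interpret F: star_alg F0 by (rule star_alg_F)
  note pf = posfun_tensor[OF state_posfun[OF st(1)] state_posfun[OF st(2)], of "\<lambda>_. 0"]
  have "0 < gT \<phi> \<psi> s" using F.pf_gns_nonneg[OF pf st(3)] nz F.pf_gns[OF pf st(3)] by (metis less_eq_real_def of_real_0)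
  moreover have "0 \<le> gT \<phi> \<psi> (t \<otimes>\<^sub>F0 s)" by (intro F.pf_gns_nonneg[OF pf] F.m_closed t st(3))
  ultimately show ?thesis using sqrt_ratio_le_iff le st(4) by blast
qed

lemma ratios_le:
  assumes x: "x \<in> ratios t" and t: "t \<in> carrier F0" "r \<ge> 0"
    and le: "\<And>\<phi> \<psi> s. state B \<phi> \<Longrightarrow> state D \<psi> \<Longrightarrow> s \<in> carrier F0 \<Longrightarrow> gT \<phi> \<psi> (t \<otimes>\<^sub>F0 s) \<le> r\<^sup>2 * gT \<phi> \<psi> s"
  shows "x \<le> r"
proof -
  from x consider "x = 0" | \<phi> \<psi> s where "x = ratio (tensor_functional \<phi> \<psi>) t s" "state B \<phi>" "state D \<psi>" "s \<in> carrier F0"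
    "tensor_functional \<phi> \<psi> (star F0 s \<otimes>\<^sub>F0 s) \<noteq> 0" by blast
  then show ?thesis
  proof cases
    case 2
    show ?thesis unfolding 2(1) by (intro ratio_le t le 2)
  qed (use t in simp)
qed

lemma spatial_norm_least:
  assumes "t \<in> carrier F0" "r \<ge> 0"
    and "\<And>\<phi> \<psi> s. state B \<phi> \<Longrightarrow> state D \<psi> \<Longrightarrow> s \<in> carrier F0 \<Longrightarrow> gT \<phi> \<psi> (t \<otimes>\<^sub>F0 s) \<le> r\<^sup>2 * gT \<phi> \<psi> s"
  shows "N t \<le> r" unfolding spatial_norm_alt by (rule cSup_least) (blast, rule ratios_le[OF _ assms])

lemma spatial_bdd:
  assumes "t \<in> carrier F0"
  shows "bdd_above (ratios t)" by (rule bdd_aboveI[of _ "proj_bound t"])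
    (rule ratios_le[OF _ assms proj_bound_nonneg[OF assms]], assumption, intro gns_proj_bound assms)

lemma spatial_norm_nonneg: "t \<in> carrier F0 \<Longrightarrow> 0 \<le> N t" unfolding spatial_norm_alt by (intro cSup_upper spatial_bdd) auto

lemma spatial_norm_upper:
  assumes st: "state B \<phi>" "state D \<psi>" and t: "t \<in> carrier F0" and s: "s \<in> carrier F0"
  shows "gT \<phi> \<psi> (t \<otimes>\<^sub>F0 s) \<le> (N t)\<^sup>2 * gT \<phi> \<psi> s"
proof -
  interpret F: star_alg F0 by (rule star_alg_F)
  note pf = posfun_tensor[OF state_posfun[OF st(1)] state_posfun[OF st(2)], of "\<lambda>_. 0"]
  let ?\<omega> = "tensor_functional \<phi> \<psi>"
  have ts: "0 \<le> Re (?\<omega> (star F0 (t \<otimes>\<^sub>F0 s) \<otimes>\<^sub>F0 (t \<otimes>\<^sub>F0 s)))" by (intro F.pf_gns_nonneg[OF pf] F.m_closed t s)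
  show ?thesis
  proof (cases "?\<omega> (star F0 s \<otimes>\<^sub>F0 s) = 0")
    case True
    then show ?thesis using gns_proj_bound[OF st t s] by simp
  next
    case False
    then have pos: "0 < Re (?\<omega> (star F0 s \<otimes>\<^sub>F0 s))"
      using F.pf_gns_nonneg[OF pf s] F.pf_gns[OF pf s] by (metis less_eq_real_def of_real_0)
    have "ratio ?\<omega> t s \<le> N t" unfolding spatial_norm_alt by (intro cSup_upper spatial_bdd t) (use st s False in blast)
    then show ?thesis using sqrt_ratio_le_iff[OF pos ts spatial_norm_nonneg[OF t]] by blast
  qed
qed

lemma cstar_seminorm_spatial: "cstar_seminorm (F p) N"
proof -
  interpret F: star_alg F0 by (rule star_alg_F)
  define \<Omega> where "\<Omega> = {tensor_functional \<phi> \<psi> | \<phi> \<psi>. state B \<phi> \<and> state D \<psi>}"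
  have \<Omega>: "\<exists>\<phi> \<psi>. \<omega> = tensor_functional \<phi> \<psi> \<and> state B \<phi> \<and> state D \<psi>" if "\<omega> \<in> \<Omega>" for \<omega> using that unfolding \<Omega>_def by blast
  have \<Omega>I: "tensor_functional \<phi> \<psi> \<in> \<Omega>" if "state B \<phi>" "state D \<psi>" for \<phi> \<psi> using that unfolding \<Omega>_def by blast
  have "cstar_seminorm F0 N"
  proof (rule F.gns_cstar_seminorm[where \<Omega> = \<Omega>])
    fix \<omega> assume "\<omega> \<in> \<Omega>"
    then obtain \<phi> \<psi> where o: "\<omega> = tensor_functional \<phi> \<psi>" "state B \<phi>" "state D \<psi>" using \<Omega> by blast
    show "posfun F0 \<omega>" unfolding o(1) by (intro posfun_tensor state_posfun o)
    show "F.gns \<omega> (t \<otimes>\<^sub>F0 s) \<le> (N t)\<^sup>2 * F.gns \<omega> s" if "t \<in> carrier F0" "s \<in> carrier F0" for t s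
      unfolding o(1) by (intro spatial_norm_upper o that)
  next
    fix t r assume t: "t \<in> carrier F0" "r \<ge> 0"
      and h: "\<And>\<omega> s. \<omega> \<in> \<Omega> \<Longrightarrow> s \<in> carrier F0 \<Longrightarrow> F.gns \<omega> (t \<otimes>\<^sub>F0 s) \<le> r\<^sup>2 * F.gns \<omega> s"
    show "N t \<le> r" by (rule spatial_norm_least[OF t h[OF \<Omega>I]])
  qed (rule spatial_norm_nonneg)
  then show ?thesis by (simp add: cstar_seminorm_def msa_simps)
qed

abbreviation FS where "FS \<equiv> F N"

lemma cstar_alg_FS: "cstar_alg FS" by (rule cstar_algI[OF star_alg_F]) (simp add: cstar_seminorm_spatial)

sublocale FS: cstar_alg "F (spatial_norm B D)" by (rule cstar_alg_FS)

lemma cstar_normed_min_tensor: "cstar_normed (min_tensor B D)" unfolding min_tensor_def by (rule FS.cstar_normed_completion)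

lemma FS_carrier_F0: "t \<in> carrier FS \<longleftrightarrow> t \<in> carrier F0" by simp

lemma lin_sandwich:
  assumes y: "y \<in> carrier F0" and t: "t \<in> carrier F0" and s: "s \<in> carrier F0"
  shows "lin f (y \<otimes>\<^sub>F0 (t \<otimes>\<^sub>F0 s)) = lin (\<lambda>x. lin (\<lambda>z. lin (\<lambda>u. f (x \<otimes>\<^sub>M (u \<otimes>\<^sub>M z))) t) s) y"
proof -
  interpret F: star_alg F0 by (rule star_alg_F)
  have "lin f (y \<otimes>\<^sub>F0 (t \<otimes>\<^sub>F0 s)) = lin (\<lambda>x. lin (\<lambda>u. lin (\<lambda>z. f (x \<otimes>\<^sub>M (u \<otimes>\<^sub>M z))) s) t) y"
    using F_carrierD(1)[OF y] F_carrierD(1)[OF t] F_carrierD(1)[OF s] F_carrierD(1)[OF F.m_closed[OF t s]]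
    by (subst lin_mult; (assumption | subst lin_mult)?; simp?)
  also have "\<dots> = lin (\<lambda>x. lin (\<lambda>z. lin (\<lambda>u. f (x \<otimes>\<^sub>M (u \<otimes>\<^sub>M z))) t) s) y" unfolding lin_def sum_distrib_left
    by (rule sum.cong[OF refl], rule trans[OF sum.swap]) (simp add: mult_ac)
  finally show ?thesis .
qed

text \<open>The vectors s and t s are finite combinations of elementary tensors, so an operator
  whose matrix coefficients between elementary tensors all vanish is zero in every product of GNS
  representations. \<open>lin_sandwich\<close> moves the sum over t innermost for this
  purpose.\<close>

lemma spatial_norm_eq_0:
  assumes t: "t \<in> carrier F0"
    and z: "\<And>\<phi> \<psi> x z. state B \<phi> \<Longrightarrow> state D \<psi> \<Longrightarrow> x \<in> carrier M \<Longrightarrow> z \<in> carrier M \<Longrightarrow>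
      lin (\<lambda>u. \<phi> (fst x \<otimes>\<^sub>B (fst u \<otimes>\<^sub>B fst z)) * \<psi> (snd x \<otimes>\<^sub>D (snd u \<otimes>\<^sub>D snd z))) t = 0"
  shows "N t = 0"
proof -
  interpret F: star_alg F0 by (rule star_alg_F)
  have "N t \<le> 0"
  proof (rule spatial_norm_least[OF t])
    fix \<phi> \<psi> s assume st: "state B \<phi>" "state D \<psi>" and s: "s \<in> carrier F0"
    have y: "star F0 (t \<otimes>\<^sub>F0 s) \<in> carrier F0" by (intro F.star_closed F.m_closed t s)
    have "tensor_functional \<phi> \<psi> (star F0 (t \<otimes>\<^sub>F0 s) \<otimes>\<^sub>F0 (t \<otimes>\<^sub>F0 s)) = 0" unfolding tensor_functional_lin lin_sandwich[OF y t s]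
      unfolding lin_def[of _ s] lin_def[of _ "star F0 (t \<otimes>\<^sub>F0 s)"] mult_M fst_conv snd_conv by (intro sum.neutral ballI)
        (simp add: z[OF st F_carrierD(4)[OF y] F_carrierD(4)[OF s]])
    then show "gT \<phi> \<psi> (t \<otimes>\<^sub>F0 s) \<le> 0\<^sup>2 * gT \<phi> \<psi> s" by (simp)
  qed simp
  then show ?thesis using spatial_norm_nonneg[OF t] by simp
qed

subsection \<open>Pure tensors\<close>

abbreviation MT where "MT \<equiv> min_tensor B D"
abbreviation pt where "pt \<equiv> pure_tensor B D"

sublocale MT: cstar_normed "min_tensor B D" by (rule cstar_normed_min_tensor)

lemma star_alg_hom_\<iota>: "star_alg_hom FS MT (to_completion FS)" unfolding min_tensor_def
  by (intro star_alg_homI FS.star_hom_to_completion FS.star_alg_axioms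
      MT.star_alg_axioms[unfolded min_tensor_def])

interpretation \<iota>: star_alg_hom FS MT "to_completion FS" by (rule star_alg_hom_\<iota>)

lemma basis_closed: "a \<in> carrier B \<Longrightarrow> b \<in> carrier D \<Longrightarrow> basis_elt (a, b) \<in> carrier (F p)" by (simp add: carrier_M)

lemma pt_closed [simp, intro]: "a \<in> carrier B \<Longrightarrow> b \<in> carrier D \<Longrightarrow> pt a b \<in> carrier MT"
  unfolding pure_tensor_def by (intro \<iota>.hom_closed basis_closed)

lemma \<iota>_eqI:
  assumes "t \<in> carrier FS" "u \<in> carrier FS" "N (\<lambda>z. t z + (-1) * u z) = 0"
  shows "to_completion FS t = to_completion FS u"
proof -
  have "t \<ominus>\<^sub>FS u = (\<lambda>z. t z + (-1) * u z)" using FS.minus_smult[OF assms(1,2)] by simp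
  then have "nrm FS (t \<ominus>\<^sub>FS u) = 0" using assms(3) by simp
  then have "nrm MT (to_completion FS (t \<ominus>\<^sub>FS u)) = 0"
    unfolding min_tensor_def using FS.nrm_to_completion[OF FS.minus_closed[OF assms(1,2)]] by simp
  then have "to_completion FS (t \<ominus>\<^sub>FS u) = zero MT" by (intro MT.nrm_eq_0 \<iota>.hom_closed FS.minus_closed assms)
  then have "to_completion FS t \<ominus>\<^sub>MT to_completion FS u = zero MT" by (simp only: \<iota>.hom_minus[OF assms(1,2)])
  then show ?thesis using MT.minus_eq_0_iff[OF \<iota>.hom_closed[OF assms(1)] \<iota>.hom_closed[OF assms(2)]] by simp
qed

lemma finite_basis [simp]: "finite {z. basis_elt x z \<noteq> 0}" by simp

lemma F_mem_minus_basis: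
  assumes "t \<in> carrier F0" "x \<in> carrier M"
  shows "(\<lambda>z. t z + (-1) * basis_elt x z) \<in> carrier F0"
proof -
  interpret F: star_alg F0 by (rule star_alg_F)
  have "basis_elt x \<in> carrier F0" using assms(2) by simp
  then have "t \<oplus>\<^sub>F0 ((-1) \<odot>\<^sub>F0 basis_elt x) \<in> carrier F0" using assms by (intro F.a_closed F.smult_closed)
  then show ?thesis by (simp only: msa_simps)
qed

text \<open>Bilinearity is not divided out of the formal tensors; it holds in the completion because
  both sides have the same matrix coefficients. The additivity and homogeneity rules for pure
  tensors all come from this criterion.\<close>

lemma pt_eqI:
  assumes a: "a \<in> carrier B" and b: "b \<in> carrier D" and t: "t \<in> carrier FS"
    and f: "\<And>\<phi> \<psi> x z. state B \<phi> \<Longrightarrow> state D \<psi> \<Longrightarrow> x \<in> carrier M \<Longrightarrow> z \<in> carrier M \<Longrightarrow>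
      lin (\<lambda>u. \<phi> (fst x \<otimes>\<^sub>B (fst u \<otimes>\<^sub>B fst z)) * \<psi> (snd x \<otimes>\<^sub>D (snd u \<otimes>\<^sub>D snd z))) t
      = \<phi> (fst x \<otimes>\<^sub>B (a \<otimes>\<^sub>B fst z)) * \<psi> (snd x \<otimes>\<^sub>D (b \<otimes>\<^sub>D snd z))"
  shows "to_completion FS t = pt a b"
proof -
  have "N (\<lambda>z. t z + (-1) * basis_elt (a, b) z) = 0"
  proof (intro spatial_norm_eq_0 F_mem_minus_basis)
    fix \<phi> \<psi> x z assume st: "state B \<phi>" "state D \<psi>" "x \<in> carrier M" "z \<in> carrier M"
    let ?f = "\<lambda>u. \<phi> (fst x \<otimes>\<^sub>B (fst u \<otimes>\<^sub>B fst z)) * \<psi> (snd x \<otimes>\<^sub>D (snd u \<otimes>\<^sub>D snd z))"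
    have "lin ?f (\<lambda>z. t z + (-1) * basis_elt (a, b) z) = lin ?f t + lin ?f (\<lambda>z. (-1) * basis_elt (a, b) z)"
      by (rule lin_add) (use F_carrierD(1)[OF t] in auto)
    also have "\<dots> = 0" unfolding f[OF st] by (subst lin_smult) simp
    finally show "lin ?f (\<lambda>z. t z + (-1) * basis_elt (a, b) z) = 0" .
  qed (use a b t carrier_M in auto)
  then show ?thesis unfolding pure_tensor_def by (intro \<iota>_eqI t basis_closed a b)
qed

lemma pt_add_l:
  assumes "a \<in> carrier B" "a' \<in> carrier B" "b \<in> carrier D"
  shows "pt (a \<oplus>\<^sub>B a') b = pt a b \<oplus>\<^sub>MT pt a' b"
proof -
  have "to_completion FS (basis_elt (a, b) \<oplus>\<^sub>FS basis_elt (a', b)) = pt (a \<oplus>\<^sub>B a') b"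
    by (rule pt_eqI, (intro FS.a_closed basis_closed B.a_closed assms)+, unfold msa_simps, subst lin_add)
      (use assms carrier_M in \<open>auto simp: state_def B.l_distr B.r_distr algebra_simps\<close>)
  then show ?thesis unfolding pure_tensor_def by (metis \<iota>.hom_add basis_closed assms)
qed

lemma pt_add_r:
  assumes "a \<in> carrier B" "b \<in> carrier D" "b' \<in> carrier D"
  shows "pt a (b \<oplus>\<^sub>D b') = pt a b \<oplus>\<^sub>MT pt a b'"
proof -
  have "to_completion FS (basis_elt (a, b) \<oplus>\<^sub>FS basis_elt (a, b')) = pt a (b \<oplus>\<^sub>D b')"
    by (rule pt_eqI, (intro FS.a_closed basis_closed D.a_closed assms)+, unfold msa_simps, subst lin_add)
      (use assms carrier_M in \<open>auto simp: state_def D.l_distr D.r_distr algebra_simps\<close>)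
  then show ?thesis unfolding pure_tensor_def by (metis \<iota>.hom_add basis_closed assms)
qed

lemma pt_smult_l:
  assumes "a \<in> carrier B" "b \<in> carrier D"
  shows "pt (c \<odot>\<^sub>B a) b = c \<odot>\<^sub>MT pt a b"
proof -
  have "to_completion FS (c \<odot>\<^sub>FS basis_elt (a, b)) = pt (c \<odot>\<^sub>B a) b"
    by (rule pt_eqI, (intro FS.smult_closed basis_closed B.smult_closed assms)+, unfold msa_simps, subst lin_smult)
      (use assms carrier_M in \<open>auto simp: state_def B.smult_mult_l B.smult_mult_r\<close>)
  then show ?thesis unfolding pure_tensor_def by (metis \<iota>.hom_smult basis_closed assms)
qed

lemma pt_smult_r:
  assumes "a \<in> carrier B" "b \<in> carrier D"
  shows "pt a (c \<odot>\<^sub>D b) = c \<odot>\<^sub>MT pt a b"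
proof -
  have "to_completion FS (c \<odot>\<^sub>FS basis_elt (a, b)) = pt a (c \<odot>\<^sub>D b)"
    by (rule pt_eqI, (intro FS.smult_closed basis_closed D.smult_closed assms)+, unfold msa_simps, subst lin_smult)
      (use assms carrier_M in \<open>auto simp: state_def D.smult_mult_l D.smult_mult_r\<close>)
  then show ?thesis unfolding pure_tensor_def by (metis \<iota>.hom_smult basis_closed assms)
qed

lemma basis_mult: "basis_elt x \<otimes>\<^sub>(F p) basis_elt y = basis_elt (x \<otimes>\<^sub>M y)"
  unfolding msa_simps basis_elt_support by (auto simp: fun_eq_iff basis_elt_def)

lemma basis_star: "star (F p) (basis_elt (a, b)) = basis_elt (star B a, star D b)"
  unfolding msa_simps basis_elt_support by (auto simp: fun_eq_iff basis_elt_def)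

lemma pt_mult:
  assumes "a \<in> carrier B" "a' \<in> carrier B" "b \<in> carrier D" "b' \<in> carrier D"
  shows "pt a b \<otimes>\<^sub>MT pt a' b' = pt (a \<otimes>\<^sub>B a') (b \<otimes>\<^sub>D b')"
proof -
  have "to_completion FS (basis_elt (a, b) \<otimes>\<^sub>FS basis_elt (a', b')) = pt a b \<otimes>\<^sub>MT pt a' b'"
    unfolding pure_tensor_def by (intro \<iota>.hom_mult basis_closed assms)
  then show ?thesis unfolding basis_mult mult_M by (simp add: pure_tensor_def)
qed

lemma pt_star:
  assumes "a \<in> carrier B" "b \<in> carrier D"
  shows "star MT (pt a b) = pt (star B a) (star D b)"
proof -
  have "to_completion FS (star FS (basis_elt (a, b))) = star MT (pt a b)"
    unfolding pure_tensor_def by (intro \<iota>.hom_star basis_closed assms)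
  then show ?thesis unfolding basis_star by (simp add: pure_tensor_def)
qed

lemma pt_one: "pt \<one>\<^sub>B \<one>\<^sub>D = \<one>\<^sub>MT"
proof -
  have "one FS = basis_elt (\<one>\<^sub>B, \<one>\<^sub>D)" by (simp add: DirProd_def)
  then show ?thesis unfolding pure_tensor_def by (metis \<iota>.hom_one)
qed

lemma pt_zero_l [simp]: "b \<in> carrier D \<Longrightarrow> pt \<zero>\<^sub>B b = \<zero>\<^sub>MT" using pt_smult_l[of "\<zero>\<^sub>B" b 0] by simp

lemma pt_zero_r [simp]: "a \<in> carrier B \<Longrightarrow> pt a \<zero>\<^sub>D = \<zero>\<^sub>MT" using pt_smult_r[of a "\<zero>\<^sub>D" 0] by simp

lemma pt_finsum_l:
  assumes "finite I" "\<And>i. i \<in> I \<Longrightarrow> f i \<in> carrier B" "b \<in> carrier D"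
  shows "pt (\<Oplus>\<^sub>B i\<in>I. f i) b = (\<Oplus>\<^sub>MT i\<in>I. pt (f i) b)" using assms(1,2)
proof induction
  case (insert i I)
  then show ?case using assms(3) by (subst B.finsum_insert MT.finsum_insert; (auto simp: pt_add_l B.finsum_closed Pi_def)?)+
qed (simp add: assms(3) B.finsum_empty MT.finsum_empty)

lemma pt_finsum_r:
  assumes "finite I" "\<And>i. i \<in> I \<Longrightarrow> f i \<in> carrier D" "a \<in> carrier B"
  shows "pt a (\<Oplus>\<^sub>D i\<in>I. f i) = (\<Oplus>\<^sub>MT i\<in>I. pt a (f i))" using assms(1,2)
proof induction
  case (insert i I)
  then show ?case using assms(3) by (subst D.finsum_insert MT.finsum_insert; (auto simp: pt_add_r D.finsum_closed Pi_def)?)+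
qed (simp add: assms(3) D.finsum_empty MT.finsum_empty)

end

subsection \<open>Orthogonality of projections with sum one\<close>

text \<open>A geometric sum of an M-th root of unity; |d| < M excludes nonzero multiples of M. It
  extracts a coefficient of a polynomial in \<open>pencil_zero\<close> and of a Laurent polynomial
  in \<open>laurent_coefficient_le\<close>.\<close>

lemma sum_roots_of_unity:
  fixes d :: int and M :: nat
  assumes "\<bar>d\<bar> < int M"
  shows "(\<Sum>j<M. cis (2 * pi * of_int d / real M) ^ j) = (if d = 0 then of_nat M else 0)"
proof (cases "d = 0")
  case False
  let ?x = "cis (2 * pi * of_int d / real M)"
  have M: "M > 0" using assms by simp
  have "?x \<noteq> 1"
  proof
    assume "?x = 1"
    then have "cos (2 * pi * of_int d / real M) = 1" by (metis cis.sel(1) one_complex.sel(1))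
    then obtain n :: int where "2 * pi * of_int d / real M = of_int n * 2 * pi" using cos_one_2pi_int by blast
    then have "of_int d = (of_int n * real M :: real)" using M by (simp add: field_simps)
    then have dn: "d = n * int M" by (metis of_int_eq_iff of_int_mult of_int_of_nat_eq)
    then have "n \<noteq> 0" using False by auto
    then have "1 \<le> \<bar>n\<bar>" by simp
    from mult_right_mono[OF this, of "int M"] have "int M \<le> \<bar>d\<bar>" unfolding dn abs_mult by simp
    then show False using assms by simp
  qed
  moreover have "?x ^ M = 1"
  proof -
    have "?x ^ M = cis (real M * (2 * pi * of_int d / real M))" by (rule Complex.DeMoivre)
    also have "real M * (2 * pi * of_int d / real M) = 2 * pi * of_int d" using M by simp
    finally show ?thesis by (simp add: cis_multiple_2pi)
  qed
  ultimately show ?thesis using False by (simp add: sum_gp_strict)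
qed simp

context cstar_normed
begin

lemma star_mult_self_eq_0: "x \<in> carrier B \<Longrightarrow> star B x \<otimes> x = \<zero> \<Longrightarrow> x = \<zero>" using nrm_cstar[of x] by (intro nrm_eq_0) auto

lemma mult_star_self_eq_0: "x \<in> carrier B \<Longrightarrow> x \<otimes> star B x = \<zero> \<Longrightarrow> x = \<zero>"
  using star_mult_self_eq_0[of "star B x"] by (metis star_closed star_star star_zero)

lemma nrm_projection_le:
  assumes "e \<in> carrier B" "star B e = e" "e \<otimes> e = e"
  shows "nrm B e \<le> 1" using nrm_cstar[OF assms(1)] assms by (cases "nrm B e = 0") (auto simp: power2_eq_square)

context
  fixes e h
  assumes e: "e \<in> carrier B" "star B e = e" "e \<otimes> e = e"
    and h: "h \<in> carrier B" "star B h = h" "e \<otimes> h = h" "h \<otimes> e = h"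
begin

text \<open>In the corner of B with unit e, the aim is an extreme point property of e: if e + h and
  e - h are contractions, then h = 0. To this end contractivity is spread from z = 1 and z = -1 to a
  whole disc of parameters z, where powers can be averaged.\<close>

abbreviation pencil where "pencil z \<equiv> e \<oplus> z \<odot> h"

lemma pencil_closed [simp, intro]: "pencil z \<in> carrier B" using e h by simp

lemma pencil_convex:
  assumes "nrm B (pencil z) \<le> 1" "nrm B (pencil w) \<le> 1" "0 \<le> s" "s \<le> 1"
  shows "nrm B (pencil (of_real s * z + of_real (1 - s) * w)) \<le> 1"
proof -
  let ?s = "of_real s" and ?t = "of_real (1 - s)"
  have "pencil (?s * z + ?t * w) = (?s + ?t) \<odot> e \<oplus> (?s * z + ?t * w) \<odot> h" using e by simp
  also have "\<dots> = (?s \<odot> e \<oplus> ?t \<odot> e) \<oplus> (?s \<odot> (z \<odot> h) \<oplus> ?t \<odot> (w \<odot> h))"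
    unfolding smult_l_distr[OF e(1)] smult_l_distr[OF h(1)] smult_assoc[OF h(1)] ..
  also have "\<dots> = ?s \<odot> pencil z \<oplus> ?t \<odot> pencil w" using e h by (simp add: smult_r_distr a_ac)
  finally have "nrm B (pencil (?s * z + ?t * w)) \<le> nrm B (?s \<odot> pencil z) + nrm B (?t \<odot> pencil w)"
    using nrm_add[of "?s \<odot> pencil z" "?t \<odot> pencil w"] by auto
  also have "\<dots> = s * nrm B (pencil z) + (1 - s) * nrm B (pencil w)" using assms by (simp add: nrm_smult del: of_real_diff)
  also have "\<dots> \<le> s * 1 + (1 - s) * 1" using assms by (intro add_mono mult_left_mono) auto
  finally show ?thesis by simp
qed

lemma pencil_mult: "pencil z \<otimes> pencil w = e \<oplus> (z + w) \<odot> h \<oplus> (z * w) \<odot> (h \<otimes> h)"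
proof -
  have "pencil z \<otimes> pencil w = (e \<oplus> z \<odot> h) \<oplus> (w \<odot> h \<oplus> w \<odot> (z \<odot> (h \<otimes> h)))"
    using e h by (simp add: l_distr r_distr smult_mult_l smult_mult_r smult_r_distr)
  also have "\<dots> = e \<oplus> (z \<odot> h \<oplus> w \<odot> h) \<oplus> (w * z) \<odot> (h \<otimes> h)" using e h by (simp add: smult_assoc a_ac)
  finally show ?thesis using h by (simp add: smult_l_distr mult.commute)
qed

lemma pencil_star: "star B (pencil z) = pencil (cnj z)" using e h by (simp add: star_add star_smult)

text \<open>The mean of (e + h)^2 and (e - h)^2 is e + h^2.\<close>

lemma pencil_square_le:
  assumes "nrm B (pencil 1) \<le> 1" "nrm B (pencil (-1)) \<le> 1"
  shows "nrm B (e \<oplus> h \<otimes> h) \<le> 1"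
proof -
  have hh: "h \<otimes> h \<in> carrier B" using h by simp
  have "pencil 1 \<otimes> pencil 1 \<oplus> pencil (-1) \<otimes> pencil (-1)
      = (e \<oplus> 2 \<odot> h \<oplus> h \<otimes> h) \<oplus> (e \<oplus> (-2) \<odot> h \<oplus> h \<otimes> h)"
    unfolding pencil_mult using hh by simp
  also have "\<dots> = (e \<oplus> e) \<oplus> (h \<otimes> h \<oplus> h \<otimes> h) \<oplus> (2 \<odot> h \<oplus> (-2) \<odot> h)" using e h hh by (simp add: a_ac)
  also have "2 \<odot> h \<oplus> (-2) \<odot> h = \<zero>" using smult_l_distr[OF h(1), of 2 "-2"] h by simp
  also have "(e \<oplus> e) \<oplus> (h \<otimes> h \<oplus> h \<otimes> h) \<oplus> \<zero> = (e \<oplus> h \<otimes> h) \<oplus> (e \<oplus> h \<otimes> h)" using e hh by (simp add: a_ac)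
  also have "\<dots> = 2 \<odot> (e \<oplus> h \<otimes> h)" using smult_l_distr[of "e \<oplus> h \<otimes> h" 1 1] e hh by simp
  finally have eq: "2 \<odot> (e \<oplus> h \<otimes> h) = pencil 1 \<otimes> pencil 1 \<oplus> pencil (-1) \<otimes> pencil (-1)" by simp
  have "2 * nrm B (e \<oplus> h \<otimes> h) = nrm B (2 \<odot> (e \<oplus> h \<otimes> h))" using e hh by (simp add: nrm_smult)
  also have "\<dots> \<le> nrm B (pencil 1 \<otimes> pencil 1) + nrm B (pencil (-1) \<otimes> pencil (-1))"
    unfolding eq by (intro nrm_add m_closed pencil_closed)
  also have "\<dots> \<le> nrm B (pencil 1) * nrm B (pencil 1) + nrm B (pencil (-1)) * nrm B (pencil (-1))"
    by (intro add_mono nrm_mult pencil_closed)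
  also have "\<dots> \<le> 1 * 1 + 1 * 1" using assms by (intro add_mono mult_mono) auto
  finally show ?thesis by simp
qed

text \<open>For c = i and c = -i the cross terms cancel and |c| = 1, so the adjoint of e + c h times
  e + c h is e + h^2.\<close>

lemma pencil_imaginary_le:
  assumes "nrm B (pencil 1) \<le> 1" "nrm B (pencil (-1)) \<le> 1" "c = \<i> \<or> c = - \<i>"
  shows "nrm B (pencil c) \<le> 1"
proof -
  have "cnj c + c = 0" "cnj c * c = 1" using assms(3) by auto
  then have "star B (pencil c) \<otimes> pencil c = e \<oplus> h \<otimes> h" unfolding pencil_star pencil_mult using e h by simp
  then have "(nrm B (pencil c))\<^sup>2 \<le> 1" using nrm_cstar[OF pencil_closed, of c] pencil_square_le[OF assms(1,2)] by simp
  then have "(nrm B (pencil c))\<^sup>2 \<le> 1\<^sup>2" by simp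
  then show ?thesis by (rule power2_le_imp_le) simp
qed

text \<open>The convex hull of 1, -1, i and -i contains the disc of radius 1/2: z is the mean of 2
  Re z and 2 i Im z, which lie on the two diagonals.\<close>

lemma pencil_disc_le:
  assumes "nrm B (pencil 1) \<le> 1" "nrm B (pencil (-1)) \<le> 1" "cmod z \<le> 1 / 2"
  shows "nrm B (pencil z) \<le> 1"
proof -
  have seg: "nrm B (pencil (of_real a * c)) \<le> 1"
    if "nrm B (pencil c) \<le> 1" "nrm B (pencil (- c)) \<le> 1" "\<bar>a\<bar> \<le> 1" for a c
  proof -
    have "of_real ((1 + a) / 2) * c + of_real (1 - (1 + a) / 2) * (- c) = of_real a * c" by (simp add: field_simps)
    then show ?thesis using pencil_convex[OF that(1,2), of "(1 + a) / 2"] that(3) by simp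
  qed
  have "\<bar>Re z\<bar> \<le> 1 / 2" "\<bar>Im z\<bar> \<le> 1 / 2" using abs_Re_le_cmod[of z] abs_Im_le_cmod[of z] assms(3) by auto
  then have "nrm B (pencil (of_real (2 * Re z) * 1)) \<le> 1" "nrm B (pencil (of_real (2 * Im z) * \<i>)) \<le> 1"
    using assms(1,2) pencil_imaginary_le[OF assms(1,2)] by (intro seg; auto)+
  from pencil_convex[OF this, of "1 / 2"]
  have "nrm B (pencil (of_real (Re z) + of_real (Im z) * \<i>)) \<le> 1" by (simp add: field_simps)
  then show ?thesis by (metis complex_eq mult.commute)
qed

text \<open>Right multiplication by e replaces the unit of B by that of the corner, so that the
  constant coefficient is e also for n = 0. Only the coefficients of 1 and z are identified; the
  linear one grows with n, while the norm of the power will stay bounded.\<close>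

lemma pencil_power:
  "\<exists>c. (\<forall>k. c k \<in> carrier B) \<and> c 0 = e \<and> c 1 = of_nat n \<odot> h \<and>
    (\<forall>z. pencil z [^] n \<otimes> e = (\<Oplus>k\<in>{..n}. z ^ k \<odot> c k))"
proof (induction n)
  case 0
  show ?case by (rule exI[of _ "\<lambda>k. if k = 0 then e else \<zero>"]) (use e h in \<open>auto simp: finsum_insert\<close>)
next
  case (Suc n)
  then obtain c where c: "\<And>k. c k \<in> carrier B" "c 0 = e" "c 1 = of_nat n \<odot> h"
    "\<And>z. pencil z [^] n \<otimes> e = (\<Oplus>k\<in>{..n}. z ^ k \<odot> c k)" by blast
  define b where "b k = (if k \<le> n then c k else \<zero>)" for k
  define d where "d k = (case k of 0 \<Rightarrow> e | Suc j \<Rightarrow> b k \<otimes> e \<oplus> b j \<otimes> h)" for k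
  have b: "b k \<in> carrier B" for k using c by (simp add: b_def)
  have bsum: "(\<Oplus>k\<in>{..n}. z ^ k \<odot> c k) = (\<Oplus>k\<in>{..n}. z ^ k \<odot> b k)" for z using c by (intro finsum_cong') (auto simp: b_def)
  have d: "d k \<in> carrier B" for k using b e h by (auto simp: d_def split: nat.split)
  have d1: "d 1 = of_nat (Suc n) \<odot> h"
  proof (cases "n = 0")
    case True
    then show ?thesis using c e h by (simp add: d_def b_def)
  next
    case False
    have "d 1 = of_nat n \<odot> h \<oplus> h" using False c e h by (simp add: d_def b_def smult_mult_l)
    then show ?thesis using h smult_l_distr[OF h(1), of "of_nat n" 1] by (simp add: add.commute)
  qed
  have "pencil z [^] Suc n \<otimes> e = (\<Oplus>k\<in>{..Suc n}. z ^ k \<odot> d k)" for z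
  proof -
    have pe: "pencil z \<otimes> e = e \<otimes> pencil z" using e h by (simp add: l_distr r_distr smult_mult_l smult_mult_r)
    have "pencil z [^] Suc n \<otimes> e = pencil z [^] n \<otimes> (pencil z \<otimes> e)" using e by (simp add: m_assoc)
    also have "\<dots> = (pencil z [^] n \<otimes> e) \<otimes> pencil z" unfolding pe using e by (simp add: m_assoc)
    also have "\<dots> = (\<Oplus>k\<in>{..n}. z ^ k \<odot> b k) \<otimes> (e \<oplus> z \<odot> h)" unfolding c(4) bsum ..
    also have "\<dots> = (\<Oplus>k\<in>{..n}. (z ^ k \<odot> b k) \<otimes> (e \<oplus> z \<odot> h))" using b by (intro finsum_ldistr) auto
    also have "\<dots> = (\<Oplus>k\<in>{..n}. z ^ k \<odot> (b k \<otimes> e) \<oplus> z ^ Suc k \<odot> (b k \<otimes> h))"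
      using b e h by (intro finsum_cong') (auto simp: r_distr smult_mult_l smult_mult_r mult.commute simp flip: smult_assoc)
    also have "\<dots> = (\<Oplus>k\<in>{..n}. z ^ k \<odot> (b k \<otimes> e)) \<oplus> (\<Oplus>k\<in>{..n}. z ^ Suc k \<odot> (b k \<otimes> h))" using b e h by (intro finsum_addf) auto
    also have "(\<Oplus>k\<in>{..n}. z ^ k \<odot> (b k \<otimes> e)) = (\<Oplus>k\<in>{..Suc n}. z ^ k \<odot> (b k \<otimes> e))"
    proof -
      have "(\<Oplus>k\<in>{..n}. z ^ k \<odot> (b k \<otimes> e)) \<in> carrier B" using b e by (intro finsum_closed) auto
      moreover have "b (Suc n) = \<zero>" by (simp add: b_def)
      ultimately show ?thesis using b e by (subst finsum_Suc) auto
    qed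
    also have "\<dots> = (\<Oplus>k\<in>{..n}. z ^ Suc k \<odot> (b (Suc k) \<otimes> e)) \<oplus> e" using b e c by (subst finsum_Suc2) (auto simp: b_def)
    also have "\<dots> \<oplus> (\<Oplus>k\<in>{..n}. z ^ Suc k \<odot> (b k \<otimes> h))
      = ((\<Oplus>k\<in>{..n}. z ^ Suc k \<odot> (b (Suc k) \<otimes> e)) \<oplus> (\<Oplus>k\<in>{..n}. z ^ Suc k \<odot> (b k \<otimes> h))) \<oplus> e"
    proof -
      have "(\<Oplus>k\<in>{..n}. z ^ Suc k \<odot> (b (Suc k) \<otimes> e)) \<in> carrier B" "(\<Oplus>k\<in>{..n}. z ^ Suc k \<odot> (b k \<otimes> h)) \<in> carrier B"
        using b e h by (auto intro!: finsum_closed)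
      then show ?thesis using e by (simp add: a_ac)
    qed
    also have "(\<Oplus>k\<in>{..n}. z ^ Suc k \<odot> (b (Suc k) \<otimes> e)) \<oplus> (\<Oplus>k\<in>{..n}. z ^ Suc k \<odot> (b k \<otimes> h))
      = (\<Oplus>k\<in>{..n}. z ^ Suc k \<odot> (b (Suc k) \<otimes> e) \<oplus> z ^ Suc k \<odot> (b k \<otimes> h))"
      using b e h by (intro finsum_addf[symmetric]) auto
    also have "\<dots> = (\<Oplus>k\<in>{..n}. z ^ Suc k \<odot> d (Suc k))" using b e h by (intro finsum_cong') (auto simp: d_def smult_r_distr)
    also have "(\<Oplus>k\<in>{..n}. z ^ Suc k \<odot> d (Suc k)) \<oplus> e = (\<Oplus>k\<in>{..Suc n}. z ^ k \<odot> d k)" using d e by (subst finsum_Suc2) (auto simp: d_def)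
    finally show ?thesis .
  qed
  then show ?case using d d1 by (intro exI[of _ d]) (auto simp: d_def)
qed

text \<open>An analogue of Liouville's theorem: the coefficient of \<open>z\<close> in \<open>(e + z h)\<^sup>n\<close> is \<open>n h\<close>, and it is
  recovered by averaging over roots of unity.\<close>

lemma pencil_zero:
  assumes "nrm B (pencil 1) \<le> 1" "nrm B (pencil (-1)) \<le> 1"
  shows "h = \<zero>"
proof -
  have bound: "real n * nrm B h \<le> 2" if n: "n > 0" for n :: nat
  proof -
    \<comment> \<open>The polynomial has degree n, and the frequencies k - 1 with k \<le> n satisfy
      |k - 1| < n + 1. So n + 1 nodes on the circle of radius 1/2 isolate the linear
      coefficient.\<close>
    define M where "M = n + 1"
    define w where "w j = cis (2 * pi * of_int 1 / real M) ^ j" for j :: nat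
    have cw: "cmod (w j) = 1" for j by (simp add: w_def norm_power)
    obtain c where c: "\<And>k. c k \<in> carrier B" "c 0 = e" "c 1 = of_nat n \<odot> h"
      "\<And>z. pencil z [^] n \<otimes> e = (\<Oplus>k\<in>{..n}. z ^ k \<odot> c k)" using pencil_power by blast
    have pn: "nrm B (pencil z [^] n \<otimes> e) \<le> 1" if "cmod z \<le> 1 / 2" for z
    proof -
      have "nrm B (pencil z [^] n \<otimes> e) \<le> nrm B (pencil z [^] n) * nrm B e" using e by (intro nrm_mult) auto
      also have "\<dots> \<le> nrm B (pencil z) ^ n * 1" using e nrm_projection_le[OF e] by (intro mult_mono nrm_pow) auto
      also have "\<dots> \<le> 1" using pencil_disc_le[OF assms that] by (simp add: power_le_one)
      finally show ?thesis .
    qed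
    have ws: "(\<Sum>j<M. cnj (w j) * (w j / 2) ^ k) = (if k = 1 then of_nat M / 2 else 0)" if k: "k \<le> n" for k
    proof -
      have "cnj (w j) * (w j / 2) ^ k = (1 / 2) ^ k * cis (2 * pi * of_int (int k - 1) / real M) ^ j" for j
      proof -
        have "cis (2 * pi * of_int (int k - 1) / real M) = cis (2 * pi * of_int 1 / real M) ^ k * cnj (cis (2 * pi * of_int 1 / real M))"
          unfolding Complex.DeMoivre cis_cnj cis_mult by (rule arg_cong[where f = cis]) (simp add: right_diff_distrib diff_divide_distrib mult_ac)
        then show ?thesis by (simp add: w_def power_divide power_mult_distrib flip: power_mult) (simp add: mult.commute)
      qed
      then have "(\<Sum>j<M. cnj (w j) * (w j / 2) ^ k) = (1 / 2) ^ k * (\<Sum>j<M. cis (2 * pi * of_int (int k - 1) / real M) ^ j)"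
        by (simp add: sum_distrib_left)
      also have "(\<Sum>j<M. cis (2 * pi * of_int (int k - 1) / real M) ^ j) = (if int k - 1 = 0 then of_nat M else 0)"
        by (rule sum_roots_of_unity) (use k n in \<open>auto simp: M_def\<close>)
      finally show ?thesis by auto
    qed
    have "(\<Oplus>j\<in>{..<M}. cnj (w j) \<odot> (pencil (w j / 2) [^] n \<otimes> e))
        = (\<Oplus>j\<in>{..<M}. \<Oplus>k\<in>{..n}. (cnj (w j) * (w j / 2) ^ k) \<odot> c k)"
      using c(1) by (intro finsum_cong') (auto simp: c(4) smult_assoc simp flip: finsum_smult intro!: finsum_closed finsum_cong')
    also have "\<dots> = (\<Oplus>k\<in>{..n}. \<Oplus>j\<in>{..<M}. (cnj (w j) * (w j / 2) ^ k) \<odot> c k)" using c(1) by (intro finsum_swap) auto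
    also have "\<dots> = (\<Oplus>k\<in>{..n}. if k = 1 then (of_nat M / 2) \<odot> c 1 else \<zero>)"
      using c(1) by (intro finsum_cong') (auto simp: finsum_smult_const ws)
    also have "\<dots> = (of_nat M / 2) \<odot> c 1" using c(1) n by (subst finsum_delta) auto
    also have "\<dots> = (of_nat M / 2 * of_nat n) \<odot> h" unfolding c(3) smult_assoc[OF h(1)] ..
    finally have "real M / 2 * real n * nrm B h = nrm B (\<Oplus>j\<in>{..<M}. cnj (w j) \<odot> (pencil (w j / 2) [^] n \<otimes> e))"
      using h by (simp add: nrm_smult norm_mult norm_divide)
    also have "\<dots> \<le> (\<Sum>j<M. nrm B (cnj (w j) \<odot> (pencil (w j / 2) [^] n \<otimes> e)))" using e by (intro nrm_finsum) auto
    also have "\<dots> \<le> (\<Sum>j<M. 1)" using e cw pn by (intro sum_mono) (simp add: nrm_smult norm_divide)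
    finally have "real M * (real n * nrm B h) \<le> real M * 2" by simp
    then show ?thesis by (rule mult_left_le_imp_le) (simp add: M_def)
  qed
  have "nrm B h = 0"
  proof (rule ccontr)
    assume "nrm B h \<noteq> 0"
    then have pos: "nrm B h > 0" using h nrm_nonneg[of h] by linarith
    then obtain n :: nat where "2 < real n * nrm B h" using reals_Archimedean3 by blast
    moreover from this have "n > 0" by (cases n) auto
    ultimately show False using bound[of n] by simp
  qed
  then show ?thesis using h nrm_eq_0 by blast
qed

end

text \<open>Compress to the corner of e_j by g_k = e_j e_k e_j. These elements sum to e_j = g_j, so
  g_i is minus the sum of the m remaining g_k. Every e_j - g_k is a contraction, hence so is their
  mean e_j + g_i / m, and so is e_j - g_i / m by convexity. Then \<open>pencil_zero\<close> yields
  g_i = 0, and g_i is the adjoint of e_i e_j times e_i e_j.\<close>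

theorem projections_orthogonal:
  assumes fin: "finite I" and cl: "\<And>i. i \<in> I \<Longrightarrow> e i \<in> carrier B"
    and proj: "\<And>i. i \<in> I \<Longrightarrow> star B (e i) = e i" "\<And>i. i \<in> I \<Longrightarrow> e i \<otimes> e i = e i"
    and sum: "(\<Oplus>i\<in>I. e i) = \<one>"
    and ij: "i \<in> I" "j \<in> I" "i \<noteq> j"
  shows "e i \<otimes> e j = \<zero>"
proof -
  define g where "g k = e j \<otimes> e k \<otimes> e j" for k
  have g: "g k \<in> carrier B" "star B (g k) = g k" "e j \<otimes> g k = g k" "g k \<otimes> e j = g k" if "k \<in> I" for k
  proof -
    show "e j \<otimes> g k = g k" using that ij cl proj(2)[OF ij(2)] unfolding g_def by (metis m_assoc m_closed)
    show "g k \<otimes> e j = g k" using that ij cl proj(2)[OF ij(2)] unfolding g_def by (metis m_assoc m_closed)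
  qed (use that ij cl proj in \<open>auto simp: g_def star_mult m_assoc\<close>)
  have gj: "g j = e j" using proj(2)[OF ij(2)] by (simp add: g_def)
  let ?R = "I - {i, j}"
  define m where "m = card ?R"
  have sumg: "(\<Oplus>k\<in>I. g k) = e j"
  proof -
    have "(\<Oplus>k\<in>I. g k) = (\<Oplus>k\<in>I. e j \<otimes> e k) \<otimes> e j" unfolding g_def using cl ij fin by (intro finsum_ldistr[symmetric]) auto
    also have "(\<Oplus>k\<in>I. e j \<otimes> e k) = e j \<otimes> (\<Oplus>k\<in>I. e k)" using cl ij fin by (intro finsum_rdistr[symmetric]) auto
    finally show ?thesis using cl ij sum proj by simp
  qed
  have "I = insert i (insert j ?R)" using ij by auto
  then have "(\<Oplus>k\<in>I. g k) = (\<Oplus>k\<in>insert i (insert j ?R). g k)" by (rule arg_cong)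
  also have "\<dots> = g i \<oplus> (g j \<oplus> (\<Oplus>k\<in>?R. g k))" using fin ij g(1) by (subst finsum_insert; (subst finsum_insert)?; auto)
  finally have "(\<Oplus>k\<in>I. g k) = g i \<oplus> (g j \<oplus> (\<Oplus>k\<in>?R. g k))" .
  then have "e j = g i \<oplus> (e j \<oplus> (\<Oplus>k\<in>?R. g k))" using sumg gj by simp
  moreover have R: "(\<Oplus>k\<in>?R. g k) \<in> carrier B" using g by (intro finsum_closed) auto
  ultimately have gR: "(\<Oplus>k\<in>?R. g k) = \<ominus> g i"
  proof -
    assume a: "e j = g i \<oplus> (e j \<oplus> (\<Oplus>k\<in>?R. g k))"
    have "g i \<oplus> (\<Oplus>k\<in>?R. g k) = (g i \<oplus> (e j \<oplus> (\<Oplus>k\<in>?R. g k))) \<ominus> e j" using R g(1)[OF ij(1)] cl[OF ij(2)] by algebra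
    also have "\<dots> = \<zero>" unfolding a[symmetric] using cl[OF ij(2)] by (simp add: minus_eq_0_iff)
    finally have "\<zero> = g i \<oplus> (\<Oplus>k\<in>?R. g k)" by simp
    then show ?thesis using R g(1)[OF ij(1)] by (metis a_comm minus_equality minus_minus)
  qed
  have le1: "nrm B (e j \<ominus> g k) \<le> 1" if k: "k \<in> I" for k
  proof -
    have ek: "star B (\<one> \<ominus> e k) = \<one> \<ominus> e k" using k cl proj by (simp add: star_minus)
    have "(\<one> \<ominus> e k) \<otimes> e k = e k \<ominus> e k \<otimes> e k" using cl[OF k] by (simp add: minus_eq l_distr l_minus)
    then have "(\<one> \<ominus> e k) \<otimes> e k = \<zero>" using cl[OF k] proj(2)[OF k] by (simp add: minus_eq_0_iff)
    moreover have "(\<one> \<ominus> e k) \<otimes> (\<one> \<ominus> e k) = (\<one> \<ominus> e k) \<ominus> (\<one> \<ominus> e k) \<otimes> e k" using cl[OF k] by (simp add: minus_eq r_distr r_minus)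
    ultimately have ek2: "(\<one> \<ominus> e k) \<otimes> (\<one> \<ominus> e k) = \<one> \<ominus> e k" using cl[OF k] by (simp add: minus_eq)
    have "e j \<otimes> (\<one> \<ominus> e k) \<otimes> e j = e j \<otimes> e j \<ominus> g k" unfolding g_def using cl[OF k] cl[OF ij(2)] by algebra
    then have "e j \<ominus> g k = e j \<otimes> (\<one> \<ominus> e k) \<otimes> e j" using proj(2)[OF ij(2)] by simp
    also have "nrm B \<dots> \<le> nrm B (e j \<otimes> (\<one> \<ominus> e k)) * nrm B (e j)" using cl k ij by (intro nrm_mult) auto
    also have "\<dots> \<le> (nrm B (e j) * nrm B (\<one> \<ominus> e k)) * nrm B (e j)" using cl k ij by (intro mult_right_mono nrm_mult) auto
    also have "\<dots> \<le> (1 * 1) * 1" using cl k ij proj ek ek2 by (intro mult_mono nrm_projection_le) auto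
    finally show ?thesis by simp
  qed
  have "g i = \<zero>"
  proof (cases "m = 0")
    case True
    then have "?R = {}" using fin by (simp add: m_def)
    then have "(\<Oplus>k\<in>?R. g k) = \<zero>" by (simp only: finsum_empty)
    then have "\<ominus> g i = \<zero>" using gR by simp
    then show ?thesis using g(1)[OF ij(1)] by (metis minus_minus minus_zero)
  next
    case False
    define s where "s = 1 / real m"
    have s: "0 < s" "s \<le> 1" using False by (auto simp: s_def)
    have up: "nrm B (e j \<oplus> of_real s \<odot> g i) \<le> 1"
    proof -
      have "(\<Oplus>k\<in>?R. e j \<ominus> g k) = (\<Oplus>k\<in>?R. e j) \<oplus> (\<Oplus>k\<in>?R. \<ominus> g k)" unfolding minus_eq using cl ij g by (intro finsum_addf) auto
      also have "(\<Oplus>k\<in>?R. \<ominus> g k) = (\<Oplus>k\<in>?R. (-1) \<odot> g k)" using g by (intro finsum_cong') (auto simp: a_inv_smult)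
      also have "\<dots> = (-1) \<odot> (\<Oplus>k\<in>?R. g k)" using g by (intro finsum_smult) auto
      also have "\<dots> = g i" unfolding gR using g(1)[OF ij(1)] by (simp add: a_inv_smult flip: smult_assoc)
      also have "(\<Oplus>k\<in>?R. e j) = (\<Oplus>k\<in>?R. 1 \<odot> e j)" using cl ij by simp
      also have "\<dots> = of_nat m \<odot> e j" using cl ij fin by (subst finsum_smult_const) (auto simp: m_def)
      finally have eq: "(\<Oplus>k\<in>?R. e j \<ominus> g k) = of_nat m \<odot> e j \<oplus> g i" .
      have "e j \<oplus> of_real s \<odot> g i = of_real s \<odot> (of_nat m \<odot> e j \<oplus> g i)"
        using cl ij g False by (simp add: smult_r_distr s_def flip: smult_assoc)
      then have "nrm B (e j \<oplus> of_real s \<odot> g i) = s * nrm B (\<Oplus>k\<in>?R. e j \<ominus> g k)"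
        unfolding eq[symmetric] using cl ij g s by (simp add: nrm_smult finsum_closed Pi_def)
      also have "\<dots> \<le> s * (\<Sum>k\<in>?R. nrm B (e j \<ominus> g k))" using s cl ij g by (intro mult_left_mono nrm_finsum) auto
      also have "\<dots> \<le> s * (\<Sum>k\<in>?R. 1)" using s le1 by (intro mult_left_mono sum_mono) auto
      also have "\<dots> = 1" using False by (simp add: s_def m_def)
      finally show ?thesis .
    qed
    define h where "h = of_real s \<odot> g i"
    have e: "e j \<in> carrier B" "star B (e j) = e j" "e j \<otimes> e j = e j" using cl proj ij by auto
    have h: "h \<in> carrier B" "star B h = h" "e j \<otimes> h = h" "h \<otimes> e j = h"
      using e g[OF ij(1)] by (auto simp: h_def star_smult smult_mult_l smult_mult_r)
    have "nrm B (e j \<oplus> (-1) \<odot> g i) \<le> 1" using le1[OF ij(1)] e g(1)[OF ij(1)] by (simp add: minus_smult)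
    moreover have "nrm B (e j \<oplus> 0 \<odot> g i) \<le> 1" using nrm_projection_le[OF e] e g(1)[OF ij(1)] by simp
    ultimately have "nrm B (e j \<oplus> (of_real s * (-1) + of_real (1 - s) * 0) \<odot> g i) \<le> 1"
      using s g[OF ij(1)] by (intro pencil_convex[OF e]) auto
    then have "nrm B (e j \<oplus> (-1) \<odot> h) \<le> 1" using g(1)[OF ij(1)] by (simp add: h_def flip: smult_assoc)
    moreover have "nrm B (e j \<oplus> 1 \<odot> h) \<le> 1" using up h by (simp flip: h_def)
    ultimately have "h = \<zero>" using pencil_zero[OF e h] by blast
    then have "inverse (of_real s) \<odot> h = \<zero>" by simp
    then show ?thesis using s g(1)[OF ij(1)] by (simp add: h_def flip: smult_assoc)
  qed
  then have "star B (e i \<otimes> e j) \<otimes> (e i \<otimes> e j) = \<zero>"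
  proof -
    have "star B (e i \<otimes> e j) \<otimes> (e i \<otimes> e j) = e j \<otimes> (e i \<otimes> e i) \<otimes> e j" using cl ij proj(1) by (simp add: star_mult m_assoc)
    then show ?thesis using proj(2)[OF ij(1)] \<open>g i = \<zero>\<close> by (simp add: g_def)
  qed
  with cl ij show ?thesis by (intro star_mult_self_eq_0[of "e i \<otimes> e j"] m_closed)
qed

text \<open>Write q = u* u and p = v v*. The hypothesis on uv makes qp idempotent. Then x = qp - qpq
  satisfies x x* = 0, so qp = qpq is self-adjoint.\<close>

lemma partial_isometry_commute:
  assumes u: "u \<in> carrier B" "u \<otimes> star B u \<otimes> u = u"
    and v: "v \<in> carrier B" "v \<otimes> star B v \<otimes> v = v"
    and uv: "(u \<otimes> v) \<otimes> star B (u \<otimes> v) \<otimes> (u \<otimes> v) = u \<otimes> v"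
  shows "(star B u \<otimes> u) \<otimes> (v \<otimes> star B v) = (v \<otimes> star B v) \<otimes> (star B u \<otimes> u)"
proof -
  define q where "q = star B u \<otimes> u"
  define p where "p = v \<otimes> star B v"
  have c: "q \<in> carrier B" "p \<in> carrier B" using u v by (auto simp: q_def p_def)
  have sa: "star B q = q" "star B p = p" using u v by (auto simp: q_def p_def star_mult)
  have qq: "q \<otimes> q = q"
  proof -
    have "q \<otimes> q = star B u \<otimes> (u \<otimes> star B u \<otimes> u)" using u(1) by (simp add: q_def m_assoc)
    then show ?thesis using u by (simp add: q_def)
  qed
  have pp: "p \<otimes> p = p"
  proof -
    have "p \<otimes> p = (v \<otimes> star B v \<otimes> v) \<otimes> star B v" using v(1) by (simp add: p_def m_assoc)
    then show ?thesis using v by (simp add: p_def)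
  qed
  have qpqp: "q \<otimes> p \<otimes> q \<otimes> p = q \<otimes> p"
  proof -
    have "q \<otimes> p \<otimes> q \<otimes> p = star B u \<otimes> ((u \<otimes> v) \<otimes> star B (u \<otimes> v) \<otimes> (u \<otimes> v)) \<otimes> star B v"
      using u v by (simp add: q_def p_def star_mult m_assoc)
    also have "\<dots> = q \<otimes> p" unfolding uv using u v by (simp add: q_def p_def m_assoc)
    finally show ?thesis .
  qed
  have qpqpq: "q \<otimes> p \<otimes> q \<otimes> p \<otimes> q = q \<otimes> p \<otimes> q" using qpqp by simp
  define x where "x = q \<otimes> p \<ominus> q \<otimes> p \<otimes> q"
  have xc: "x \<in> carrier B" using c by (simp add: x_def)
  have sx: "star B x = p \<otimes> q \<ominus> q \<otimes> p \<otimes> q" using c sa by (simp add: x_def star_minus star_mult m_assoc)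
  have expand: "(a \<ominus> b) \<otimes> (a' \<ominus> b) = (a \<otimes> a' \<ominus> a \<otimes> b) \<ominus> (b \<otimes> a' \<ominus> b \<otimes> b)"
    if "a \<in> carrier B" "b \<in> carrier B" "a' \<in> carrier B" for a a' b
    using that by algebra
  have prods: "(q \<otimes> p) \<otimes> (p \<otimes> q) = q \<otimes> p \<otimes> q" "(q \<otimes> p) \<otimes> (q \<otimes> p \<otimes> q) = q \<otimes> p \<otimes> q"
    "(q \<otimes> p \<otimes> q) \<otimes> (p \<otimes> q) = q \<otimes> p \<otimes> q" "(q \<otimes> p \<otimes> q) \<otimes> (q \<otimes> p \<otimes> q) = q \<otimes> p \<otimes> q"
  proof -
    have "(q \<otimes> p) \<otimes> (p \<otimes> q) = q \<otimes> (p \<otimes> p) \<otimes> q" using c by (simp add: m_assoc)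
    then show "(q \<otimes> p) \<otimes> (p \<otimes> q) = q \<otimes> p \<otimes> q" by (simp only: pp)
    have "(q \<otimes> p) \<otimes> (q \<otimes> p \<otimes> q) = q \<otimes> p \<otimes> q \<otimes> p \<otimes> q" using c by (simp add: m_assoc)
    then show "(q \<otimes> p) \<otimes> (q \<otimes> p \<otimes> q) = q \<otimes> p \<otimes> q" by (simp only: qpqpq)
    have "(q \<otimes> p \<otimes> q) \<otimes> (p \<otimes> q) = q \<otimes> p \<otimes> q \<otimes> p \<otimes> q" using c by (simp add: m_assoc)
    then show "(q \<otimes> p \<otimes> q) \<otimes> (p \<otimes> q) = q \<otimes> p \<otimes> q" by (simp only: qpqpq)
    have "(q \<otimes> p \<otimes> q) \<otimes> (q \<otimes> p \<otimes> q) = q \<otimes> p \<otimes> (q \<otimes> q) \<otimes> p \<otimes> q" using c by (simp add: m_assoc)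
    then show "(q \<otimes> p \<otimes> q) \<otimes> (q \<otimes> p \<otimes> q) = q \<otimes> p \<otimes> q" by (simp only: qq qpqpq)
  qed
  have "x \<otimes> star B x = (q \<otimes> p \<otimes> q \<ominus> q \<otimes> p \<otimes> q) \<ominus> (q \<otimes> p \<otimes> q \<ominus> q \<otimes> p \<otimes> q)" unfolding sx unfolding x_def
    using expand[of "q \<otimes> p" "q \<otimes> p \<otimes> q" "p \<otimes> q", unfolded prods] c by (simp only: m_closed)
  also have "\<dots> = \<zero>" using c by (simp add: minus_eq_0_iff)
  finally have "x = \<zero>" by (rule mult_star_self_eq_0[OF xc])
  then have "q \<otimes> p = q \<otimes> p \<otimes> q" using c by (simp add: x_def minus_eq_0_iff)
  moreover from arg_cong[OF this, of "star B"] have "p \<otimes> q = q \<otimes> p \<otimes> q" using c sa by (simp add: star_mult m_assoc)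
  ultimately show ?thesis by (simp flip: q_def p_def)
qed

lemma orthogonal_sum_mult:
  assumes fin: "finite I" and c: "\<And>i. i \<in> I \<Longrightarrow> x i \<in> carrier B" "\<And>i. i \<in> I \<Longrightarrow> y i \<in> carrier B"
    and o: "\<And>i j. i \<in> I \<Longrightarrow> j \<in> I \<Longrightarrow> i \<noteq> j \<Longrightarrow> x i \<otimes> y j = \<zero>"
  shows "(\<Oplus>i\<in>I. x i) \<otimes> (\<Oplus>i\<in>I. y i) = (\<Oplus>i\<in>I. x i \<otimes> y i)"
proof -
  have "(\<Oplus>i\<in>I. x i) \<otimes> (\<Oplus>i\<in>I. y i) = (\<Oplus>i\<in>I. x i \<otimes> (\<Oplus>i\<in>I. y i))" using fin c by (intro finsum_ldistr) (auto intro!: finsum_closed)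
  also have "\<dots> = (\<Oplus>i\<in>I. x i \<otimes> y i)"
  proof (intro finsum_cong' refl Pi_I)
    fix i assume i: "i \<in> I"
    have "x i \<otimes> (\<Oplus>i\<in>I. y i) = (\<Oplus>j\<in>I. x i \<otimes> y j)" using fin c i by (intro finsum_rdistr) auto
    also have "\<dots> = (\<Oplus>j\<in>I. if j = i then x i \<otimes> y i else \<zero>)" using c i o by (intro finsum_cong') auto
    also have "\<dots> = x i \<otimes> y i" using fin c i by (subst finsum_delta) auto
    finally show "x i \<otimes> (\<Oplus>i\<in>I. y i) = x i \<otimes> y i" .
  qed (use c in auto)
  finally show ?thesis .
qed

lemma orthogonal_sum_partial_isometry:
  assumes fin: "finite I" and c: "\<And>i. i \<in> I \<Longrightarrow> x i \<in> carrier B"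
    and o1: "\<And>i j. i \<in> I \<Longrightarrow> j \<in> I \<Longrightarrow> i \<noteq> j \<Longrightarrow> x i \<otimes> star B (x j) = \<zero>"
    and o2: "\<And>i j. i \<in> I \<Longrightarrow> j \<in> I \<Longrightarrow> i \<noteq> j \<Longrightarrow> star B (x i) \<otimes> x j = \<zero>"
    and pi: "\<And>i. i \<in> I \<Longrightarrow> x i \<otimes> star B (x i) \<otimes> x i = x i"
  shows "(\<Oplus>i\<in>I. x i) \<otimes> star B (\<Oplus>i\<in>I. x i) \<otimes> (\<Oplus>i\<in>I. x i) = (\<Oplus>i\<in>I. x i)"
proof -
  have "star B (\<Oplus>i\<in>I. x i) = (\<Oplus>i\<in>I. star B (x i))" using c by (intro star_finsum) auto
  then have "(\<Oplus>i\<in>I. x i) \<otimes> star B (\<Oplus>i\<in>I. x i) = (\<Oplus>i\<in>I. x i \<otimes> star B (x i))" using orthogonal_sum_mult[OF fin c _ o1] c by simp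
  then have "(\<Oplus>i\<in>I. x i) \<otimes> star B (\<Oplus>i\<in>I. x i) \<otimes> (\<Oplus>i\<in>I. x i)
      = (\<Oplus>i\<in>I. x i \<otimes> star B (x i)) \<otimes> (\<Oplus>i\<in>I. x i)" by simp
  also have "\<dots> = (\<Oplus>i\<in>I. x i \<otimes> star B (x i) \<otimes> x i)" using c o2 by (intro orthogonal_sum_mult fin) (auto simp: m_assoc)
  also have "\<dots> = (\<Oplus>i\<in>I. x i)" using c pi by (intro finsum_cong') auto
  finally show ?thesis .
qed

end

subsection \<open>The defining relations\<close>

lemma word_product_Nil [simp]: "word_product B u [] x = \<one>\<^sub>B" by (simp add: word_product_def)

lemma word_product_Cons [simp]:
  "word_product B u (a # x) (b # y) = u a b \<otimes>\<^sub>B word_product B u x y" by (simp add: word_product_def)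

lemma words_length: "x \<in> words A n \<Longrightarrow> length x = n" by (simp add: words_def)

lemma words_tail: "a # x \<in> words A (Suc n) \<Longrightarrow> x \<in> words A n" by (force simp: words_def)

lemma words_Cons2: "a # b # x \<in> words A (Suc n) \<longleftrightarrow> A $ a $ b = 1 \<and> b # x \<in> words A n"
  by (auto simp: words_def nth_Cons split: nat.splits)

lemma (in star_alg) word_product_closed:
  assumes "\<And>a b. u a b \<in> carrier B"
  shows "word_product B u x y \<in> carrier B"
proof (induction x arbitrary: y)
  case (Cons a x)
  then show ?case by (cases y) (auto simp: assms word_product_def[of _ _ _ "[]"])
qed simp

lemma word_product_hom:
  assumes "star_alg_hom B D \<theta>" "\<And>a b. u a b \<in> carrier B"
  shows "\<theta> (word_product B u x y) = word_product D (\<lambda>a b. \<theta> (u a b)) x y"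
proof -
  interpret star_alg_hom B D \<theta> by fact
  show ?thesis
  proof (induction x arbitrary: y)
    case (Cons a x)
    then show ?case by (cases y) (auto simp: hom_one hom_mult assms B.word_product_closed word_product_def[of _ _ _ "[]"])
  qed (simp add: hom_one)
qed

text \<open>Each relation is an equation modulo elements of seminorm 0, so a homomorphism preserving
  the seminorm both preserves and reflects it. This transports the relations to completions and to
  pulled-back seminorms.\<close>

lemma GA_relations_hom:
  fixes u :: "'n::finite \<Rightarrow> 'n \<Rightarrow> 'a"
  assumes h: "star_alg_hom B D \<theta>" and u: "\<And>a b. u a b \<in> carrier B"
    and iso: "\<And>x. x \<in> carrier B \<Longrightarrow> nrm D (\<theta> x) = nrm B x"
  shows "GA_relations A l D (\<lambda>a b. \<theta> (u a b)) \<longleftrightarrow> GA_relations A l B u"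
proof -
  interpret star_alg_hom B D \<theta> by fact
  have eq: "eqv D (\<theta> x) (\<theta> y) \<longleftrightarrow> eqv B x y" if "x \<in> carrier B" "y \<in> carrier B" for x y
    using that iso[of "x \<ominus>\<^sub>B y"] by (simp add: eqv_def hom_minus)
  have pi: "partial_isometry D (\<theta> v) \<longleftrightarrow> partial_isometry B v" if "v \<in> carrier B" for v
    unfolding partial_isometry_def using that eq[of "v \<otimes>\<^sub>B star B v \<otimes>\<^sub>B v" v] by (simp add: hom_mult hom_star)
  have pr: "projection D (\<theta> v) \<longleftrightarrow> projection B v" if "v \<in> carrier B" for v
    unfolding projection_def using that eq[of "v \<otimes>\<^sub>B v" v] eq[of "star B v" v] by (simp add: hom_mult hom_star)
  have sum: "(\<Oplus>\<^sub>D i\<in>UNIV. \<theta> (f i)) = \<theta> (\<Oplus>\<^sub>B i\<in>UNIV. f i)" if "\<And>i. f i \<in> carrier B" for f :: "'n \<Rightarrow> 'a"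
    using that by (intro hom_finsum[symmetric]) auto
  have ssum: "(\<Oplus>\<^sub>D i\<in>UNIV. c i \<odot>\<^sub>D \<theta> (f i)) = \<theta> (\<Oplus>\<^sub>B i\<in>UNIV. c i \<odot>\<^sub>B f i)" if "\<And>i. f i \<in> carrier B" for c and f :: "'n \<Rightarrow> 'a"
    using sum[of "\<lambda>i. c i \<odot>\<^sub>B f i"] that by (simp add: hom_smult)
  have cl: "(\<Oplus>\<^sub>B i\<in>UNIV. f i) \<in> carrier B" if "\<And>i. f i \<in> carrier B" for f :: "'n \<Rightarrow> 'a" using that by (intro B.finsum_closed) auto
  have magic: "magic_unitary D (\<lambda>a b. \<theta> (r a b)) \<longleftrightarrow> magic_unitary B r" if r: "\<And>a b. r a b \<in> carrier B" for r :: "'n \<Rightarrow> 'n \<Rightarrow> 'a"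
    unfolding magic_unitary_def by (simp add: pr r sum eq cl flip: hom_one)
  have fixv: "fixes_vector D (\<lambda>a b. \<theta> (r a b)) v \<longleftrightarrow> fixes_vector B r v" if r: "\<And>a b. r a b \<in> carrier B" for r :: "'n \<Rightarrow> 'n \<Rightarrow> 'a" and v
  proof -
    have "c \<odot>\<^sub>D \<one>\<^sub>D = \<theta> (c \<odot>\<^sub>B \<one>\<^sub>B)" for c by (simp add: hom_smult hom_one)
    then show ?thesis unfolding fixes_vector_def by (simp add: r ssum eq cl)
  qed
  have p: "\<theta> (u a b) \<otimes>\<^sub>D star D (\<theta> (u a b)) = \<theta> (u a b \<otimes>\<^sub>B star B (u a b))"
    and q: "star D (\<theta> (u a b)) \<otimes>\<^sub>D \<theta> (u a b) = \<theta> (star B (u a b) \<otimes>\<^sub>B u a b)" for a b using u by (simp_all add: hom_mult hom_star)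
  have w: "word_product D (\<lambda>a b. \<theta> (u a b)) z d = \<theta> (word_product B u z d)" for z d using word_product_hom[OF h, of u z d] u by simp
  show ?thesis unfolding GA_relations_def Let_def p q w by (simp add: pi magic fixv ssum eq cl u B.word_product_closed)
qed

section \<open>The relations as equations in a definite norm\<close>

context cstar_normed
begin

lemma eqv_iff: "x \<in> carrier B \<Longrightarrow> y \<in> carrier B \<Longrightarrow> eqv B x y \<longleftrightarrow> x = y"
  unfolding eqv_def using nrm_eq_0[of "x \<ominus> y"] minus_eq_0_iff[of x y] nrm_zero by auto

definition magic :: "('n::finite \<Rightarrow> 'n \<Rightarrow> 'a) \<Rightarrow> bool" where
  "magic r \<longleftrightarrow> (\<forall>x y. star B (r x y) = r x y \<and> r x y \<otimes> r x y = r x y)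
    \<and> (\<forall>x. (\<Oplus>y\<in>UNIV. r x y) = \<one>) \<and> (\<forall>y. (\<Oplus>x\<in>UNIV. r x y) = \<one>)"

lemma magic_iff: "(\<And>x y. r x y \<in> carrier B) \<Longrightarrow> magic_unitary B r \<longleftrightarrow> magic r"
  unfolding magic_unitary_def magic_def projection_def by (simp add: eqv_iff finsum_closed Pi_def)

lemma fixes_vector_iff:
  "(\<And>x y. r x y \<in> carrier B) \<Longrightarrow> fixes_vector B r v \<longleftrightarrow>
    (\<forall>x. (\<Oplus>y\<in>UNIV. of_real (v $ y) \<odot> r x y) = of_real (v $ x) \<odot> \<one>)"
  unfolding fixes_vector_def by (simp add: eqv_iff finsum_closed Pi_def)

lemma partial_isometry_iff: "v \<in> carrier B \<Longrightarrow> partial_isometry B v \<longleftrightarrow> v \<otimes> star B v \<otimes> v = v"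
  unfolding partial_isometry_def by (simp add: eqv_iff)

lemma GA_relations_iff:
  fixes u :: "'n::finite \<Rightarrow> 'n \<Rightarrow> 'a"
  assumes u: "\<And>x y. u x y \<in> carrier B"
  shows "GA_relations A l B u \<longleftrightarrow>
      (\<forall>x y. u x y \<otimes> star B (u x y) \<otimes> u x y = u x y)
      \<and> magic (\<lambda>x y. u x y \<otimes> star B (u x y)) \<and> magic (\<lambda>x y. star B (u x y) \<otimes> u x y)
      \<and> (\<forall>x. (\<Oplus>y\<in>UNIV. of_real (perron_vector A $ y) \<odot> (u x y \<otimes> star B (u x y))) = of_real (perron_vector A $ x) \<odot> \<one>)
      \<and> (\<forall>x. (\<Oplus>y\<in>UNIV. of_real (perron_vector A $ y) \<odot> (star B (u x y) \<otimes> u x y)) = of_real (perron_vector A $ x) \<odot> \<one>)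
      \<and> (\<forall>x y. (\<Oplus>z\<in>UNIV. of_real (A $ x $ z) \<odot> (u z y \<otimes> star B (u z y)))
               = (\<Oplus>z\<in>UNIV. of_real (A $ z $ y) \<odot> (star B (u x z) \<otimes> u x z)))
      \<and> (\<forall>n. enat n \<le> l \<longrightarrow> (\<forall>x\<in>words A n. \<forall>y\<in>words A n.
            word_product B u x y \<otimes> star B (word_product B u x y) \<otimes> word_product B u x y = word_product B u x y))"
proof -
  have c: "u x y \<otimes> star B (u x y) \<in> carrier B" "star B (u x y) \<otimes> u x y \<in> carrier B" for x y using u by auto
  have s: "(\<Oplus>z\<in>UNIV. k z \<odot> f z) \<in> carrier B" if "\<And>z. f z \<in> carrier B" for k and f :: "'n \<Rightarrow> 'a" using that by (intro finsum_closed) auto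
  have e: "eqv B (\<Oplus>z\<in>UNIV. of_real (A $ x $ z) \<odot> (u z y \<otimes> star B (u z y)))
               (\<Oplus>z\<in>UNIV. of_real (A $ z $ y) \<odot> (star B (u x z) \<otimes> u x z)) \<longleftrightarrow>
      (\<Oplus>z\<in>UNIV. of_real (A $ x $ z) \<odot> (u z y \<otimes> star B (u z y)))
               = (\<Oplus>z\<in>UNIV. of_real (A $ z $ y) \<odot> (star B (u x z) \<otimes> u x z))" for x y
    by (intro eqv_iff s c)
  show ?thesis
    unfolding GA_relations_def Let_def magic_iff[OF c(1)] magic_iff[OF c(2)] fixes_vector_iff[OF c(1)] fixes_vector_iff[OF c(2)] e
    by (simp only: partial_isometry_iff u word_product_closed)
qed

end

locale GA_alg = cstar_normed B for B :: "'a star_algebra" (structure) +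
  fixes A :: "real^'n^'n" and l :: enat and u :: "'n \<Rightarrow> 'n \<Rightarrow> 'a"
  assumes A01: "A $ i $ j \<in> {0, 1}"
    and u_closed [simp, intro]: "u a b \<in> carrier B"
    and rel: "GA_relations A l B u"
begin

abbreviation p where "p a b \<equiv> u a b \<otimes> star B (u a b)"
abbreviation q where "q a b \<equiv> star B (u a b) \<otimes> u a b"
abbreviation wp where "wp \<equiv> word_product B u"

lemmas rels = rel[unfolded GA_relations_iff[OF u_closed]]

lemma u_pi: "u a b \<otimes> star B (u a b) \<otimes> u a b = u a b" using rels by blast
lemma magic_p: "magic p" using rels by blast
lemma magic_q: "magic q" using rels by blast
lemma fix_p: "(\<Oplus>y\<in>UNIV. of_real (perron_vector A $ y) \<odot> p x y) = of_real (perron_vector A $ x) \<odot> \<one>" using rels by blast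
lemma fix_q: "(\<Oplus>y\<in>UNIV. of_real (perron_vector A $ y) \<odot> q x y) = of_real (perron_vector A $ x) \<odot> \<one>" using rels by blast
lemma Ap_qA: "(\<Oplus>z\<in>UNIV. of_real (A $ x $ z) \<odot> p z y) = (\<Oplus>z\<in>UNIV. of_real (A $ z $ y) \<odot> q x z)" using rels by blast
lemma word_pi: "enat n \<le> l \<Longrightarrow> x \<in> words A n \<Longrightarrow> y \<in> words A n \<Longrightarrow> wp x y \<otimes> star B (wp x y) \<otimes> wp x y = wp x y" using rels by blast

lemma wp_closed [simp, intro]: "wp x y \<in> carrier B" by (rule word_product_closed) simp

lemma magic_orth:
  assumes r: "\<And>a b. r a b \<in> carrier B" and m: "magic r"
  shows "b \<noteq> b' \<Longrightarrow> r a b \<otimes> r a b' = \<zero>" "a \<noteq> a' \<Longrightarrow> r a b \<otimes> r a' b = \<zero>"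
proof -
  show "r a b \<otimes> r a b' = \<zero>" if "b \<noteq> b'"
    using m that unfolding magic_def by (intro projections_orthogonal[of UNIV "\<lambda>b. r a b"]) (auto simp: r)
  show "r a b \<otimes> r a' b = \<zero>" if "a \<noteq> a'"
    using m that unfolding magic_def by (intro projections_orthogonal[of UNIV "\<lambda>a. r a b"]) (auto simp: r)
qed

lemma p_orth: "b \<noteq> b' \<Longrightarrow> p a b \<otimes> p a b' = \<zero>" "a \<noteq> a' \<Longrightarrow> p a b \<otimes> p a' b = \<zero>" using magic_orth[OF _ magic_p] by auto

lemma q_orth: "b \<noteq> b' \<Longrightarrow> q a b \<otimes> q a b' = \<zero>" "a \<noteq> a' \<Longrightarrow> q a b \<otimes> q a' b = \<zero>" using magic_orth[OF _ magic_q] by auto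

lemma star_u_pi: "star B (u a b) \<otimes> u a b \<otimes> star B (u a b) = star B (u a b)"
  using arg_cong[OF u_pi[of a b], of "star B"] by (simp add: star_mult m_assoc)

lemma u_star_u_0:
  assumes "q a b \<otimes> q a' b' = \<zero>"
  shows "u a b \<otimes> star B (u a' b') = \<zero>"
proof -
  have "u a b \<otimes> star B (u a' b') = (u a b \<otimes> star B (u a b) \<otimes> u a b) \<otimes> (star B (u a' b') \<otimes> u a' b' \<otimes> star B (u a' b'))"
    by (simp only: u_pi star_u_pi)
  also have "\<dots> = u a b \<otimes> (q a b \<otimes> q a' b') \<otimes> star B (u a' b')" by (simp add: m_assoc)
  finally show ?thesis by (simp add: assms)
qed

lemma star_u_u_0:
  assumes "p a b \<otimes> p a' b' = \<zero>"
  shows "star B (u a b) \<otimes> u a' b' = \<zero>"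
proof -
  have "star B (u a b) \<otimes> u a' b' = (star B (u a b) \<otimes> u a b \<otimes> star B (u a b)) \<otimes> (u a' b' \<otimes> star B (u a' b') \<otimes> u a' b')"
    by (simp only: u_pi star_u_pi)
  also have "\<dots> = star B (u a b) \<otimes> (p a b \<otimes> p a' b') \<otimes> u a' b'" by (simp add: m_assoc)
  finally show ?thesis by (simp add: assms)
qed

lemma u_row_0: "b \<noteq> b' \<Longrightarrow> u a b \<otimes> star B (u a b') = \<zero>" "b \<noteq> b' \<Longrightarrow> star B (u a b) \<otimes> u a b' = \<zero>"
  by (intro u_star_u_0 star_u_u_0 q_orth p_orth; assumption)+

text \<open>Multiply the (a, c') entry of Ap = qA by q_ac on the left and by p_a'c' on the right.
  Orthogonality in a column of p and in a row of q leaves one summand on each side.\<close>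

lemma A_q_p: "of_real (A $ a $ a') \<odot> (q a c \<otimes> p a' c') = of_real (A $ c $ c') \<odot> (q a c \<otimes> p a' c')"
proof -
  have 1: "q a c \<otimes> (\<Oplus>x\<in>UNIV. of_real (A $ a $ x) \<odot> p x c') \<otimes> p a' c' = of_real (A $ a $ a') \<odot> (q a c \<otimes> p a' c')"
  proof -
    have "(\<Oplus>x\<in>UNIV. of_real (A $ a $ x) \<odot> p x c') \<otimes> p a' c' = (\<Oplus>x\<in>UNIV. (of_real (A $ a $ x) \<odot> p x c') \<otimes> p a' c')"
      by (intro finsum_ldistr) auto
    also have "\<dots> = (\<Oplus>x\<in>UNIV. if x = a' then of_real (A $ a $ a') \<odot> p a' c' else \<zero>)"
      using magic_p by (intro finsum_cong') (auto simp: smult_mult_l p_orth magic_def)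
    also have "\<dots> = of_real (A $ a $ a') \<odot> p a' c'" by (subst finsum_delta) auto
    finally have s: "(\<Oplus>x\<in>UNIV. of_real (A $ a $ x) \<odot> p x c') \<otimes> p a' c' = of_real (A $ a $ a') \<odot> p a' c'" .
    have "(\<Oplus>x\<in>UNIV. of_real (A $ a $ x) \<odot> p x c') \<in> carrier B" by (intro finsum_closed) auto
    then have "q a c \<otimes> (\<Oplus>x\<in>UNIV. of_real (A $ a $ x) \<odot> p x c') \<otimes> p a' c' = q a c \<otimes> (of_real (A $ a $ a') \<odot> p a' c')"
      unfolding s[symmetric] by (intro m_assoc) auto
    then show ?thesis by (simp add: smult_mult_r)
  qed
  have 2: "q a c \<otimes> (\<Oplus>x\<in>UNIV. of_real (A $ x $ c') \<odot> q a x) \<otimes> p a' c' = of_real (A $ c $ c') \<odot> (q a c \<otimes> p a' c')"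
  proof -
    have "q a c \<otimes> (\<Oplus>x\<in>UNIV. of_real (A $ x $ c') \<odot> q a x) = (\<Oplus>x\<in>UNIV. q a c \<otimes> (of_real (A $ x $ c') \<odot> q a x))"
      by (intro finsum_rdistr) auto
    also have "\<dots> = (\<Oplus>x\<in>UNIV. if x = c then of_real (A $ c $ c') \<odot> q a c else \<zero>)"
      using magic_q by (intro finsum_cong') (auto simp: smult_mult_r q_orth magic_def)
    also have "\<dots> = of_real (A $ c $ c') \<odot> q a c" by (subst finsum_delta) auto
    finally show ?thesis by (simp add: smult_mult_l)
  qed
  show ?thesis using 1 2 Ap_qA[of a c'] by simp
qed

lemma q_p_0: "A $ a $ a' \<noteq> A $ c $ c' \<Longrightarrow> q a c \<otimes> p a' c' = \<zero>" using A_q_p[of a a' c c'] A01[of a a'] A01[of c c'] by auto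

lemma u_u_0:
  assumes "A $ a $ a' \<noteq> A $ c $ c'"
  shows "u a c \<otimes> u a' c' = \<zero>"
proof -
  have "u a c \<otimes> u a' c' = (u a c \<otimes> star B (u a c) \<otimes> u a c) \<otimes> (u a' c' \<otimes> star B (u a' c') \<otimes> u a' c')" by (simp only: u_pi)
  also have "\<dots> = u a c \<otimes> (q a c \<otimes> p a' c') \<otimes> u a' c'" by (simp add: m_assoc)
  finally show ?thesis by (simp add: q_p_0[OF assms])
qed

text \<open>If x is admissible and y is not, some transition has A = 1 in x and A = 0 in y, and the
  product contains the two corresponding consecutive factors, whose product vanishes by
  \<open>u_u_0\<close>. This discards inadmissible intermediate words in the coproduct.\<close>

lemma wp_non_word:
  assumes "x \<in> words A n" "length y = n" "y \<notin> words A n"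
  shows "wp x y = \<zero>" using assms
proof (induction x arbitrary: y n)
  case Nil
  then show ?case by (auto simp: words_def)
next
  case (Cons a x)
  then obtain m where n: "n = Suc m" using words_length by (metis length_Cons)
  then obtain c y' where y: "y = c # y'" "length y' = m" using Cons.prems by (cases y) auto
  have la: "length x = m" using words_length[OF Cons.prems(1)] n by simp
  show ?case
  proof (cases x)
    case Nil
    then have "y' = []" using la y by simp
    then have "y \<in> words A n" using n y la Nil by (auto simp: words_def)
    then show ?thesis using Cons.prems by simp
  next
    case x: (Cons a' x'')
    then obtain c' y'' where y': "y' = c' # y''" using la y by (cases y') auto
    show ?thesis
    proof (cases "A $ c $ c' = 1")
      case True
      then have "y' \<notin> words A m" using Cons.prems(3) y y' n words_Cons2 by blast
      then have "wp x y' = \<zero>" using Cons.IH[of m y'] words_tail Cons.prems(1) n y by blast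
      then show ?thesis unfolding y(1) by simp
    next
      case False
      have "A $ a $ a' = 1" using Cons.prems(1) x n words_Cons2 by blast
      then have "u a c \<otimes> u a' c' = \<zero>" using False by (intro u_u_0) auto
      moreover have "wp (a # x) y = (u a c \<otimes> u a' c') \<otimes> wp x'' y''" unfolding y(1) y' x by (simp add: m_assoc)
      ultimately show ?thesis by simp
    qed
  qed
qed

text \<open>Condition (III) enters twice, for a word and for the word without its first letter;
  \<open>partial_isometry_commute\<close> turns the two into commutation.\<close>

lemma wp_commute:
  assumes "enat (Suc n) \<le> l" "a # x \<in> words A (Suc n)" "c # y \<in> words A (Suc n)"
  shows "q a c \<otimes> (wp x y \<otimes> star B (wp x y)) = (wp x y \<otimes> star B (wp x y)) \<otimes> q a c"
proof (rule partial_isometry_commute)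
  have "enat n \<le> l" using assms(1) by (meson enat_ord_simps(1) le_SucI order_refl order_trans)
  then show "wp x y \<otimes> star B (wp x y) \<otimes> wp x y = wp x y" using assms words_tail by (intro word_pi)
  show "(u a c \<otimes> wp x y) \<otimes> star B (u a c \<otimes> wp x y) \<otimes> (u a c \<otimes> wp x y) = u a c \<otimes> wp x y" using word_pi[OF assms] by simp
qed (use u_pi in auto)

text \<open>Induction on x, peeling off the first letter. For one product differing tails, for the
  other differing first letters, expose a vanishing factor at once. In the remaining case the
  projection q_ac is moved past the range projection of the tail by \<open>wp_commute\<close> to
  expose it.\<close>

lemma wp_orth:
  assumes "enat n \<le> l" "x \<in> words A n" "y \<in> words A n" "y' \<in> words A n" "y \<noteq> y'"
  shows "wp x y \<otimes> star B (wp x y') = \<zero> \<and> star B (wp x y) \<otimes> wp x y' = \<zero>" using assms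
proof (induction x arbitrary: y y' n)
  case Nil
  then show ?case by (auto simp: words_def)
next
  case (Cons a x)
  then obtain m where n: "n = Suc m" by (auto simp: words_def)
  obtain c \<delta> c' \<delta>' where y: "y = c # \<delta>" "y' = c' # \<delta>'" using Cons.prems n by (metis words_length length_Suc_conv)
  have ml: "enat m \<le> l" using Cons.prems(1) n by (meson enat_ord_simps(1) le_SucI order_refl order_trans)
  have W: "x \<in> words A m" "\<delta> \<in> words A m" "\<delta>' \<in> words A m" using Cons.prems n y words_tail by blast+
  let ?U = "wp x \<delta>" and ?U' = "wp x \<delta>'"
  have com: "q a c \<otimes> (?U \<otimes> star B ?U) = (?U \<otimes> star B ?U) \<otimes> q a c" using Cons.prems n y by (intro wp_commute) auto
  have Upi: "?U \<otimes> star B ?U \<otimes> ?U = ?U" by (rule word_pi[OF ml W(1,2)])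
  have sUpi: "star B ?U \<otimes> (?U \<otimes> star B ?U) = star B ?U" using arg_cong[OF Upi, of "star B"] by (simp add: star_mult m_assoc)
  have "wp (a # x) y \<otimes> star B (wp (a # x) y') = \<zero>"
  proof (cases "\<delta> = \<delta>'")
    case False
    then have z: "?U \<otimes> star B ?U' = \<zero>" using Cons.IH[OF ml W] by blast
    have "wp (a # x) y \<otimes> star B (wp (a # x) y') = u a c \<otimes> (?U \<otimes> star B ?U') \<otimes> star B (u a c')"
      unfolding y by (simp add: star_mult m_assoc)
    then show ?thesis by (simp add: z)
  next
    case True
    then have cc: "c \<noteq> c'" using Cons.prems y by auto
    have "wp (a # x) y \<otimes> star B (wp (a # x) y') = u a c \<otimes> (?U \<otimes> star B ?U) \<otimes> star B (u a c')"
      unfolding y True by (simp add: star_mult m_assoc)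
    also have "u a c = u a c \<otimes> q a c" using u_pi[of a c] by (simp add: m_assoc)
    also have "u a c \<otimes> q a c \<otimes> (?U \<otimes> star B ?U) \<otimes> star B (u a c') = u a c \<otimes> (q a c \<otimes> (?U \<otimes> star B ?U)) \<otimes> star B (u a c')"
      by (simp add: m_assoc)
    also have "\<dots> = u a c \<otimes> ((?U \<otimes> star B ?U) \<otimes> q a c) \<otimes> star B (u a c')" unfolding com ..
    also have "\<dots> = u a c \<otimes> (?U \<otimes> star B ?U) \<otimes> star B (u a c) \<otimes> (u a c \<otimes> star B (u a c'))" by (simp add: m_assoc)
    finally show ?thesis by (simp add: u_row_0(1)[OF cc])
  qed
  moreover have "star B (wp (a # x) y) \<otimes> wp (a # x) y' = \<zero>"
  proof (cases "c = c'")
    case False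
    have "star B (wp (a # x) y) \<otimes> wp (a # x) y' = star B ?U \<otimes> (star B (u a c) \<otimes> u a c') \<otimes> ?U'"
      unfolding y by (simp add: star_mult m_assoc)
    then show ?thesis by (simp add: u_row_0(2)[OF False])
  next
    case True
    then have "\<delta> \<noteq> \<delta>'" using Cons.prems y by auto
    then have z: "star B ?U \<otimes> ?U' = \<zero>" using Cons.IH[OF ml W] by blast
    have "star B (wp (a # x) y) \<otimes> wp (a # x) y' = star B ?U \<otimes> q a c \<otimes> ?U'" unfolding y True by (simp add: star_mult m_assoc)
    also have "star B ?U = star B ?U \<otimes> (?U \<otimes> star B ?U)" by (simp only: sUpi)
    also have "star B ?U \<otimes> (?U \<otimes> star B ?U) \<otimes> q a c \<otimes> ?U' = star B ?U \<otimes> ((?U \<otimes> star B ?U) \<otimes> q a c) \<otimes> ?U'" by (simp add: m_assoc)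
    also have "\<dots> = star B ?U \<otimes> (q a c \<otimes> (?U \<otimes> star B ?U)) \<otimes> ?U'" unfolding com ..
    also have "\<dots> = star B ?U \<otimes> q a c \<otimes> ?U \<otimes> (star B ?U \<otimes> ?U')" by (simp add: m_assoc)
    finally show ?thesis by (simp add: z)
  qed
  ultimately show ?case by blast
qed

subsection \<open>The coproduct\<close>

sublocale T: tensor_pair B B by unfold_locales

abbreviation TT where "TT \<equiv> min_tensor B B"
abbreviation V where "V a b \<equiv> (\<Oplus>\<^sub>TT c\<in>UNIV. T.pt (u a c) (u c b))"
abbreviation tens where "tens r s a b \<equiv> (\<Oplus>\<^sub>TT c\<in>UNIV. T.pt (r a c) (s c b))"

lemma V_closed [simp, intro]: "V a b \<in> carrier TT" by (intro T.MT.finsum_closed) auto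

lemma V_legs_orth:
  assumes "c \<noteq> d"
  shows "T.pt (u a c) (u c b) \<otimes>\<^sub>TT star TT (T.pt (u a d) (u d b)) = \<zero>\<^sub>TT"
    "star TT (T.pt (u a c) (u c b)) \<otimes>\<^sub>TT T.pt (u a d) (u d b) = \<zero>\<^sub>TT" by (simp_all add: T.pt_star T.pt_mult u_row_0[OF assms])

lemma star_V: "star TT (V a b) = (\<Oplus>\<^sub>TT c\<in>UNIV. star TT (T.pt (u a c) (u c b)))" by (intro T.MT.star_finsum) auto

lemma V_p: "V a b \<otimes>\<^sub>TT star TT (V a b) = tens p p a b"
proof -
  have "V a b \<otimes>\<^sub>TT star TT (V a b) = (\<Oplus>\<^sub>TT c\<in>UNIV. T.pt (u a c) (u c b) \<otimes>\<^sub>TT star TT (T.pt (u a c) (u c b)))"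
    unfolding star_V by (intro T.MT.orthogonal_sum_mult) (auto simp: V_legs_orth)
  also have "\<dots> = tens p p a b" by (simp add: T.pt_star T.pt_mult)
  finally show ?thesis .
qed

lemma V_q: "star TT (V a b) \<otimes>\<^sub>TT V a b = tens q q a b"
proof -
  have "star TT (V a b) \<otimes>\<^sub>TT V a b = (\<Oplus>\<^sub>TT c\<in>UNIV. star TT (T.pt (u a c) (u c b)) \<otimes>\<^sub>TT T.pt (u a c) (u c b))"
    unfolding star_V by (intro T.MT.orthogonal_sum_mult) (auto simp: V_legs_orth)
  also have "\<dots> = tens q q a b" by (simp add: T.pt_star T.pt_mult)
  finally show ?thesis .
qed

lemma V_pi: "V a b \<otimes>\<^sub>TT star TT (V a b) \<otimes>\<^sub>TT V a b = V a b" by (rule T.MT.orthogonal_sum_partial_isometry)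
    (simp_all add: V_legs_orth, simp add: T.pt_star T.pt_mult u_pi)

lemma tens_left:
  fixes r s :: "'n \<Rightarrow> 'n \<Rightarrow> 'a"
  assumes r: "\<And>a b. r a b \<in> carrier B" and s: "\<And>a b. s a b \<in> carrier B"
  shows "(\<Oplus>\<^sub>TT b\<in>UNIV. k b \<odot>\<^sub>TT tens r s a b) = (\<Oplus>\<^sub>TT c\<in>UNIV. T.pt (r a c) (\<Oplus>b\<in>UNIV. k b \<odot> s c b))"
proof -
  have "(\<Oplus>\<^sub>TT b\<in>UNIV. k b \<odot>\<^sub>TT tens r s a b) = (\<Oplus>\<^sub>TT b\<in>UNIV. \<Oplus>\<^sub>TT c\<in>UNIV. T.pt (r a c) (k b \<odot> s c b))"
    using r s by (intro T.MT.finsum_cong') (auto simp: T.pt_smult_r T.MT.finsum_smult intro!: T.MT.finsum_closed)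
  also have "\<dots> = (\<Oplus>\<^sub>TT c\<in>UNIV. \<Oplus>\<^sub>TT b\<in>UNIV. T.pt (r a c) (k b \<odot> s c b))" using r s by (intro T.MT.finsum_swap) auto
  also have "\<dots> = (\<Oplus>\<^sub>TT c\<in>UNIV. T.pt (r a c) (\<Oplus>b\<in>UNIV. k b \<odot> s c b))"
    using r s by (intro T.MT.finsum_cong') (auto simp: T.pt_finsum_r intro!: finsum_closed)
  finally show ?thesis .
qed

lemma tens_right:
  fixes r s :: "'n \<Rightarrow> 'n \<Rightarrow> 'a"
  assumes r: "\<And>a b. r a b \<in> carrier B" and s: "\<And>a b. s a b \<in> carrier B"
  shows "(\<Oplus>\<^sub>TT a\<in>UNIV. k a \<odot>\<^sub>TT tens r s a b) = (\<Oplus>\<^sub>TT c\<in>UNIV. T.pt (\<Oplus>a\<in>UNIV. k a \<odot> r a c) (s c b))"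
proof -
  have "(\<Oplus>\<^sub>TT a\<in>UNIV. k a \<odot>\<^sub>TT tens r s a b) = (\<Oplus>\<^sub>TT a\<in>UNIV. \<Oplus>\<^sub>TT c\<in>UNIV. T.pt (k a \<odot> r a c) (s c b))"
    using r s by (intro T.MT.finsum_cong') (auto simp: T.pt_smult_l T.MT.finsum_smult intro!: T.MT.finsum_closed)
  also have "\<dots> = (\<Oplus>\<^sub>TT c\<in>UNIV. \<Oplus>\<^sub>TT a\<in>UNIV. T.pt (k a \<odot> r a c) (s c b))" using r s by (intro T.MT.finsum_swap) auto
  also have "\<dots> = (\<Oplus>\<^sub>TT c\<in>UNIV. T.pt (\<Oplus>a\<in>UNIV. k a \<odot> r a c) (s c b))"
    using r s by (intro T.MT.finsum_cong') (auto simp: T.pt_finsum_l intro!: finsum_closed)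
  finally show ?thesis .
qed

lemma tens_fix:
  fixes r s :: "'n \<Rightarrow> 'n \<Rightarrow> 'a"
  assumes r: "\<And>a b. r a b \<in> carrier B" and s: "\<And>a b. s a b \<in> carrier B"
    and fr: "(\<Oplus>b\<in>UNIV. k b \<odot> r a b) = k a \<odot> \<one>" and fs: "\<And>c. (\<Oplus>b\<in>UNIV. k b \<odot> s c b) = k c \<odot> \<one>"
  shows "(\<Oplus>\<^sub>TT b\<in>UNIV. k b \<odot>\<^sub>TT tens r s a b) = k a \<odot>\<^sub>TT \<one>\<^sub>TT"
proof -
  have "(\<Oplus>\<^sub>TT b\<in>UNIV. k b \<odot>\<^sub>TT tens r s a b) = (\<Oplus>\<^sub>TT c\<in>UNIV. T.pt (k c \<odot> r a c) \<one>)"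
    unfolding tens_left[of r s, OF r s] fs using r by (simp add: T.pt_smult_l T.pt_smult_r)
  also have "\<dots> = T.pt (\<Oplus>c\<in>UNIV. k c \<odot> r a c) \<one>" using r by (simp add: T.pt_finsum_l)
  also have "\<dots> = k a \<odot>\<^sub>TT \<one>\<^sub>TT" unfolding fr by (simp add: T.pt_smult_l T.pt_one)
  finally show ?thesis .
qed

lemma tens_fix_col:
  fixes r s :: "'n \<Rightarrow> 'n \<Rightarrow> 'a"
  assumes r: "\<And>a b. r a b \<in> carrier B" and s: "\<And>a b. s a b \<in> carrier B"
    and fr: "\<And>c. (\<Oplus>a\<in>UNIV. r a c) = \<one>" and fs: "(\<Oplus>c\<in>UNIV. s c b) = \<one>"
  shows "(\<Oplus>\<^sub>TT a\<in>UNIV. tens r s a b) = \<one>\<^sub>TT"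
proof -
  have "(\<Oplus>\<^sub>TT a\<in>UNIV. tens r s a b) = (\<Oplus>\<^sub>TT a\<in>UNIV. 1 \<odot>\<^sub>TT tens r s a b)"
    using r s by (intro T.MT.finsum_cong') (auto intro!: T.MT.finsum_closed)
  also have "\<dots> = (\<Oplus>\<^sub>TT c\<in>UNIV. T.pt (\<Oplus>a\<in>UNIV. 1 \<odot> r a c) (s c b))" by (rule tens_right[OF r s])
  also have "\<dots> = (\<Oplus>\<^sub>TT c\<in>UNIV. T.pt \<one> (s c b))" using r fr by simp
  also have "\<dots> = T.pt \<one> (\<Oplus>c\<in>UNIV. s c b)" using s by (simp add: T.pt_finsum_r)
  finally show ?thesis by (simp add: fs T.pt_one)
qed

lemma tens_fix_row:
  fixes r s :: "'n \<Rightarrow> 'n \<Rightarrow> 'a"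
  assumes r: "\<And>a b. r a b \<in> carrier B" and s: "\<And>a b. s a b \<in> carrier B"
    and fr: "(\<Oplus>c\<in>UNIV. r a c) = \<one>" and fs: "\<And>c. (\<Oplus>b\<in>UNIV. s c b) = \<one>"
  shows "(\<Oplus>\<^sub>TT b\<in>UNIV. tens r s a b) = \<one>\<^sub>TT"
proof -
  have "(\<Oplus>\<^sub>TT b\<in>UNIV. tens r s a b) = (\<Oplus>\<^sub>TT b\<in>UNIV. 1 \<odot>\<^sub>TT tens r s a b)"
    using r s by (intro T.MT.finsum_cong') (auto intro!: T.MT.finsum_closed)
  also have "\<dots> = 1 \<odot>\<^sub>TT \<one>\<^sub>TT" using fr fs by (intro tens_fix[where k = "\<lambda>_. 1", OF r s]) (simp_all add: r s)
  finally show ?thesis by simp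
qed

lemma pi_projections:
  assumes v: "v \<in> carrier TT" "v \<otimes>\<^sub>TT star TT v \<otimes>\<^sub>TT v = v"
  shows "star TT (v \<otimes>\<^sub>TT star TT v) = v \<otimes>\<^sub>TT star TT v"
    "(v \<otimes>\<^sub>TT star TT v) \<otimes>\<^sub>TT (v \<otimes>\<^sub>TT star TT v) = v \<otimes>\<^sub>TT star TT v"
    "star TT (star TT v \<otimes>\<^sub>TT v) = star TT v \<otimes>\<^sub>TT v"
    "(star TT v \<otimes>\<^sub>TT v) \<otimes>\<^sub>TT (star TT v \<otimes>\<^sub>TT v) = star TT v \<otimes>\<^sub>TT v"
proof -
  have "(v \<otimes>\<^sub>TT star TT v) \<otimes>\<^sub>TT (v \<otimes>\<^sub>TT star TT v) = (v \<otimes>\<^sub>TT star TT v \<otimes>\<^sub>TT v) \<otimes>\<^sub>TT star TT v" using v(1) by (simp add: T.MT.m_assoc)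
  then show "(v \<otimes>\<^sub>TT star TT v) \<otimes>\<^sub>TT (v \<otimes>\<^sub>TT star TT v) = v \<otimes>\<^sub>TT star TT v" by (simp only: v(2))
  have "(star TT v \<otimes>\<^sub>TT v) \<otimes>\<^sub>TT (star TT v \<otimes>\<^sub>TT v) = star TT v \<otimes>\<^sub>TT (v \<otimes>\<^sub>TT star TT v \<otimes>\<^sub>TT v)" using v(1) by (simp add: T.MT.m_assoc)
  then show "(star TT v \<otimes>\<^sub>TT v) \<otimes>\<^sub>TT (star TT v \<otimes>\<^sub>TT v) = star TT v \<otimes>\<^sub>TT v" by (simp only: v(2))
qed (use v(1) in \<open>simp_all add: T.MT.star_mult\<close>)

lemma V_word_product:
  assumes "length y = n" "length z = n"
  shows "word_product TT V y z = (\<Oplus>\<^sub>TT w\<in>{w. length w = n}. T.pt (wp y w) (wp w z))" using assms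
proof (induction y arbitrary: z n)
  case Nil
  then show ?case by (simp add: T.MT.finsum_insert T.MT.finsum_empty T.pt_one)
next
  case (Cons a y)
  then obtain m b z' where n: "n = Suc m" "z = b # z'" "length y = m" "length z' = m" by (cases z) auto
  have fin: "finite {w :: 'n list. length w = k}" for k using finite_lists_length_eq[of "UNIV :: 'n set" k] by simp
  have lists: "{w :: 'n list. length w = Suc m} = (\<lambda>x. fst x # snd x) ` (UNIV \<times> {w. length w = m})"
  proof (intro equalityI subsetI)
    fix w :: "'n list" assume "w \<in> {w. length w = Suc m}"
    then obtain c \<delta> where "w = c # \<delta>" "length \<delta> = m" by (cases w) auto
    then show "w \<in> (\<lambda>x. fst x # snd x) ` (UNIV \<times> {w. length w = m})" by (auto intro!: image_eqI[of _ _ "(c, \<delta>)"])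
  qed auto
  have "word_product TT V (a # y) z = V a b \<otimes>\<^sub>TT (\<Oplus>\<^sub>TT w\<in>{w. length w = m}. T.pt (wp y w) (wp w z'))"
    unfolding n(2) word_product_Cons Cons.IH[OF n(3,4)] ..
  also have "\<dots> = (\<Oplus>\<^sub>TT c\<in>UNIV. T.pt (u a c) (u c b) \<otimes>\<^sub>TT (\<Oplus>\<^sub>TT w\<in>{w. length w = m}. T.pt (wp y w) (wp w z')))"
    by (intro T.MT.finsum_ldistr) (auto intro!: T.MT.finsum_closed)
  also have "\<dots> = (\<Oplus>\<^sub>TT c\<in>UNIV. \<Oplus>\<^sub>TT w\<in>{w. length w = m}. T.pt (wp (a # y) (c # w)) (wp (c # w) (b # z')))"
    using fin by (intro T.MT.finsum_cong') (auto simp: T.MT.finsum_rdistr T.pt_mult intro!: T.MT.finsum_closed)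
  also have "\<dots> = (\<Oplus>\<^sub>TT x\<in>UNIV \<times> {w. length w = m}. T.pt (wp (a # y) (fst x # snd x)) (wp (fst x # snd x) z))"
    unfolding n(2) by (rule T.MT.finsum_Sigma_prod[symmetric]) (use fin in auto)
  also have "\<dots> = (\<Oplus>\<^sub>TT w\<in>(\<lambda>x. fst x # snd x) ` (UNIV \<times> {w. length w = m}). T.pt (wp (a # y) w) (wp w z))"
    by (rule T.MT.finsum_reindex[symmetric]) (auto simp: inj_on_def)
  finally show ?case unfolding n(1) lists .
qed

text \<open>Inadmissible intermediate words contribute 0 by \<open>wp_non_word\<close>. Over the
  admissible ones the summands are partial isometries whose supports and ranges are orthogonal by
  \<open>wp_orth\<close>, applied in the first leg.\<close>

lemma V_word_pi:
  assumes n: "enat n \<le> l" and x: "x \<in> words A n" and y: "y \<in> words A n"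
  shows "word_product TT V x y \<otimes>\<^sub>TT star TT (word_product TT V x y) \<otimes>\<^sub>TT word_product TT V x y = word_product TT V x y"
proof -
  have fin: "finite {z :: 'n list. length z = n}" using finite_lists_length_eq[of "UNIV :: 'n set" n] by simp
  have sub: "words A n \<subseteq> {z. length z = n}" using words_length by blast
  have eq: "word_product TT V x y = (\<Oplus>\<^sub>TT z\<in>words A n. T.pt (wp x z) (wp z y))"
    unfolding V_word_product[OF words_length[OF x] words_length[OF y]]
    by (intro T.MT.finsum_superset fin sub) (auto simp: wp_non_word[OF x])
  show ?thesis unfolding eq
  proof (rule T.MT.orthogonal_sum_partial_isometry)
    fix z \<delta> assume w: "z \<in> words A n" "\<delta> \<in> words A n" "z \<noteq> \<delta>"
    note o = wp_orth[OF n x w]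
    show "T.pt (wp x z) (wp z y) \<otimes>\<^sub>TT star TT (T.pt (wp x \<delta>) (wp \<delta> y)) = \<zero>\<^sub>TT"
      "star TT (T.pt (wp x z) (wp z y)) \<otimes>\<^sub>TT T.pt (wp x \<delta>) (wp \<delta> y) = \<zero>\<^sub>TT" using o by (simp_all add: T.pt_star T.pt_mult)
  next
    fix z assume w: "z \<in> words A n"
    show "T.pt (wp x z) (wp z y) \<otimes>\<^sub>TT star TT (T.pt (wp x z) (wp z y)) \<otimes>\<^sub>TT T.pt (wp x z) (wp z y) = T.pt (wp x z) (wp z y)"
      using word_pi[OF n x w] word_pi[OF n w y] by (simp add: T.pt_star T.pt_mult)
  qed (use fin sub finite_subset in auto)
qed

theorem V_relations: "GA_relations A l TT V"
  unfolding T.MT.GA_relations_iff[of V, OF V_closed] V_p V_q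
proof (intro conjI allI impI ballI)
  note mp = magic_p[unfolded magic_def] and mq = magic_q[unfolded magic_def]
  show "tens p p a b \<otimes>\<^sub>TT V a b = V a b" for a b using V_pi[of a b] unfolding V_p .
  show "T.MT.magic (tens p p)" unfolding T.MT.magic_def
  proof (intro conjI allI)
    show "star TT (tens p p a b) = tens p p a b" for a b using pi_projections(1)[OF V_closed V_pi, of a b] unfolding V_p .
    show "tens p p a b \<otimes>\<^sub>TT tens p p a b = tens p p a b" for a b using pi_projections(2)[OF V_closed V_pi, of a b] unfolding V_p .
    show "(\<Oplus>\<^sub>TT b\<in>UNIV. tens p p a b) = \<one>\<^sub>TT" for a by (rule tens_fix_row) (use mp in auto)
    show "(\<Oplus>\<^sub>TT a\<in>UNIV. tens p p a b) = \<one>\<^sub>TT" for b by (rule tens_fix_col) (use mp in auto)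
  qed
  show "T.MT.magic (tens q q)" unfolding T.MT.magic_def
  proof (intro conjI allI)
    show "star TT (tens q q a b) = tens q q a b" for a b using pi_projections(3)[OF V_closed V_pi, of a b] unfolding V_q .
    show "tens q q a b \<otimes>\<^sub>TT tens q q a b = tens q q a b" for a b using pi_projections(4)[OF V_closed V_pi, of a b] unfolding V_q .
    show "(\<Oplus>\<^sub>TT b\<in>UNIV. tens q q a b) = \<one>\<^sub>TT" for a by (rule tens_fix_row) (use mq in auto)
    show "(\<Oplus>\<^sub>TT a\<in>UNIV. tens q q a b) = \<one>\<^sub>TT" for b by (rule tens_fix_col) (use mq in auto)
  qed
  show "(\<Oplus>\<^sub>TT b\<in>UNIV. of_real (perron_vector A $ b) \<odot>\<^sub>TT tens p p a b) = of_real (perron_vector A $ a) \<odot>\<^sub>TT \<one>\<^sub>TT" for a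
    by (intro tens_fix fix_p) auto
  show "(\<Oplus>\<^sub>TT b\<in>UNIV. of_real (perron_vector A $ b) \<odot>\<^sub>TT tens q q a b) = of_real (perron_vector A $ a) \<odot>\<^sub>TT \<one>\<^sub>TT" for a
    by (intro tens_fix fix_q) auto
  \<comment> \<open>The matrix A travels through the two legs, with the index between them summed:
    A(p \<otimes> p) = (Ap) \<otimes> p = (qA) \<otimes> p = q \<otimes> (Ap) = q \<otimes>
    (qA).\<close>
  show "(\<Oplus>\<^sub>TT c\<in>UNIV. of_real (A $ a $ c) \<odot>\<^sub>TT tens p p c b) = (\<Oplus>\<^sub>TT c\<in>UNIV. of_real (A $ c $ b) \<odot>\<^sub>TT tens q q a c)" for a b
  proof -
    have "(\<Oplus>\<^sub>TT c\<in>UNIV. of_real (A $ a $ c) \<odot>\<^sub>TT tens p p c b)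
        = (\<Oplus>\<^sub>TT d\<in>UNIV. T.pt (\<Oplus>c\<in>UNIV. of_real (A $ a $ c) \<odot> p c d) (p d b))"
      by (rule tens_right) auto
    also have "\<dots> = (\<Oplus>\<^sub>TT d\<in>UNIV. T.pt (\<Oplus>c\<in>UNIV. of_real (A $ c $ d) \<odot> q a c) (p d b))" unfolding Ap_qA ..
    also have "\<dots> = (\<Oplus>\<^sub>TT d\<in>UNIV. \<Oplus>\<^sub>TT c\<in>UNIV. T.pt (of_real (A $ c $ d) \<odot> q a c) (p d b))"
      by (intro T.MT.finsum_cong') (auto simp: T.pt_finsum_l intro!: T.MT.finsum_closed)
    also have "\<dots> = (\<Oplus>\<^sub>TT c\<in>UNIV. \<Oplus>\<^sub>TT d\<in>UNIV. T.pt (of_real (A $ c $ d) \<odot> q a c) (p d b))" by (intro T.MT.finsum_swap) auto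
    also have "\<dots> = (\<Oplus>\<^sub>TT c\<in>UNIV. T.pt (q a c) (\<Oplus>d\<in>UNIV. of_real (A $ c $ d) \<odot> p d b))"
      by (intro T.MT.finsum_cong') (auto simp: T.pt_finsum_r T.pt_smult_l T.pt_smult_r intro!: T.MT.finsum_closed finsum_closed)
    also have "\<dots> = (\<Oplus>\<^sub>TT c\<in>UNIV. T.pt (q a c) (\<Oplus>d\<in>UNIV. of_real (A $ d $ b) \<odot> q c d))" unfolding Ap_qA ..
    also have "\<dots> = (\<Oplus>\<^sub>TT c\<in>UNIV. of_real (A $ c $ b) \<odot>\<^sub>TT tens q q a c)" by (rule tens_left[symmetric]) auto
    finally show ?thesis .
  qed
qed (rule V_word_pi)

end

subsection \<open>The free *-algebra\<close>

abbreviation winv :: "'n letter list \<Rightarrow> 'n letter list" where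
  "winv \<equiv> (\<lambda>w. rev (map (\<lambda>(x, y, s). (x, y, \<not> s)) w))"

lemma inv_monoid_words: "inv_monoid (word_monoid :: 'n letter list monoid) winv"
proof -
  interpret Group.monoid "word_monoid :: 'n letter list monoid"
    by (rule monoidI) auto
  show ?thesis by unfold_locales (auto simp: rev_map comp_def case_prod_unfold)
qed

lemma star_alg_free: "star_alg (free_star_algebra p)"
  unfolding free_star_algebra_def by (rule inv_monoid.star_alg_msa[OF inv_monoid_words])

lemma free_carrier: "f \<in> carrier (free_star_algebra p) \<longleftrightarrow> finite {w. f w \<noteq> 0}" by (simp add: free_star_algebra_def)

lemma free_gen_closed: "free_gen x y \<in> carrier (free_star_algebra p)" by (simp add: free_carrier free_gen_def)

lemma nrm_free [simp]: "nrm (free_star_algebra p) = p" by (simp add: free_star_algebra_def)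

text \<open>Separating the norm field from the algebraic structure lets the relations for different
  seminorms be compared inside one algebra, as \<open>GA_relations_Sup\<close> does.\<close>

lemma free_nrm_update: "free_star_algebra p = free_star_algebra (\<lambda>_. 0) \<lparr>nrm := p\<rparr>"
  by (simp add: free_star_algebra_def monoid_star_algebra_def)

definition letter_eval :: "'a star_algebra \<Rightarrow> ('n \<Rightarrow> 'n \<Rightarrow> 'a) \<Rightarrow> 'n letter \<Rightarrow> 'a" where
  "letter_eval D v x = (case x of (y, z, s) \<Rightarrow> if s then star D (v y z) else v y z)"

definition word_eval :: "'a star_algebra \<Rightarrow> ('n \<Rightarrow> 'n \<Rightarrow> 'a) \<Rightarrow> 'n letter list \<Rightarrow> 'a" where
  "word_eval D v w = foldr (\<lambda>x y. letter_eval D v x \<otimes>\<^sub>D y) w \<one>\<^sub>D"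

lemma word_eval_simps [simp]:
  "word_eval D v [] = \<one>\<^sub>D"
  "word_eval D v (x # w) = letter_eval D v x \<otimes>\<^sub>D word_eval D v w" by (simp_all add: word_eval_def)

definition free_lift :: "'a star_algebra \<Rightarrow> ('n \<Rightarrow> 'n \<Rightarrow> 'a) \<Rightarrow> 'n free_elt \<Rightarrow> 'a" where
  "free_lift D v = lin_ext D (word_eval D v)"

context star_alg
begin

context
  fixes v :: "'n \<Rightarrow> 'n \<Rightarrow> 'a" assumes v: "\<And>x y. v x y \<in> carrier B"
begin

lemma letter_eval_closed: "letter_eval B v x \<in> carrier B" using v by (auto simp: letter_eval_def split: prod.split)

lemma word_eval_closed: "word_eval B v w \<in> carrier B" by (induction w) (auto simp: letter_eval_closed)

lemma word_eval_append: "word_eval B v (w @ w') = word_eval B v w \<otimes> word_eval B v w'"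
  by (induction w) (auto simp: letter_eval_closed word_eval_closed m_assoc)

lemma word_eval_winv: "word_eval B v (winv w) = star B (word_eval B v w)"
proof (induction w)
  case (Cons x w)
  have "letter_eval B v (case x of (y, z, s) \<Rightarrow> (y, z, \<not> s)) = star B (letter_eval B v x)"
    using v by (auto simp: letter_eval_def split: prod.split)
  then show ?case using Cons by (simp add: word_eval_append star_mult letter_eval_closed word_eval_closed)
qed simp

lemma free_lift_star_hom: "star_hom (free_star_algebra p) B (free_lift B v)" unfolding free_star_algebra_def free_lift_def
  by (rule lin_ext_star_hom[OF inv_monoid_words star_alg_axioms])
    (simp_all add: word_eval_closed word_eval_append word_eval_winv)

lemma free_lift_gen [simp]: "free_lift B v (free_gen x y) = v x y" unfolding free_lift_def free_gen_def
  using v by (subst lin_ext_basis) (auto simp: word_eval_closed letter_eval_def)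

lemma free_lift_alg_hom: "star_alg_hom (free_star_algebra p) B (free_lift B v)"
  by (intro star_alg_homI star_alg_free free_lift_star_hom star_alg_axioms)

end

lemma free_hom_basis:
  assumes h: "star_hom (free_star_algebra p) B \<theta>"
  shows "\<theta> (basis_elt w) = word_eval B (\<lambda>z c. \<theta> (free_gen z c)) w"
proof -
  interpret h: star_alg_hom "free_star_algebra p" B \<theta>
    by (intro star_alg_homI star_alg_free h star_alg_axioms)
  have b: "basis_elt w \<in> carrier (free_star_algebra p)" for w by (simp add: free_carrier)
  have mult: "mult (free_star_algebra p) (basis_elt x) (basis_elt y) = basis_elt (x @ y)" for x y
    unfolding free_star_algebra_def msa_simps basis_elt_support by (auto simp: fun_eq_iff basis_elt_def)
  have star: "star (free_star_algebra p) (basis_elt x) = basis_elt (winv x)" for x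
    unfolding free_star_algebra_def msa_simps basis_elt_support by (auto simp: fun_eq_iff basis_elt_def)
  have one: "one (free_star_algebra p) = basis_elt []" by (simp add: free_star_algebra_def)
  have letter: "\<theta> (basis_elt [x]) = letter_eval B (\<lambda>z c. \<theta> (free_gen z c)) x" for x
  proof (cases x)
    case (fields z c s)
    show ?thesis
    proof (cases s)
      case True
      have "\<theta> (basis_elt [x]) = \<theta> (star (free_star_algebra p) (free_gen z c))" using fields True by (simp add: free_gen_def star)
      then show ?thesis using fields True by (simp add: letter_eval_def h.hom_star free_gen_closed)
    qed (use fields in \<open>simp add: letter_eval_def free_gen_def\<close>)
  qed
  show ?thesis
  proof (induction w)
    case Nil
    then show ?case using h.hom_one by (simp add: one)
  next
    case (Cons x w)
    have "\<theta> (basis_elt (x # w)) = \<theta> (mult (free_star_algebra p) (basis_elt [x]) (basis_elt w))" by (simp add: mult)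
    also have "\<dots> = \<theta> (basis_elt [x]) \<otimes> \<theta> (basis_elt w)" by (intro h.hom_mult b)
    finally show ?case by (simp add: letter Cons)
  qed
qed

lemma free_hom_unique:
  assumes h: "star_hom (free_star_algebra p) B \<theta>" and f: "f \<in> carrier (free_star_algebra p)"
  shows "\<theta> f = free_lift B (\<lambda>x y. \<theta> (free_gen x y)) f"
  using star_hom_lin_ext[OF inv_monoid_words star_alg_axioms h[unfolded free_star_algebra_def] f[unfolded free_star_algebra_def]]
  unfolding free_hom_basis[OF h] free_lift_def .

end

lemma star_alg_hom_eq_on_free:
  assumes "star_alg B" "star_hom (free_star_algebra p) B \<theta>" "star_hom (free_star_algebra p) B \<theta>'"
    and "\<And>x y. \<theta> (free_gen x y) = \<theta>' (free_gen x y)" "f \<in> carrier (free_star_algebra p)"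
  shows "\<theta> f = \<theta>' f" using star_alg.free_hom_unique[OF assms(1,2,5)] star_alg.free_hom_unique[OF assms(1,3,5)] assms(4) by simp

subsection \<open>The universal seminorm\<close>

text \<open>Each member satisfies |x|^2 = |x* x|, so the square of the supremum at x is at most the
  supremum at x* x; \<open>cstar_seminormI\<close> supplies the converse.\<close>

lemma (in star_alg) cstar_seminorm_Sup:
  assumes S: "S \<noteq> {}" "\<And>p. p \<in> S \<Longrightarrow> cstar_seminorm B p"
    and bd: "\<And>x. x \<in> carrier B \<Longrightarrow> bdd_above {p x | p. p \<in> S}"
  shows "cstar_seminorm B (\<lambda>x. Sup {p x | p. p \<in> S})" (is "cstar_seminorm B ?n")
proof -
  have up: "p x \<le> ?n x" if "p \<in> S" "x \<in> carrier B" for p x using that bd by (intro cSup_upper) auto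
  have least: "?n x \<le> r" if "\<And>p. p \<in> S \<Longrightarrow> p x \<le> r" for x r using that S(1) by (intro cSup_least) auto
  have nn: "0 \<le> p x" if "p \<in> S" "x \<in> carrier B" for p x using S(2)[OF that(1)] that(2) by (simp add: cstar_seminorm_def)
  have nonneg: "0 \<le> ?n x" if "x \<in> carrier B" for x using S(1) nn[OF _ that] up[OF _ that] by (meson all_not_in_conv order_trans)
  have alg: "cstar_alg (B\<lparr>nrm := p\<rparr>)" if "p \<in> S" for p
  proof (rule cstar_algI)
    show "star_alg (B\<lparr>nrm := p\<rparr>)" by (rule star_algI)
        (auto simp: a_ac m_assoc l_distr r_distr smult_l_distr smult_r_distr smult_assoc smult_mult_l smult_mult_r star_add star_mult star_smult)
    show "cstar_seminorm (B\<lparr>nrm := p\<rparr>) (nrm (B\<lparr>nrm := p\<rparr>))" using S(2)[OF that] by (simp add: cstar_seminorm_def)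
  qed
  show ?thesis
  proof (rule cstar_seminormI[OF nonneg])
    fix x assume x: "x \<in> carrier B"
    show "?n (c \<odot> x) \<le> cmod c * ?n x" for c
    proof (rule least)
      fix p assume p: "p \<in> S"
      have "p (c \<odot> x) = cmod c * p x" using S(2)[OF p] x by (simp add: cstar_seminorm_def)
      also have "\<dots> \<le> cmod c * ?n x" using up[OF p x] by (intro mult_left_mono) auto
      finally show "p (c \<odot> x) \<le> cmod c * ?n x" .
    qed
    show "?n (star B x) \<le> ?n x"
    proof (rule least)
      fix p assume p: "p \<in> S"
      interpret P: cstar_alg "B\<lparr>nrm := p\<rparr>" by (rule alg[OF p])
      show "p (star B x) \<le> ?n x" using P.nrm_star[of x] x up[OF p x] by simp
    qed
    have "sqrt ((?n x)\<^sup>2) \<le> sqrt (?n (star B x \<otimes> x))"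
    proof -
      have "?n x \<le> sqrt (?n (star B x \<otimes> x))"
      proof (rule least)
        fix p assume p: "p \<in> S"
        have "(p x)\<^sup>2 = p (star B x \<otimes> x)" using S(2)[OF p] x by (simp add: cstar_seminorm_def)
        also have "\<dots> \<le> ?n (star B x \<otimes> x)" using x by (intro up[OF p]) auto
        finally show "p x \<le> sqrt (?n (star B x \<otimes> x))" by (rule real_le_rsqrt)
      qed
      then show ?thesis using nonneg[OF x] by simp
    qed
    then show "(?n x)\<^sup>2 \<le> ?n (star B x \<otimes> x)" by (simp only: real_sqrt_le_iff)
    fix y assume y: "y \<in> carrier B"
    show "?n (x \<oplus> y) \<le> ?n x + ?n y"
    proof (rule least)
      fix p assume p: "p \<in> S"
      have "p (x \<oplus> y) \<le> p x + p y" using S(2)[OF p] x y by (simp add: cstar_seminorm_def)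
      then show "p (x \<oplus> y) \<le> ?n x + ?n y" using up[OF p x] up[OF p y] by linarith
    qed
    show "?n (x \<otimes> y) \<le> ?n x * ?n y"
    proof (rule least)
      fix p assume p: "p \<in> S"
      have "p (x \<otimes> y) \<le> p x * p y" using S(2)[OF p] x y by (simp add: cstar_seminorm_def)
      also have "\<dots> \<le> ?n x * ?n y" using up[OF p x] up[OF p y] nn[OF p y] nonneg[OF x] by (intro mult_mono) auto
      finally show "p (x \<otimes> y) \<le> ?n x * ?n y" .
    qed
  qed
qed

lemma eqv_nrm_update: "eqv (B\<lparr>nrm := n\<rparr>) x y \<longleftrightarrow> n (x \<ominus>\<^sub>B y) = 0" by (simp add: eqv_def a_minus_def a_inv_def)

text \<open>Only the norm field of the record changes, and every relation asserts that the seminorm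
  vanishes at a fixed element. A supremum vanishes there if all its members do.\<close>

lemma GA_relations_Sup:
  assumes null: "\<And>x. (\<And>p. p \<in> S \<Longrightarrow> p x = 0) \<Longrightarrow> n x = (0::real)"
    and rel: "\<And>p. p \<in> S \<Longrightarrow> GA_relations A l (B\<lparr>nrm := p\<rparr>) u"
  shows "GA_relations A l (B\<lparr>nrm := n\<rparr>) u"
proof -
  have fs: "finsum (B\<lparr>nrm := p\<rparr>) = finsum B" for p by (intro ext) (simp add: finsum_def)
  have wp: "word_product (B\<lparr>nrm := p\<rparr>) = word_product B" for p by (intro ext) (simp add: word_product_def)
  note defs = GA_relations_def Let_def magic_unitary_def fixes_vector_def partial_isometry_def projection_def
    eqv_nrm_update fs wp
  show ?thesis using rel unfolding defs by (simp add: null)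
qed

definition GA_seminorms :: "real^'n^'n \<Rightarrow> enat \<Rightarrow> ('n::finite free_elt \<Rightarrow> real) set" where
  "GA_seminorms A l = {p. cstar_seminorm (free_star_algebra p) p \<and> GA_relations A l (free_star_algebra p) free_gen}"

text \<open>The universal property in terms of seminorms: elements satisfying the relations in some
  algebra with a C*-seminorm induce a member of the family over which \<open>GA_seminorm\<close>
  takes its supremum. Applied to the complex numbers it yields the classical points, applied to the
  tensor square the coproduct.\<close>

lemma GA_seminorms_pullback:
  assumes D: "cstar_alg D" and v: "\<And>x y. v x y \<in> carrier D" and rel: "GA_relations A l D v"
  shows "(\<lambda>f. nrm D (free_lift D v f)) \<in> GA_seminorms A l" (is "?p \<in> _")
proof -
  interpret D: cstar_alg D by fact
  interpret h: star_alg_hom "free_star_algebra ?p" D "free_lift D v" by (rule D.free_lift_alg_hom[OF v])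
  have "cstar_seminorm (free_star_algebra ?p) ?p" unfolding cstar_seminorm_def
    by (auto simp: h.hom_add h.hom_mult h.hom_smult h.hom_star D.nrm_add D.nrm_mult D.nrm_smult D.nrm_cstar)
  moreover have "GA_relations A l D (\<lambda>a b. free_lift D v (free_gen a b)) \<longleftrightarrow> GA_relations A l (free_star_algebra ?p) free_gen"
    by (rule GA_relations_hom[OF h.star_alg_hom_axioms free_gen_closed]) simp
  moreover have "free_lift D v (free_gen a b) = v a b" for a b by (rule D.free_lift_gen[of v]) (rule v)
  ultimately show ?thesis using rel by (simp add: GA_seminorms_def)
qed

lemma (in GA_alg) nrm_u_le: "nrm B (u a b) \<le> 1"
proof -
  have "(nrm B (u a b))\<^sup>2 = nrm B (q a b)" by (simp add: nrm_cstar)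
  also have "\<dots> \<le> 1" using magic_q by (intro nrm_projection_le) (auto simp: magic_def)
  finally have "(nrm B (u a b))\<^sup>2 \<le> 1\<^sup>2" by simp
  then show ?thesis by (rule power2_le_imp_le) simp
qed

lemma (in seminormed_star_alg) nrm_word_eval_le:
  assumes v: "\<And>a b. v a b \<in> carrier B" "\<And>a b. nrm B (v a b) \<le> 1"
  shows "nrm B (word_eval B v w) \<le> 1"
proof (induction w)
  case (Cons x w)
  have l: "nrm B (letter_eval B v x) \<le> 1" using v by (auto simp: letter_eval_def nrm_star split: prod.split)
  have "nrm B (word_eval B v (x # w)) \<le> nrm B (letter_eval B v x) * nrm B (word_eval B v w)"
    using letter_eval_closed[of v, OF v(1)] word_eval_closed[of v, OF v(1)] by (simp add: nrm_mult)
  also have "\<dots> \<le> 1 * 1" using l Cons letter_eval_closed[of v, OF v(1)] word_eval_closed[of v, OF v(1)] by (intro mult_mono) auto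
  finally show ?case by simp
qed (simp add: nrm_one)

lemma (in seminormed_star_alg) nrm_lin_ext_le:
  assumes "\<And>x. f x \<noteq> 0 \<Longrightarrow> \<eta> x \<in> carrier B" "\<And>x. f x \<noteq> 0 \<Longrightarrow> nrm B (\<eta> x) \<le> 1"
  shows "nrm B (lin_ext B \<eta> f) \<le> (\<Sum>x | f x \<noteq> 0. cmod (f x))"
proof -
  have "nrm B (lin_ext B \<eta> f) \<le> (\<Sum>x | f x \<noteq> 0. nrm B (f x \<odot> \<eta> x))" unfolding lin_ext_def using assms by (intro nrm_finsum) auto
  also have "\<dots> \<le> (\<Sum>x | f x \<noteq> 0. cmod (f x))" using assms by (intro sum_mono) (auto simp: nrm_smult mult_left_le)
  finally show ?thesis .
qed

subsection \<open>Classical points\<close>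

text \<open>The (x, y) entry of the monomial matrix diag(z) P_\<pi>, for g = (z, \<pi>). The group
  law thereby becomes the matrix product, which is the shape of the coproduct.\<close>

definition point_gen :: "(complex^'n) \<times> ('n \<Rightarrow> 'n) \<Rightarrow> 'n \<Rightarrow> 'n \<Rightarrow> complex" where
  "point_gen g x y = (if x = snd g y then fst g $ x else 0)"

abbreviation ev :: "(complex^'n) \<times> ('n \<Rightarrow> 'n) \<Rightarrow> 'n free_elt \<Rightarrow> complex" where
  "ev g \<equiv> free_lift complex_alg (point_gen g)"

locale GA =
  fixes A :: "real^'n^'n" and l :: enat
  assumes A01: "A $ i $ j \<in> {0, 1}" and prim: "primitive_matrix A"
begin

abbreviation G where "G \<equiv> torus_wreath_Aut A"
abbreviation X where "X \<equiv> torus_wreath_topology A"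

lemma G_carrier: "g \<in> carrier G \<longleftrightarrow> (\<forall>i. cmod (fst g $ i) = 1) \<and> bij (snd g) \<and> (\<forall>i j. A $ snd g i $ snd g j = A $ i $ j)"
  by (cases g) (auto simp: torus_wreath_Aut_def torus_def Aut_matrix_def)

lemma topspace_X: "topspace X = carrier G" by (simp add: torus_wreath_topology_def torus_wreath_Aut_def)

lemma point_gen_mult:
  assumes "g \<in> carrier G" "h \<in> carrier G"
  shows "point_gen (g \<otimes>\<^sub>G h) x y = (\<Sum>z\<in>UNIV. point_gen g x z * point_gen h z y)"
proof -
  have "(\<Sum>z\<in>UNIV. point_gen g x z * point_gen h z y)
      = (\<Sum>z\<in>UNIV. if z = snd h y then point_gen g x (snd h y) * fst h $ (snd h y) else 0)"
    by (intro sum.cong) (auto simp: point_gen_def)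
  also have "\<dots> = point_gen g x (snd h y) * fst h $ (snd h y)" by simp
  also have "\<dots> = point_gen (g \<otimes>\<^sub>G h) x y"
  proof -
    have "inj (snd g)" using assms(1) by (auto simp: G_carrier bij_def)
    then show ?thesis by (cases g, cases h) (auto simp: point_gen_def torus_wreath_Aut_def)
  qed
  finally show ?thesis by simp
qed

text \<open>Both p and q become the permutation matrix of \<pi>, so (I) is the invariance of the
  Perron-Frobenius vector and (II) is the invariance of A. A product of entries has modulus 0 or 1,
  which is what a partial isometry is among the complex numbers, so (III) holds for all
  words.\<close>

lemma point_relations:
  assumes g: "g \<in> carrier G"
  shows "GA_relations A l complex_alg (point_gen g)"
proof -
  have c: "z * cnj z = 1" if "cmod z = 1" for z using that by (metis complex_norm_square of_real_1 one_power2)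
  note g' = g[unfolded G_carrier]
  define \<pi> where "\<pi> = snd g"
  have b: "bij \<pi>" using g' by (simp add: \<pi>_def)
  have p: "point_gen g a b * cnj (point_gen g a b) = (if a = \<pi> b then 1 else 0)" for a b using g' c by (simp add: point_gen_def \<pi>_def)
  have q: "cnj (point_gen g a b) * point_gen g a b = (if a = \<pi> b then 1 else 0)" for a b using p by (simp add: mult.commute)
  define \<sigma> where "\<sigma> = Hilbert_Choice.inv \<pi>"
  have \<sigma>: "a = \<pi> b \<longleftrightarrow> b = \<sigma> a" for a b using b unfolding \<sigma>_def by (metis bij_inv_eq_iff)
  have A\<pi>: "\<pi> \<in> Aut_matrix A" using g' by (simp add: Aut_matrix_def \<pi>_def)
  have nn: "0 \<le> A $ i $ j" for i j using A01[of i j] by auto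
  have pv: "perron_vector A $ \<sigma> a = perron_vector A $ a" for a using perron_vector_Aut[OF nn prim A\<pi>, of "\<sigma> a"] \<sigma>[of a "\<sigma> a"] by simp
  have wabs: "cmod (word_product complex_alg (point_gen g) x y) \<in> {0, 1}" for x y
  proof (induction x arbitrary: y)
    case (Cons a x)
    show ?case
    proof (cases y)
      case (Cons b y')
      then show ?thesis using Cons.IH[of y'] g' by (auto simp: norm_mult point_gen_def)
    qed (simp add: word_product_def)
  qed simp
  have w: "z * cnj z * z = z" if "cmod z \<in> {0, 1}" for z using that c[of z] by auto
  have mag: "cx.magic (\<lambda>a b. if a = \<pi> b then 1 else 0)" unfolding cx.magic_def finsum_complex_alg by (auto simp: \<sigma>)
      (simp add: \<sigma>[symmetric])
  have "w = \<sigma> a \<longleftrightarrow> a = \<pi> w" for w a using \<sigma> by simp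
  show ?thesis unfolding cx.GA_relations_iff[of "point_gen g" A l, OF UNIV_I] p q finsum_complex_alg
  proof (intro conjI allI impI ballI mag)
    show "(if a = \<pi> b then 1 else 0) * point_gen g a b = point_gen g a b" for a b by (simp add: point_gen_def \<pi>_def)
    show "(\<Sum>b\<in>UNIV. of_real (perron_vector A $ b) * (if a = \<pi> b then 1 else 0)) = of_real (perron_vector A $ a) * 1" for a
      by (simp add: \<sigma> pv if_distrib cong: if_cong)
    then show "(\<Sum>b\<in>UNIV. of_real (perron_vector A $ b) * (if a = \<pi> b then 1 else 0)) = of_real (perron_vector A $ a) * 1" for a .
    show "(\<Sum>c\<in>UNIV. of_real (A $ a $ c) * (if c = \<pi> b then 1 else 0))
        = (\<Sum>c\<in>UNIV. of_real (A $ c $ b) * (if a = \<pi> c then 1 else 0))" for a b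
    proof -
      have "A $ \<sigma> a $ b = A $ \<pi> (\<sigma> a) $ \<pi> b" using g' by (simp add: \<pi>_def)
      also have "\<pi> (\<sigma> a) = a" using \<sigma>[of a "\<sigma> a"] by simp
      finally have "A $ \<sigma> a $ b = A $ a $ \<pi> b" .
      then show ?thesis unfolding \<sigma>[of a] by (simp add: if_distrib cong: if_cong)
    qed
  qed (rule w[OF wabs])
qed

lemma ev_seminorm: "g \<in> carrier G \<Longrightarrow> (\<lambda>f. cmod (ev g f)) \<in> GA_seminorms A l"
  using GA_seminorms_pullback[of complex_alg "point_gen g" A l] point_relations cx.cstar_alg_axioms by simp

text \<open>The bound on generators is proved for a definite norm, hence the detour through the
  completion. There every generator has norm at most 1, so p f is at most the sum of the moduli of
  the coefficients, whatever p is. This makes the supremum in \<open>GA_seminorm\<close>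
  finite.\<close>

lemma GA_seminorms_le:
  assumes p: "p \<in> GA_seminorms A l" and f: "f \<in> carrier (free_star_algebra p)"
  shows "p f \<le> (\<Sum>w | f w \<noteq> 0. cmod (f w))"
proof -
  let ?F = "free_star_algebra p"
  interpret F: cstar_alg ?F
    using p by (intro cstar_algI star_alg_free) (simp add: GA_seminorms_def)
  let ?C = "Defs.completion ?F" and ?\<iota> = "to_completion ?F"
  interpret C: cstar_normed ?C by (rule F.cstar_normed_completion)
  have h: "star_alg_hom ?F ?C ?\<iota>" by (intro star_alg_homI F.star_alg_axioms C.star_alg_axioms F.star_hom_to_completion)
  interpret h: star_alg_hom ?F ?C ?\<iota> by (rule h)
  have "GA_relations A l ?C (\<lambda>a b. ?\<iota> (free_gen a b)) \<longleftrightarrow> GA_relations A l ?F free_gen"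
    by (rule GA_relations_hom[OF h]) (rule free_gen_closed, rule F.nrm_to_completion)
  then have "GA_relations A l ?C (\<lambda>a b. ?\<iota> (free_gen a b))" using p by (simp add: GA_seminorms_def)
  then interpret C: GA_alg ?C A l "\<lambda>a b. ?\<iota> (free_gen a b)"
    by (intro GA_alg.intro GA_alg_axioms.intro C.cstar_normed_axioms A01 h.hom_closed free_gen_closed)
  have "p f = nrm ?C (?\<iota> f)" using F.nrm_to_completion[OF f] by simp
  also have "?\<iota> f = lin_ext ?C (word_eval ?C (\<lambda>a b. ?\<iota> (free_gen a b))) f"
    using C.free_hom_unique[OF F.star_hom_to_completion f] by (simp add: free_lift_def)
  also have "nrm ?C \<dots> \<le> (\<Sum>w | f w \<noteq> 0. cmod (f w))"
    by (intro C.nrm_lin_ext_le C.word_eval_closed C.nrm_word_eval_le C.u_closed C.nrm_u_le)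
  finally show ?thesis .
qed

section \<open>The universal C*-seminorm and its completion\<close>

definition \<nu> :: "'n free_elt \<Rightarrow> real" where "\<nu> = GA_seminorm A l"

lemma \<nu>_Sup: "\<nu> = (\<lambda>x. Sup {p x | p. p \<in> GA_seminorms A l})" by (simp add: \<nu>_def GA_seminorm_def GA_seminorms_def fun_eq_iff)

abbreviation FA where "FA \<equiv> free_star_algebra \<nu>"

lemma FA_carrier: "f \<in> carrier FA \<longleftrightarrow> f \<in> carrier (free_star_algebra p)" by (simp add: free_carrier)

lemma GA_seminorms_bdd: "f \<in> carrier FA \<Longrightarrow> bdd_above {p f | p. p \<in> GA_seminorms A l}"
  using GA_seminorms_le FA_carrier by (intro bdd_aboveI[of _ "\<Sum>w | f w \<noteq> 0. cmod (f w)"]) auto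

lemma GA_seminorms_nonempty: "GA_seminorms A l \<noteq> {}"
proof -
  have "Group.group G" by (rule group_torus_wreath_Aut)
  then have "\<one>\<^sub>G \<in> carrier G" by (rule group.is_monoid[THEN monoid.one_closed])
  then show ?thesis using ev_seminorm by blast
qed

lemma le_\<nu>:
  assumes "p \<in> GA_seminorms A l" "f \<in> carrier FA"
  shows "p f \<le> \<nu> f"
proof -
  have "p f \<le> Sup {p f | p. p \<in> GA_seminorms A l}" using assms by (intro cSup_upper GA_seminorms_bdd) auto
  then show ?thesis by (simp add: \<nu>_Sup)
qed

lemma ev_le_\<nu>: "g \<in> carrier G \<Longrightarrow> f \<in> carrier FA \<Longrightarrow> cmod (ev g f) \<le> \<nu> f" by (rule le_\<nu>[OF ev_seminorm])

lemma cstar_seminorm_free_irrelevant: "cstar_seminorm (free_star_algebra p) n \<longleftrightarrow> cstar_seminorm (free_star_algebra p') n"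
  unfolding cstar_seminorm_def free_star_algebra_def monoid_star_algebra_def by simp

lemma cstar_alg_FA: "cstar_alg FA"
proof (rule cstar_algI[OF star_alg_free])
  have "cstar_seminorm FA (\<lambda>x. Sup {p x | p. p \<in> GA_seminorms A l})"
  proof (rule star_alg.cstar_seminorm_Sup[OF star_alg_free GA_seminorms_nonempty _ GA_seminorms_bdd])
    show "cstar_seminorm FA p" if "p \<in> GA_seminorms A l" for p
      using that cstar_seminorm_free_irrelevant[of \<nu> p p] by (simp add: GA_seminorms_def)
  qed
  then have "cstar_seminorm FA \<nu>" by (subst (2) \<nu>_Sup)
  then show "cstar_seminorm FA (nrm FA)" by simp
qed

sublocale FA: cstar_alg "free_star_algebra \<nu>" by (rule cstar_alg_FA)

lemma FA_relations: "GA_relations A l FA free_gen" unfolding free_nrm_update[of \<nu>]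
proof (rule GA_relations_Sup[where S = "GA_seminorms A l"])
  show "\<nu> x = 0" if "\<And>p. p \<in> GA_seminorms A l \<Longrightarrow> p x = 0" for x
  proof -
    have "{p x | p. p \<in> GA_seminorms A l} = {0}" using that GA_seminorms_nonempty by force
    then show ?thesis by (simp add: \<nu>_Sup)
  qed
  show "GA_relations A l (free_star_algebra (\<lambda>_. 0)\<lparr>nrm := p\<rparr>) free_gen" if "p \<in> GA_seminorms A l" for p
    using that unfolding free_nrm_update[symmetric] GA_seminorms_def by blast
qed

abbreviation C where "C \<equiv> C_GA A l"
abbreviation \<iota> where "\<iota> \<equiv> to_completion FA"
abbreviation U where "U \<equiv> GA_gen A l"

lemma C_def': "C = Defs.completion FA" by (simp add: C_GA_def \<nu>_def)

lemma U_def': "U = (\<lambda>a b. \<iota> (free_gen a b))" by (intro ext) (simp add: GA_gen_def \<nu>_def)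

sublocale C: cstar_normed "C_GA A l"
  unfolding C_def' by (rule FA.cstar_normed_completion)

lemma star_alg_hom_\<iota>: "star_alg_hom FA C \<iota>" using FA.star_hom_to_completion
  by (intro star_alg_homI FA.star_alg_axioms C.star_alg_axioms) (simp add: C_def')

sublocale \<iota>: star_alg_hom "free_star_algebra \<nu>" "C_GA A l" "to_completion (free_star_algebra \<nu>)" by (rule star_alg_hom_\<iota>)

lemma nrm_\<iota>: "f \<in> carrier FA \<Longrightarrow> nrm C (\<iota> f) = \<nu> f" using FA.nrm_to_completion[of f] by (simp add: C_def')

lemma C_relations: "GA_relations A l C U"
proof -
  have "GA_relations A l C (\<lambda>a b. \<iota> (free_gen a b)) \<longleftrightarrow> GA_relations A l FA free_gen"
    by (rule GA_relations_hom[OF star_alg_hom_\<iota>]) (rule free_gen_closed, simp add: nrm_\<iota>)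
  then show ?thesis using FA_relations by (simp only: U_def')
qed

lemma GA_alg_C: "GA_alg C A l U"
proof (intro GA_alg.intro GA_alg_axioms.intro C.cstar_normed_axioms A01 C_relations)
  show "U a b \<in> carrier C" for a b unfolding U_def' by (intro \<iota>.hom_closed free_gen_closed)
qed

sublocale CG: GA_alg "C_GA A l" A l "GA_gen A l" by (rule GA_alg_C)

subsection \<open>Existence of the coproduct\<close>

abbreviation CC where "CC \<equiv> min_tensor C C"

text \<open>The generators are lifted to formal tensors, before completion, because
  \<open>completion_map\<close> extends contractions between uncompleted algebras. Contractivity is
  the maximality of \<open>\<nu>\<close>: the relations for the elements \<open>CG.V\<close> make
  the pulled-back tensor norm a member of the family.\<close>

lemma coproduct_exists:
  "\<exists>\<Delta>. star_hom C CC \<Delta> \<and> (\<forall>x y. \<Delta> (U x y) = (\<Oplus>\<^sub>CC z\<in>UNIV. pure_tensor C C (U x z) (U z y)))"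
proof -
  let ?FS = "CG.T.FS"
  interpret j: star_alg_hom ?FS CC "to_completion ?FS" by (rule CG.T.star_alg_hom_\<iota>)
  define w where "w x y = (\<Oplus>\<^sub>?FS z\<in>UNIV. basis_elt (U x z, U z y))" for x y
  have b: "basis_elt (U x z, U z y) \<in> carrier ?FS" for x y z by (intro CG.T.basis_closed CG.u_closed)
  have w: "w x y \<in> carrier ?FS" for x y unfolding w_def using b by (intro CG.T.FS.finsum_closed) blast
  have jw: "to_completion ?FS (w x y) = CG.V x y" for x y unfolding w_def pure_tensor_def using b by (intro j.hom_finsum) blast
  define d where "d = free_lift ?FS w"
  have d: "star_hom FA ?FS d" unfolding d_def by (rule CG.T.FS.free_lift_star_hom[OF w])
  have dg: "d (free_gen x y) = w x y" for x y unfolding d_def by (rule CG.T.FS.free_lift_gen[OF w])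
  have jd: "star_hom FA CC (\<lambda>f. to_completion ?FS (d f))" by (rule star_hom_compose[OF d j.hom])
  have le: "nrm ?FS (d f) \<le> nrm FA f" if f: "f \<in> carrier FA" for f
  proof -
    have df: "d f \<in> carrier ?FS" using star_homD(1)[OF d f] .
    have "nrm ?FS (d f) = nrm CC (to_completion ?FS (d f))" unfolding min_tensor_def using CG.T.FS.nrm_to_completion[OF df] by simp
    also have "to_completion ?FS (d f) = free_lift CC CG.V f" using CG.T.MT.free_hom_unique[OF jd f] by (simp add: dg jw)
    also have "nrm CC (free_lift CC CG.V f) \<le> \<nu> f"
      by (rule le_\<nu>[OF GA_seminorms_pullback f]) (rule CG.T.MT.cstar_alg_axioms CG.V_closed CG.V_relations)+
    finally show ?thesis by simp
  qed
  obtain \<Delta> where D: "star_hom (Defs.completion FA) (Defs.completion ?FS) \<Delta>"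
    "\<And>f. f \<in> carrier FA \<Longrightarrow> \<Delta> (\<iota> f) = to_completion ?FS (d f)"
    by (rule FA.completion_map[OF CG.T.FS.seminormed_star_alg_axioms d le]) (blast intro: that)+
  have "star_hom C CC \<Delta>" using D(1) unfolding C_def'[symmetric] min_tensor_def .
  moreover have "\<Delta> (U x y) = CG.V x y" for x y
  proof -
    have Ue: "\<iota> (free_gen x y) = U x y" by (simp add: U_def')
    have "\<Delta> (\<iota> (free_gen x y)) = CG.V x y" by (simp only: D(2)[OF free_gen_closed] dg jw)
    then show ?thesis by (simp only: Ue)
  qed
  ultimately show ?thesis by blast
qed

lemma coproduct_props:
  "star_hom C CC (GA_coproduct A l)"
  "GA_coproduct A l (U x y) = (\<Oplus>\<^sub>CC z\<in>UNIV. pure_tensor C C (U x z) (U z y))"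
  using someI_ex[OF coproduct_exists] unfolding GA_coproduct_def Let_def by blast+

end

subsection \<open>The quotient norm\<close>

locale cstar_ideal = cstar_normed + star_ideal
begin

sublocale seminormed_star_ideal by unfold_locales

context
  fixes j and \<delta> :: real
  assumes j: "j \<in> I" "star B j = j" and \<delta>: "\<delta> > 0"
begin

text \<open>The powers of \<open>1 + i\<delta>j\<close> grow at most like \<open>(1 + \<delta>\<^sup>2\<parallel>j\<parallel>\<^sup>2)\<^sup>k\<^sup>/\<^sup>2\<close>. Their averages are congruent to 1
  modulo \<open>I\<close> and nearly annihilate \<open>j\<close>, so they play the role of \<open>1 - e\<close> for an approximate unit \<open>e\<close> of \<open>I\<close>.\<close>

abbreviation ju where "ju \<equiv> \<one> \<oplus> (\<i> * of_real \<delta>) \<odot> j"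
abbreviation jsum where "jsum n \<equiv> (\<Oplus>k\<in>{..<n::nat}. ju [^] k)"

lemma j_carrier: "j \<in> carrier B" using j by simp

lemma ju_closed [simp, intro]: "ju \<in> carrier B" using j_carrier by simp

text \<open>For self-adjoint j the imaginary factor cancels the terms of first order: ju* ju = 1 +
  \<delta>^2 j^2.\<close>

lemma nrm_ju: "nrm B ju \<le> sqrt (1 + (\<delta> * nrm B j)\<^sup>2)"
proof (rule real_le_rsqrt)
  have e: "\<one> \<in> carrier B" "star B \<one> = \<one>" "\<one> \<otimes> \<one> = \<one>" by auto
  have h: "j \<in> carrier B" "star B j = j" "\<one> \<otimes> j = j" "j \<otimes> \<one> = j" using j_carrier j by auto
  have "star B ju \<otimes> ju = \<one> \<oplus> of_real (\<delta>\<^sup>2) \<odot> (j \<otimes> j)"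
  proof -
    let ?c = "\<i> * of_real \<delta>"
    have c: "cnj ?c + ?c = 0" "cnj ?c * ?c = of_real (\<delta>\<^sup>2)" by (auto simp: complex_eq_iff power2_eq_square)
    show ?thesis unfolding pencil_star[OF e h] pencil_mult[OF e h] c using j_carrier by simp
  qed
  then have "(nrm B ju)\<^sup>2 = nrm B (\<one> \<oplus> of_real (\<delta>\<^sup>2) \<odot> (j \<otimes> j))" using nrm_cstar[OF ju_closed] by simp
  also have "\<dots> \<le> nrm B \<one> + nrm B (of_real (\<delta>\<^sup>2) \<odot> (j \<otimes> j))" using j_carrier by (intro nrm_add) auto
  also have "\<dots> \<le> 1 + \<delta>\<^sup>2 * (nrm B j * nrm B j)"
    using j_carrier nrm_one by (intro add_mono) (auto simp: nrm_smult norm_power intro!: mult_left_mono nrm_mult)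
  finally show "(nrm B ju)\<^sup>2 \<le> 1 + (\<delta> * nrm B j)\<^sup>2" by (simp add: power2_eq_square mult_ac)
qed

lemma nrm_ju_pow:
  assumes "k \<le> n" shows "nrm B (ju [^] k) \<le> sqrt (1 + (\<delta> * nrm B j)\<^sup>2) ^ n"
proof -
  have "nrm B (ju [^] k) \<le> nrm B ju ^ k" by (rule nrm_pow) simp
  also have "\<dots> \<le> sqrt (1 + (\<delta> * nrm B j)\<^sup>2) ^ k" using nrm_ju by (intro power_mono) auto
  also have "\<dots> \<le> sqrt (1 + (\<delta> * nrm B j)\<^sup>2) ^ n" using assms by (intro power_increasing) auto
  finally show ?thesis .
qed

lemma jsum_closed [simp, intro]: "jsum n \<in> carrier B" by (intro finsum_closed) auto

lemma nrm_jsum: "nrm B (jsum n) \<le> real n * sqrt (1 + (\<delta> * nrm B j)\<^sup>2) ^ n"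
proof -
  have "nrm B (jsum n) \<le> (\<Sum>k<n. nrm B (ju [^] k))" by (intro nrm_finsum) auto
  also have "\<dots> \<le> (\<Sum>k<n. sqrt (1 + (\<delta> * nrm B j)\<^sup>2) ^ n)" by (intro sum_mono nrm_ju_pow) simp
  finally show ?thesis by simp
qed

text \<open>The left side is the sum of powers times ju - 1, which telescopes. Since the powers stay
  bounded, the average of powers times j has norm of order 1/(n \<delta>).\<close>

lemma jsum_telescope: "(\<i> * of_real \<delta>) \<odot> (jsum n \<otimes> j) = ju [^] n \<ominus> \<one>"
proof (induction n)
  case 0
  have "\<one> \<ominus> \<one> = \<zero>" by (simp add: minus_eq_0_iff)
  then show ?case using j_carrier by simp
next
  case (Suc n)
  have c: "ju [^] n \<in> carrier B" by simp
  have "jsum (Suc n) = ju [^] n \<oplus> jsum n" by (simp add: lessThan_Suc finsum_insert)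
  then have "(\<i> * of_real \<delta>) \<odot> (jsum (Suc n) \<otimes> j)
      = (\<i> * of_real \<delta>) \<odot> (ju [^] n \<otimes> j) \<oplus> (\<i> * of_real \<delta>) \<odot> (jsum n \<otimes> j)"
    using j_carrier c by (simp add: l_distr smult_r_distr)
  also have "\<dots> = (\<i> * of_real \<delta>) \<odot> (ju [^] n \<otimes> j) \<oplus> (ju [^] n \<ominus> \<one>)" unfolding Suc ..
  also have "\<dots> = (ju [^] n \<oplus> (\<i> * of_real \<delta>) \<odot> (ju [^] n \<otimes> j)) \<ominus> \<one>" using c j_carrier by (simp add: minus_eq a_ac)
  also have "ju [^] n \<oplus> (\<i> * of_real \<delta>) \<odot> (ju [^] n \<otimes> j) = ju [^] n \<otimes> ju" using c j_carrier by (simp add: r_distr smult_mult_r)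
  finally show ?case by simp
qed

lemma nrm_jsum_j: "\<delta> * nrm B (jsum n \<otimes> j) \<le> sqrt (1 + (\<delta> * nrm B j)\<^sup>2) ^ n + 1"
proof -
  have "\<delta> * nrm B (jsum n \<otimes> j) = nrm B ((\<i> * of_real \<delta>) \<odot> (jsum n \<otimes> j))" using j_carrier \<delta> by (simp add: nrm_smult norm_mult)
  also have "\<dots> \<le> nrm B (ju [^] n) + nrm B \<one>" unfolding jsum_telescope by (intro nrm_minus) auto
  also have "\<dots> \<le> sqrt (1 + (\<delta> * nrm B j)\<^sup>2) ^ n + 1" using nrm_ju_pow[of n n] nrm_one by (intro add_mono) auto
  finally show ?thesis .
qed

lemma q_jsum: "q (jsum n) = q (of_nat n \<odot> \<one>)"
proof -
  interpret Q: star_alg Q by (rule star_alg_Q)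
  interpret h: star_alg_hom B Q q by (rule star_alg_hom_q)
  have "q ju = q \<one>"
  proof -
    have "ju = (\<i> * of_real \<delta>) \<odot> j \<oplus> \<one>" using j_carrier by (simp add: a_comm)
    then have "ju \<ominus> \<one> = (\<i> * of_real \<delta>) \<odot> j" using j_carrier by (simp add: add_minus_cancel)
    then show ?thesis using smult_I[OF j(1)] by (simp add: q_eq_iff)
  qed
  then have qu: "q (ju [^] k) = one Q" for k :: nat by (induction k) (simp_all add: h.hom_mult h.hom_one)
  have "q (jsum n) = (\<Oplus>\<^sub>Q k\<in>{..<n}. 1 \<odot>\<^sub>Q one Q)" using h.hom_finsum[of "\<lambda>k. ju [^] k" "{..<n}"] by (simp add: qu)
  also have "\<dots> = of_nat n \<odot>\<^sub>Q one Q" by (subst Q.finsum_smult_const) auto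
  finally show ?thesis by (simp add: h.hom_smult q_one)
qed

text \<open>With g the average of the powers, y = x g* lies in the coset of x because g is congruent
  to 1. In y* y = g k g* + g j g* the first term has norm at most W^2 c, and the second is small
  because g j is.\<close>

lemma quotient_norm_step:
  assumes x: "x \<in> carrier B" and k: "k \<in> carrier B" "star B x \<otimes> x = j \<oplus> k" "nrm B k \<le> c" and n: "n > 0"
    and W: "W = sqrt (1 + (\<delta> * nrm B j)\<^sup>2) ^ n"
  shows "(nrm Q (q x))\<^sup>2 \<le> W * c * W + (W + 1) / (real n * \<delta>) * W"
proof -
  interpret Q: star_alg Q by (rule star_alg_Q)
  interpret h: star_alg_hom B Q q by (rule star_alg_hom_q)
  define g where "g = of_real (1 / real n) \<odot> jsum n"
  have g: "g \<in> carrier B" by (simp add: g_def)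
  have W0: "0 \<le> W" by (simp add: W)
  have c0: "0 \<le> c" using nrm_nonneg[OF k(1)] k(3) by linarith
  have ng: "nrm B g \<le> W" using nrm_jsum[of n] n by (simp add: g_def nrm_smult norm_divide W field_simps)
  have ngj: "nrm B (g \<otimes> j) \<le> (W + 1) / (real n * \<delta>)" using nrm_jsum_j[of n] n \<delta> j_carrier
    by (simp add: g_def nrm_smult norm_divide W smult_mult_l field_simps)
  have "q g = of_real (1 / real n) \<odot>\<^sub>Q (of_nat n \<odot>\<^sub>Q one Q)" by (simp add: g_def h.hom_smult q_jsum q_one)
  then have qg: "q g = one Q" using n by (simp flip: Q.smult_assoc)
  define y where "y = x \<otimes> star B g"
  have y: "y \<in> carrier B" using x g by (simp add: y_def)
  have "q y = q x" using x g by (simp add: y_def h.hom_mult h.hom_star qg)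
  then have "nrm Q (q x) \<le> nrm B y" using nrm_q_le[OF y] by simp
  then have "(nrm Q (q x))\<^sup>2 \<le> (nrm B y)\<^sup>2" using nrm_q_nonneg[OF x] by (intro power_mono) auto
  also have "\<dots> = nrm B (star B y \<otimes> y)" using nrm_cstar[OF y] by simp
  also have "star B y \<otimes> y = g \<otimes> (star B x \<otimes> x) \<otimes> star B g" using x g by (simp add: y_def star_mult m_assoc)
  also have "\<dots> = g \<otimes> k \<otimes> star B g \<oplus> g \<otimes> j \<otimes> star B g" unfolding k(2) using g j_carrier k(1) by (simp add: r_distr l_distr a_comm)
  also have "nrm B \<dots> \<le> nrm B (g \<otimes> k \<otimes> star B g) + nrm B (g \<otimes> j \<otimes> star B g)" using g j_carrier k(1) by (intro nrm_add) auto
  also have "\<dots> \<le> nrm B (g \<otimes> k) * nrm B (star B g) + nrm B (g \<otimes> j) * nrm B (star B g)"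
    using g j_carrier k(1) by (intro add_mono nrm_mult) auto
  also have "\<dots> \<le> (nrm B g * nrm B k) * nrm B (star B g) + nrm B (g \<otimes> j) * nrm B (star B g)"
    using g k(1) by (intro add_mono mult_right_mono nrm_mult) auto
  also have "\<dots> \<le> (W * c) * W + (W + 1) / (real n * \<delta>) * W"
    using g k j_carrier ng ngj W0 \<delta> n c0 by (intro add_mono mult_mono) (auto simp: nrm_star)
  finally show ?thesis .
qed

end

lemma quotient_norm_le:
  assumes x: "x \<in> carrier B" and j: "j \<in> I" "star B j = j" and k: "k \<in> carrier B" "star B x \<otimes> x = j \<oplus> k" "nrm B k \<le> c"
  shows "(nrm Q (q x))\<^sup>2 \<le> c"
proof -
  define R where "R = (nrm B j)\<^sup>2"
  define r where "r m = inverse (real (Suc m))" for m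
  define E where "E m = exp (R * (r m)\<^sup>2)" for m
  have c0: "0 \<le> c" using nrm_nonneg[OF k(1)] k(3) by linarith
  have le: "(nrm Q (q x))\<^sup>2 \<le> E m * c * E m + (E m + 1) * r m * E m" for m
  proof -
    \<comment> \<open>With r = 1/(m+1) this gives n \<delta> = 1/r, so that g j tends to 0, while n
      (\<delta> |j|)^2 = R r^2 tends to 0, so that the growth factor W tends to 1.\<close>
    define n where "n = Suc m ^ 4"
    define \<delta> where "\<delta> = r m ^ 3"
    define W where "W = sqrt (1 + (\<delta> * nrm B j)\<^sup>2) ^ n"
    have rp: "r m > 0" by (simp add: r_def)
    have nr: "real n = inverse (r m) ^ 4" by (simp add: n_def r_def)
    have "W \<le> E m"
    proof -
      have "sqrt (1 + (\<delta> * nrm B j)\<^sup>2) \<le> 1 + (\<delta> * nrm B j)\<^sup>2"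
      proof -
        have "sqrt (1 + y) \<le> 1 + y" if "0 \<le> y" for y :: real
          using that by (intro real_le_lsqrt) (auto simp: power2_eq_square algebra_simps)
        then show ?thesis by simp
      qed
      also have "\<dots> \<le> exp ((\<delta> * nrm B j)\<^sup>2)" by (rule exp_ge_add_one_self)
      finally have "W \<le> exp ((\<delta> * nrm B j)\<^sup>2) ^ n" unfolding W_def by (intro power_mono) auto
      also have "\<dots> = exp (real n * (\<delta> * nrm B j)\<^sup>2)" by (simp add: exp_of_nat_mult)
      also have "real n * (\<delta> * nrm B j)\<^sup>2 = R * (r m)\<^sup>2" using rp unfolding nr \<delta>_def R_def by (simp add: field_simps eval_nat_numeral)
      finally show ?thesis by (simp add: E_def)
    qed
    have W0: "0 \<le> W" by (simp add: W_def)
    have "(nrm Q (q x))\<^sup>2 \<le> W * c * W + (W + 1) / (real n * \<delta>) * W"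
      by (rule quotient_norm_step[OF j _ x k _ W_def]) (use rp in \<open>auto simp: \<delta>_def n_def\<close>)
    also have "real n * \<delta> = inverse (r m)" using rp unfolding nr \<delta>_def by (simp add: field_simps eval_nat_numeral)
    also have "W * c * W + (W + 1) / inverse (r m) * W = W * c * W + (W + 1) * r m * W" by (simp add: field_simps)
    also have "\<dots> \<le> E m * c * E m + (E m + 1) * r m * E m" using \<open>W \<le> E m\<close> W0 c0 rp by (intro add_mono mult_mono) auto
    finally show ?thesis .
  qed
  have "r \<longlonglongrightarrow> 0" unfolding r_def[abs_def] by (rule LIMSEQ_inverse_real_of_nat)
  then have "(\<lambda>m. E m * c * E m + (E m + 1) * r m * E m) \<longlonglongrightarrow> c" unfolding E_def by (auto intro!: tendsto_eq_intros)
  then show ?thesis by (rule LIMSEQ_le_const) (use le in blast)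
qed

text \<open>Take i in I such that |i + x* x| is close to the quotient norm, and replace i by its
  self-adjoint part. Then x* x = j + k with j = -Re i self-adjoint in I and |k| close to the
  quotient norm of x* x, the situation of \<open>quotient_norm_le\<close>.\<close>

theorem quotient_cstar_ineq:
  assumes x: "x \<in> carrier B"
  shows "(nrm Q (q x))\<^sup>2 \<le> nrm Q (q (star B x \<otimes> x))"
proof (rule field_le_epsilon)
  fix \<epsilon> :: real assume e: "\<epsilon> > 0"
  let ?h = "star B x \<otimes> x"
  have h: "?h \<in> carrier B" "star B ?h = ?h" using x by (auto simp: star_mult)
  obtain i where i: "i \<in> I" "nrm B (i \<oplus> ?h) < nrm Q (q ?h) + \<epsilon>" using nrm_q_approx[OF h(1) e] .
  have ic: "i \<in> carrier B" using i by simp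
  define j where "j = (- 1 / 2) \<odot> (i \<oplus> star B i)"
  define k where "k = (1 / 2) \<odot> ((i \<oplus> ?h) \<oplus> star B (i \<oplus> ?h))"
  have jI: "j \<in> I" unfolding j_def using i star_I by (intro smult_I) simp
  have js: "star B j = j" using ic by (simp add: j_def star_smult star_add a_comm)
  have kc: "k \<in> carrier B" using ic h by (simp add: k_def)
  have "j \<oplus> k = (- 1 / 2) \<odot> (i \<oplus> star B i) \<oplus> ((1 / 2) \<odot> (i \<oplus> star B i) \<oplus> (1 / 2) \<odot> (?h \<oplus> ?h))"
  proof -
    have "(i \<oplus> ?h) \<oplus> star B (i \<oplus> ?h) = (i \<oplus> star B i) \<oplus> (?h \<oplus> ?h)" using ic h by (simp add: star_add a_ac)
    then show ?thesis using ic h by (simp add: j_def k_def smult_r_distr)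
  qed
  also have "\<dots> = ((- 1 / 2) \<odot> (i \<oplus> star B i) \<oplus> (1 / 2) \<odot> (i \<oplus> star B i)) \<oplus> (1 / 2) \<odot> (?h \<oplus> ?h)"
    using ic h by (intro a_assoc[symmetric]) auto
  also have "(- 1 / 2) \<odot> (i \<oplus> star B i) \<oplus> (1 / 2) \<odot> (i \<oplus> star B i) = (- 1 / 2 + 1 / 2) \<odot> (i \<oplus> star B i)"
    using ic by (intro smult_l_distr[symmetric]) auto
  also have "(1 / 2) \<odot> (?h \<oplus> ?h) = (1 / 2 + 1 / 2) \<odot> ?h" using h(1) by (simp only: smult_r_distr smult_l_distr)
  finally have jk: "?h = j \<oplus> k" using ic h by simp
  have "nrm B k \<le> (1 / 2) * (nrm B (i \<oplus> ?h) + nrm B (star B (i \<oplus> ?h)))"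
    using ic h nrm_add[of "i \<oplus> ?h" "star B (i \<oplus> ?h)"] by (simp add: k_def nrm_smult)
  also have "\<dots> = nrm B (i \<oplus> ?h)" using ic h by (simp add: nrm_star)
  finally have "nrm B k \<le> nrm Q (q ?h) + \<epsilon>" using i by simp
  then show "(nrm Q (q x))\<^sup>2 \<le> nrm Q (q ?h) + \<epsilon>" by (intro quotient_norm_le[OF x jI js kc jk])
qed

end

subsection \<open>The commutator ideal\<close>

context cstar_normed
begin

definition comm_ideals :: "'a set set" where
  "comm_ideals = {I. closed_ideal B I \<and> (\<forall>x\<in>carrier B. \<forall>y\<in>carrier B. x \<otimes> y \<ominus> y \<otimes> x \<in> I)}"

abbreviation J where "J \<equiv> commutator_ideal B"

lemma J_Inter: "J = \<Inter> comm_ideals" by (simp add: commutator_ideal_def comm_ideals_def)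

lemma carrier_comm_ideal: "carrier B \<in> comm_ideals" by (auto simp: comm_ideals_def closed_ideal_def oneideal)

lemma J_ideal: "ideal J B"
  unfolding J_Inter by (rule i_Intersect) (use carrier_comm_ideal in \<open>auto simp: comm_ideals_def closed_ideal_def\<close>)

lemma J_le: "I \<in> comm_ideals \<Longrightarrow> J \<subseteq> I" by (auto simp: J_Inter)

lemma J_commutator: "x \<in> carrier B \<Longrightarrow> y \<in> carrier B \<Longrightarrow> x \<otimes> y \<ominus> y \<otimes> x \<in> J" by (auto simp: J_Inter comm_ideals_def)

lemma J_closed:
  assumes "range Y \<subseteq> J" "x \<in> carrier B" "(\<lambda>n. nrm B (Y n \<ominus> x)) \<longlonglongrightarrow> 0"
  shows "x \<in> J" unfolding J_Inter
proof
  fix I assume I: "I \<in> comm_ideals"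
  then have "range Y \<subseteq> I" using J_le assms(1) by blast
  then show "x \<in> I" using I assms(2,3) unfolding comm_ideals_def closed_ideal_def by blast
qed

text \<open>The definition of \<open>commutator_ideal\<close> does not mention the involution. The
  family of competing ideals is stable under taking adjoints, so its intersection is a
  *-ideal.\<close>

lemma star_comm_ideal:
  assumes I: "I \<in> comm_ideals"
  shows "{x \<in> carrier B. star B x \<in> I} \<in> comm_ideals" (is "?I \<in> _")
proof -
  interpret I: ideal I B using I by (simp add: comm_ideals_def closed_ideal_def)
  have "ideal ?I B" by (rule idealI2) (auto simp: star_add star_mult I.I_l_closed I.I_r_closed)
  moreover have "x \<in> ?I" if X: "range X \<subseteq> ?I" "x \<in> carrier B" "(\<lambda>n. nrm B (X n \<ominus> x)) \<longlonglongrightarrow> 0" for X x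
  proof -
    have Xc: "X n \<in> carrier B" "star B (X n) \<in> I" for n using X(1) by auto
    have "nrm B (star B (X n) \<ominus> star B x) = nrm B (X n \<ominus> x)" for n using Xc X(2) by (simp add: nrm_star flip: star_minus)
    then have "(\<lambda>n. nrm B (star B (X n) \<ominus> star B x)) \<longlonglongrightarrow> 0" using X(3) by simp
    moreover have "range (\<lambda>n. star B (X n)) \<subseteq> I" using Xc by auto
    ultimately have "star B x \<in> I" using I X(2) unfolding comm_ideals_def closed_ideal_def by blast
    then show ?thesis using X(2) by simp
  qed
  moreover have "x \<otimes> y \<ominus> y \<otimes> x \<in> ?I" if "x \<in> carrier B" "y \<in> carrier B" for x y
  proof -
    have "star B (x \<otimes> y \<ominus> y \<otimes> x) = star B y \<otimes> star B x \<ominus> star B x \<otimes> star B y" using that by (simp add: star_minus star_mult)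
    then show ?thesis using I that by (simp add: comm_ideals_def)
  qed
  ultimately show ?thesis unfolding comm_ideals_def closed_ideal_def by blast
qed

lemma J_star:
  assumes "x \<in> J" shows "star B x \<in> J" unfolding J_Inter
proof
  fix I assume "I \<in> comm_ideals"
  then have "x \<in> {x \<in> carrier B. star B x \<in> I}" using J_le[OF star_comm_ideal] assms by blast
  then show "star B x \<in> I" by simp
qed

lemma cstar_ideal_J: "cstar_ideal B J"
proof -
  interpret ideal J B by (rule J_ideal)
  show ?thesis by unfold_locales (rule J_star)
qed

end

subsection \<open>Laurent monomials\<close>

text \<open>On the piece cut out by e the elements T i act as commuting unitaries, since T T* e = e.
  Monomials with integer exponents therefore multiply as expected once they are multiplied by
  e.\<close>

locale laurent = seminormed_star_alg B for B :: "'a star_algebra" (structure) +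
  fixes T :: "'n::finite \<Rightarrow> 'a" and e
  assumes comm: "x \<in> carrier B \<Longrightarrow> y \<in> carrier B \<Longrightarrow> x \<otimes> y = y \<otimes> x"
    and T_closed [simp, intro]: "T i \<in> carrier B" and e_closed [simp, intro]: "e \<in> carrier B"
    and T_le: "nrm B (T i) \<le> 1" and e_le: "nrm B e \<le> 1"
    and T_e: "T i \<otimes> star B (T i) \<otimes> e = e"
begin

sublocale cring B
  by (intro cring.intro comm_monoid.intro comm_monoid_axioms.intro ring_axioms is_monoid comm) auto

declare pow_nat [simp del]

definition mon :: "'n \<Rightarrow> int \<Rightarrow> 'a" where
  "mon i k = (if 0 \<le> k then T i [^] (nat k :: nat) else star B (T i) [^] (nat (- k) :: nat))"

definition Mon :: "('n \<Rightarrow> int) \<Rightarrow> 'a" where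
  "Mon k = (\<Otimes>i\<in>UNIV. mon i (k i))"

lemma mon_closed [simp, intro]: "mon i k \<in> carrier B" by (simp add: mon_def)

lemma Mon_closed [simp, intro]: "Mon k \<in> carrier B" by (simp add: Mon_def)

lemma T_mon: "T i \<otimes> mon i k \<otimes> e = mon i (k + 1) \<otimes> e"
proof (cases "0 \<le> k")
  case True
  then have "mon i (k + 1) = T i [^] Suc (nat k)" by (simp add: mon_def nat_add_distrib)
  then show ?thesis using True by (simp add: mon_def m_comm)
next
  case False
  define m where "m = nat (- k) - 1"
  have k: "k = - int (Suc m)" using False by (simp add: m_def)
  have m1: "mon i (k + 1) = star B (T i) [^] m" using k by (cases m) (auto simp: mon_def nat_add_distrib)
  have "T i \<otimes> mon i k \<otimes> e = star B (T i) [^] m \<otimes> (T i \<otimes> star B (T i) \<otimes> e)" using k by (simp add: mon_def m_ac nat_add_distrib)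
  then show ?thesis by (simp add: T_e m1)
qed

lemma star_T_mon: "star B (T i) \<otimes> mon i k \<otimes> e = mon i (k - 1) \<otimes> e"
proof (cases "k \<le> 0")
  case True
  define m where "m = nat (- k)"
  have k: "k = - int m" using True by (simp add: m_def)
  have "mon i (k - 1) = star B (T i) [^] Suc m" using k by (simp add: mon_def nat_add_distrib)
  moreover have "mon i k = star B (T i) [^] m" unfolding k by (cases "m = 0") (simp_all add: mon_def)
  ultimately show ?thesis by (simp add: m_comm)
next
  case False
  define m where "m = nat k - 1"
  have k: "k = int (Suc m)" using False by (simp add: m_def)
  have m1: "mon i (k - 1) = T i [^] m" using k by (simp add: mon_def)
  have mk: "mon i k = T i [^] Suc m" unfolding k by (simp add: mon_def del: of_nat_Suc)
  have "star B (T i) \<otimes> mon i k \<otimes> e = T i [^] m \<otimes> (T i \<otimes> star B (T i) \<otimes> e)" unfolding mk by (simp add: m_ac)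
  then show ?thesis by (simp add: T_e m1)
qed

lemma Mon_split: "Mon k = mon i (k i) \<otimes> (\<Otimes>j\<in>UNIV - {i}. mon j (k j))"
proof -
  have "insert i (UNIV - {i}) = (UNIV :: 'n set)" by auto
  then have "Mon k = (\<Otimes>j\<in>insert i (UNIV - {i}). mon j (k j))" unfolding Mon_def by (rule arg_cong[OF sym])
  also have "\<dots> = mon i (k i) \<otimes> (\<Otimes>j\<in>UNIV - {i}. mon j (k j))" by (rule finprod_insert) auto
  finally show ?thesis .
qed

text \<open>Commutativity brings the i-th factor next to t and e, where a rule in one variable
  applies.\<close>

lemma Mon_update:
  assumes t: "t \<in> carrier B" "t \<otimes> mon i (k i) \<otimes> e = mon i m \<otimes> e"
  shows "t \<otimes> (Mon k \<otimes> e) = Mon (k(i := m)) \<otimes> e"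
proof -
  let ?R = "\<Otimes>j\<in>UNIV - {i}. mon j (k j)"
  have R: "?R \<in> carrier B" by simp
  have R': "(\<Otimes>j\<in>UNIV - {i}. mon j ((k(i := m)) j)) = ?R" by (intro finprod_cong') auto
  have "t \<otimes> (Mon k \<otimes> e) = (t \<otimes> mon i (k i) \<otimes> e) \<otimes> ?R" unfolding Mon_split[of k i] using R t(1) by (simp add: m_ac)
  also have "\<dots> = Mon (k(i := m)) \<otimes> e" unfolding t(2) Mon_split[of "k(i := m)" i] R' using R by (simp add: m_ac)
  finally show ?thesis .
qed

lemma T_Mon: "T i \<otimes> (Mon k \<otimes> e) = Mon (k(i := k i + 1)) \<otimes> e" by (rule Mon_update) (simp_all add: T_mon)

lemma star_T_Mon: "star B (T i) \<otimes> (Mon k \<otimes> e) = Mon (k(i := k i - 1)) \<otimes> e" by (rule Mon_update) (simp_all add: star_T_mon)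

lemma nrm_Mon_e: "nrm B (Mon k \<otimes> e) \<le> 1"
proof -
  have pow: "nrm B (y [^] n) \<le> 1" if "y \<in> carrier B" "nrm B y \<le> 1" for y and n :: nat
    using nrm_pow[OF that(1), of n] power_le_one[of "nrm B y" n] that by auto
  have m: "nrm B (mon i j) \<le> 1" for i j using T_le by (auto simp: mon_def nrm_star intro!: pow)
  have "nrm B (\<Otimes>i\<in>S. mon i (k i)) \<le> 1" if "finite S" for S using that
  proof induction
    case (insert i S)
    have "nrm B (\<Otimes>i\<in>insert i S. mon i (k i)) = nrm B (mon i (k i) \<otimes> (\<Otimes>i\<in>S. mon i (k i)))" using insert by (simp add: finprod_insert)
    also have "\<dots> \<le> nrm B (mon i (k i)) * nrm B (\<Otimes>i\<in>S. mon i (k i))" by (intro nrm_mult) auto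
    also have "\<dots> \<le> 1 * 1" using insert m by (intro mult_mono) auto
    finally show ?case by simp
  qed (simp add: nrm_one)
  then have "nrm B (Mon k) \<le> 1" by (simp add: Mon_def)
  have "nrm B (Mon k \<otimes> e) \<le> nrm B (Mon k) * nrm B e" by (intro nrm_mult) auto
  also have "\<dots> \<le> 1 * 1" using \<open>nrm B (Mon k) \<le> 1\<close> e_le by (intro mult_mono) auto
  finally show ?thesis by simp
qed

end

section \<open>Exponents of words and their evaluation\<close>

fun wdeg :: "'n letter list \<Rightarrow> 'n \<Rightarrow> int" where
  "wdeg [] = (\<lambda>_. 0)"
| "wdeg ((a, b, s) # w) = (wdeg w)(a := wdeg w a + (if s then - 1 else 1))"

text \<open>On the piece belonging to \<pi> only the entries u_ab with a = \<pi> b survive, and such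
  an entry is T_a. Hence the exponents in \<open>wdeg\<close> are counted by the first index, and
  only words made of such letters contribute.\<close>

definition wfits :: "('n \<Rightarrow> 'n) \<Rightarrow> 'n letter list \<Rightarrow> bool" where
  "wfits \<pi> w \<longleftrightarrow> (\<forall>(a, b, s) \<in> set w. a = \<pi> b)"

lemma wfits_simps [simp]: "wfits \<pi> []" "wfits \<pi> ((a, b, s) # w) \<longleftrightarrow> a = \<pi> b \<and> wfits \<pi> w" by (auto simp: wfits_def)

lemma wdeg_le: "\<bar>wdeg w i\<bar> \<le> int (length w)"
proof (induction w rule: wdeg.induct)
  case (2 a b s w)
  then show ?case by (cases "i = a") auto
qed simp

text \<open>Letters are absorbed into the monomial one at a time. A letter with a \<noteq> \<pi> b
  is moved next to e by commutativity, where it vanishes.\<close>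

lemma (in laurent) word_eval_Mon:
  assumes v: "\<And>a b. v a b \<in> carrier B" "\<And>b. v (\<pi> b) b = T (\<pi> b)"
    and zero: "\<And>a b. a \<noteq> \<pi> b \<Longrightarrow> v a b \<otimes> e = \<zero>" "\<And>a b. a \<noteq> \<pi> b \<Longrightarrow> star B (v a b) \<otimes> e = \<zero>"
  shows "word_eval B v w \<otimes> e = (if wfits \<pi> w then Mon (wdeg w) \<otimes> e else \<zero>)"
proof (induction w rule: wdeg.induct)
  case 1
  have "Mon (\<lambda>_. 0) = \<one>" by (simp add: Mon_def mon_def)
  then show ?case by simp
next
  case (2 a b s w)
  have L: "letter_eval B v (a, b, s) \<in> carrier B" and Wc: "word_eval B v w \<in> carrier B"
    using letter_eval_closed[of v] word_eval_closed[of v] v(1) by auto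
  have eq: "word_eval B v ((a, b, s) # w) \<otimes> e = letter_eval B v (a, b, s) \<otimes> (word_eval B v w \<otimes> e)" using L Wc by (simp add: m_assoc)
  show ?case
  proof (cases "a = \<pi> b")
    case True
    have "letter_eval B v (a, b, s) = (if s then star B (T a) else T a)" using True v(2) by (simp add: letter_eval_def)
    then have "letter_eval B v (a, b, s) \<otimes> (Mon (wdeg w) \<otimes> e) = Mon (wdeg ((a, b, s) # w)) \<otimes> e"
      using T_Mon[of a "wdeg w"] star_T_Mon[of a "wdeg w"] by (cases s) (simp_all del: fun_upd_apply)
    then show ?thesis unfolding eq 2 using True L by (simp del: wdeg.simps)
  next
    case False
    have "letter_eval B v (a, b, s) \<otimes> (word_eval B v w \<otimes> e) = word_eval B v w \<otimes> (letter_eval B v (a, b, s) \<otimes> e)"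
      using L Wc by (simp add: m_lcomm)
    also have "letter_eval B v (a, b, s) \<otimes> e = \<zero>" using zero[OF False] by (auto simp: letter_eval_def)
    finally show ?thesis unfolding eq using False Wc by simp
  qed
qed

text \<open>The scalar counterpart of \<open>word_eval_Mon\<close>; on the unit circle conjugation
  is the exponent -1.\<close>

lemma word_eval_point:
  assumes "\<And>i. cmod (z $ i) = 1"
  shows "word_eval complex_alg (point_gen (z, \<pi>)) w = (if wfits \<pi> w then \<Prod>i\<in>UNIV. (z $ i) powi (wdeg w i) else 0)"
proof (induction w rule: wdeg.induct)
  case (2 a b s w)
  have nz: "z $ i \<noteq> 0" for i using assms[of i] by auto
  have cnj: "cnj (z $ a) = (z $ a) powi (- 1)"
  proof -
    have "z $ a * cnj (z $ a) = 1" using complex_norm_square[of "z $ a"] assms[of a] by simp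
    then have "inverse (z $ a) = cnj (z $ a)" by (rule inverse_unique)
    then show ?thesis by (simp add: power_int_minus)
  qed
  show ?case
  proof (cases "a = \<pi> b \<and> wfits \<pi> w")
    case True
    let ?d = "(wdeg w)(a := wdeg w a + (if s then - 1 else 1))"
    have "(\<Prod>i\<in>UNIV. (z $ i) powi (?d i)) = (z $ a) powi (?d a) * (\<Prod>i\<in>UNIV - {a}. (z $ i) powi (?d i))" by (rule prod.remove) auto
    also have "(\<Prod>i\<in>UNIV - {a}. (z $ i) powi (?d i)) = (\<Prod>i\<in>UNIV - {a}. (z $ i) powi (wdeg w i))" by (intro prod.cong) auto
    also have "(z $ a) powi (?d a) = (z $ a) powi (if s then - 1 else 1) * (z $ a) powi (wdeg w a)"
      using nz[of a] by (simp add: power_int_add)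
    also have "\<dots> * (\<Prod>i\<in>UNIV - {a}. (z $ i) powi (wdeg w i)) = (z $ a) powi (if s then - 1 else 1) * (\<Prod>i\<in>UNIV. (z $ i) powi (wdeg w i))"
      by (subst (2) prod.remove[of _ a]) auto
    finally have "(\<Prod>i\<in>UNIV. (z $ i) powi (?d i)) = (z $ a) powi (if s then - 1 else 1) * (\<Prod>i\<in>UNIV. (z $ i) powi (wdeg w i))" .
    then show ?thesis using True 2 cnj by (auto simp: letter_eval_def point_gen_def)
  next
    case False
    then show ?thesis using 2 by (auto simp: letter_eval_def point_gen_def)
  qed
qed simp

subsection \<open>Averaging over roots of unity\<close>

text \<open>Average the Laurent polynomial times z^(-k) over the grid of M-th roots of unity with M
  = 2D + 1. Exponents differ by at most 2D < M in each coordinate, so the grid separates them and a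
  finite average replaces the Fourier integral.\<close>

lemma laurent_coefficient_le:
  fixes d :: "'w \<Rightarrow> 'n::finite \<Rightarrow> int" and f :: "'w \<Rightarrow> complex" and D :: nat
  assumes W: "finite W" "\<And>w i. w \<in> W \<Longrightarrow> \<bar>d w i\<bar> \<le> int D" and k: "\<And>i. \<bar>k i\<bar> \<le> int D"
    and S: "\<And>z. (\<And>i. cmod (z i) = 1) \<Longrightarrow> cmod (\<Sum>w\<in>W. f w * (\<Prod>i\<in>UNIV. z i powi d w i)) \<le> S"
  shows "cmod (\<Sum>w | w \<in> W \<and> d w = k. f w) \<le> S"
proof -
  define M where "M = 2 * D + 1"
  define T :: "('n \<Rightarrow> nat) set" where "T = PiE UNIV (\<lambda>_. {..<M})"
  define z where "z t i = cis (2 * pi * real (t i) / real M)" for t :: "'n \<Rightarrow> nat" and i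
  have M: "M > 0" by (simp add: M_def)
  have cT: "card T = M ^ CARD('n)" by (simp add: T_def card_PiE)
  have zp: "z t i powi m = cis (2 * pi * of_int m / real M) ^ t i" for t i m
    by (simp add: z_def cis_power_int Complex.DeMoivre mult_ac)
  have avg: "(\<Sum>t\<in>T. \<Prod>i\<in>UNIV. z t i powi (d w i - k i)) = (if d w = k then of_nat (card T) else 0)" if w: "w \<in> W" for w
  proof -
    have lt: "\<bar>d w i - k i\<bar> < int M" for i using W(2)[OF w, of i] k[of i] by (simp add: M_def)
    have "(\<Sum>t\<in>T. \<Prod>i\<in>UNIV. z t i powi (d w i - k i)) = (\<Prod>i\<in>UNIV. \<Sum>j<M. cis (2 * pi * of_int (d w i - k i) / real M) ^ j)"
      unfolding T_def zp by (rule prod_sum_PiE[symmetric]) auto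
    also have "\<dots> = (\<Prod>i\<in>UNIV. if d w i = k i then of_nat M else 0)"
      by (intro prod.cong refl) (simp only: sum_roots_of_unity[OF lt] right_minus_eq)
    also have "\<dots> = (if d w = k then of_nat (card T) else 0)" by (auto simp: cT prod_zero_iff fun_eq_iff intro: prod_zero)
    finally show ?thesis .
  qed
  have nz: "z t i \<noteq> 0" and cz: "cmod (z t i) = 1" for t i by (auto simp: z_def)
  have "(\<Sum>t\<in>T. (\<Sum>w\<in>W. f w * (\<Prod>i\<in>UNIV. z t i powi d w i)) * (\<Prod>i\<in>UNIV. z t i powi (- k i)))
      = (\<Sum>t\<in>T. \<Sum>w\<in>W. f w * (\<Prod>i\<in>UNIV. z t i powi (d w i - k i)))"
    by (intro sum.cong refl) (simp add: sum_distrib_right mult.assoc flip: prod.distrib power_int_add[OF disjI1[OF nz]])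
  also have "\<dots> = (\<Sum>w\<in>W. f w * (\<Sum>t\<in>T. \<Prod>i\<in>UNIV. z t i powi (d w i - k i)))" by (subst sum.swap) (simp add: sum_distrib_left)
  also have "\<dots> = (\<Sum>w\<in>W. if d w = k then f w * of_nat (card T) else 0)" by (intro sum.cong refl) (simp add: avg)
  also have "\<dots> = of_nat (card T) * (\<Sum>w | w \<in> W \<and> d w = k. f w)"
    using W(1) by (simp add: sum.If_cases sum_distrib_left mult.commute Int_def)
  finally have eq: "of_nat (card T) * (\<Sum>w | w \<in> W \<and> d w = k. f w)
    = (\<Sum>t\<in>T. (\<Sum>w\<in>W. f w * (\<Prod>i\<in>UNIV. z t i powi d w i)) * (\<Prod>i\<in>UNIV. z t i powi (- k i)))" ..
  have "real (card T) * cmod (\<Sum>w | w \<in> W \<and> d w = k. f w) = cmod (of_nat (card T) * (\<Sum>w | w \<in> W \<and> d w = k. f w))"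
    by (simp add: norm_mult)
  also have "\<dots> \<le> (\<Sum>t\<in>T. cmod ((\<Sum>w\<in>W. f w * (\<Prod>i\<in>UNIV. z t i powi d w i)) * (\<Prod>i\<in>UNIV. z t i powi (- k i))))"
    unfolding eq by (rule norm_sum)
  also have "\<dots> \<le> (\<Sum>t\<in>T. S)" using S cz by (intro sum_mono) (simp add: norm_mult norm_power_int flip: prod_norm)
  finally show ?thesis using M cT by simp
qed

text \<open>If S < a, the polynomial factor loses against (S/a)^(2^n). Taking N-th roots, with x =
  (S/a)^(1/N), reduces this to the convergence of n x^n to 0.\<close>

lemma le_of_doubling_powers:
  fixes a S K :: real
  assumes a: "0 \<le> a" and S: "0 \<le> S" and K: "0 \<le> K" and N: "N > 0"
    and le: "\<And>n. a ^ (2 ^ n) \<le> K * real (2 ^ n) ^ N * S ^ (2 ^ n)"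
  shows "a \<le> S"
proof (rule ccontr)
  assume "\<not> a \<le> S"
  then have aS: "S < a" by simp
  have a0: "0 < a" using aS S by simp
  define x where "x = root N (S / a)"
  have x: "0 \<le> x" "x < 1" "x ^ N = S / a" using a0 S aS N by (auto simp: x_def real_root_pow_pos2)
  \<comment> \<open>K' \<ge> 1 gives K \<le> K'^N, so that the whole right-hand side is bounded by
    an N-th power.\<close>
  define K' where "K' = max 1 K"
  have K': "K \<le> K' ^ N" "0 \<le> K'"
  proof -
    have "K' ^ 1 \<le> K' ^ N" using N by (intro power_increasing) (auto simp: K'_def)
    then show "K \<le> K' ^ N" by (simp add: K'_def)
  qed (simp add: K'_def)
  have ge: "1 \<le> K' * (real (2 ^ n) * x ^ (2 ^ n))" for n
  proof -
    have "1 \<le> K * real (2 ^ n) ^ N * (S ^ (2 ^ n) / a ^ (2 ^ n))" using le[of n] a0 by (simp add: field_simps)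
    also have "S ^ (2 ^ n) / a ^ (2 ^ n) = (x ^ N) ^ (2 ^ n)" by (simp add: x power_divide)
    also have "\<dots> = (x ^ (2 ^ n)) ^ N" by (simp flip: power_mult add: mult.commute)
    also have "K * real (2 ^ n) ^ N * (x ^ (2 ^ n)) ^ N \<le> K' ^ N * real (2 ^ n) ^ N * (x ^ (2 ^ n)) ^ N"
      using K' x by (intro mult_right_mono) auto
    also have "\<dots> = (K' * (real (2 ^ n) * x ^ (2 ^ n))) ^ N" by (simp add: power_mult_distrib)
    finally have "1 ^ N \<le> (K' * (real (2 ^ n) * x ^ (2 ^ n))) ^ N" by simp
    then show ?thesis by (rule power_mono_iff[THEN iffD1, rotated 3]) (use N K' x in auto)
  qed
  have "(\<lambda>n. real n * x ^ n) \<longlonglongrightarrow> 0" using powser_times_n_limit_0[of x] x by simp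
  then have "((\<lambda>n. real n * x ^ n) \<circ> (\<lambda>n. 2 ^ n)) \<longlonglongrightarrow> 0" by (rule LIMSEQ_subseq_LIMSEQ) (simp add: strict_mono_def)
  then have "(\<lambda>n. K' * (real (2 ^ n) * x ^ (2 ^ n))) \<longlonglongrightarrow> K' * 0" unfolding o_def by (intro tendsto_mult tendsto_const)
  then have "1 \<le> K' * 0" using ge by (intro LIMSEQ_le_const) auto
  then show False by simp
qed

lemma free_mult_support:
  assumes "mult (free_star_algebra p) f g w \<noteq> 0"
  obtains x y where "w = x @ y" "f x \<noteq> 0" "g y \<noteq> 0"
proof -
  have "(\<Sum>x | f x \<noteq> 0. \<Sum>y | g y \<noteq> 0. if x @ y = w then f x * g y else 0) \<noteq> 0"
    using assms by (simp add: free_star_algebra_def msa_simps)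
  then obtain x where x: "f x \<noteq> 0" "(\<Sum>y | g y \<noteq> 0. if x @ y = w then f x * g y else 0) \<noteq> 0"
    by (rule sum.not_neutral_contains_not_neutral) auto
  from x(2) obtain y where "g y \<noteq> 0" "(if x @ y = w then f x * g y else 0) \<noteq> 0" by (rule sum.not_neutral_contains_not_neutral) auto
  then show ?thesis using x(1) by (intro that[of x y]) (auto split: if_splits)
qed

lemma free_star_support:
  assumes "star (free_star_algebra p) f w \<noteq> 0"
  obtains x where "length x = length w" "f x \<noteq> 0"
proof -
  have "(\<Sum>x | f x \<noteq> 0. if winv x = w then cnj (f x) else 0) \<noteq> 0" using assms by (simp add: free_star_algebra_def msa_simps)
  then obtain x where "f x \<noteq> 0" "(if winv x = w then cnj (f x) else 0) \<noteq> 0" by (rule sum.not_neutral_contains_not_neutral) auto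
  then show ?thesis by (intro that[of x]) (auto split: if_splits)
qed

context GA
begin

subsection \<open>The commutative quotient\<close>

sublocale CJ: cstar_ideal "C_GA A l" "commutator_ideal (C_GA A l)" by (rule C.cstar_ideal_J)

abbreviation Q where "Q \<equiv> star_quot C (commutator_ideal C)"

sublocale Q: seminormed_star_alg "star_quot (C_GA A l) (commutator_ideal (C_GA A l))" by (rule CJ.seminormed_Q)

sublocale q: star_alg_hom "C_GA A l" "star_quot (C_GA A l) (commutator_ideal (C_GA A l))" CJ.q
  by (rule CJ.star_alg_hom_q)

definition \<theta> where "\<theta> f = CJ.q (\<iota> f)"

lemma star_hom_\<theta>: "star_hom FA Q \<theta>" unfolding \<theta>_def[abs_def] by (rule star_hom_compose[OF \<iota>.hom q.hom])

sublocale \<theta>: star_alg_hom "free_star_algebra \<nu>" "star_quot (C_GA A l) (commutator_ideal (C_GA A l))" \<theta>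
  by unfold_locales (rule star_hom_\<theta>)

abbreviation uq where "uq a b \<equiv> CJ.q (U a b)"
abbreviation pq where "pq a b \<equiv> uq a b \<otimes>\<^sub>Q star Q (uq a b)"

lemma \<theta>_gen: "\<theta> (free_gen a b) = uq a b" by (simp add: \<theta>_def U_def')

lemma Q_comm:
  assumes "x \<in> carrier Q" "y \<in> carrier Q" shows "x \<otimes>\<^sub>Q y = y \<otimes>\<^sub>Q x"
proof -
  obtain a b where ab: "a \<in> carrier C" "x = CJ.q a" "b \<in> carrier C" "y = CJ.q b" using assms unfolding CJ.carrier_Q by auto
  then show ?thesis using C.J_commutator[of a b] by (simp add: CJ.q_mult CJ.q_eq_iff)
qed

sublocale Q: cring "star_quot (C_GA A l) (commutator_ideal (C_GA A l))"
  by (intro cring.intro comm_monoid.intro comm_monoid_axioms.intro Q.ring_axioms Q.is_monoid Q_comm) auto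

lemma uq_closed [simp, intro]: "uq a b \<in> carrier Q" by simp

lemma pq_q: "pq a b = CJ.q (CG.p a b)" by (simp add: q.hom_mult q.hom_star)

lemma pq_q': "pq a b = CJ.q (CG.q a b)" by (simp add: q.hom_mult q.hom_star Q.m_comm)

lemma pq_idem: "pq a b \<otimes>\<^sub>Q pq a b = pq a b" using CG.magic_p unfolding pq_q by (simp add: C.magic_def flip: q.hom_mult)

lemma pq_col_sum: "(\<Oplus>\<^sub>Q a\<in>UNIV. pq a b) = \<one>\<^sub>Q"
proof -
  have "(\<Oplus>\<^sub>Q a\<in>UNIV. CJ.q (CG.p a b)) = CJ.q (\<Oplus>\<^sub>C a\<in>UNIV. CG.p a b)" by (rule q.hom_finsum[symmetric]) auto
  then show ?thesis using CG.magic_p unfolding pq_q by (simp add: C.magic_def q.hom_one)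
qed

lemma pq_row_0: "b \<noteq> b' \<Longrightarrow> pq a b \<otimes>\<^sub>Q pq a b' = \<zero>\<^sub>Q"
  unfolding pq_q using CG.p_orth(1)[of b b' a] by (simp add: q.hom_zero flip: q.hom_mult)

lemma pq_col_0: "a \<noteq> a' \<Longrightarrow> pq a b \<otimes>\<^sub>Q pq a' b = \<zero>\<^sub>Q"
  unfolding pq_q using CG.p_orth(2)[of a a' b] by (simp add: q.hom_zero flip: q.hom_mult)

text \<open>The relation \<open>CG.q_p_0\<close> mixes q and p; in Q both have the image
  \<open>pq\<close>, so it becomes a relation between entries of one magic unitary.\<close>

lemma pq_A_0:
  assumes "A $ a $ a' \<noteq> A $ c $ c'" shows "pq a c \<otimes>\<^sub>Q pq a' c' = \<zero>\<^sub>Q"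
proof -
  have "pq a c \<otimes>\<^sub>Q pq a' c' = CJ.q (CG.q a c \<otimes>\<^sub>C CG.p a' c')" by (subst pq_q', subst pq_q) (simp add: q.hom_mult)
  then show ?thesis using CG.q_p_0[OF assms] by (simp add: q.hom_zero)
qed

lemma pq_uq: "pq a b \<otimes>\<^sub>Q uq a b = uq a b" using CG.u_pi[of a b] by (simp flip: q.hom_mult q.hom_star)

lemma pq_star_uq: "pq a b \<otimes>\<^sub>Q star Q (uq a b) = star Q (uq a b)"
proof -
  have "star Q (uq a b) \<otimes>\<^sub>Q uq a b \<otimes>\<^sub>Q star Q (uq a b) = star Q (uq a b)"
    using CG.star_u_pi[of a b] by (simp flip: q.hom_mult q.hom_star)
  then show ?thesis by (simp add: Q.m_comm)
qed

lemma nrm_uq: "nrm Q (uq a b) \<le> 1" using CJ.nrm_q_le[of "U a b"] CG.nrm_u_le[of a b] by simp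

lemma nrm_pq: "nrm Q (pq a b) \<le> 1"
proof -
  have "nrm Q (pq a b) \<le> nrm Q (uq a b) * nrm Q (star Q (uq a b))" by (intro Q.nrm_mult) auto
  also have "\<dots> \<le> 1 * 1" using nrm_uq[of a b] by (intro mult_mono) (auto simp: Q.nrm_star)
  finally show ?thesis by simp
qed

text \<open>For each column b the projections p_ab sum to 1 over a, so some a retains at least the
  fraction 1/N of the norm. Doing this for every column in S chooses \<pi>(b) = a. Nothing is
  claimed about \<pi> here; that it is an automorphism follows later from e being nonzero.\<close>

lemma Q_localize:
  fixes S :: "'n set"
  assumes "finite S" and x: "x \<in> carrier Q"
  shows "\<exists>e \<pi>. e \<in> carrier Q \<and> nrm Q e \<le> 1 \<and> nrm Q x \<le> real CARD('n) ^ card S * nrm Q (x \<otimes>\<^sub>Q e)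
    \<and> (\<forall>b\<in>S. pq (\<pi> b) b \<otimes>\<^sub>Q e = e)"
  using assms(1)
proof induction
  case empty
  show ?case using x Q.nrm_one by (intro exI[of _ "\<one>\<^sub>Q"]) auto
next
  case (insert b S)
  then obtain e \<pi> where e: "e \<in> carrier Q" "nrm Q e \<le> 1" "nrm Q x \<le> real CARD('n) ^ card S * nrm Q (x \<otimes>\<^sub>Q e)"
    "\<And>b. b \<in> S \<Longrightarrow> pq (\<pi> b) b \<otimes>\<^sub>Q e = e" by blast
  define m where "m = Max (range (\<lambda>a. nrm Q (x \<otimes>\<^sub>Q e \<otimes>\<^sub>Q pq a b)))"
  have "m \<in> range (\<lambda>a. nrm Q (x \<otimes>\<^sub>Q e \<otimes>\<^sub>Q pq a b))" unfolding m_def by (rule Max_in) auto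
  then obtain a where a: "m = nrm Q (x \<otimes>\<^sub>Q e \<otimes>\<^sub>Q pq a b)" by auto
  have le: "nrm Q (x \<otimes>\<^sub>Q e \<otimes>\<^sub>Q pq a' b) \<le> m" for a' unfolding m_def by (rule Max_ge) auto
  have xe: "x \<otimes>\<^sub>Q e \<in> carrier Q" using x e by simp
  have "x \<otimes>\<^sub>Q e = (\<Oplus>\<^sub>Q a'\<in>UNIV. x \<otimes>\<^sub>Q e \<otimes>\<^sub>Q pq a' b)" using xe pq_col_sum[of b] Q.finsum_rdistr[of UNIV "x \<otimes>\<^sub>Q e" "\<lambda>a. pq a b"] by simp
  then have "nrm Q (x \<otimes>\<^sub>Q e) \<le> (\<Sum>a'\<in>UNIV. nrm Q (x \<otimes>\<^sub>Q e \<otimes>\<^sub>Q pq a' b))"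
    using xe Q.nrm_finsum[of "\<lambda>a'. x \<otimes>\<^sub>Q e \<otimes>\<^sub>Q pq a' b" UNIV] by simp
  also have "\<dots> \<le> (\<Sum>a'\<in>(UNIV :: 'n set). m)" by (intro sum_mono le)
  finally have "nrm Q (x \<otimes>\<^sub>Q e) \<le> real CARD('n) * nrm Q (x \<otimes>\<^sub>Q (e \<otimes>\<^sub>Q pq a b))" using x e by (simp add: a Q.m_assoc)
  then have "real CARD('n) ^ card S * nrm Q (x \<otimes>\<^sub>Q e)
      \<le> real CARD('n) ^ card S * (real CARD('n) * nrm Q (x \<otimes>\<^sub>Q (e \<otimes>\<^sub>Q pq a b)))"
    by (intro mult_left_mono) auto
  from order_trans[OF e(3) this] have n: "nrm Q x \<le> real CARD('n) ^ card (insert b S) * nrm Q (x \<otimes>\<^sub>Q (e \<otimes>\<^sub>Q pq a b))"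
    using insert(1,2) by (simp add: mult_ac)
  have "nrm Q (e \<otimes>\<^sub>Q pq a b) \<le> nrm Q e * nrm Q (pq a b)" using e by (intro Q.nrm_mult) auto
  also have "\<dots> \<le> 1 * 1" using e nrm_pq[of a b] by (intro mult_mono) auto
  finally have n1: "nrm Q (e \<otimes>\<^sub>Q pq a b) \<le> 1" by simp
  have fx: "pq ((\<pi>(b := a)) c) c \<otimes>\<^sub>Q (e \<otimes>\<^sub>Q pq a b) = e \<otimes>\<^sub>Q pq a b" if "c \<in> insert b S" for c
  proof (cases "c = b")
    case True
    have "pq a b \<otimes>\<^sub>Q (e \<otimes>\<^sub>Q pq a b) = e \<otimes>\<^sub>Q (pq a b \<otimes>\<^sub>Q pq a b)" using e by (intro Q.m_lcomm) auto
    then show ?thesis using True by (simp only: pq_idem fun_upd_same)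
  next
    case False
    have "pq (\<pi> c) c \<otimes>\<^sub>Q (e \<otimes>\<^sub>Q pq a b) = (pq (\<pi> c) c \<otimes>\<^sub>Q e) \<otimes>\<^sub>Q pq a b" using e by (intro Q.m_assoc[symmetric]) auto
    then show ?thesis using False that e(4)[of c] by simp
  qed
  show ?case using e(1) n n1 fx by (intro exI[of _ "e \<otimes>\<^sub>Q pq a b"] exI[of _ "\<pi>(b := a)"]) auto
qed

lemma one_in_G: "\<one>\<^sub>G \<in> carrier G" by (simp add: group.is_monoid group_torus_wreath_Aut monoid.one_closed)

text \<open>If e is nonzero, \<pi> is injective, since otherwise two orthogonal projections would
  both fix e. It preserves A, since otherwise the product of two projections fixing e would be 0. So
  (z, \<pi>) is a point of G for every z in the torus, and the coefficients on this piece are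
  controlled by the values of f at these points.\<close>

lemma nrm_\<theta>_le:
  assumes f: "f \<in> carrier FA" and D: "\<And>w. f w \<noteq> 0 \<Longrightarrow> length w \<le> D"
    and S: "\<And>g. g \<in> carrier G \<Longrightarrow> cmod (ev g f) \<le> S"
  shows "nrm Q (\<theta> f) \<le> real CARD('n) ^ CARD('n) * real (2 * D + 1) ^ CARD('n) * S"
proof -
  have S0: "0 \<le> S" using S[OF one_in_G] norm_ge_zero order_trans by blast
  have x: "\<theta> f \<in> carrier Q" using f by simp
  obtain e \<pi> where e: "e \<in> carrier Q" "nrm Q e \<le> 1" "nrm Q (\<theta> f) \<le> real CARD('n) ^ CARD('n) * nrm Q (\<theta> f \<otimes>\<^sub>Q e)"
    and \<pi>: "\<And>b. pq (\<pi> b) b \<otimes>\<^sub>Q e = e" using Q_localize[OF _ x, of UNIV] by auto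
  have "nrm Q (\<theta> f \<otimes>\<^sub>Q e) \<le> real (2 * D + 1) ^ CARD('n) * S"
  proof (cases "e = \<zero>\<^sub>Q")
    case True
    then show ?thesis using x S0 by simp
  next
    case e0: False
    have pp: "(pq a b \<otimes>\<^sub>Q pq (\<pi> c) c) \<otimes>\<^sub>Q e = pq a b \<otimes>\<^sub>Q e" for a b c using e(1) \<pi>[of c] by (subst Q.m_assoc) auto
    have "inj \<pi>"
    proof (rule injI, rule ccontr)
      fix b c assume bc: "\<pi> b = \<pi> c" "b \<noteq> c"
      have "e = (pq (\<pi> b) b \<otimes>\<^sub>Q pq (\<pi> c) c) \<otimes>\<^sub>Q e" using pp[of "\<pi> b" b c] \<pi>[of b] by simp
      also have "pq (\<pi> b) b \<otimes>\<^sub>Q pq (\<pi> c) c = \<zero>\<^sub>Q" using pq_row_0[OF bc(2), of "\<pi> b"] bc(1) by simp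
      finally show False using e0 e(1) by simp
    qed
    then have bij: "bij \<pi>" by (simp add: bij_def finite_UNIV_inj_surj)
    have A\<pi>: "A $ \<pi> i $ \<pi> j = A $ i $ j" for i j
    proof (rule ccontr)
      assume ne: "A $ \<pi> i $ \<pi> j \<noteq> A $ i $ j"
      have "e = (pq (\<pi> i) i \<otimes>\<^sub>Q pq (\<pi> j) j) \<otimes>\<^sub>Q e" using pp[of "\<pi> i" i j] \<pi>[of i] by simp
      also have "pq (\<pi> i) i \<otimes>\<^sub>Q pq (\<pi> j) j = \<zero>\<^sub>Q" by (rule pq_A_0[OF ne])
      finally show False using e0 e(1) by simp
    qed
    have p0: "pq a b \<otimes>\<^sub>Q e = \<zero>\<^sub>Q" if "a \<noteq> \<pi> b" for a b using pp[of a b b] pq_col_0[OF that, of b] e(1) by simp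
    have z1: "uq a b \<otimes>\<^sub>Q e = \<zero>\<^sub>Q" if "a \<noteq> \<pi> b" for a b
    proof -
      have "uq a b \<otimes>\<^sub>Q e = (pq a b \<otimes>\<^sub>Q uq a b) \<otimes>\<^sub>Q e" by (simp only: pq_uq)
      also have "\<dots> = uq a b \<otimes>\<^sub>Q (pq a b \<otimes>\<^sub>Q e)" using e(1) by (simp add: Q.m_ac)
      finally show ?thesis by (simp add: p0[OF that])
    qed
    have z2: "star Q (uq a b) \<otimes>\<^sub>Q e = \<zero>\<^sub>Q" if "a \<noteq> \<pi> b" for a b
    proof -
      have "star Q (uq a b) \<otimes>\<^sub>Q e = (pq a b \<otimes>\<^sub>Q star Q (uq a b)) \<otimes>\<^sub>Q e" by (simp only: pq_star_uq)
      also have "\<dots> = star Q (uq a b) \<otimes>\<^sub>Q (pq a b \<otimes>\<^sub>Q e)" using e(1) by (simp add: Q.m_ac)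
      finally show ?thesis by (simp add: p0[OF that])
    qed
    define T where "T i = uq i (Hilbert_Choice.inv \<pi> i)" for i
    have inv: "Hilbert_Choice.inv \<pi> (\<pi> b) = b" "\<pi> (Hilbert_Choice.inv \<pi> b) = b" for b
      using bij by (auto simp: bij_is_inj bij_is_surj surj_f_inv_f)
    interpret L: laurent Q T e
    proof
      show "T i \<otimes>\<^sub>Q star Q (T i) \<otimes>\<^sub>Q e = e" for i using \<pi>[of "Hilbert_Choice.inv \<pi> i"] by (simp add: T_def inv)
    qed (use e nrm_uq Q_comm in \<open>auto simp: T_def\<close>)
    let ?W = "{w. f w \<noteq> 0}"
    have finW: "finite ?W" using f free_carrier by blast
    \<comment> \<open>The coefficient of the monomial with exponent k: words with the same exponent
      are collected, and those vanishing on the piece are dropped.\<close>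
    define c where "c k = (\<Sum>w | w \<in> ?W \<and> wdeg w = k. if wfits \<pi> w then f w else 0)" for k
    define K where "K = PiE (UNIV :: 'n set) (\<lambda>_. {- int D..int D})"
    have cK: "card K = (2 * D + 1) ^ CARD('n)" by (simp add: K_def card_PiE nat_add_distrib nat_mult_distrib)
    have finK: "finite K" by (simp add: K_def finite_PiE)
    have dK: "wdeg w \<in> K" if "w \<in> ?W" for w
      using wdeg_le[of w] D[of w] that unfolding K_def by (auto simp: abs_le_iff) (smt (verit) of_nat_mono)+
    have ck: "cmod (c k) \<le> S" if "k \<in> K" for k unfolding c_def
    proof (rule laurent_coefficient_le[OF finW])
      show "\<bar>wdeg w i\<bar> \<le> int D" if "w \<in> ?W" for w i
      proof -
        have "wdeg w i \<in> {- int D..int D}" using dK[OF that] by (auto simp: K_def PiE_iff)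
        then show ?thesis by (simp add: abs_le_iff)
      qed
      show "\<bar>k i\<bar> \<le> int D" for i
      proof -
        have "k i \<in> {- int D..int D}" using that by (auto simp: K_def PiE_iff)
        then show ?thesis by (simp add: abs_le_iff)
      qed
    next
      fix z :: "'n \<Rightarrow> complex" assume z: "\<And>i. cmod (z i) = 1"
      have "ev (\<chi> i. z i, \<pi>) f = (\<Sum>w\<in>?W. f w * (if wfits \<pi> w then \<Prod>i\<in>UNIV. z i powi wdeg w i else 0))"
        using z by (simp add: free_lift_def lin_ext_complex word_eval_point cong: if_cong)
      also have "\<dots> = (\<Sum>w\<in>?W. (if wfits \<pi> w then f w else 0) * (\<Prod>i\<in>UNIV. z i powi wdeg w i))" by (intro sum.cong) auto
      finally show "cmod (\<Sum>w\<in>?W. (if wfits \<pi> w then f w else 0) * (\<Prod>i\<in>UNIV. z i powi wdeg w i)) \<le> S"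
        using S[of "(\<chi> i. z i, \<pi>)"] z bij A\<pi> by (simp add: G_carrier)
    qed
    have wc: "word_eval Q uq w \<in> carrier Q" for w by (rule Q.word_eval_closed) simp
    have "\<theta> f = free_lift Q uq f" using Q.free_hom_unique[OF star_hom_\<theta> f] by (simp add: \<theta>_gen)
    also have "\<dots> = (\<Oplus>\<^sub>Q w\<in>?W. f w \<odot>\<^sub>Q word_eval Q uq w)" by (simp add: free_lift_def lin_ext_def)
    finally have "\<theta> f \<otimes>\<^sub>Q e = (\<Oplus>\<^sub>Q w\<in>?W. f w \<odot>\<^sub>Q word_eval Q uq w \<otimes>\<^sub>Q e)"
      using Q.finsum_ldistr[OF finW e(1), of "\<lambda>w. f w \<odot>\<^sub>Q word_eval Q uq w"] wc by (simp add: Pi_iff)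
    also have "\<dots> = (\<Oplus>\<^sub>Q w\<in>?W. \<Oplus>\<^sub>Q k\<in>K. (if wdeg w = k \<and> wfits \<pi> w then f w else 0) \<odot>\<^sub>Q (L.Mon k \<otimes>\<^sub>Q e))"
    proof (rule Q.finsum_cong')
      fix w assume w: "w \<in> ?W"
      have "f w \<odot>\<^sub>Q word_eval Q uq w \<otimes>\<^sub>Q e = f w \<odot>\<^sub>Q (word_eval Q uq w \<otimes>\<^sub>Q e)" using e(1) wc by (simp add: Q.smult_mult_l)
      also have "word_eval Q uq w \<otimes>\<^sub>Q e = (if wfits \<pi> w then L.Mon (wdeg w) \<otimes>\<^sub>Q e else \<zero>\<^sub>Q)"
        by (rule L.word_eval_Mon) (auto simp: T_def inv z1 z2)
      also have "f w \<odot>\<^sub>Q \<dots> = (if wfits \<pi> w then f w else 0) \<odot>\<^sub>Q (L.Mon (wdeg w) \<otimes>\<^sub>Q e)" using e(1) by simp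
      also have "\<dots> = (\<Oplus>\<^sub>Q k\<in>K. if k = wdeg w then (if wfits \<pi> w then f w else 0) \<odot>\<^sub>Q (L.Mon (wdeg w) \<otimes>\<^sub>Q e) else \<zero>\<^sub>Q)"
        using Q.finsum_delta[OF finK, of "(if wfits \<pi> w then f w else 0) \<odot>\<^sub>Q (L.Mon (wdeg w) \<otimes>\<^sub>Q e)" "wdeg w"] dK[OF w] e(1) by simp
      also have "\<dots> = (\<Oplus>\<^sub>Q k\<in>K. (if wdeg w = k \<and> wfits \<pi> w then f w else 0) \<odot>\<^sub>Q (L.Mon k \<otimes>\<^sub>Q e))"
        using e(1) by (intro Q.finsum_cong') auto
      finally show "f w \<odot>\<^sub>Q word_eval Q uq w \<otimes>\<^sub>Q e
        = (\<Oplus>\<^sub>Q k\<in>K. (if wdeg w = k \<and> wfits \<pi> w then f w else 0) \<odot>\<^sub>Q (L.Mon k \<otimes>\<^sub>Q e))" .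
    qed (use e(1) in auto)
    also have "\<dots> = (\<Oplus>\<^sub>Q k\<in>K. \<Oplus>\<^sub>Q w\<in>?W. (if wdeg w = k \<and> wfits \<pi> w then f w else 0) \<odot>\<^sub>Q (L.Mon k \<otimes>\<^sub>Q e))"
      using finW finK e(1) by (intro Q.finsum_swap) auto
    also have "\<dots> = (\<Oplus>\<^sub>Q k\<in>K. c k \<odot>\<^sub>Q (L.Mon k \<otimes>\<^sub>Q e))"
    proof (rule Q.finsum_cong')
      fix k assume "k \<in> K"
      have "(\<Sum>w\<in>?W. if wdeg w = k \<and> wfits \<pi> w then f w else 0) = (\<Sum>w\<in>?W. if wdeg w = k then (if wfits \<pi> w then f w else 0) else 0)"
        by (intro sum.cong) auto
      also have "\<dots> = c k" unfolding c_def using finW by (subst sum.inter_filter[symmetric]) (auto intro!: sum.cong)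
      finally have ck: "(\<Sum>w\<in>?W. if wdeg w = k \<and> wfits \<pi> w then f w else 0) = c k" .
      show "(\<Oplus>\<^sub>Q w\<in>?W. (if wdeg w = k \<and> wfits \<pi> w then f w else 0) \<odot>\<^sub>Q (L.Mon k \<otimes>\<^sub>Q e)) = c k \<odot>\<^sub>Q (L.Mon k \<otimes>\<^sub>Q e)"
        using e(1) finW by (subst Q.finsum_smult_const) (simp_all add: ck)
    qed (use e(1) in auto)
    finally have eq: "\<theta> f \<otimes>\<^sub>Q e = (\<Oplus>\<^sub>Q k\<in>K. c k \<odot>\<^sub>Q (L.Mon k \<otimes>\<^sub>Q e))" .
    have "nrm Q (\<theta> f \<otimes>\<^sub>Q e) \<le> (\<Sum>k\<in>K. nrm Q (c k \<odot>\<^sub>Q (L.Mon k \<otimes>\<^sub>Q e)))" unfolding eq using e(1) by (intro Q.nrm_finsum) auto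
    also have "\<dots> \<le> (\<Sum>k\<in>K. S * 1)"
    proof (rule sum_mono)
      fix k assume "k \<in> K"
      have "nrm Q (c k \<odot>\<^sub>Q (L.Mon k \<otimes>\<^sub>Q e)) = cmod (c k) * nrm Q (L.Mon k \<otimes>\<^sub>Q e)" using e(1) by (intro Q.nrm_smult) auto
      also have "\<dots> \<le> S * 1" using ck[OF \<open>k \<in> K\<close>] L.nrm_Mon_e[of k] S0 e(1) by (intro mult_mono) auto
      finally show "nrm Q (c k \<odot>\<^sub>Q (L.Mon k \<otimes>\<^sub>Q e)) \<le> S * 1" .
    qed
    also have "\<dots> = real (2 * D + 1) ^ CARD('n) * S" by (simp add: cK)
    finally show ?thesis .
  qed
  then have "real CARD('n) ^ CARD('n) * nrm Q (\<theta> f \<otimes>\<^sub>Q e) \<le> real CARD('n) ^ CARD('n) * (real (2 * D + 1) ^ CARD('n) * S)"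
    by (intro mult_left_mono) auto
  from order_trans[OF e(3) this] show ?thesis by (simp only: mult.assoc)
qed

text \<open>Put y_0 = f and let y_(n+1) be the adjoint of y_n times y_n. Word length and supremum of
  y_n are at most D 2^n and S^(2^n), while the C*-inequality in the quotient gives |\<theta>
  f|^(2^n) \<le> |\<theta> y_n|. The degree enters \<open>nrm_\<theta>_le\<close> only polynomially,
  so \<open>le_of_doubling_powers\<close> applies.\<close>

theorem nrm_\<theta>_le_sup:
  assumes f: "f \<in> carrier FA" and S: "\<And>g. g \<in> carrier G \<Longrightarrow> cmod (ev g f) \<le> S"
  shows "nrm Q (\<theta> f) \<le> S"
proof -
  have S0: "0 \<le> S" using S[OF one_in_G] norm_ge_zero order_trans by blast
  let ?N = "CARD('n)"
  define y where "y = rec_nat f (\<lambda>_ y. star FA y \<otimes>\<^sub>FA y)"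
  have y0: "y 0 = f" and ys: "y (Suc n) = star FA (y n) \<otimes>\<^sub>FA y n" for n by (simp_all add: y_def)
  have yc: "y n \<in> carrier FA" for n by (induction n) (simp_all only: y0 ys f FA.star_closed FA.m_closed)
  obtain D where D: "\<And>w. f w \<noteq> 0 \<Longrightarrow> length w \<le> D"
  proof
    have "finite (length ` {w. f w \<noteq> 0})" using f free_carrier by blast
    then show "length w \<le> Max (insert 0 (length ` {w. f w \<noteq> 0}))" if "f w \<noteq> 0" for w using that by (intro Max_ge) auto
  qed
  have len: "length w \<le> D * 2 ^ n" if "y n w \<noteq> 0" for n w using that
  proof (induction n arbitrary: w)
    case 0
    then show ?case using D by (simp add: y0)
  next
    case (Suc n)
    from Suc.prems obtain a b where ab: "w = a @ b" "star FA (y n) a \<noteq> 0" "y n b \<noteq> 0" unfolding ys by (rule free_mult_support)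
    from ab(2) obtain a' where "length a' = length a" "y n a' \<noteq> 0" by (rule free_star_support)
    then show ?case using Suc.IH[of a'] Suc.IH[of b] ab by simp
  qed
  have evn: "cmod (ev g (y n)) \<le> S ^ 2 ^ n" if g: "g \<in> carrier G" for g n
  proof (induction n)
    case 0
    then show ?case using S[OF g] by (simp add: y0)
  next
    case (Suc n)
    have h: "star_hom FA complex_alg (ev g)" by (rule star_alg.free_lift_star_hom[OF star_alg_complex_alg]) simp
    have "ev g (y (Suc n)) = cnj (ev g (y n)) * ev g (y n)" using star_homD(3,6)[OF h] yc by (simp add: ys)
    then have "cmod (ev g (y (Suc n))) = (cmod (ev g (y n)))\<^sup>2" by (simp add: norm_mult power2_eq_square)
    also have "\<dots> \<le> (S ^ 2 ^ n)\<^sup>2" using Suc by (intro power_mono) auto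
    finally show ?case by (simp flip: power_mult add: mult.commute)
  qed
  have pn: "nrm Q (\<theta> f) ^ 2 ^ n \<le> nrm Q (\<theta> (y n))" for n
  proof (induction n)
    case 0
    then show ?case by (simp add: y0)
  next
    case (Suc n)
    have "nrm Q (\<theta> f) ^ 2 ^ Suc n = (nrm Q (\<theta> f) ^ 2 ^ n)\<^sup>2" by (simp flip: power_mult add: mult.commute)
    also have "\<dots> \<le> (nrm Q (\<theta> (y n)))\<^sup>2" using Suc f by (intro power_mono) auto
    also have "\<dots> \<le> nrm Q (CJ.q (star C (\<iota> (y n)) \<otimes>\<^sub>C \<iota> (y n)))" unfolding \<theta>_def using yc by (intro CJ.quotient_cstar_ineq) simp
    also have "star C (\<iota> (y n)) \<otimes>\<^sub>C \<iota> (y n) = \<iota> (y (Suc n))" using yc by (simp only: ys \<iota>.hom_mult \<iota>.hom_star FA.star_closed)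
    finally show ?case by (simp add: \<theta>_def)
  qed
  show ?thesis
  proof (rule le_of_doubling_powers)
    show "nrm Q (\<theta> f) ^ 2 ^ n \<le> (real ?N ^ ?N * real (2 * D + 1) ^ ?N) * real (2 ^ n) ^ ?N * S ^ 2 ^ n" for n
    proof -
      have "nrm Q (\<theta> f) ^ 2 ^ n \<le> real ?N ^ ?N * real (2 * (D * 2 ^ n) + 1) ^ ?N * S ^ 2 ^ n"
        using pn[of n] nrm_\<theta>_le[of "y n" "D * 2 ^ n" "S ^ 2 ^ n", OF yc len evn] by linarith
      also have "\<dots> \<le> real ?N ^ ?N * real ((2 * D + 1) * 2 ^ n) ^ ?N * S ^ 2 ^ n"
        using S0 by (intro mult_right_mono mult_left_mono power_mono of_nat_mono) (auto simp: algebra_simps)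
      also have "\<dots> = (real ?N ^ ?N * real (2 * D + 1) ^ ?N) * real (2 ^ n) ^ ?N * S ^ 2 ^ n"
        by (simp only: of_nat_mult power_mult_distrib mult.assoc)
      finally show ?thesis .
    qed
  qed (use f S0 in auto)
qed

end

subsection \<open>Maps into algebras of continuous functions\<close>

lemma star_hom_C_of_iff:
  assumes h: "\<And>x. x \<in> carrier B \<Longrightarrow> h x \<in> carrier (C_of Y)" and B: "star_alg B"
    and pt: "\<And>y. y \<in> topspace Y \<Longrightarrow> star_hom B complex_alg (\<lambda>x. h x y)"
  shows "star_hom B (C_of Y) h"
proof -
  interpret B: star_alg B by (rule B)
  interpret Y: star_alg "C_of Y" by (rule star_alg_C_of)
  have eqI: "f = g" if "f \<in> carrier (C_of Y)" "g \<in> carrier (C_of Y)" "\<And>y. y \<in> topspace Y \<Longrightarrow> f y = g y" for f g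
    using that by (intro extensionalityI[of f "topspace Y"]) auto
  have ext: "h x \<in> extensional (topspace Y)" if "x \<in> carrier B" for x using h[OF that] by simp
  note p = star_homD[OF pt]
  show ?thesis by (rule star_homI; (rule h, assumption)?; rule extensionalityI[of _ "topspace Y"])
      (auto simp: ext p)
qed

lemma star_hom_C_of_eval:
  assumes h: "star_hom B (C_of Y) h" and y: "y \<in> topspace Y"
  shows "star_hom B complex_alg (\<lambda>x. h x y)" using star_homD[OF h] y by (intro star_homI) auto

lemma continuous_map_uniform_limit_seq:
  fixes f :: "nat \<Rightarrow> 'a \<Rightarrow> 'b::metric_space"
  assumes "\<And>n. continuous_map X euclidean (f n)"
    and "\<And>e. e > 0 \<Longrightarrow> \<exists>k. \<forall>n\<ge>k. \<forall>x\<in>topspace X. dist (f n x) (g x) < e"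
  shows "continuous_map X euclidean g"
proof -
  have "continuous_map X Met_TC.mtopology g" by (rule Met_TC.continuous_map_uniform_limit[where F = sequentially and f = f])
      (use assms in \<open>auto simp: eventually_sequentially\<close>)
  then show ?thesis by simp
qed

text \<open>Contractivity at every point makes h along a Cauchy sequence uniformly Cauchy, so the
  limit is continuous. The limit formula for an arbitrary representing sequence is part of the
  conclusion because surjectivity later constructs such a sequence explicitly.\<close>

lemma (in seminormed_star_alg) C_of_extension:
  assumes h: "star_hom B (C_of Y) h" and le: "\<And>x y. x \<in> carrier B \<Longrightarrow> y \<in> topspace Y \<Longrightarrow> cmod (h x y) \<le> nrm B x"
  obtains h' where "star_hom CB (C_of Y) h'"
    "\<And>X y. X \<in> carrier CA \<Longrightarrow> y \<in> topspace Y \<Longrightarrow> (\<lambda>n. h (X n) y) \<longlonglongrightarrow> h' (cl X) y"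
    "\<And>x. x \<in> carrier B \<Longrightarrow> h' (to_completion B x) = h x"
    "\<And>c y. c \<in> carrier CB \<Longrightarrow> y \<in> topspace Y \<Longrightarrow> cmod (h' c y) \<le> nrm CB c"
proof -
  interpret Y: star_alg "C_of Y" by (rule star_alg_C_of)
  interpret h: star_alg_hom B "C_of Y" h by unfold_locales (rule h)
  interpret CI: seminormed_star_ideal CA "null_sequences B" by (rule null_ideal)
  have ev: "star_hom B complex_alg (\<lambda>x. h x y)" if "y \<in> topspace Y" for y by (rule star_hom_C_of_eval[OF h that])
  have diff: "h (x \<ominus> x') y = h x y - h x' y" if "x \<in> carrier B" "x' \<in> carrier B" "y \<in> topspace Y" for x x' y
  proof -
    interpret e: star_alg_hom B complex_alg "\<lambda>x. h x y"
      by (intro star_alg_homI star_alg_complex_alg star_alg_axioms ev that)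
    show ?thesis using e.hom_minus[OF that(1,2)] by simp
  qed
  have uc: "\<exists>k. \<forall>m\<ge>k. \<forall>n\<ge>k. \<forall>y\<in>topspace Y. cmod (h (X m) y - h (X n) y) < e" if X: "X \<in> carrier CA" and "e > 0" for X e
  proof -
    obtain k where k: "\<And>m n. m \<ge> k \<Longrightarrow> n \<ge> k \<Longrightarrow> nrm B (X m \<ominus> X n) < e" using X \<open>e > 0\<close> unfolding cauchy_algebra_carrier by meson
    have "cmod (h (X m) y - h (X n) y) < e" if "m \<ge> k" "n \<ge> k" "y \<in> topspace Y" for m n y
    proof -
      have c: "X m \<in> carrier B" "X n \<in> carrier B" using CA_carrierD[OF X] by auto
      show ?thesis using le[OF minus_closed[OF c] that(3)] k[OF that(1,2)] diff[OF c that(3)] by simp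
    qed
    then show ?thesis by blast
  qed
  define H where "H X = restrict (\<lambda>y. lim (\<lambda>n. h (X n) y)) (topspace Y)" for X
  have H: "(\<lambda>n. h (X n) y) \<longlonglongrightarrow> H X y" if X: "X \<in> carrier CA" and y: "y \<in> topspace Y" for X y
  proof -
    have "Cauchy (\<lambda>n. h (X n) y)"
    proof (rule CauchyI)
      fix e :: real assume "e > 0"
      from uc[OF X this] y show "\<exists>k. \<forall>m\<ge>k. \<forall>n\<ge>k. norm (h (X m) y - h (X n) y) < e" by meson
    qed
    then show ?thesis using y by (simp add: H_def Cauchy_convergent_iff convergent_LIMSEQ_iff)
  qed
  have Hc: "H X \<in> carrier (C_of Y)" if X: "X \<in> carrier CA" for X
  proof -
    have "continuous_map Y euclidean (H X)"
    proof (rule continuous_map_uniform_limit_seq)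
      show "continuous_map Y euclidean (h (X n))" for n using h.hom_closed[OF CA_carrierD[OF X]] by simp
      fix e :: real assume "e > 0"
      then obtain k where k: "\<And>m n y. m \<ge> k \<Longrightarrow> n \<ge> k \<Longrightarrow> y \<in> topspace Y \<Longrightarrow> cmod (h (X m) y - h (X n) y) < e / 2"
        using uc[OF X, of "e / 2"] by (metis half_gt_zero)
      have "cmod (h (X m) y - H X y) \<le> e / 2" if "m \<ge> k" "y \<in> topspace Y" for m y
      proof (rule LIMSEQ_le_const2)
        show "(\<lambda>n. cmod (h (X m) y - h (X n) y)) \<longlonglongrightarrow> cmod (h (X m) y - H X y)"
          by (intro tendsto_norm tendsto_diff tendsto_const H X that)
        show "\<exists>N. \<forall>n\<ge>N. cmod (h (X m) y - h (X n) y) \<le> e / 2" using k that less_imp_le by meson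
      qed
      then show "\<exists>k. \<forall>n\<ge>k. \<forall>y\<in>topspace Y. dist (h (X n) y) (H X y) < e" using \<open>e > 0\<close> by (intro exI[of _ k]) (force simp: dist_norm)
    qed
    then show ?thesis by (simp add: H_def)
  qed
  have Hh: "star_hom CA (C_of Y) H"
  proof (rule star_hom_C_of_iff)
    fix y assume y: "y \<in> topspace Y"
    note e = star_homD[OF ev[OF y]]
    note cd = CA_carrierD
    show "star_hom CA complex_alg (\<lambda>X. H X y)"
    proof (rule star_homI)
      fix X X' assume X: "X \<in> carrier CA" "X' \<in> carrier CA"
      have "(\<lambda>n. h (X n \<oplus> X' n) y) \<longlonglongrightarrow> H X y + H X' y" using tendsto_add[OF H[OF X(1) y] H[OF X(2) y]] e(2) X by (simp add: cd)
      moreover have "(\<lambda>n. h (X n \<oplus> X' n) y) \<longlonglongrightarrow> H (\<lambda>n. X n \<oplus> X' n) y" using H[OF CA_add_closed[OF X] y] .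
      ultimately show "H (X \<oplus>\<^sub>CA X') y = H X y \<oplus>\<^sub>complex_alg H X' y" using LIMSEQ_unique by auto
      have "(\<lambda>n. h (X n \<otimes> X' n) y) \<longlonglongrightarrow> H X y * H X' y" using tendsto_mult[OF H[OF X(1) y] H[OF X(2) y]] e(3) X by (simp add: cd)
      moreover have "(\<lambda>n. h (X n \<otimes> X' n) y) \<longlonglongrightarrow> H (\<lambda>n. X n \<otimes> X' n) y" using H[OF CA_mult_closed[OF X] y] .
      ultimately show "H (X \<otimes>\<^sub>CA X') y = H X y \<otimes>\<^sub>complex_alg H X' y" using LIMSEQ_unique by auto
    next
      fix X c assume X: "X \<in> carrier CA"
      have "(\<lambda>n. h (c \<odot> X n) y) \<longlonglongrightarrow> c * H X y" using tendsto_mult[OF tendsto_const H[OF X y], of c] e(5) X by (simp add: cd)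
      moreover have "(\<lambda>n. h (c \<odot> X n) y) \<longlonglongrightarrow> H (\<lambda>n. c \<odot> X n) y" using H[OF CA_smult_closed[OF X] y] .
      ultimately show "H (c \<odot>\<^sub>CA X) y = c \<odot>\<^sub>complex_alg H X y" using LIMSEQ_unique by auto
    next
      fix X assume X: "X \<in> carrier CA"
      have "(\<lambda>n. h (star B (X n)) y) \<longlonglongrightarrow> cnj (H X y)" using tendsto_cnj[OF H[OF X y]] e(6) X by (simp add: cd)
      moreover have "(\<lambda>n. h (star B (X n)) y) \<longlonglongrightarrow> H (\<lambda>n. star B (X n)) y" using H[OF CA_star_closed[OF X] y] .
      ultimately show "H (star CA X) y = star complex_alg (H X y)" using LIMSEQ_unique by auto
    next
      have "(\<lambda>n::nat. h \<one> y) \<longlonglongrightarrow> H (\<lambda>n. \<one>) y" using H[OF CA_const[OF one_closed] y] .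
      then show "H \<one>\<^sub>CA y = \<one>\<^sub>complex_alg" using e(4) by (simp add: LIMSEQ_const_iff)
    qed simp
  qed (rule Hc, assumption, rule star_alg_CA)
  have H0: "H X = \<zero>\<^sub>(C_of Y)" if X: "X \<in> null_sequences B" for X
  proof (rule extensionalityI[of _ "topspace Y"])
    have Xc: "X \<in> carrier CA" using X null_iff by blast
    fix y assume y: "y \<in> topspace Y"
    have "(\<lambda>n. h (X n) y) \<longlonglongrightarrow> 0"
    proof (rule Lim_null_comparison)
      show "\<forall>\<^sub>F n in sequentially. norm (h (X n) y) \<le> nrm B (X n)" using le[OF CA_carrierD[OF Xc] y] by simp
      show "(\<lambda>n. nrm B (X n)) \<longlonglongrightarrow> 0" using X by (simp add: null_sequences_def)
    qed
    then show "H X y = \<zero>\<^sub>(C_of Y) y" using H[OF Xc y] LIMSEQ_unique y by auto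
  qed (auto simp: H_def)
  obtain h' where h': "star_hom CB (C_of Y) h'" "\<And>X. X \<in> carrier CA \<Longrightarrow> h' (cl X) = H X"
    using CI.quot_lift[OF star_alg_C_of Hh H0] unfolding completion_quot by metis
  show ?thesis
  proof (rule that[OF h'(1)])
    show "(\<lambda>n. h (X n) y) \<longlonglongrightarrow> h' (cl X) y" if "X \<in> carrier CA" "y \<in> topspace Y" for X y using H[OF that] h'(2)[OF that(1)] by simp
    show "h' (to_completion B x) = h x" if x: "x \<in> carrier B" for x
    proof -
      have "H (\<lambda>n. x) y = h x y" if "y \<in> topspace Y" for y using H[OF CA_const[OF x] that] by (simp add: LIMSEQ_const_iff)
      then have "H (\<lambda>n. x) = h x" using h.hom_closed[OF x] by (intro extensionalityI[of _ "topspace Y"]) (auto simp: H_def)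
      then show ?thesis using h'(2)[OF CA_const[OF x]] by (simp add: to_completion_cl)
    qed
    show "cmod (h' c y) \<le> nrm CB c" if c: "c \<in> carrier CB" and y: "y \<in> topspace Y" for c y
    proof -
      obtain X where X: "X \<in> carrier CA" "c = cl X" using c unfolding carrier_completion by auto
      show ?thesis
      proof (rule LIMSEQ_le)
        show "(\<lambda>n. cmod (h (X n) y)) \<longlonglongrightarrow> cmod (h' c y)" using H[OF X(1) y] h'(2)[OF X(1)] by (simp add: X tendsto_norm)
        show "(\<lambda>n. nrm B (X n)) \<longlonglongrightarrow> nrm CB c" using nrm_cl_tendsto[OF X(1)] by (simp add: X)
        show "\<exists>N. \<forall>n\<ge>N. cmod (h (X n) y) \<le> nrm B (X n)" using le[OF CA_carrierD[OF X(1)] y] by simp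
      qed
    qed
  qed
qed

context GA
begin

subsection \<open>The Gelfand transform\<close>

lemma ev_hom: "star_hom (free_star_algebra p) complex_alg (ev g)" by (rule star_alg.free_lift_star_hom[OF star_alg_complex_alg]) simp

lemma ev_alg_hom: "star_alg_hom FA complex_alg (ev g)" by (intro star_alg_homI star_alg_free star_alg_complex_alg ev_hom)

lemma ev_simps:
  "x \<in> carrier FA \<Longrightarrow> y \<in> carrier FA \<Longrightarrow> ev g (x \<oplus>\<^sub>FA y) = ev g x + ev g y"
  "x \<in> carrier FA \<Longrightarrow> y \<in> carrier FA \<Longrightarrow> ev g (x \<ominus>\<^sub>FA y) = ev g x - ev g y"
  "x \<in> carrier FA \<Longrightarrow> y \<in> carrier FA \<Longrightarrow> ev g (x \<otimes>\<^sub>FA y) = ev g x * ev g y"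
  "x \<in> carrier FA \<Longrightarrow> ev g (c \<odot>\<^sub>FA x) = c * ev g x"
  "x \<in> carrier FA \<Longrightarrow> ev g (star FA x) = cnj (ev g x)"
  "ev g \<one>\<^sub>FA = 1" "ev g \<zero>\<^sub>FA = 0"
  using star_alg_hom.hom_minus[OF ev_alg_hom[of g], of x y] star_alg_hom.hom_zero[OF ev_alg_hom[of g]] star_homD[OF ev_hom[where g = g and p = \<nu>]]
  by simp_all

lemma ev_gen: "ev g (free_gen a b) = point_gen g a b" using star_alg.free_lift_gen[OF star_alg_complex_alg, of "point_gen g"] by simp

lemma continuous_point_gen: "continuous_map X euclidean (\<lambda>g. point_gen g a b)"
proof -
  have e: "continuous_map X euclidean fst" unfolding torus_wreath_topology_def
    using continuous_map_fst continuous_map_into_fulltopology by blast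
  have f: "continuous_map X (discrete_topology (Aut_matrix A)) snd" unfolding torus_wreath_topology_def by (rule continuous_map_snd)
  have "continuous_map X euclidean (\<lambda>g. of_bool (a = snd g b) * fst g $ a)" by (intro continuous_map_mult_cx continuous_map_vec_nth e
        continuous_map_discrete_factor[OF f, of "\<lambda>\<pi>. of_bool (a = \<pi> b)"])
  then show ?thesis by (rule continuous_map_eq) (simp add: point_gen_def)
qed

lemma continuous_word_eval: "continuous_map X euclidean (\<lambda>g. word_eval complex_alg (point_gen g) w)"
proof (induction w)
  case (Cons x w)
  have "continuous_map X euclidean (\<lambda>g. letter_eval complex_alg (point_gen g) x)"
    using continuous_point_gen continuous_map_cnj[OF continuous_point_gen] by (cases x rule: prod_cases3) (auto simp: letter_eval_def)
  then show ?case using Cons by (simp add: continuous_map_mult_cx)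
qed simp

lemma continuous_ev: "continuous_map X euclidean (\<lambda>g. ev g f)" unfolding free_lift_def lin_ext_complex
  by (intro continuous_map_sum_cx continuous_map_mult_cx continuous_word_eval) simp

definition \<Psi> where "\<Psi> f = restrict (\<lambda>g. ev g f) (carrier G)"

lemma star_hom_\<Psi>: "star_hom FA (C_of X) \<Psi>"
proof (rule star_hom_C_of_iff)
  show "\<Psi> f \<in> carrier (C_of X)" for f
    using continuous_ev[of f] by (simp add: \<Psi>_def topspace_X continuous_map_restrict_iff flip: topspace_X)
  show "star_hom FA complex_alg (\<lambda>f. \<Psi> f g)" if "g \<in> topspace X" for g
    using ev_hom[where g = g and p = \<nu>] that by (simp add: \<Psi>_def topspace_X)
qed (rule star_alg_free)

lemma character_C_exists: "\<exists>\<Phi>0. star_hom C (C_of X) \<Phi>0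
  \<and> (\<forall>Y\<in>carrier FA.CA. \<forall>g\<in>carrier G. (\<lambda>n. ev g (Y n)) \<longlonglongrightarrow> \<Phi>0 (FA.cl Y) g)
  \<and> (\<forall>f\<in>carrier FA. \<forall>g\<in>carrier G. \<Phi>0 (\<iota> f) g = ev g f)
  \<and> (\<forall>c\<in>carrier C. \<forall>g\<in>carrier G. cmod (\<Phi>0 c g) \<le> nrm C c)"
proof -
  have le: "cmod (\<Psi> f g) \<le> nrm FA f" if "f \<in> carrier FA" "g \<in> topspace X" for f g
    using ev_le_\<nu>[of g f] that by (simp add: \<Psi>_def topspace_X)
  show ?thesis
  proof (rule FA.C_of_extension[OF star_hom_\<Psi> le])
    fix h assume h: "star_hom (Defs.completion FA) (C_of X) h"
      "\<And>Y g. Y \<in> carrier FA.CA \<Longrightarrow> g \<in> topspace X \<Longrightarrow> (\<lambda>n. \<Psi> (Y n) g) \<longlonglongrightarrow> h (FA.cl Y) g"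
      "\<And>f. f \<in> carrier FA \<Longrightarrow> h (\<iota> f) = \<Psi> f"
      "\<And>c g. c \<in> carrier (Defs.completion FA) \<Longrightarrow> g \<in> topspace X \<Longrightarrow> cmod (h c g) \<le> nrm (Defs.completion FA) c"
    show ?thesis
    proof (intro exI[of _ h] conjI ballI)
      show "star_hom C (C_of X) h" unfolding C_def' by (rule h(1))
      fix g assume g: "g \<in> carrier G"
      have gX: "g \<in> topspace X" using g by (simp only: topspace_X)
      show "(\<lambda>n. ev g (Y n)) \<longlonglongrightarrow> h (FA.cl Y) g" if "Y \<in> carrier FA.CA" for Y using h(2)[OF that gX] g by (simp add: \<Psi>_def)
      show "h (\<iota> f) g = ev g f" if "f \<in> carrier FA" for f using h(3)[OF that] g by (simp add: \<Psi>_def)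
      show "cmod (h c g) \<le> nrm C c" if "c \<in> carrier C" for c using h(4)[of c g] that gX unfolding C_def' by blast
    qed
  qed
qed

definition \<Phi>0 where "\<Phi>0 = (SOME \<Phi>0. star_hom C (C_of X) \<Phi>0
  \<and> (\<forall>Y\<in>carrier FA.CA. \<forall>g\<in>carrier G. (\<lambda>n. ev g (Y n)) \<longlonglongrightarrow> \<Phi>0 (FA.cl Y) g)
  \<and> (\<forall>f\<in>carrier FA. \<forall>g\<in>carrier G. \<Phi>0 (\<iota> f) g = ev g f)
  \<and> (\<forall>c\<in>carrier C. \<forall>g\<in>carrier G. cmod (\<Phi>0 c g) \<le> nrm C c))"

lemma \<Phi>0:
  shows star_hom_\<Phi>0: "star_hom C (C_of X) \<Phi>0"
    and \<Phi>0_lim: "Y \<in> carrier FA.CA \<Longrightarrow> g \<in> carrier G \<Longrightarrow> (\<lambda>n. ev g (Y n)) \<longlonglongrightarrow> \<Phi>0 (FA.cl Y) g"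
    and \<Phi>0_\<iota>: "f \<in> carrier FA \<Longrightarrow> g \<in> carrier G \<Longrightarrow> \<Phi>0 (\<iota> f) g = ev g f"
    and \<Phi>0_le: "c \<in> carrier C \<Longrightarrow> g \<in> carrier G \<Longrightarrow> cmod (\<Phi>0 c g) \<le> nrm C c"
  using someI_ex[OF character_C_exists] unfolding \<Phi>0_def[symmetric] by blast+

sublocale \<Phi>0: star_alg_hom "C_GA A l" "C_of (torus_wreath_topology A)" \<Phi>0
  by (intro star_alg_homI star_alg_C_of star_hom_\<Phi>0 C.star_alg_axioms)

lemma \<Phi>0_simps:
  assumes "g \<in> carrier G"
  shows "x \<in> carrier C \<Longrightarrow> y \<in> carrier C \<Longrightarrow> \<Phi>0 (x \<oplus>\<^sub>C y) g = \<Phi>0 x g + \<Phi>0 y g"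
    "x \<in> carrier C \<Longrightarrow> y \<in> carrier C \<Longrightarrow> \<Phi>0 (x \<otimes>\<^sub>C y) g = \<Phi>0 x g * \<Phi>0 y g"
    "x \<in> carrier C \<Longrightarrow> \<Phi>0 (c \<odot>\<^sub>C x) g = c * \<Phi>0 x g"
    "x \<in> carrier C \<Longrightarrow> \<Phi>0 (star C x) g = cnj (\<Phi>0 x g)"
    "\<Phi>0 \<one>\<^sub>C g = 1" "\<Phi>0 \<zero>\<^sub>C g = 0" using assms \<Phi>0.hom_add \<Phi>0.hom_mult \<Phi>0.hom_smult \<Phi>0.hom_star \<Phi>0.hom_one \<Phi>0.hom_zero
  by (simp_all add: topspace_X)

lemma \<Phi>0_minus:
  assumes "g \<in> carrier G" "x \<in> carrier C" "y \<in> carrier C"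
  shows "\<Phi>0 (x \<ominus>\<^sub>C y) g = \<Phi>0 x g - \<Phi>0 y g" using assms by (simp add: C.minus_smult \<Phi>0_simps)

lemma C_of_eqI:
  assumes "f \<in> carrier (C_of X)" "f' \<in> carrier (C_of X)" "\<And>g. g \<in> carrier G \<Longrightarrow> f g = f' g"
  shows "f = f'" using assms by (intro extensionalityI[of f "topspace X"]) (auto simp: topspace_X)

lemma \<Phi>0_zero_iff:
  assumes "x \<in> carrier C"
  shows "\<Phi>0 x = \<zero>\<^sub>(C_of X) \<longleftrightarrow> (\<forall>g\<in>carrier G. \<Phi>0 x g = 0)"
proof
  assume "\<forall>g\<in>carrier G. \<Phi>0 x g = 0"
  then show "\<Phi>0 x = \<zero>\<^sub>(C_of X)" using assms by (intro C_of_eqI \<Phi>0.hom_closed \<Phi>0.D.zero_closed) (auto simp: topspace_X)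
qed (simp add: topspace_X)

text \<open>The joint kernel of the evaluations is a closed ideal, by contractivity, and contains
  all commutators, since the values are complex numbers.\<close>

lemma \<Phi>0_J:
  assumes "x \<in> commutator_ideal C" shows "\<Phi>0 x = \<zero>\<^sub>(C_of X)"
proof -
  let ?K = "{x \<in> carrier C. \<forall>g\<in>carrier G. \<Phi>0 x g = 0}"
  have "ideal ?K C" by (rule C.idealI2) (auto simp: \<Phi>0_simps)
  moreover have "x \<in> ?K" if Y: "range Y \<subseteq> ?K" "x \<in> carrier C" "(\<lambda>n. nrm C (Y n \<ominus>\<^sub>C x)) \<longlonglongrightarrow> 0" for Y x
  proof -
    have Yn: "Y n \<in> carrier C" "g \<in> carrier G \<Longrightarrow> \<Phi>0 (Y n) g = 0" for n g using Y(1) by auto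
    have "\<Phi>0 x g = 0" if g: "g \<in> carrier G" for g
    proof -
      have "cmod (\<Phi>0 x g) \<le> nrm C (Y n \<ominus>\<^sub>C x)" for n using \<Phi>0_le[of "Y n \<ominus>\<^sub>C x" g] \<Phi>0_minus[OF g Yn(1) Y(2), of n] Yn Y(2) g by simp
      then have "cmod (\<Phi>0 x g) \<le> 0" using LIMSEQ_le_const[OF Y(3)] by blast
      then show ?thesis by simp
    qed
    then show ?thesis using Y(2) by simp
  qed
  moreover have "x \<otimes>\<^sub>C y \<ominus>\<^sub>C y \<otimes>\<^sub>C x \<in> ?K" if "x \<in> carrier C" "y \<in> carrier C" for x y using that by (simp add: \<Phi>0_minus \<Phi>0_simps)
  ultimately have "?K \<in> C.comm_ideals" unfolding C.comm_ideals_def closed_ideal_def by blast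
  from C.J_le[OF this] assms show ?thesis using \<Phi>0_zero_iff by blast
qed

lemma \<Phi>_exists: "\<exists>\<Phi>. star_hom Q (C_of X) \<Phi> \<and> (\<forall>c\<in>carrier C. \<Phi> (CJ.q c) = \<Phi>0 c)"
  using CJ.quot_lift[OF star_alg_C_of star_hom_\<Phi>0 \<Phi>0_J] by metis

definition \<Phi> where "\<Phi> = (SOME \<Phi>. star_hom Q (C_of X) \<Phi> \<and> (\<forall>c\<in>carrier C. \<Phi> (CJ.q c) = \<Phi>0 c))"

lemma star_hom_\<Phi>: "star_hom Q (C_of X) \<Phi>" and \<Phi>_q: "c \<in> carrier C \<Longrightarrow> \<Phi> (CJ.q c) = \<Phi>0 c"
  using someI_ex[OF \<Phi>_exists] unfolding \<Phi>_def[symmetric] by blast+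

sublocale \<Phi>: star_alg_hom "star_quot (C_GA A l) (commutator_ideal (C_GA A l))" "C_of (torus_wreath_topology A)" \<Phi>
  by (intro star_alg_homI star_alg_C_of star_hom_\<Phi> Q.star_alg_axioms)

lemma C_dense:
  assumes "c \<in> carrier C" "e > 0"
  obtains f where "f \<in> carrier FA" "nrm C (c \<ominus>\<^sub>C \<iota> f) < e" using FA.completion_dense[of c e] assms unfolding C_def' by blast

text \<open>\<open>nrm_\<theta>_le_sup\<close> covers the images of polynomials; density in C and
  contractivity of \<Phi>0 extend the bound to Q.\<close>

lemma nrm_Q_le_sup:
  assumes a: "a \<in> carrier Q" and S: "\<And>g. g \<in> carrier G \<Longrightarrow> cmod (\<Phi> a g) \<le> S"
  shows "nrm Q a \<le> S"
proof (rule field_le_epsilon)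
  fix e :: real assume e: "e > 0"
  obtain c where c: "c \<in> carrier C" "a = CJ.q c" using a unfolding CJ.carrier_Q by auto
  obtain f where f: "f \<in> carrier FA" "nrm C (c \<ominus>\<^sub>C \<iota> f) < e / 2" using C_dense[OF c(1), of "e / 2"] e by auto
  have "nrm Q (\<theta> f) \<le> S + e / 2"
  proof (rule nrm_\<theta>_le_sup[OF f(1)])
    fix g assume g: "g \<in> carrier G"
    have "cmod (\<Phi>0 c g - ev g f) \<le> e / 2" using \<Phi>0_le[of "c \<ominus>\<^sub>C \<iota> f" g] \<Phi>0_minus[OF g c(1), of "\<iota> f"] \<Phi>0_\<iota>[OF f(1) g] f c(1) g by simp
    moreover have "cmod (\<Phi>0 c g) \<le> S" using S[OF g] c by (simp add: \<Phi>_q)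
    ultimately show "cmod (ev g f) \<le> S + e / 2" using norm_triangle_ineq2[of "ev g f" "\<Phi>0 c g"] by (simp add: norm_minus_commute)
  qed
  moreover have "nrm Q (a \<ominus>\<^sub>Q \<theta> f) \<le> e / 2" using CJ.nrm_q_le[of "c \<ominus>\<^sub>C \<iota> f"] q.hom_minus[of c "\<iota> f"] c f by (simp add: \<theta>_def)
  ultimately show "nrm Q a \<le> S + e" using Q.nrm_le_minus[OF a, of "\<theta> f"] f(1) by simp
qed

text \<open>The commutator ideal is closed, so an element at distance 0 from it belongs to
  it.\<close>

lemma nrm_Q_eq_0:
  assumes a: "a \<in> carrier Q" "nrm Q a = 0" shows "a = \<zero>\<^sub>Q"
proof -
  obtain c where c: "c \<in> carrier C" "a = CJ.q c" using a unfolding CJ.carrier_Q by auto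
  have "\<exists>j\<in>commutator_ideal C. nrm C (j \<ominus>\<^sub>C c) < inverse (real (Suc n))" for n
  proof -
    obtain j where j: "j \<in> commutator_ideal C" "nrm C (j \<oplus>\<^sub>C c) < nrm Q (CJ.q c) + inverse (real (Suc n))"
      using CJ.nrm_q_approx[OF c(1), of "inverse (real (Suc n))"] by auto
    have jc: "j \<in> carrier C" using j(1) CJ.a_subset by blast
    have "\<ominus>\<^sub>C j \<ominus>\<^sub>C c = \<ominus>\<^sub>C (j \<oplus>\<^sub>C c)" using jc c(1) by (simp add: a_minus_def C.minus_add)
    then have "nrm C (\<ominus>\<^sub>C j \<ominus>\<^sub>C c) = nrm C (j \<oplus>\<^sub>C c)" using jc c(1) by simp
    then show ?thesis using j a(2) c(2) CJ.a_inv_closed by (intro bexI[of _ "\<ominus>\<^sub>C j"]) auto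
  qed
  then obtain Y where Y: "\<And>n. Y n \<in> commutator_ideal C" "\<And>n. nrm C (Y n \<ominus>\<^sub>C c) < inverse (real (Suc n))" by metis
  have "(\<lambda>n. nrm C (Y n \<ominus>\<^sub>C c)) \<longlonglongrightarrow> 0"
  proof (rule Lim_null_comparison[OF _ LIMSEQ_inverse_real_of_nat])
    have "Y n \<in> carrier C" for n using Y(1) CJ.a_subset by blast
    then show "\<forall>\<^sub>F n in sequentially. norm (nrm C (Y n \<ominus>\<^sub>C c)) \<le> inverse (real (Suc n))"
      using Y(2) c(1) less_imp_le by (auto intro!: always_eventually)
  qed
  then have "c \<in> commutator_ideal C" using C.J_closed[of Y c] Y(1) c(1) by blast
  then show ?thesis using c CJ.q_zero_iff by simp
qed

lemma inj_\<Phi>: "inj_on \<Phi> (carrier Q)"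
proof (rule inj_onI)
  fix a b assume ab: "a \<in> carrier Q" "b \<in> carrier Q" "\<Phi> a = \<Phi> b"
  have "\<Phi> (a \<ominus>\<^sub>Q b) = \<zero>\<^sub>(C_of X)" using ab \<Phi>.hom_minus[OF ab(1,2)] \<Phi>0.D.minus_eq_0_iff[of "\<Phi> a" "\<Phi> b"] by (simp only: \<Phi>.hom_closed)
  then have "nrm Q (a \<ominus>\<^sub>Q b) \<le> 0" using ab by (intro nrm_Q_le_sup) (auto simp: topspace_X)
  then have "nrm Q (a \<ominus>\<^sub>Q b) = 0" using ab by (intro antisym) auto
  then have "a \<ominus>\<^sub>Q b = \<zero>\<^sub>Q" using ab by (intro nrm_Q_eq_0) auto
  then show "a = b" using ab Q.minus_eq_0_iff by blast
qed

subsection \<open>Density of polynomials in the generators\<close>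

lemma compact_X: "compact_space X" using compact_group_torus_wreath unfolding compact_group_def by blast

text \<open>The Stone-Weierstrass theorem is applied on a compact set of matrices: sending g to the
  matrix of the values of all u_ab embeds G homeomorphically, being continuous and injective from a
  compact space into a Hausdorff space. The real functions on the image that come from polynomials
  form a ring, and it separates points because the matrix entries do.\<close>

lemma ev_dense_real:
  fixes h :: "(complex^'n) \<times> ('n \<Rightarrow> 'n) \<Rightarrow> real"
  assumes h: "continuous_map X euclideanreal h" and e: "e > 0"
  obtains y where "y \<in> carrier FA" "\<And>g. g \<in> carrier G \<Longrightarrow> cmod (of_real (h g) - ev g y) < e"
proof -
  define m :: "(complex^'n) \<times> ('n \<Rightarrow> 'n) \<Rightarrow> complex^'n^'n" where "m g = (\<chi> a b. point_gen g a b)" for g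
  define K where "K = m ` carrier G"
  have mc: "continuous_map X euclidean m" by (intro continuous_map_vecI) (simp add: m_def continuous_point_gen)
  then have mK: "continuous_map X (top_of_set K) m" by (auto simp: continuous_map_in_subtopology K_def topspace_X)
  have inj: "inj_on m (carrier G)"
  proof (rule inj_onI)
    fix g h assume g: "g \<in> carrier G" and h: "h \<in> carrier G" and "m g = m h"
    then have eq: "point_gen g a b = point_gen h a b" for a b by (metis m_def vec_lambda_beta)
    have nz: "fst g $ i \<noteq> 0" for i using g unfolding G_carrier by (metis norm_zero zero_neq_one)
    have sn: "snd g b = snd h b" for b using eq[of "snd g b" b] nz[of "snd g b"] by (auto simp: point_gen_def split: if_splits)
    have "fst g $ i = fst h $ i" for i
    proof -
      obtain b where "i = snd g b" using g unfolding G_carrier by (metis bij_pointE)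
      then show ?thesis using eq[of i b] sn[of b] by (simp add: point_gen_def)
    qed
    then show "g = h" using sn by (intro prod_eqI) (auto simp: vec_eq_iff)
  qed
  have "compactin euclidean (m ` topspace X)"
    using image_compactin[OF _ mc, of "topspace X"] compact_X by (simp add: compact_space_def)
  then have cK: "compact K" by (simp add: K_def topspace_X)
  have "homeomorphic_map X (top_of_set K) m" by (rule continuous_imp_homeomorphic_map[OF mK compact_X])
      (use inj in \<open>auto simp: K_def topspace_X intro: Hausdorff_space_subtopology\<close>)
  then obtain m' where m': "homeomorphic_maps X (top_of_set K) m m'" using homeomorphic_map_maps by blast
  then have m'c: "continuous_map (top_of_set K) X m'" and m'm: "\<And>g. g \<in> carrier G \<Longrightarrow> m' (m g) = g"
    by (auto simp: homeomorphic_maps_def topspace_X)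
  have cont: "continuous_on K r" if "continuous_map X euclideanreal r'" "\<And>g. g \<in> carrier G \<Longrightarrow> r (m g) = r' g"
    for r :: "complex^'n^'n \<Rightarrow> real" and r'
  proof -
    have "continuous_map (top_of_set K) euclideanreal (r' \<circ> m')" by (rule continuous_map_compose[OF m'c that(1)])
    then have "continuous_map (top_of_set K) euclideanreal r" by (rule continuous_map_eq) (auto simp: K_def m'm that(2))
    then show ?thesis by simp
  qed
  define R :: "(complex^'n^'n \<Rightarrow> real) set" where
    "R = {r. \<exists>y\<in>carrier FA. \<forall>g\<in>carrier G. of_real (r (m g)) = ev g y}"
  \<comment> \<open>Real parts remain polynomial because the algebra contains adjoints: take half
    the sum of y and its adjoint.\<close>
  have re: "\<exists>y'\<in>carrier FA. \<forall>g. of_real (Re (ev g y)) = ev g y'" if "y \<in> carrier FA" for y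
  proof -
    have "of_real (Re (ev g y)) = ev g ((1 / 2) \<odot>\<^sub>FA (y \<oplus>\<^sub>FA star FA y))" for g
      using that by (simp only: ev_simps FA.star_closed FA.a_closed) (simp add: complex_eq_iff)
    then show ?thesis using that by (intro bexI[of _ "(1 / 2) \<odot>\<^sub>FA (y \<oplus>\<^sub>FA star FA y)"]) (auto simp only: FA.star_closed FA.a_closed FA.smult_closed)
  qed
  interpret R: function_ring_on R K
  proof
    show "continuous_on K r" if r: "r \<in> R" for r
    proof -
      obtain y where y: "\<And>g. g \<in> carrier G \<Longrightarrow> of_real (r (m g)) = ev g y" using r unfolding R_def by blast
      have "continuous_map X euclideanreal (Re \<circ> (\<lambda>g. ev g y))"
        by (rule continuous_map_compose[OF continuous_ev]) (simp add: continuous_on_Re continuous_on_id)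
      moreover have "r (m g) = (Re \<circ> (\<lambda>g. ev g y)) g" if "g \<in> carrier G" for g using y[OF that] by (metis Re_complex_of_real comp_apply)
      ultimately show ?thesis by (rule cont)
    qed
    fix r s assume "r \<in> R" "s \<in> R"
    then obtain y z where y: "y \<in> carrier FA" "\<And>g. g \<in> carrier G \<Longrightarrow> of_real (r (m g)) = ev g y"
      and z: "z \<in> carrier FA" "\<And>g. g \<in> carrier G \<Longrightarrow> of_real (s (m g)) = ev g z" unfolding R_def by blast
    show "(\<lambda>x. r x + s x) \<in> R" unfolding R_def
    proof (intro CollectI bexI ballI)
      show "of_real (r (m g) + s (m g)) = ev g (y \<oplus>\<^sub>FA z)" if g: "g \<in> carrier G" for g
        using y(2)[OF g] z(2)[OF g] by (simp only: of_real_add ev_simps(1)[OF y(1) z(1)])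
    qed (rule FA.a_closed[OF y(1) z(1)])
    show "(\<lambda>x. r x * s x) \<in> R" unfolding R_def
    proof (intro CollectI bexI ballI)
      show "of_real (r (m g) * s (m g)) = ev g (y \<otimes>\<^sub>FA z)" if g: "g \<in> carrier G" for g
        using y(2)[OF g] z(2)[OF g] by (simp only: of_real_mult ev_simps(3)[OF y(1) z(1)])
    qed (rule FA.m_closed[OF y(1) z(1)])
  next
    show "(\<lambda>_. c) \<in> R" for c unfolding R_def by (intro CollectI bexI[of _ "of_real c \<odot>\<^sub>FA \<one>\<^sub>FA"])
        (simp_all only: ev_simps FA.one_closed FA.smult_closed mult_1_right simp_thms Ball_def)
  next
    fix x x' assume "x \<in> K" "x' \<in> K" "x \<noteq> x'"
    then obtain g g' where g: "g \<in> carrier G" "g' \<in> carrier G" "x = m g" "x' = m g'" "m g \<noteq> m g'" by (auto simp: K_def)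
    then obtain a b where ab: "point_gen g a b \<noteq> point_gen g' a b" by (auto simp: m_def vec_eq_iff)
    have fc: "free_gen a b \<in> carrier FA" by (rule free_gen_closed)
    \<comment> \<open>The imaginary part of an entry is the real part of -i times the entry.\<close>
    have ifc: "(- \<i>) \<odot>\<^sub>FA free_gen a b \<in> carrier FA" using fc by (rule FA.smult_closed)
    have "Re (point_gen g a b) \<noteq> Re (point_gen g' a b) \<or> Im (point_gen g a b) \<noteq> Im (point_gen g' a b)"
      using ab by (simp add: complex_eq_iff)
    then show "\<exists>r\<in>R. r x \<noteq> r x'"
    proof
      assume "Re (point_gen g a b) \<noteq> Re (point_gen g' a b)"
      moreover have "(\<lambda>x. Re (x $ a $ b)) \<in> R" using re[OF fc] by (auto simp: R_def m_def ev_gen)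
      ultimately show ?thesis using g by (intro bexI[of _ "\<lambda>x. Re (x $ a $ b)"]) (auto simp: m_def)
    next
      assume "Im (point_gen g a b) \<noteq> Im (point_gen g' a b)"
      moreover have "Re (ev g ((- \<i>) \<odot>\<^sub>FA free_gen a b)) = Im (point_gen g a b)" for g by (simp only: ev_simps fc ev_gen) simp
      then have "(\<lambda>x. Im (x $ a $ b)) \<in> R" using re[OF ifc] by (auto simp: R_def m_def)
      ultimately show ?thesis using g by (intro bexI[of _ "\<lambda>x. Im (x $ a $ b)"]) (auto simp: m_def)
    qed
  qed (rule cK)
  have "continuous_on K (h \<circ> m')" by (rule cont[OF h]) (simp add: m'm)
  from R.Stone_Weierstrass_basic[OF this e] obtain r where r: "r \<in> R" "\<And>x. x \<in> K \<Longrightarrow> \<bar>(h \<circ> m') x - r x\<bar> < e" by blast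
  from r(1) obtain y where y: "y \<in> carrier FA" "\<And>g. g \<in> carrier G \<Longrightarrow> of_real (r (m g)) = ev g y" unfolding R_def by blast
  show ?thesis
  proof (rule that[OF y(1)])
    fix g assume g: "g \<in> carrier G"
    have "cmod (of_real (h g) - ev g y) = \<bar>h g - r (m g)\<bar>" by (simp flip: y(2)[OF g] of_real_diff)
    also have "\<dots> < e" using r(2)[of "m g"] g by (simp add: K_def m'm)
    finally show "cmod (of_real (h g) - ev g y) < e" .
  qed
qed

lemma ev_dense:
  assumes h: "continuous_map X euclidean h" and e: "e > 0"
  obtains y where "y \<in> carrier FA" "\<And>g. g \<in> carrier G \<Longrightarrow> cmod (h g - ev g y) < e"
proof -
  have c: "continuous_map X euclideanreal (\<lambda>g. Re (h g))" "continuous_map X euclideanreal (\<lambda>g. Im (h g))"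
    using continuous_map_compose[OF h, of euclideanreal Re] continuous_map_compose[OF h, of euclideanreal Im]
    by (simp_all add: o_def continuous_on_Re continuous_on_Im continuous_on_id)
  obtain y z where y: "y \<in> carrier FA" "\<And>g. g \<in> carrier G \<Longrightarrow> cmod (of_real (Re (h g)) - ev g y) < e / 2"
    and z: "z \<in> carrier FA" "\<And>g. g \<in> carrier G \<Longrightarrow> cmod (of_real (Im (h g)) - ev g z) < e / 2"
    using ev_dense_real[OF c(1), of "e / 2"] ev_dense_real[OF c(2), of "e / 2"] e by (metis half_gt_zero)
  have iz: "\<i> \<odot>\<^sub>FA z \<in> carrier FA" using z(1) by (rule FA.smult_closed)
  show ?thesis
  proof (rule that[of "y \<oplus>\<^sub>FA \<i> \<odot>\<^sub>FA z"])
    show "y \<oplus>\<^sub>FA \<i> \<odot>\<^sub>FA z \<in> carrier FA" using y(1) iz by (rule FA.a_closed)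
    fix g assume g: "g \<in> carrier G"
    have "h g - ev g (y \<oplus>\<^sub>FA \<i> \<odot>\<^sub>FA z) = (of_real (Re (h g)) - ev g y) + \<i> * (of_real (Im (h g)) - ev g z)"
      by (simp only: ev_simps y(1) z(1) iz) (simp add: complex_eq_iff)
    then have "cmod (h g - ev g (y \<oplus>\<^sub>FA \<i> \<odot>\<^sub>FA z)) \<le> cmod (of_real (Re (h g)) - ev g y) + cmod (\<i> * (of_real (Im (h g)) - ev g z))"
      by (simp only: norm_triangle_ineq)
    also have "\<dots> < e" using y(2)[OF g] z(2)[OF g] by (simp add: norm_mult)
    finally show "cmod (h g - ev g (y \<oplus>\<^sub>FA \<i> \<odot>\<^sub>FA z)) < e" .
  qed
qed

text \<open>Lifting with norm control: a polynomial close to h has norm at most 5S/4 in Q. Adding an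
  element of the commutator ideal, invisible at the points of G, brings the norm in C below 2S, and
  density returns to a polynomial. The factors 3 and 1/2 leave room for two errors of size
  S/4.\<close>

lemma approximation_step:
  assumes h: "continuous_map X euclidean h" and S: "S > 0" "\<And>g. g \<in> carrier G \<Longrightarrow> cmod (h g) \<le> S"
  obtains y where "y \<in> carrier FA" "\<nu> y \<le> 3 * S" "\<And>g. g \<in> carrier G \<Longrightarrow> cmod (h g - ev g y) \<le> S / 2"
proof -
  obtain x where x: "x \<in> carrier FA" "\<And>g. g \<in> carrier G \<Longrightarrow> cmod (h g - ev g x) < S / 4" using ev_dense[OF h, of "S / 4"] S(1) by auto
  have "nrm Q (\<theta> x) \<le> S + S / 4"
  proof (rule nrm_\<theta>_le_sup[OF x(1)])
    fix g assume g: "g \<in> carrier G"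
    show "cmod (ev g x) \<le> S + S / 4"
      using norm_triangle_ineq2[of "ev g x" "h g"] x(2)[OF g] S(2)[OF g] by (simp add: norm_minus_commute)
  qed
  then have qx: "nrm Q (CJ.q (\<iota> x)) + S / 2 < 2 * S" using S(1) by (simp add: \<theta>_def)
  obtain j where "j \<in> commutator_ideal C" "nrm C (j \<oplus>\<^sub>C \<iota> x) < nrm Q (CJ.q (\<iota> x)) + S / 2"
  proof (rule CJ.nrm_q_approx[OF \<iota>.hom_closed[OF x(1)], of "S / 2"])
    show "S / 2 > 0" using S(1) by simp
  qed (rule that)
  then have j: "j \<in> commutator_ideal C" "nrm C (j \<oplus>\<^sub>C \<iota> x) < 2 * S" using qx by auto
  have jc: "j \<in> carrier C" using j(1) CJ.a_subset by blast
  obtain y where y: "y \<in> carrier FA" "nrm C ((j \<oplus>\<^sub>C \<iota> x) \<ominus>\<^sub>C \<iota> y) < S / 4" using C_dense[of "j \<oplus>\<^sub>C \<iota> x" "S / 4"] jc x(1) S(1) by auto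
  show ?thesis
  proof (rule that[OF y(1)])
    have "nrm C (\<iota> y) \<le> nrm C (j \<oplus>\<^sub>C \<iota> x) + nrm C ((j \<oplus>\<^sub>C \<iota> x) \<ominus>\<^sub>C \<iota> y)"
      using C.nrm_le_minus[of "\<iota> y" "j \<oplus>\<^sub>C \<iota> x"] C.nrm_minus_commute[of "\<iota> y" "j \<oplus>\<^sub>C \<iota> x"] jc x(1) y(1) by simp
    then show "\<nu> y \<le> 3 * S" using y j S(1) nrm_\<iota>[OF y(1)] by linarith
    fix g assume g: "g \<in> carrier G"
    have "\<Phi>0 ((j \<oplus>\<^sub>C \<iota> x) \<ominus>\<^sub>C \<iota> y) g = ev g x - ev g y"
      using \<Phi>0_J[OF j(1)] jc x(1) y(1) g by (simp add: \<Phi>0_minus \<Phi>0_simps \<Phi>0_\<iota> topspace_X)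
    then have "cmod (ev g x - ev g y) \<le> S / 4" using \<Phi>0_le[of "(j \<oplus>\<^sub>C \<iota> x) \<ominus>\<^sub>C \<iota> y" g] y jc x(1) g by simp
    then show "cmod (h g - ev g y) \<le> S / 2" using norm_triangle_ineq[of "h g - ev g x" "ev g x - ev g y"] x(2)[OF g] by simp
  qed
qed

text \<open>\<open>approximation_step\<close> is iterated on the remainder h - ev (Y n): the errors
  halve and the increments have \<nu>-norm at most 3 S / 2^n. The partial sums form a Cauchy
  sequence of polynomials, which represents an element of the completion.\<close>

lemma surj_\<Phi>0:
  assumes h: "h \<in> carrier (C_of X)"
  shows "\<exists>c\<in>carrier C. \<Phi>0 c = h"
proof -
  have hc: "continuous_map X euclidean h" using h by simp
  obtain S where S: "S > 0" "\<And>g. g \<in> carrier G \<Longrightarrow> cmod (h g) \<le> S"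
  proof -
    have "compactin euclidean (h ` topspace X)"
      using image_compactin[OF _ hc, of "topspace X"] compact_X by (simp add: compact_space_def)
    then have "bounded (h ` carrier G)" by (simp add: topspace_X compact_imp_bounded)
    then show ?thesis using that unfolding bounded_pos by blast
  qed
  have "\<exists>Y. \<forall>n. (Y n \<in> carrier FA \<and> (\<forall>g\<in>carrier G. cmod (h g - ev g (Y n)) \<le> S / 2 ^ n))
      \<and> \<nu> (Y (Suc n) \<ominus>\<^sub>FA Y n) \<le> 3 * S / 2 ^ n"
  proof (rule dependent_nat_choice)
    show "\<exists>y. y \<in> carrier FA \<and> (\<forall>g\<in>carrier G. cmod (h g - ev g y) \<le> S / 2 ^ 0)"
      using S by (intro exI[of _ "\<zero>\<^sub>FA"] conjI ballI FA.zero_closed) (simp only: ev_simps diff_zero power_0 div_by_1)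
  next
    fix x n assume x: "x \<in> carrier FA \<and> (\<forall>g\<in>carrier G. cmod (h g - ev g x) \<le> S / 2 ^ n)"
    have hx: "continuous_map X euclidean (\<lambda>g. h g - ev g x)"
    proof -
      have "continuous_map X euclidean (\<lambda>g. \<Sum>b\<in>UNIV. (if b then h g else (- 1) * ev g x))"
      proof (rule continuous_map_sum_cx)
        fix b :: bool
        show "continuous_map X euclidean (\<lambda>g. if b then h g else (- 1) * ev g x)"
          using hc continuous_map_mult_cx[of X "\<lambda>_. - 1" "\<lambda>g. ev g x"] continuous_ev[of x] by (cases b) auto
      qed
      then show ?thesis by (simp add: UNIV_bool)
    qed
    obtain y where y: "y \<in> carrier FA" "\<nu> y \<le> 3 * (S / 2 ^ n)"
      "\<And>g. g \<in> carrier G \<Longrightarrow> cmod ((h g - ev g x) - ev g y) \<le> (S / 2 ^ n) / 2"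
      using approximation_step[OF hx, of "S / 2 ^ n"] x S(1) by auto
    have xc: "x \<in> carrier FA" using x by blast
    have "(x \<oplus>\<^sub>FA y) \<ominus>\<^sub>FA x = y" using FA.add_minus_cancel[OF y(1) xc] FA.a_comm[OF xc y(1)] by (simp only:)
    moreover have "cmod (h g - ev g (x \<oplus>\<^sub>FA y)) \<le> S / 2 ^ Suc n" if g: "g \<in> carrier G" for g
      using y(3)[OF g] by (simp only: ev_simps(1)[OF xc y(1)] diff_diff_eq) (simp add: mult.commute)
    ultimately show "\<exists>z. (z \<in> carrier FA \<and> (\<forall>g\<in>carrier G. cmod (h g - ev g z) \<le> S / 2 ^ Suc n)) \<and> \<nu> (z \<ominus>\<^sub>FA x) \<le> 3 * S / 2 ^ n"
      using y(2) FA.a_closed[OF xc y(1)] by (intro exI[of _ "x \<oplus>\<^sub>FA y"]) simp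
  qed
  then obtain Y where Y: "\<And>n. Y n \<in> carrier FA" "\<And>n g. g \<in> carrier G \<Longrightarrow> cmod (h g - ev g (Y n)) \<le> S / 2 ^ n"
    "\<And>n. \<nu> (Y (Suc n) \<ominus>\<^sub>FA Y n) \<le> 3 * S / 2 ^ n" by blast
  \<comment> \<open>The sum of 3 S / 2^k over n \<le> k < n + d in closed form, which the induction
    on d reproduces.\<close>
  have step: "\<nu> (Y (n + d) \<ominus>\<^sub>FA Y n) \<le> 6 * S / 2 ^ n - 6 * S / 2 ^ (n + d)" for n d
  proof (induction d)
    case 0
    have "Y n \<ominus>\<^sub>FA Y n = \<zero>\<^sub>FA" using FA.minus_eq_0_iff[OF Y(1) Y(1)] by blast
    then show ?case using FA.nrm_zero by (simp del: msa_simps)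
  next
    case (Suc d)
    have "\<nu> (Y (n + Suc d) \<ominus>\<^sub>FA Y n) \<le> \<nu> (Y (Suc (n + d)) \<ominus>\<^sub>FA Y (n + d)) + \<nu> (Y (n + d) \<ominus>\<^sub>FA Y n)"
      using FA.nrm_triangle[OF Y(1)[of "Suc (n + d)"] Y(1)[of "n + d"] Y(1)[of n]] by simp
    also have "\<dots> \<le> 3 * S / 2 ^ (n + d) + (6 * S / 2 ^ n - 6 * S / 2 ^ (n + d))" using Y(3)[of "n + d"] Suc by simp
    also have "\<dots> = 6 * S / 2 ^ n - 6 * S / 2 ^ (n + Suc d)" by (simp add: field_simps)
    finally show ?case .
  qed
  have lim0: "(\<lambda>n. K * (1 / 2) ^ n) \<longlonglongrightarrow> 0" for K :: real
    using tendsto_mult[OF tendsto_const LIMSEQ_realpow_zero[of "1 / 2"], of K] by simp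
  have YC: "Y \<in> carrier FA.CA" unfolding cauchy_algebra_carrier
  proof (intro conjI allI impI)
    fix e :: real assume e: "e > 0"
    then obtain k where k: "\<And>n. n \<ge> k \<Longrightarrow> 6 * S * (1 / 2) ^ n < e"
      using order_tendstoD(2)[OF lim0[of "6 * S"] e] unfolding eventually_sequentially by blast
    have le: "\<nu> (Y m \<ominus>\<^sub>FA Y n) < e" if "n \<ge> k" "n \<le> m" for m n
    proof -
      have "\<nu> (Y m \<ominus>\<^sub>FA Y n) \<le> 6 * S / 2 ^ n - 6 * S / 2 ^ m" using step[of n "m - n"] that by simp
      also have "\<dots> \<le> 6 * S * (1 / 2) ^ n" using S(1) by (simp add: power_one_over field_simps)
      finally show ?thesis using k[OF that(1)] by simp
    qed
    show "\<exists>k. \<forall>m\<ge>k. \<forall>n\<ge>k. nrm FA (Y m \<ominus>\<^sub>FA Y n) < e"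
    proof (intro exI[of _ k] allI impI)
      fix m n assume "k \<le> m" "k \<le> n"
      then show "nrm FA (Y m \<ominus>\<^sub>FA Y n) < e"
        using le[of n m] le[of m n] FA.nrm_minus_commute[OF Y(1) Y(1), of m n] by (cases "n \<le> m") auto
    qed
  qed (rule Y(1))
  have cc: "FA.cl Y \<in> carrier C" unfolding C_def' FA.carrier_completion using YC by (rule imageI)
  have "\<Phi>0 (FA.cl Y) = h"
  proof (rule C_of_eqI[OF \<Phi>0.hom_closed[OF cc] h])
    fix g assume g: "g \<in> carrier G"
    have "(\<lambda>n. ev g (Y n) - h g) \<longlonglongrightarrow> 0"
    proof (rule Lim_null_comparison[OF _ lim0])
      show "\<forall>\<^sub>F n in sequentially. norm (ev g (Y n) - h g) \<le> S * (1 / 2) ^ n"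
        using Y(2)[OF g] by (simp add: norm_minus_commute power_one_over)
    qed
    then have "(\<lambda>n. ev g (Y n)) \<longlonglongrightarrow> h g" by (rule LIM_zero_cancel)
    then show "\<Phi>0 (FA.cl Y) g = h g" using \<Phi>0_lim[OF YC g] LIMSEQ_unique by blast
  qed
  then show ?thesis using cc by blast
qed

theorem star_iso_\<Phi>: "star_iso Q (C_of X) \<Phi>"
proof -
  have "\<Phi> ` carrier Q = carrier (C_of X)"
  proof (intro equalityI subsetI)
    fix h assume "h \<in> carrier (C_of X)"
    then obtain c where "c \<in> carrier C" "\<Phi>0 c = h" using surj_\<Phi>0 by blast
    then show "h \<in> \<Phi> ` carrier Q" using \<Phi>_q[of c] by (intro image_eqI[of _ _ "CJ.q c"]) auto
  qed (use \<Phi>.hom_closed in blast)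
  then show ?thesis using inj_\<Phi> star_hom_\<Phi> by (simp only: star_iso_def bij_betw_def simp_thms)
qed

end

subsection \<open>Characters are contractive\<close>

context seminormed_star_alg
begin

lemma geometric_sum:
  assumes x: "x \<in> carrier B"
  shows "(\<Oplus>k\<in>{..<n::nat}. x [^] k) \<otimes> (\<one> \<ominus> x) = \<one> \<ominus> x [^] n" (is ?l)
    "(\<one> \<ominus> x) \<otimes> (\<Oplus>k\<in>{..<n}. x [^] k) = \<one> \<ominus> x [^] n" (is ?r)
proof -
  have "?l \<and> ?r"
  proof (induction n)
    case 0
    have "\<one> \<ominus> \<one> = \<zero>" by (simp add: minus_eq_0_iff)
    then show ?case using x by simp
  next
    case (Suc n)
    let ?s = "\<Oplus>k\<in>{..<n}. x [^] k"
    have c: "?s \<in> carrier B" "x [^] n \<in> carrier B" using x by auto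
    have s: "(\<Oplus>k\<in>{..<Suc n}. x [^] k) = x [^] n \<oplus> ?s" using x by (simp add: lessThan_Suc finsum_insert)
    have d: "(p \<ominus> r) \<oplus> (\<one> \<ominus> p) = \<one> \<ominus> r" if "p \<in> carrier B" "r \<in> carrier B" for p r
    proof -
      have "(p \<ominus> r) \<oplus> (\<one> \<ominus> p) = p \<oplus> (\<ominus> p \<oplus> (\<one> \<oplus> \<ominus> r))" using that by (simp add: minus_eq a_ac)
      also have "\<dots> = (p \<oplus> \<ominus> p) \<oplus> (\<one> \<oplus> \<ominus> r)" using that by (simp add: a_assoc)
      finally show ?thesis using that by (simp add: r_neg minus_eq)
    qed
    have m: "x [^] n \<otimes> (\<one> \<ominus> x) = x [^] n \<ominus> x [^] Suc n" "(\<one> \<ominus> x) \<otimes> x [^] n = x [^] n \<ominus> x [^] Suc n"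
      using x c nat_pow_Suc2[OF x, of n] by (simp_all add: minus_eq l_distr r_distr l_minus r_minus del: nat_pow_Suc)
    show ?case unfolding s using Suc m c x d[of "x [^] n" "x [^] Suc n"] by (simp add: l_distr r_distr del: nat_pow_Suc)
  qed
  then show ?l ?r by auto
qed

lemma nrm_geometric_sum:
  assumes "x \<in> carrier B" "nrm B x \<le> r" "r < 1"
  shows "nrm B (\<Oplus>k\<in>{..<n::nat}. x [^] k) \<le> 1 / (1 - r)"
proof -
  have r0: "0 \<le> r" using assms nrm_nonneg order_trans by blast
  have "nrm B (\<Oplus>k\<in>{..<n}. x [^] k) \<le> (\<Sum>k<n. nrm B (x [^] k))" using assms by (intro nrm_finsum) auto
  also have "\<dots> \<le> (\<Sum>k<n. r ^ k)" using assms by (intro sum_mono order_trans[OF nrm_pow] power_mono) auto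
  also have "\<dots> = (1 - r ^ n) / (1 - r)" using assms by (simp add: sum_gp_strict)
  also have "\<dots> \<le> 1 / (1 - r)" using assms r0 by (intro divide_right_mono) auto
  finally show ?thesis .
qed

text \<open>The resolvent identity for approximate inverses: for exact inverses a of u and b of v it
  reads a - b = a (v - u) b, and the terms with P and R account for the defects.\<close>

lemma inverse_perturbation:
  assumes c: "a \<in> carrier B" "b \<in> carrier B" "u \<in> carrier B" "v \<in> carrier B" "P \<in> carrier B" "R \<in> carrier B"
    and au: "a \<otimes> u = \<one> \<ominus> P" and vb: "v \<otimes> b = \<one> \<ominus> R"
  shows "a \<ominus> b = (a \<otimes> (v \<ominus> u) \<otimes> b \<oplus> a \<otimes> R) \<ominus> P \<otimes> b"
proof -
  have "a \<otimes> (v \<ominus> u) \<otimes> b = a \<otimes> (v \<otimes> b) \<ominus> (a \<otimes> u) \<otimes> b" using c by (simp add: minus_eq l_distr r_distr l_minus r_minus m_assoc)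
  also have "\<dots> = (a \<oplus> \<ominus> (a \<otimes> R)) \<oplus> (\<ominus> b \<oplus> P \<otimes> b)"
    unfolding au vb using c by (simp add: minus_eq l_distr r_distr l_minus r_minus minus_add)
  finally have "(a \<otimes> (v \<ominus> u) \<otimes> b \<oplus> a \<otimes> R) \<ominus> P \<otimes> b = ((a \<oplus> \<ominus> (a \<otimes> R)) \<oplus> (\<ominus> b \<oplus> P \<otimes> b) \<oplus> a \<otimes> R) \<oplus> \<ominus> (P \<otimes> b)" by (simp add: minus_eq)
  also have "\<dots> = (a \<oplus> \<ominus> b) \<oplus> ((a \<otimes> R \<oplus> \<ominus> (a \<otimes> R)) \<oplus> (P \<otimes> b \<oplus> \<ominus> (P \<otimes> b)))" using c by (simp add: a_ac del: r_neg l_neg)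
  finally show ?thesis using c by (simp add: r_neg minus_eq)
qed

text \<open>If |\<kappa> c| > |c|, then x = c / \<kappa>(c) has norm below 1, so 1 - x is
  invertible, against \<kappa>(1 - x) = 0. The inverse is represented by one Cauchy sequence, whose
  n-th term is the sum of the powers X_n^k for k < n, so no limit inside the completion has to be
  taken. The bound is used for a character built from the coproduct, of which only the homomorphism
  property and the values on generators are known.\<close>

lemma completion_character_le:
  assumes \<kappa>: "star_hom CB complex_alg \<kappa>" and c: "c \<in> carrier CB"
  shows "cmod (\<kappa> c) \<le> nrm CB c"
proof (rule ccontr)
  assume "\<not> ?thesis"
  then have lt: "nrm CB c < cmod (\<kappa> c)" by simp
  interpret K: seminormed_star_alg "CB" by (rule seminormed_completion)
  interpret CI: seminormed_star_ideal CA "null_sequences B" by (rule null_ideal)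
  interpret k: star_alg_hom CA "CB" cl
    by (intro star_alg_homI star_alg_CA star_hom_cl K.star_alg_axioms)
  interpret \<kappa>: star_alg_hom "CB" complex_alg \<kappa>
    by (intro star_alg_homI star_alg_complex_alg K.star_alg_axioms \<kappa>)
  have z: "cmod (\<kappa> c) > 0" using lt K.nrm_nonneg[OF c] by linarith
  obtain X0 where X0: "X0 \<in> carrier CA" "c = cl X0" using c unfolding carrier_completion by auto
  define X where "X = (\<lambda>n. (1 / \<kappa> c) \<odot> X0 n)"
  have X: "X \<in> carrier CA" using CA_smult_closed[OF X0(1)] by (simp add: X_def)
  have clX: "cl X = (1 / \<kappa> c) \<odot>\<^sub>CB c" using k.hom_smult[OF X0(1), of "1 / \<kappa> c"] X0(2) by (simp add: X_def)
  have \<kappa>X: "\<kappa> (cl X) = 1" using z by (simp add: clX \<kappa>.hom_smult[OF c])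
  define s where "s = nrm CB (cl X)"
  have s1: "s < 1" using lt z c by (simp add: s_def clX K.nrm_smult norm_divide)
  \<comment> \<open>A number strictly between s and 1: eventually all terms of the sequence X have
    norm at most r < 1.\<close>
  define r where "r = (s + 1) / 2"
  have s0: "0 \<le> s" using K.nrm_nonneg[OF k.hom_closed[OF X]] by (simp add: s_def)
  have r: "0 \<le> r" "r < 1" "s < r" using s1 s0 by (auto simp: r_def)
  note Xc = CA_carrierD[OF X]
  have "\<forall>\<^sub>F n in sequentially. nrm B (X n) < r" using order_tendstoD(2)[OF nrm_cl_tendsto[OF X]] r(3) by (simp add: s_def)
  then obtain k0 where k0: "\<And>n. n \<ge> k0 \<Longrightarrow> nrm B (X n) \<le> r" unfolding eventually_sequentially using less_imp_le by blast
  have pw: "nrm B (X n [^] n) \<le> r ^ n" if "n \<ge> k0" for n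
    using nrm_pow[OF Xc, of n n] power_mono[OF k0[OF that] nrm_nonneg[OF Xc], of n] by simp
  define Y where "Y = (\<lambda>n. \<Oplus>k\<in>{..<n}. X n [^] k)"
  define K where "K = 1 / (1 - r)"
  have K0: "0 < K" using r by (simp add: K_def)
  have Yc: "Y n \<in> carrier B" for n using Xc by (auto simp: Y_def intro!: finsum_closed)
  have YK: "nrm B (Y n) \<le> K" if "n \<ge> k0" for n unfolding Y_def K_def by (rule nrm_geometric_sum[OF Xc k0[OF that] r(2)])
  have diff: "nrm B (Y m \<ominus> Y n) \<le> K * nrm B (X m \<ominus> X n) * K + K * r ^ n + r ^ m * K" if mn: "m \<ge> k0" "n \<ge> k0" for m n
  proof -
    let ?u = "\<one> \<ominus> X m" and ?v = "\<one> \<ominus> X n"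
    have p: "X m [^] m \<in> carrier B" "X n [^] n \<in> carrier B" and uv: "?u \<in> carrier B" "?v \<in> carrier B" using Xc by auto
    have vu: "?v \<ominus> ?u = X m \<ominus> X n"
    proof -
      have "?v \<ominus> ?u = (\<one> \<oplus> \<ominus> \<one>) \<oplus> (X m \<oplus> \<ominus> X n)" using Xc by (simp add: minus_eq minus_add a_ac del: r_neg l_neg)
      then show ?thesis using Xc by (simp add: r_neg minus_eq)
    qed
    have eq: "Y m \<ominus> Y n = (Y m \<otimes> (X m \<ominus> X n) \<otimes> Y n \<oplus> Y m \<otimes> X n [^] n) \<ominus> X m [^] m \<otimes> Y n" unfolding vu[symmetric]
      by (rule inverse_perturbation[OF Yc Yc uv p]) (simp_all add: Y_def geometric_sum Xc)
    have "nrm B (Y m \<ominus> Y n) \<le> nrm B (Y m \<otimes> (X m \<ominus> X n) \<otimes> Y n) + nrm B (Y m \<otimes> X n [^] n) + nrm B (X m [^] m \<otimes> Y n)"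
      unfolding eq using Yc Xc p by (intro order_trans[OF nrm_minus] add_mono nrm_add order_refl) auto
    also have "\<dots> \<le> (nrm B (Y m) * nrm B (X m \<ominus> X n)) * nrm B (Y n) + nrm B (Y m) * nrm B (X n [^] n) + nrm B (X m [^] m) * nrm B (Y n)"
      using Yc Xc p by (intro add_mono nrm_mult order_trans[OF nrm_mult] mult_right_mono) auto
    also have "\<dots> \<le> (K * nrm B (X m \<ominus> X n)) * K + K * r ^ n + r ^ m * K" using Yc Xc p YK mn pw K0 r by (intro add_mono mult_mono) auto
    finally show ?thesis .
  qed
  have YC: "Y \<in> carrier CA" unfolding cauchy_algebra_carrier
  proof (intro conjI allI impI Yc)
    fix e :: real assume e: "e > 0"
    obtain k1 where k1: "\<And>m n. m \<ge> k1 \<Longrightarrow> n \<ge> k1 \<Longrightarrow> nrm B (X m \<ominus> X n) < e / (3 * K * K)"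
      using X e K0 unfolding cauchy_algebra_carrier by (metis divide_pos_pos mult_pos_pos zero_less_numeral)
    have "(\<lambda>n. r ^ n) \<longlonglongrightarrow> 0" using r by (intro LIMSEQ_realpow_zero)
    then have "\<forall>\<^sub>F n in sequentially. r ^ n < e / (3 * K)" by (rule order_tendstoD(2)) (use e K0 in simp)
    then obtain k2 where k2: "\<And>n. n \<ge> k2 \<Longrightarrow> r ^ n < e / (3 * K)" unfolding eventually_sequentially by blast
    show "\<exists>k. \<forall>m\<ge>k. \<forall>n\<ge>k. nrm B (Y m \<ominus> Y n) < e"
    proof (intro exI[of _ "max k0 (max k1 k2)"] allI impI)
      fix m n assume mn: "max k0 (max k1 k2) \<le> m" "max k0 (max k1 k2) \<le> n"
      have "K * nrm B (X m \<ominus> X n) * K < e / 3" using k1[of m n] mn K0 by (simp add: field_simps)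
      moreover have "K * r ^ n < e / 3" "r ^ m * K < e / 3" using k2[of n] k2[of m] mn K0 by (auto simp: field_simps)
      ultimately show "nrm B (Y m \<ominus> Y n) < e" using diff[of m n] mn by simp
    qed
  qed
  have one: "(\<lambda>n. \<one>) \<in> carrier CA" by (rule CA_const) simp
  have YX: "Y \<otimes>\<^sub>CA (\<one>\<^sub>CA \<ominus>\<^sub>CA X) = (\<lambda>n. \<one> \<ominus> X n [^] n)" using CA_minus[OF one X] by (simp add: Y_def geometric_sum Xc)
  have YXc: "(\<lambda>n. \<one> \<ominus> X n [^] n) \<in> carrier CA" unfolding YX[symmetric] by (intro CI.m_closed CI.minus_closed CI.one_closed YC X)
  have "(\<lambda>n. nrm B ((\<one> \<ominus> X n [^] n) \<ominus> \<one>)) \<longlonglongrightarrow> 0"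
  proof (rule Lim_null_comparison)
    have "nrm B ((\<one> \<ominus> X n [^] n) \<ominus> \<one>) \<le> r ^ n" if "n \<ge> k0" for n
    proof -
      have "(\<one> \<ominus> X n [^] n) \<ominus> \<one> = \<ominus> (X n [^] n)" using Xc[of n] add_minus_cancel[of "\<ominus> (X n [^] n)" \<one>] by (simp add: minus_eq a_comm)
      then show ?thesis using pw[OF that] Xc by simp
    qed
    then show "\<forall>\<^sub>F n in sequentially. norm (nrm B ((\<one> \<ominus> X n [^] n) \<ominus> \<one>)) \<le> r ^ n"
      using Xc unfolding eventually_sequentially by (intro exI[of _ k0]) simp
    show "(\<lambda>n. r ^ n) \<longlonglongrightarrow> 0" using r by (intro LIMSEQ_realpow_zero)
  qed
  then have "(\<lambda>n. \<one> \<ominus> X n [^] n) \<ominus>\<^sub>CA (\<lambda>n. \<one>) \<in> null_sequences B" using Xc by (auto simp: CA_minus[OF YXc one] null_sequences_def)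
  then have "cl (\<lambda>n. \<one> \<ominus> X n [^] n) = cl (\<lambda>n. \<one>)" using CI.q_eq_iff[OF YXc one] by blast
  then have "\<kappa> (cl (Y \<otimes>\<^sub>CA (\<one>\<^sub>CA \<ominus>\<^sub>CA X))) = 1" unfolding YX using k.hom_one \<kappa>.hom_one by simp
  moreover have "\<kappa> (cl (Y \<otimes>\<^sub>CA (\<one>\<^sub>CA \<ominus>\<^sub>CA X))) = \<kappa> (cl Y) * (1 - \<kappa> (cl X))" using YC X k.hom_one \<kappa>.hom_one
    by (simp only: k.hom_mult k.hom_minus \<kappa>.hom_mult \<kappa>.hom_minus CI.minus_closed CI.one_closed k.hom_closed K.minus_closed K.one_closed
        complex_alg_simps minus_complex_alg)
  ultimately show False by (simp add: \<kappa>X)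
qed

end

subsection \<open>Characters of tensor products\<close>

lemma character_state:
  assumes "star_alg B" "star_hom B complex_alg \<kappa>" "\<And>x. x \<in> carrier B \<Longrightarrow> cmod (\<kappa> x) \<le> nrm B x"
  shows "state B \<kappa>"
proof -
  interpret B: star_alg B by fact
  note h = star_homD[OF assms(2)]
  have "\<kappa> (star B x \<otimes>\<^sub>B x) \<in> \<real>\<^sub>\<ge>\<^sub>0" if "x \<in> carrier B" for x
    using that by (simp add: h mult.commute[of "cnj _"] flip: complex_norm_square)
  then show ?thesis using assms(3) by (simp add: state_def h)
qed

context tensor_pair
begin

lemma character_tensor:
  assumes "star_hom B complex_alg \<kappa>" "star_hom D complex_alg \<xi>"
  shows "star_hom (F p) complex_alg (lin (\<eta> \<kappa> \<xi>))"
proof -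
  note h = star_homD[OF assms(1)] star_homD[OF assms(2)]
  have "lin (\<eta> \<kappa> \<xi>) = lin_ext complex_alg (\<eta> \<kappa> \<xi>)" by (simp add: fun_eq_iff lin_def lin_ext_complex)
  then show ?thesis by (simp only:) (rule lin_ext_star_hom[OF inv_monoid_M star_alg_complex_alg]; auto simp: h mult_M carrier_M)
qed

text \<open>Contractive characters are states, and at the vector s = 1 the GNS inequality for their
  product bounds the squared modulus of the value at t by (N t)^2, because the product is
  multiplicative.\<close>

lemma character_tensor_le:
  assumes \<kappa>: "star_hom B complex_alg \<kappa>" "\<And>x. x \<in> carrier B \<Longrightarrow> cmod (\<kappa> x) \<le> nrm B x"
    and \<xi>: "star_hom D complex_alg \<xi>" "\<And>x. x \<in> carrier D \<Longrightarrow> cmod (\<xi> x) \<le> nrm D x"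
    and t: "t \<in> carrier F0"
  shows "cmod (lin (\<eta> \<kappa> \<xi>) t) \<le> N t"
proof -
  interpret F0: star_alg F0 by (rule star_alg_F)
  let ?\<omega> = "lin (\<eta> \<kappa> \<xi>)"
  note h = star_homD[OF character_tensor[OF \<kappa>(1) \<xi>(1), of "\<lambda>_. 0"]]
  have st: "state B \<kappa>" "state D \<xi>" by (intro character_state B.star_alg_axioms D.star_alg_axioms \<kappa> \<xi>; assumption)+
  have sq: "Re (?\<omega> (star F0 u \<otimes>\<^sub>F0 u)) = (cmod (?\<omega> u))\<^sup>2" if "u \<in> carrier F0" for u
    using h(3)[OF F0.star_closed[OF that] that] h(6)[OF that] by (simp add: mult.commute[of "cnj _"] flip: complex_norm_square)
  have "Re (?\<omega> (star F0 (t \<otimes>\<^sub>F0 \<one>\<^sub>F0) \<otimes>\<^sub>F0 (t \<otimes>\<^sub>F0 \<one>\<^sub>F0))) \<le> (N t)\<^sup>2 * Re (?\<omega> (star F0 \<one>\<^sub>F0 \<otimes>\<^sub>F0 \<one>\<^sub>F0))"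
    using spatial_norm_upper[OF st t F0.one_closed] unfolding tensor_functional_lin .
  then have "(cmod (?\<omega> t))\<^sup>2 \<le> (N t)\<^sup>2"
    using sq[OF t] sq[OF F0.one_closed] h(4) by (simp only: F0.r_one[OF t] complex_alg_simps norm_one power_one mult_1_right)
  then show ?thesis using spatial_norm_nonneg[OF t] power2_le_imp_le by blast
qed

end

lemma star_hom_complex_eq_on_basis:
  assumes M: "inv_monoid M i" and h: "star_hom (monoid_star_algebra M i p) complex_alg \<phi>"
    "star_hom (monoid_star_algebra M i p) complex_alg \<psi>"
    and eq: "\<And>x. x \<in> carrier M \<Longrightarrow> \<phi> (basis_elt x) = \<psi> (basis_elt x)"
    and t: "t \<in> carrier (monoid_star_algebra M i p)"
  shows "\<phi> t = \<psi> t"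
proof -
  have "\<phi> t = (\<Sum>x | t x \<noteq> 0. t x * \<phi> (basis_elt x))" "\<psi> t = (\<Sum>x | t x \<noteq> 0. t x * \<psi> (basis_elt x))"
    using star_hom_lin_ext[OF M star_alg_complex_alg h(1) t] star_hom_lin_ext[OF M star_alg_complex_alg h(2) t]
    by (simp_all add: lin_ext_complex)
  then show ?thesis using eq t by (auto intro!: sum.cong)
qed

lemma (in star_alg) posfun_linear_combination:
  assumes "posfun B \<phi>" "\<And>i. i \<in> I \<Longrightarrow> v i \<in> carrier B"
  shows "\<phi> (\<Oplus>i\<in>I. c i \<odot> v i) = (\<Sum>i\<in>I. c i * \<phi> (v i))" using assms by (simp add: pf_finsum pf_smult)

context GA
begin

subsection \<open>The tensor square of the commutative quotient\<close>

abbreviation QQ where "QQ \<equiv> min_tensor Q Q"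

sublocale QT: tensor_pair "star_quot (C_GA A l) (commutator_ideal (C_GA A l))" "star_quot (C_GA A l) (commutator_ideal (C_GA A l))"
  by unfold_locales

lemma \<Phi>_character: "g \<in> carrier G \<Longrightarrow> star_hom Q complex_alg (\<lambda>a. \<Phi> a g)"
  by (rule star_hom_C_of_eval[OF star_hom_\<Phi>]) (simp only: topspace_X)

lemma \<Phi>0_character: "g \<in> carrier G \<Longrightarrow> star_hom C complex_alg (\<lambda>a. \<Phi>0 a g)"
  by (rule star_hom_C_of_eval[OF star_hom_\<Phi>0]) (simp only: topspace_X)

lemma \<Phi>_le:
  assumes g: "g \<in> carrier G" and a: "a \<in> carrier Q"
  shows "cmod (\<Phi> a g) \<le> nrm Q a"
proof (rule field_le_epsilon)
  fix e :: real assume e: "e > 0"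
  obtain c where c: "c \<in> carrier C" "a = CJ.q c" using a unfolding CJ.carrier_Q by auto
  obtain j where j: "j \<in> commutator_ideal C" "nrm C (j \<oplus>\<^sub>C c) < nrm Q (CJ.q c) + e" by (rule CJ.nrm_q_approx[OF c(1) e])
  have jc: "j \<in> carrier C" using j(1) CJ.a_subset by blast
  have "\<Phi>0 (j \<oplus>\<^sub>C c) g = \<Phi>0 c g" using \<Phi>0_J[OF j(1)] jc c(1) g by (simp add: \<Phi>0_simps topspace_X)
  then have "cmod (\<Phi> a g) \<le> nrm C (j \<oplus>\<^sub>C c)" using \<Phi>0_le[of "j \<oplus>\<^sub>C c" g] jc c g by (simp add: \<Phi>_q)
  then show "cmod (\<Phi> a g) \<le> nrm Q a + e" using j(2) c(2) by simp
qed

lemma \<Phi>_state: "g \<in> carrier G \<Longrightarrow> state Q (\<lambda>a. \<Phi> a g)" by (intro character_state Q.star_alg_axioms \<Phi>_character \<Phi>_le)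

definition EQ where "EQ g h = lin (QT.\<eta> (\<lambda>a. \<Phi> a g) (\<lambda>a. \<Phi> a h))"

lemma EQ_hom: "g \<in> carrier G \<Longrightarrow> h \<in> carrier G \<Longrightarrow> star_hom (QT.F p) complex_alg (EQ g h)"
  unfolding EQ_def by (intro QT.character_tensor \<Phi>_character)

lemma EQ_le: "g \<in> carrier G \<Longrightarrow> h \<in> carrier G \<Longrightarrow> t \<in> carrier QT.F0 \<Longrightarrow> cmod (EQ g h t) \<le> QT.N t"
  unfolding EQ_def by (intro QT.character_tensor_le \<Phi>_character \<Phi>_le)

text \<open>P is the supremum over G x G. Applying \<open>nrm_Q_le_sup\<close> in one leg at a time
  shows that P dominates every product of states of Q. Since P is submultiplicative and compatible
  with the involution, \<open>gns_le_bound\<close> upgrades this to the operator norms that define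
  the spatial norm.\<close>

lemma spatial_le_sup:
  assumes t: "t \<in> carrier QT.F0" and r: "\<And>g h. g \<in> carrier G \<Longrightarrow> h \<in> carrier G \<Longrightarrow> cmod (EQ g h t) \<le> r"
  shows "QT.N t \<le> r"
proof -
  interpret F0: star_alg QT.F0 by (rule QT.star_alg_F)
  define P where "P x = (SUP p\<in>carrier G \<times> carrier G. cmod (EQ (fst p) (snd p) x))" for x
  have ge: "cmod (EQ g h x) \<le> P x" if "x \<in> carrier QT.F0" "g \<in> carrier G" "h \<in> carrier G" for g h x
  proof -
    have "cmod (EQ (fst (g, h)) (snd (g, h)) x) \<le> P x" unfolding P_def
      by (rule cSUP_upper) (use EQ_le that in \<open>auto intro!: bdd_aboveI2[where M = "QT.N x"]\<close>)
    then show ?thesis by simp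
  qed
  have le: "P x \<le> M" if "\<And>g h. g \<in> carrier G \<Longrightarrow> h \<in> carrier G \<Longrightarrow> cmod (EQ g h x) \<le> M" for x M
    unfolding P_def by (rule cSUP_least) (use one_in_G that in auto)
  have P0: "0 \<le> P x" if "x \<in> carrier QT.F0" for x using ge[OF that one_in_G one_in_G] norm_ge_zero order_trans by blast
  have "QT.N t \<le> P t"
  proof (rule QT.spatial_norm_least[OF t P0[OF t]])
    fix \<phi> \<psi> s assume st: "state Q \<phi>" "state Q \<psi>" and s: "s \<in> carrier QT.F0"
    note lc = Q.posfun_linear_combination[OF state_posfun]
    have bd: "cmod (tensor_functional \<phi> \<psi> x) \<le> P x" if x: "x \<in> carrier QT.F0" for x
    proof -
      let ?S = "{z. x z \<noteq> 0}"
      note F = QT.F_carrierD[OF x]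
      have fs: "fst z \<in> carrier Q" "snd z \<in> carrier Q" if "z \<in> ?S" for z using F(2,3)[of z] that by auto
      \<comment> \<open>The slice of x by \<psi> in the second leg. Its value at g is \<psi> of the
        slice b by evaluation at g in the first leg, so that a is bounded through b.\<close>
      define a where "a = (\<Oplus>\<^sub>Q z\<in>?S. (x z * \<psi> (snd z)) \<odot>\<^sub>Q fst z)"
      have a: "a \<in> carrier Q" unfolding a_def using fs by (intro Q.finsum_closed) auto
      have "nrm Q a \<le> P x"
      proof (rule nrm_Q_le_sup[OF a])
        fix g assume g: "g \<in> carrier G"
        define b where "b = (\<Oplus>\<^sub>Q z\<in>?S. (x z * \<Phi> (fst z) g) \<odot>\<^sub>Q snd z)"
        have b: "b \<in> carrier Q" unfolding b_def using fs by (intro Q.finsum_closed) auto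
        have "nrm Q b \<le> P x"
        proof (rule nrm_Q_le_sup[OF b])
          fix h assume h: "h \<in> carrier G"
          have "\<Phi> b h = EQ g h x" unfolding b_def
            using lc[OF \<Phi>_state[OF h], of ?S snd "\<lambda>z. x z * \<Phi> (fst z) g"] fs by (simp add: EQ_def lin_def mult.assoc)
          then show "cmod (\<Phi> b h) \<le> P x" using ge[OF x g h] by simp
        qed
        moreover have "cmod (\<psi> b) \<le> nrm Q b" using st(2) b by (simp add: state_def)
        moreover have "\<Phi> a g = \<psi> b" unfolding a_def b_def
          using lc[OF \<Phi>_state[OF g], of ?S fst "\<lambda>z. x z * \<psi> (snd z)"] lc[OF st(2), of ?S snd "\<lambda>z. x z * \<Phi> (fst z) g"] fs
          by (simp add: mult_ac)
        ultimately show "cmod (\<Phi> a g) \<le> P x" by simp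
      qed
      moreover have "cmod (\<phi> a) \<le> nrm Q a" using st(1) a by (simp add: state_def)
      moreover have "tensor_functional \<phi> \<psi> x = \<phi> a" unfolding a_def QT.tensor_functional_lin lin_def
        using lc[OF st(1), of ?S fst "\<lambda>z. x z * \<psi> (snd z)"] fs by (simp add: mult_ac)
      ultimately show ?thesis by simp
    qed
    show "QT.gT \<phi> \<psi> (t \<otimes>\<^sub>QT.F0 s) \<le> (P t)\<^sup>2 * QT.gT \<phi> \<psi> s"
    proof (rule QT.gns_le_bound[OF QT.posfun_tensor[OF state_posfun state_posfun] P0 bd _ _ t s])
      fix x y assume x: "x \<in> carrier QT.F0" and y: "y \<in> carrier QT.F0"
      show "P (x \<otimes>\<^sub>QT.F0 y) \<le> P x * P y"
      proof (rule le)
        fix g h assume g: "g \<in> carrier G" "h \<in> carrier G"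
        have "cmod (EQ g h (x \<otimes>\<^sub>QT.F0 y)) = cmod (EQ g h x) * cmod (EQ g h y)"
          by (simp only: star_homD(3)[OF EQ_hom[OF g] x y] complex_alg_simps norm_mult)
        also have "\<dots> \<le> P x * P y" using ge[OF x g] ge[OF y g] by (intro mult_mono) (auto intro: P0 x)
        finally show "cmod (EQ g h (x \<otimes>\<^sub>QT.F0 y)) \<le> P x * P y" .
      qed
      show "P (star QT.F0 x) \<le> P x" by (rule le) (simp only: star_homD(6)[OF EQ_hom x] complex_alg_simps complex_mod_cnj ge[OF x])
    qed (use st in auto)
  qed
  also have "P t \<le> r" by (rule le[OF r])
  finally show ?thesis .
qed

lemma \<Phi>\<Phi>_exists: "\<exists>\<Phi>\<Phi>. star_hom QQ (C_of (prod_topology X X)) \<Phi>\<Phi>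
  \<and> (\<forall>t\<in>carrier QT.FS. \<forall>g\<in>carrier G. \<forall>h\<in>carrier G. \<Phi>\<Phi> (to_completion QT.FS t) (g, h) = EQ g h t)
  \<and> (\<forall>T\<in>carrier QQ. \<forall>g\<in>carrier G. \<forall>h\<in>carrier G. cmod (\<Phi>\<Phi> T (g, h)) \<le> nrm QQ T)"
proof -
  let ?Y = "prod_topology X X"
  have Y: "topspace ?Y = carrier G \<times> carrier G" by (simp add: topspace_X)
  define H where "H t = restrict (\<lambda>p. EQ (fst p) (snd p) t) (topspace ?Y)" for t
  have H: "star_hom QT.FS (C_of ?Y) H"
  proof (rule star_hom_C_of_iff)
    fix t assume t: "t \<in> carrier QT.FS"
    have c: "continuous_map ?Y euclidean (\<lambda>p. \<Phi> a (fst p))" "continuous_map ?Y euclidean (\<lambda>p. \<Phi> a (snd p))" if "a \<in> carrier Q" for a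
      using continuous_map_compose[OF continuous_map_fst, of X euclidean "\<Phi> a" X]
        continuous_map_compose[OF continuous_map_snd, of X euclidean "\<Phi> a" X] \<Phi>.hom_closed[OF that] by (simp_all add: o_def)
    have "continuous_map ?Y euclidean (\<lambda>p. EQ (fst p) (snd p) t)" unfolding EQ_def lin_def using QT.F_carrierD[OF t]
      by (intro continuous_map_sum_cx continuous_map_mult_cx c) auto
    then show "H t \<in> carrier (C_of ?Y)" by (simp only: H_def C_of_simps continuous_map_restrict_iff restrict_extensional simp_thms)
  next
    fix p assume p: "p \<in> topspace ?Y"
    then have "fst p \<in> carrier G" "snd p \<in> carrier G" unfolding Y mem_Times_iff by blast+
    from EQ_hom[OF this, of QT.N] show "star_hom QT.FS complex_alg (\<lambda>t. H t p)" unfolding H_def restrict_apply'[OF p] .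
  qed (rule QT.star_alg_F)
  have le: "cmod (H t p) \<le> nrm QT.FS t" if "t \<in> carrier QT.FS" "p \<in> topspace ?Y" for t p
    using EQ_le[of "fst p" "snd p" t] that QT.FS_carrier_F0[of t] Y by (auto simp: H_def)
  show ?thesis
  proof (rule QT.FS.C_of_extension[OF H le])
    fix h assume h: "star_hom (Defs.completion QT.FS) (C_of ?Y) h"
      "\<And>t. t \<in> carrier QT.FS \<Longrightarrow> h (to_completion QT.FS t) = H t"
      "\<And>T p. T \<in> carrier (Defs.completion QT.FS) \<Longrightarrow> p \<in> topspace ?Y \<Longrightarrow> cmod (h T p) \<le> nrm (Defs.completion QT.FS) T"
    have gh: "(g, h) \<in> topspace ?Y" if "g \<in> carrier G" "h \<in> carrier G" for g h unfolding Y using that by blast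
    show ?thesis unfolding min_tensor_def using h(1,3) h(2)[unfolded H_def] gh by (intro exI[of _ h]) simp
  qed
qed

text \<open>By \<open>spatial_le_sup\<close> contractivity for the spatial norms has to be tested
  only at pairs of points, and evaluation at such a pair is a product of contractive characters of C
  as well.\<close>

lemma qq_exists: "\<exists>qq. star_hom CC QQ qq
  \<and> (\<forall>a\<in>carrier C. \<forall>b\<in>carrier C. qq (pure_tensor C C a b) = pure_tensor Q Q (CJ.q a) (CJ.q b))"
proof -
  let ?\<eta> = "\<lambda>x. basis_elt (CJ.q (fst x), CJ.q (snd x)) :: _ \<times> _ \<Rightarrow> complex"
  define \<tau> where "\<tau> = lin_ext QT.FS ?\<eta>"
  have \<eta>c: "?\<eta> x \<in> carrier QT.FS" if "x \<in> carrier CG.T.M" for x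
    using that by (intro QT.basis_closed q.hom_closed) (auto simp: CG.T.carrier_M)
  have \<tau>h: "star_hom (CG.T.F p) QT.FS \<tau>" for p unfolding \<tau>_def
  proof (rule lin_ext_star_hom[OF CG.T.inv_monoid_M QT.star_alg_F \<eta>c], assumption)
    show "?\<eta> \<one>\<^sub>CG.T.M = \<one>\<^sub>QT.FS" using q.hom_one by (simp add: DirProd_def)
    show "?\<eta> (x \<otimes>\<^sub>CG.T.M y) = ?\<eta> x \<otimes>\<^sub>QT.FS ?\<eta> y" if "x \<in> carrier CG.T.M" "y \<in> carrier CG.T.M" for x y
      using that by (simp only: QT.basis_mult QT.mult_M CG.T.mult_M CG.T.carrier_M fst_conv snd_conv q.hom_mult)
    show "?\<eta> (map_prod (star C) (star C) x) = star QT.FS (?\<eta> x)" if "x \<in> carrier CG.T.M" for x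
      using that by (simp only: QT.basis_star CG.T.carrier_M fst_map_prod snd_map_prod q.hom_star)
  qed
  have \<tau>b: "\<tau> (basis_elt x) = ?\<eta> x" if "x \<in> carrier CG.T.M" for x
    unfolding \<tau>_def by (rule QT.FS.lin_ext_basis[where \<eta> = ?\<eta>, OF \<eta>c[OF that]])
  have le: "nrm QT.FS (\<tau> t) \<le> nrm CG.T.FS t" if t: "t \<in> carrier CG.T.FS" for t
  proof -
    have t0: "t \<in> carrier CG.T.F0" using t CG.T.FS_carrier_F0 by blast
    have "QT.N (\<tau> t) \<le> CG.T.N t"
    proof (rule spatial_le_sup)
      show "\<tau> t \<in> carrier QT.F0" using star_homD(1)[OF \<tau>h t] QT.FS_carrier_F0 by blast
      fix g h assume g: "g \<in> carrier G" "h \<in> carrier G"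
      have "EQ g h (\<tau> t) = lin (CG.T.\<eta> (\<lambda>a. \<Phi>0 a g) (\<lambda>a. \<Phi>0 a h)) t"
      proof (rule star_hom_complex_eq_on_basis[OF CG.T.inv_monoid_M star_hom_compose[OF \<tau>h EQ_hom[OF g]]
            CG.T.character_tensor[OF \<Phi>0_character[OF g(1)] \<Phi>0_character[OF g(2)]] _ t])
        fix x assume x: "x \<in> carrier CG.T.M"
        then have "fst x \<in> carrier C" "snd x \<in> carrier C" by (auto simp: CG.T.carrier_M)
        then show "EQ g h (\<tau> (basis_elt x)) = lin (CG.T.\<eta> (\<lambda>a. \<Phi>0 a g) (\<lambda>a. \<Phi>0 a h)) (basis_elt x)"
          unfolding \<tau>b[OF x] by (simp add: EQ_def \<Phi>_q)
      qed
      then show "cmod (EQ g h (\<tau> t)) \<le> CG.T.N t"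
        using CG.T.character_tensor_le[OF \<Phi>0_character[OF g(1)] _ \<Phi>0_character[OF g(2)] _ t0] \<Phi>0_le g by simp
    qed
    then show ?thesis by simp
  qed
  show ?thesis
  proof (rule CG.T.FS.completion_map[OF QT.FS.seminormed_star_alg_axioms \<tau>h le])
    fix qq assume qq: "star_hom (Defs.completion CG.T.FS) (Defs.completion QT.FS) qq"
      "\<And>t. t \<in> carrier CG.T.FS \<Longrightarrow> qq (to_completion CG.T.FS t) = to_completion QT.FS (\<tau> t)"
    have "qq (pure_tensor C C a b) = pure_tensor Q Q (CJ.q a) (CJ.q b)" if ab: "a \<in> carrier C" "b \<in> carrier C" for a b
      using qq(2)[OF CG.T.basis_closed[OF ab]] \<tau>b[of "(a, b)"] ab by (simp add: pure_tensor_def CG.T.carrier_M)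
    then show ?thesis using qq(1) by (intro exI[of _ qq]) (simp add: min_tensor_def)
  qed
qed

text \<open>The coproduct is compared with the group law after evaluation at pairs of points, and
  injectivity of Q \<otimes> Q -> C(G x G) turns pointwise statements into statements in Q \<otimes>
  Q.\<close>

theorem classical_version: "is_classical_version C (GA_coproduct A l) G X"
proof -
  let ?\<Delta> = "GA_coproduct A l"
  obtain \<Phi>\<Phi> where pp: "star_hom QQ (C_of (prod_topology X X)) \<Phi>\<Phi>"
    "\<And>t g h. t \<in> carrier QT.FS \<Longrightarrow> g \<in> carrier G \<Longrightarrow> h \<in> carrier G \<Longrightarrow> \<Phi>\<Phi> (to_completion QT.FS t) (g, h) = EQ g h t"
    "\<And>T g h. T \<in> carrier QQ \<Longrightarrow> g \<in> carrier G \<Longrightarrow> h \<in> carrier G \<Longrightarrow> cmod (\<Phi>\<Phi> T (g, h)) \<le> nrm QQ T" using \<Phi>\<Phi>_exists by blast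
  obtain qq where qq: "star_hom CC QQ qq"
    "\<And>a b. a \<in> carrier C \<Longrightarrow> b \<in> carrier C \<Longrightarrow> qq (pure_tensor C C a b) = pure_tensor Q Q (CJ.q a) (CJ.q b)" using qq_exists by blast
  have pt: "\<Phi>\<Phi> (pure_tensor Q Q a b) (g, h) = \<Phi> a g * \<Phi> b h"
    if "a \<in> carrier Q" "b \<in> carrier Q" "g \<in> carrier G" "h \<in> carrier G" for a b g h
    unfolding pure_tensor_def using pp(2)[OF QT.basis_closed[OF that(1,2)] that(3,4)] by (simp add: EQ_def)
  have ch: "star_hom QQ complex_alg (\<lambda>T. \<Phi>\<Phi> T (g, h))" if "g \<in> carrier G" "h \<in> carrier G" for g h
    by (rule star_hom_C_of_eval[OF pp(1)]) (use that in \<open>simp add: topspace_X\<close>)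
  have \<Delta>q: "star_hom C QQ (\<lambda>a. qq (?\<Delta> a))" by (rule star_hom_compose[OF coproduct_props(1) qq(1)])
  \<comment> \<open>Both sides are characters of C in the variable a. They agree on generators
    because the entries multiply like matrices, hence on polynomials, and everywhere by
    contractivity and density.\<close>
  have mult: "\<Phi>\<Phi> (qq (?\<Delta> a)) (g, h) = \<Phi>0 a (g \<otimes>\<^sub>G h)" if a: "a \<in> carrier C" and g: "g \<in> carrier G" and h: "h \<in> carrier G" for a g h
  proof -
    let ?\<kappa> = "\<lambda>a. \<Phi>\<Phi> (qq (?\<Delta> a)) (g, h)"
    have gh: "g \<otimes>\<^sub>G h \<in> carrier G" using g h by (simp add: group.is_monoid group_torus_wreath_Aut monoid.m_closed)
    have k: "star_hom C complex_alg ?\<kappa>" by (rule star_hom_compose[OF \<Delta>q ch[OF g h]])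
    interpret k: star_alg_hom C complex_alg ?\<kappa>
      by (intro star_alg_homI star_alg_complex_alg C.star_alg_axioms k)
    interpret QQh: star_alg_hom CC QQ qq
      by (intro star_alg_homI CG.T.MT.star_alg_axioms QT.MT.star_alg_axioms qq(1))
    interpret c: star_alg_hom QQ complex_alg "\<lambda>T. \<Phi>\<Phi> T (g, h)"
      by (intro star_alg_homI star_alg_complex_alg QT.MT.star_alg_axioms ch g h)
    have kle: "cmod (?\<kappa> c) \<le> nrm C c" if "c \<in> carrier C" for c
      using FA.completion_character_le[of ?\<kappa> c] k that unfolding C_def' by blast
    have \<iota>: "?\<kappa> (\<iota> f) = ev (g \<otimes>\<^sub>G h) f" if f: "f \<in> carrier FA" for f
    proof (rule star_alg_hom_eq_on_free[OF star_alg_complex_alg star_hom_compose[OF \<iota>.hom k] ev_hom _ f])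
      fix a b
      have "?\<kappa> (\<iota> (free_gen a b)) = ?\<kappa> (U a b)" by (simp add: U_def')
      also have "qq (?\<Delta> (U a b)) = (\<Oplus>\<^sub>QQ c\<in>UNIV. pure_tensor Q Q (uq a c) (uq c b))"
        unfolding coproduct_props(2) by (subst QQh.hom_finsum) (auto simp: qq(2))
      also have "\<Phi>\<Phi> \<dots> (g, h) = (\<Sum>c\<in>UNIV. \<Phi> (uq a c) g * \<Phi> (uq c b) h)" by (subst c.hom_finsum) (auto simp: pt g h)
      also have "\<dots> = (\<Sum>c\<in>UNIV. point_gen g a c * point_gen h c b)"
        using \<Phi>0_\<iota>[OF free_gen_closed g] \<Phi>0_\<iota>[OF free_gen_closed h] by (simp add: \<Phi>_q U_def' ev_gen free_gen_closed)
      also have "\<dots> = ev (g \<otimes>\<^sub>G h) (free_gen a b)" using point_gen_mult[OF g h] by (simp add: ev_gen)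
      finally show "?\<kappa> (\<iota> (free_gen a b)) = ev (g \<otimes>\<^sub>G h) (free_gen a b)" .
    qed
    have "cmod (?\<kappa> a - \<Phi>0 a (g \<otimes>\<^sub>G h)) \<le> 0"
    proof (rule field_le_epsilon)
      fix e :: real assume "e > 0"
      then obtain f where f: "f \<in> carrier FA" "nrm C (a \<ominus>\<^sub>C \<iota> f) < e / 2" using C_dense[OF a, of "e / 2"] by auto
      have "cmod (?\<kappa> a - ev (g \<otimes>\<^sub>G h) f) \<le> e / 2" using kle[of "a \<ominus>\<^sub>C \<iota> f"] k.hom_minus[OF a, of "\<iota> f"] \<iota>[OF f(1)] f a by simp
      moreover have "cmod (\<Phi>0 a (g \<otimes>\<^sub>G h) - ev (g \<otimes>\<^sub>G h) f) \<le> e / 2"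
        using \<Phi>0_le[of "a \<ominus>\<^sub>C \<iota> f", OF _ gh] \<Phi>0_minus[OF gh a, of "\<iota> f"] \<Phi>0_\<iota>[OF f(1) gh] f a by simp
      ultimately show "cmod (?\<kappa> a - \<Phi>0 a (g \<otimes>\<^sub>G h)) \<le> 0 + e"
        using norm_triangle_ineq4[of "?\<kappa> a - ev (g \<otimes>\<^sub>G h) f" "\<Phi>0 a (g \<otimes>\<^sub>G h) - ev (g \<otimes>\<^sub>G h) f"] by simp
    qed
    then show ?thesis by simp
  qed
  \<comment> \<open>A formal tensor near T is uniformly small on G x G, hence small in the spatial
    norm by \<open>spatial_le_sup\<close>.\<close>
  have inj: "T = \<zero>\<^sub>QQ" if T: "T \<in> carrier QQ" and z: "\<And>g h. g \<in> carrier G \<Longrightarrow> h \<in> carrier G \<Longrightarrow> \<Phi>\<Phi> T (g, h) = 0" for T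
  proof -
    have "nrm QQ T \<le> 0"
    proof (rule field_le_epsilon)
      fix e :: real assume "e > 0"
      then obtain t where t: "t \<in> carrier QT.FS" "nrm QQ (T \<ominus>\<^sub>QQ to_completion QT.FS t) < e / 2"
        using QT.FS.completion_dense[of T "e / 2"] T unfolding min_tensor_def by auto
      have \<iota>t: "to_completion QT.FS t \<in> carrier QQ" using QT.FS.to_completion_closed[OF t(1)] by (simp add: min_tensor_def)
      have "QT.N t \<le> e / 2"
      proof (rule spatial_le_sup)
        show "t \<in> carrier QT.F0" using t(1) QT.FS_carrier_F0 by blast
        fix g h assume g: "g \<in> carrier G" "h \<in> carrier G"
        interpret c: star_alg_hom QQ complex_alg "\<lambda>T. \<Phi>\<Phi> T (g, h)"
          by (intro star_alg_homI star_alg_complex_alg QT.MT.star_alg_axioms ch g)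
        show "cmod (EQ g h t) \<le> e / 2"
          using pp(3)[OF QT.MT.minus_closed[OF T \<iota>t] g] c.hom_minus[OF T \<iota>t] z[OF g] pp(2)[OF t(1) g] t(2) by simp
      qed
      then have "nrm QQ (to_completion QT.FS t) \<le> e / 2" using QT.FS.nrm_to_completion[OF t(1)] by (simp add: min_tensor_def)
      then show "nrm QQ T \<le> 0 + e" using QT.MT.nrm_le_minus[OF T \<iota>t] t(2) by simp
    qed
    then show ?thesis using QT.MT.nrm_eq_0[OF T] QT.MT.nrm_nonneg[OF T] by simp
  qed
  \<comment> \<open>Elements of the commutator ideal vanish at all points of G, in particular at g
    h, so their coproduct vanishes at the pair (g, h).\<close>
  have J0: "qq (?\<Delta> a) = \<zero>\<^sub>QQ" if a: "a \<in> commutator_ideal C" for a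
  proof (rule inj)
    have ac: "a \<in> carrier C" using a CJ.a_subset by blast
    show "qq (?\<Delta> a) \<in> carrier QQ" by (rule star_homD(1)[OF \<Delta>q ac])
    fix g h assume g: "g \<in> carrier G" "h \<in> carrier G"
    have gh: "g \<otimes>\<^sub>G h \<in> carrier G" using g by (simp add: group.is_monoid group_torus_wreath_Aut monoid.m_closed)
    show "\<Phi>\<Phi> (qq (?\<Delta> a)) (g, h) = 0" using mult[OF ac g] \<Phi>0_J[OF a] gh by (simp add: topspace_X)
  qed
  obtain \<Delta>' where \<Delta>': "star_hom Q QQ \<Delta>'" "\<And>a. a \<in> carrier C \<Longrightarrow> \<Delta>' (CJ.q a) = qq (?\<Delta> a)"
    by (rule CJ.quot_lift[OF QT.MT.star_alg_axioms \<Delta>q J0]) (assumption, rule that)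
  have fin: "\<Phi>\<Phi> (\<Delta>' a) (g, h) = \<Phi> a (g \<otimes>\<^sub>G h)" if "a \<in> carrier Q" "g \<in> carrier G" "h \<in> carrier G" for a g h
  proof -
    obtain c where c: "c \<in> carrier C" "a = CJ.q c" using \<open>a \<in> carrier Q\<close> unfolding CJ.carrier_Q by auto
    then show ?thesis using mult[OF c(1) that(2,3)] \<Delta>'(2)[OF c(1)] \<Phi>_q[OF c(1)] by simp
  qed
  show ?thesis unfolding is_classical_version_def Let_def
    by (intro conjI compact_group_torus_wreath exI[of _ qq] exI[of _ \<Delta>'] exI[of _ \<Phi>] exI[of _ \<Phi>\<Phi>] ballI
        qq \<Delta>' pp(1) star_iso_\<Phi> pt fin)
qed

end

theorem proposition5p1:
  fixes A :: "real^'n^'n" and l :: enat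
  assumes "CARD('n) \<ge> 2"
    and "\<forall>i j. A $ i $ j \<in> {0, 1}"
    and "primitive_matrix A"
  shows "is_classical_version (C_GA A l) (GA_coproduct A l)
           (torus_wreath_Aut A) (torus_wreath_topology A)"
proof -
  interpret GA A l using assms by unfold_locales auto
  show ?thesis by (rule classical_version)
qed

end
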